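(* Let $p(t)\in O[t]$ be a monic polynomial of degree $n$ which is irreducible modulo $\mathfrak p$, and let $\beta\in\mathfrak{gl}_n(O)$ be such that its characteristic polynomial satisfies $\chi_\beta(t)\equiv p(t)\pmod{\mathfrak p}$. Let $K=F[\beta]$ (an unramified field extension of $F$ of degree $n$) with integer ring $O_K=O[\beta]$ and maximal ideal $\mathfrak p_K=\varpi O_K$. Then $\theta\mapsto\mathrm{Ind}_{G(O_r,\beta)}^{G(O_r)}\sigma_{\beta,\theta}$ is a bijection of the set of group homomorphisms $\theta:O_K^\times\to\mathbb C^\times$ which factor through $O_K^\times\to(O_K/\mathfrak p_K^r)^\times$ and satisfy $$\theta(1+\varpi^lx)=\tau(\varpi^{-l'}T_{K/F}(\beta x))\quad\text{for all }x\in O_K$$ onto $\mathrm{Irr}(G(O_r)\mid\psi_\beta)$, where $G=GL_n$.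
   Context: Let $F$ be a non-archimedean local field with integer ring $O$, maximal ideal $\mathfrak p=\varpi O$ and finite residue field $\mathbb F=O/\mathfrak p$ of odd characteristic; $O_m=O/\mathfrak p^m$. Fix a continuous unitary character $\tau$ of the additive group $F$ with $\{x\in F:\tau(xO)=1\}=O$. For a finite abelian group $A$, $A^\wedge$ is its group of complex characters. A bar denotes reduction modulo $\mathfrak p$. $T_{K/F}$ is the trace. $G=GL_n$ ($n\ge2$), $\mathfrak g=\mathfrak{gl}_n$, $B(X,Y)=\mathrm{tr}(XY)$, $K_m(O_r)=\ker(G(O_r)\to G(O_m))$ for $0<m<r$. Fix $r\ge2$ and write $r=l+l'$ with $l'=l$ if $r=2l$, $l'=l-1$ if $r=2l-1$. $\psi_\beta$ is the character of the abelian group $K_l(O_r)$ with $\psi_\beta(1+\varpi^lX\bmod\mathfrak p^r)=\tau(\varpi^{-l'}B(X,\beta))$, $X\in\mathfrak g(O)$; its stabilizer in $G(O_r)$ is $G(O_r,\beta)=\{g\bmod\mathfrak p^r:\mathrm{Ad}(g)\beta\equiv\beta\pmod{\mathfrak p^{l'}}\}$. $\mathrm{Irr}(G(O_r)\mid\psi_\beta)$ is the set of isomorphism classes of irreducible complex representations of $G(O_r)$ whose restriction to $K_l(O_r)$ contains $\psi_\beta$. $G_\beta$, $\mathfrak g_\beta$ are the centralizers of $\beta$ in $G$, $\mathfrak g$. Here $G_\beta(O_r)$ is identified with $(O_K/\mathfrak p_K^r)^\times$, so $\theta$ is regarded as a character of $G_\beta(O_r)$. Definition of $\sigma_{\beta,\theta}$,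 an irreducible representation of $G(O_r,\beta)=G_\beta(O_r)\cdot K_{l'}(O_r)$. If $r=2l$: $\sigma_{\beta,\theta}(gh)=\theta(g)\psi_\beta(h)$ for $g\in G_\beta(O_r)$, $h\in K_l(O_r)$. If $r=2l-1\ge3$: let $Z(O_r,\beta)\subset K_{l-1}(O_r)$ be the subgroup of the elements $1+\varpi^{l-1}X\bmod\mathfrak p^r$ with $\overline X\in\mathfrak g_\beta(\mathbb F)$. For $\rho\in\mathfrak g_\beta(\mathbb F)^\wedge$ let $\psi_{\beta,\rho}$ be the character $1+\varpi^{l-1}X\mapsto\tau(\varpi^{-l}B(X,\beta)-(2\varpi)^{-1}B(X^2,\beta))\rho(\overline X)$ of $Z(O_r,\beta)$, and $\pi_{\beta,\rho}$ (on $V_{\beta,\rho}$) the unique irreducible representation of $K_{l-1}(O_r)$ whose restriction to $Z(O_r,\beta)$ contains $\psi_{\beta,\rho}$. Fix for each $\rho$ a group homomorphism $U_{\beta,\rho}:G_\beta(O_r)\to GL_{\mathbb C}(V_{\beta,\rho})$ (which exists here) such that $\pi_{\beta,\rho}(g^{-1}xg)=U_{\beta,\rho}(g)^{-1}\pi_{\beta,\rho}(x)U_{\beta,\rho}(g)$ for $g\in G_\beta(O_r)$, $x\in K_{l-1}(O_r)$, and $U_{\beta,\rho}=1$ on $G_\beta(O_r)\cap K_{l-1}(O_r)$. For $\theta\in G_\beta(O_r)^\wedge$ with $\theta=\psi_\beta$ on $G_\beta(O_r)\cap K_l(O_r)$ there is a unique $\rho$ with $\theta=\psi_{\beta,\rho}$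 on $G_\beta(O_r)\cap K_{l-1}(O_r)$, and $\sigma_{\beta,\theta}(gh)=\theta(g)U_{\beta,\rho}(g)\pi_{\beta,\rho}(h)$ for $g\in G_\beta(O_r)$, $h\in K_{l-1}(O_r)$. *)

theory Defs
  imports
    "Jordan_Normal_Form.Char_Poly"
    "Jordan_Normal_Form.VS_Connect"
    "HOL-Algebra.Polynomial_Divisibility"
    "HOL-Algebra.Multiplicative_Group"
begin

section \<open>Local fields\<close>

text \<open>A non-archimedean local field is a field that is complete with respect to a normalised
  discrete valuation and has a finite residue field. The value \<open>v 0\<close> is irrelevant:
  \<open>\<p>\<^sup>m\<close> is \<open>{x. x = 0 \<or> v x \<ge> m}\<close>.\<close>

definition pow_ideal :: "('f::field \<Rightarrow> int) \<Rightarrow> nat \<Rightarrow> 'f set" where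
  "pow_ideal v m = {x. x = 0 \<or> int m \<le> v x}"

definition int_ring :: "('f::field \<Rightarrow> int) \<Rightarrow> 'f ring" where
  "int_ring v = class_ring\<lparr>carrier := {x. x = 0 \<or> 0 \<le> v x}\<rparr>"

definition res_ring :: "('f::field \<Rightarrow> int) \<Rightarrow> nat \<Rightarrow> 'f set ring" where
  "res_ring v m = int_ring v Quot pow_ideal v m"

locale nonarch_local_field =
  fixes v :: "'f::field \<Rightarrow> int"
  assumes val_mult: "x \<noteq> 0 \<Longrightarrow> y \<noteq> 0 \<Longrightarrow> v (x * y) = v x + v y"
    and val_add: "x \<noteq> 0 \<Longrightarrow> y \<noteq> 0 \<Longrightarrow> x + y \<noteq> 0 \<Longrightarrow> min (v x) (v y) \<le> v (x + y)"
    and val_normalised: "\<exists>x. x \<noteq> 0 \<and> v x = 1"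
    and val_complete: "(\<forall>k. \<exists>N::nat. \<forall>i\<ge>N. \<forall>j\<ge>N. Y i - Y j \<in> pow_ideal v k) \<Longrightarrow>
        \<exists>L. \<forall>k. \<exists>N::nat. \<forall>i\<ge>N. Y i - L \<in> pow_ideal v k"
    and finite_residue_field: "finite (carrier (res_ring v 1))"

definition residue_char :: "('f::field \<Rightarrow> int) \<Rightarrow> nat" where
  "residue_char v = group.ord (add_monoid (res_ring v 1)) \<one>\<^bsub>res_ring v 1\<^esub>"

definition unitary_additive_char :: "('f::field \<Rightarrow> int) \<Rightarrow> ('f \<Rightarrow> complex) \<Rightarrow> bool" where
  "unitary_additive_char v \<tau> \<longleftrightarrow>
     (\<forall>x y. \<tau> (x + y) = \<tau> x * \<tau> y) \<and> (\<forall>x. cmod (\<tau> x) = 1) \<and>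
     (\<forall>x. \<forall>e>0. \<exists>k. \<forall>y. y - x \<in> pow_ideal v k \<longrightarrow> cmod (\<tau> y - \<tau> x) < e)"


section \<open>Matrix rings and general linear groups\<close>

text \<open>Matrices over an arbitrary ring record: the entries of matrices over \<open>O/\<p>\<^sup>m\<close> are cosets, which
  do not form a type of class \<open>ring\<close>.\<close>

definition mat_ring :: "('a, 'b) ring_scheme \<Rightarrow> nat \<Rightarrow> 'a mat ring" where
  "mat_ring R n =
     \<lparr>carrier = {A \<in> carrier_mat n n. \<forall>i<n. \<forall>j<n. A $$ (i, j) \<in> carrier R},
      mult = (\<lambda>A B. mat n n (\<lambda>(i, j). \<Oplus>\<^bsub>R\<^esub>k\<in>{..<n}. A $$ (i, k) \<otimes>\<^bsub>R\<^esub> B $$ (k, j))),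
      one = mat n n (\<lambda>(i, j). if i = j then \<one>\<^bsub>R\<^esub> else \<zero>\<^bsub>R\<^esub>),
      zero = mat n n (\<lambda>_. \<zero>\<^bsub>R\<^esub>),
      add = (\<lambda>A B. mat n n (\<lambda>(i, j). A $$ (i, j) \<oplus>\<^bsub>R\<^esub> B $$ (i, j)))\<rparr>"

abbreviation int_mats :: "('f::field \<Rightarrow> int) \<Rightarrow> nat \<Rightarrow> 'f mat set" where
  "int_mats v n \<equiv> carrier (mat_ring (int_ring v) n)"

definition GL_res :: "('f::field \<Rightarrow> int) \<Rightarrow> nat \<Rightarrow> nat \<Rightarrow> 'f set mat monoid" where
  "GL_res v n m = units_of (mat_ring (res_ring v m) n)"

definition red :: "('f::field \<Rightarrow> int) \<Rightarrow> nat \<Rightarrow> 'f \<Rightarrow> 'f set" where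
  "red v m a = pow_ideal v m +>\<^bsub>int_ring v\<^esub> a"

abbreviation red_mat :: "('f::field \<Rightarrow> int) \<Rightarrow> nat \<Rightarrow> 'f mat \<Rightarrow> 'f set mat" where
  "red_mat v m \<equiv> map_mat (red v m)"

text \<open>For \<open>m \<le> r\<close> the canonical map \<open>O/\<p>\<^sup>r \<rightarrow> O/\<p>\<^sup>m\<close> sends a coset \<open>C\<close> to \<open>C + \<p>\<^sup>m\<close>.\<close>

definition cong_subgroup :: "('f::field \<Rightarrow> int) \<Rightarrow> nat \<Rightarrow> nat \<Rightarrow> nat \<Rightarrow> 'f set mat set" where
  "cong_subgroup v n r m =
     kernel (GL_res v n r) (GL_res v n m) (map_mat (\<lambda>C. C <+>\<^bsub>int_ring v\<^esub> pow_ideal v m))"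

definition mtrace :: "'a::comm_monoid_add mat \<Rightarrow> 'a" where
  "mtrace A = (\<Sum>i<dim_row A. A $$ (i, i))"


section \<open>Complex representations of a finite group\<close>

text \<open>A representation is a pair of its degree and a homomorphism into matrices of that size. An
  isomorphism class is the set of all matrix representations of that isomorphism type.\<close>

type_synonym 'g matrix_rep = "nat \<times> ('g \<Rightarrow> complex mat)"

definition GLC :: "nat \<Rightarrow> complex mat monoid" where
  "GLC d = units_of (ring_mat TYPE(complex) d ())"

definition is_rep :: "('g, 'b) monoid_scheme \<Rightarrow> 'g matrix_rep \<Rightarrow> bool" where
  "is_rep G R \<longleftrightarrow> snd R \<in> hom G (GLC (fst R))"

definition irreducible_rep :: "('g, 'b) monoid_scheme \<Rightarrow> 'g matrix_rep \<Rightarrow> bool" where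
  "irreducible_rep G R \<longleftrightarrow> is_rep G R \<and> fst R \<noteq> 0 \<and>
     (\<forall>W. subspace class_ring W (module_vec TYPE(complex) (fst R)) \<longrightarrow>
          (\<forall>g\<in>carrier G. \<forall>w\<in>W. snd R g *\<^sub>v w \<in> W) \<longrightarrow>
          W = {0\<^sub>v (fst R)} \<or> W = carrier_vec (fst R))"

definition rep_equiv :: "('g, 'b) monoid_scheme \<Rightarrow> 'g matrix_rep \<Rightarrow> 'g matrix_rep \<Rightarrow> bool" where
  "rep_equiv G R S \<longleftrightarrow> fst R = fst S \<and>
     (\<exists>T\<in>carrier (GLC (fst R)). \<forall>g\<in>carrier G. T * snd R g = snd S g * T)"

definition rep_class :: "('g, 'b) monoid_scheme \<Rightarrow> 'g matrix_rep \<Rightarrow> 'g matrix_rep set" where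
  "rep_class G R = {S. is_rep G S \<and> rep_equiv G R S}"

definition mult_chars :: "('g, 'b) monoid_scheme \<Rightarrow> ('g \<Rightarrow> complex) set" where
  "mult_chars A = hom A (units_of class_ring) \<inter> extensional (carrier A)"

text \<open>The restriction of \<open>R\<close> to \<open>H\<close> contains the one-dimensional representation \<open>\<chi>\<close>.\<close>

definition contains_char :: "'g set \<Rightarrow> ('g \<Rightarrow> complex) \<Rightarrow> 'g matrix_rep \<Rightarrow> bool" where
  "contains_char H \<chi> R \<longleftrightarrow>
     (\<exists>w\<in>carrier_vec (fst R). w \<noteq> 0\<^sub>v (fst R) \<and> (\<forall>h\<in>H. snd R h *\<^sub>v w = \<chi> h \<cdot>\<^sub>v w))"

definition Irr_over :: "('g, 'b) monoid_scheme \<Rightarrow> 'g set \<Rightarrow> ('g \<Rightarrow> complex) \<Rightarrow> 'g matrix_rep set set"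
  where "Irr_over G H \<chi> = rep_class G ` {R. irreducible_rep G R \<and> contains_char H \<chi> R}"

text \<open>The induced representation is the space of functions \<open>f\<close> on \<open>G\<close> with
  \<open>f (h x) = \<sigma> h (f x)\<close> for \<open>h \<in> H\<close>, on which \<open>G\<close> acts by right translation; \<open>Ind_class\<close> is its
  isomorphism class.\<close>

definition Ind_space ::
  "('g, 'b) monoid_scheme \<Rightarrow> 'g set \<Rightarrow> 'g matrix_rep \<Rightarrow> ('g \<Rightarrow> complex vec) set" where
  "Ind_space G H \<sigma> = {f \<in> carrier G \<rightarrow>\<^sub>E carrier_vec (fst \<sigma>).
     \<forall>h\<in>H. \<forall>x\<in>carrier G. f (h \<otimes>\<^bsub>G\<^esub> x) = snd \<sigma> h *\<^sub>v f x}"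

definition Ind_class :: "('g, 'b) monoid_scheme \<Rightarrow> 'g set \<Rightarrow> 'g matrix_rep \<Rightarrow> 'g matrix_rep set" where
  "Ind_class G H \<sigma> = {S. is_rep G S \<and>
     (\<exists>\<Phi>. bij_betw \<Phi> (carrier_vec (fst S)) (Ind_space G H \<sigma>) \<and>
        (\<forall>u\<in>carrier_vec (fst S). \<forall>w\<in>carrier_vec (fst S).
           \<Phi> (u + w) = (\<lambda>x\<in>carrier G. \<Phi> u x + \<Phi> w x)) \<and>
        (\<forall>c. \<forall>w\<in>carrier_vec (fst S). \<Phi> (c \<cdot>\<^sub>v w) = (\<lambda>x\<in>carrier G. c \<cdot>\<^sub>v \<Phi> w x)) \<and>
        (\<forall>g\<in>carrier G. \<forall>w\<in>carrier_vec (fst S).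
           \<Phi> (snd S g *\<^sub>v w) = (\<lambda>x\<in>carrier G. \<Phi> w (x \<otimes>\<^bsub>G\<^esub> g))))}"


section \<open>The algebra \<open>F[\<beta>]\<close>\<close>

definition poly_mat :: "nat \<Rightarrow> 'f::field poly \<Rightarrow> 'f mat \<Rightarrow> 'f mat" where
  "poly_mat n q A =
     mat n n (\<lambda>ij. \<Sum>k\<le>Polynomial.degree q. Polynomial.coeff q k * (A ^\<^sub>m k) $$ ij)"

definition int_poly :: "('f::field \<Rightarrow> int) \<Rightarrow> 'f poly \<Rightarrow> bool" where
  "int_poly v q \<longleftrightarrow> (\<forall>i. Polynomial.coeff q i \<in> carrier (int_ring v))"

text \<open>Reduction of a monic polynomial over \<open>O\<close> to a polynomial over \<open>O/\<p>\<close>; univariate polynomials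
  over a ring record are coefficient lists with the leading coefficient first.\<close>

definition red_poly :: "('f::field \<Rightarrow> int) \<Rightarrow> 'f poly \<Rightarrow> 'f set list" where
  "red_poly v q = map (red v 1) (rev (Polynomial.coeffs q))"

text \<open>\<open>F[\<beta>]\<close>, both as a ring and as a vector space over \<open>F\<close>.\<close>

definition Kalg :: "nat \<Rightarrow> 'f::field mat \<Rightarrow> ('f, 'f mat) module" where
  "Kalg n \<beta> = \<lparr>carrier = range (\<lambda>q. poly_mat n q \<beta>), mult = (*), one = 1\<^sub>m n,
     zero = 0\<^sub>m n n, add = (+), smult = (\<cdot>\<^sub>m)\<rparr>"

text \<open>The integer ring of \<open>F[\<beta>]\<close> is the integral closure of \<open>O\<close>.\<close>

definition OK :: "('f::field \<Rightarrow> int) \<Rightarrow> nat \<Rightarrow> 'f mat \<Rightarrow> ('f, 'f mat) module" where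
  "OK v n \<beta> = (Kalg n \<beta>)\<lparr>carrier := {x \<in> carrier (Kalg n \<beta>).
     \<exists>q. int_poly v q \<and> Polynomial.coeff q (Polynomial.degree q) = 1 \<and>
         poly_mat n q x = 0\<^sub>m n n}\<rparr>"

definition pK_pow :: "('f::field \<Rightarrow> int) \<Rightarrow> 'f \<Rightarrow> nat \<Rightarrow> 'f mat \<Rightarrow> nat \<Rightarrow> 'f mat set" where
  "pK_pow v \<omega> n \<beta> m = PIdl\<^bsub>OK v n \<beta>\<^esub> (\<omega> ^ m \<cdot>\<^sub>m 1\<^sub>m n)"

text \<open>The trace of an endomorphism of a finite-dimensional vector space, computed in any basis.\<close>

definition linear_trace :: "('f::field, 'm) module \<Rightarrow> ('m \<Rightarrow> 'm) \<Rightarrow> 'f" where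
  "linear_trace V T = (THE c. \<exists>B M. finite B \<and> vectorspace.basis class_ring V B \<and>
     (\<forall>b\<in>B. T b = module.lincomb V (M b) B) \<and> c = (\<Sum>b\<in>B. M b b))"

definition field_trace :: "nat \<Rightarrow> 'f::field mat \<Rightarrow> 'f mat \<Rightarrow> 'f" where
  "field_trace n \<beta> x = linear_trace (Kalg n \<beta>) (\<lambda>y. x * y)"


section \<open>The characters \<open>\<psi>\<^sub>\<beta>\<close>, \<open>\<psi>\<^sub>\<beta>\<^sub>,\<^sub>\<rho>\<close> and the representations \<open>\<sigma>\<^sub>\<beta>\<^sub>,\<^sub>\<theta>\<close>\<close>

text \<open>Here and below, \<open>\<omega>\<close> is a prime element of \<open>O\<close> and \<open>r = l + l'\<close>. A function on residue classes
  given by a formula in representatives is written with a definite description.\<close>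

definition psi ::
  "('f::field \<Rightarrow> int) \<Rightarrow> 'f \<Rightarrow> ('f \<Rightarrow> complex) \<Rightarrow> nat \<Rightarrow> nat \<Rightarrow> nat \<Rightarrow> 'f mat \<Rightarrow> 'f set mat \<Rightarrow> complex"
  where "psi v \<omega> \<tau> n l l' \<beta> g = (THE c. \<exists>Y\<in>int_mats v n.
     g = red_mat v (l + l') (1\<^sub>m n + \<omega> ^ l \<cdot>\<^sub>m Y) \<and> c = \<tau> (mtrace (Y * \<beta>) / \<omega> ^ l'))"

definition stab :: "('f::field \<Rightarrow> int) \<Rightarrow> nat \<Rightarrow> nat \<Rightarrow> nat \<Rightarrow> 'f mat \<Rightarrow> 'f set mat set" where
  "stab v n l l' \<beta> = {red_mat v (l + l') g | g h. g \<in> int_mats v n \<and> h \<in> int_mats v n \<and>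
     g * h = 1\<^sub>m n \<and> h * g = 1\<^sub>m n \<and> red_mat v l' (g * \<beta> * h) = red_mat v l' \<beta>}"

definition G_cent :: "('f::field \<Rightarrow> int) \<Rightarrow> nat \<Rightarrow> nat \<Rightarrow> 'f mat \<Rightarrow> 'f set mat set" where
  "G_cent v n m \<beta> = {g \<in> carrier (GL_res v n m).
     g \<otimes>\<^bsub>mat_ring (res_ring v m) n\<^esub> red_mat v m \<beta> = red_mat v m \<beta> \<otimes>\<^bsub>mat_ring (res_ring v m) n\<^esub> g}"

definition g_cent :: "('f::field \<Rightarrow> int) \<Rightarrow> nat \<Rightarrow> nat \<Rightarrow> 'f mat \<Rightarrow> 'f set mat set" where
  "g_cent v n m \<beta> = {Y \<in> carrier (mat_ring (res_ring v m) n).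
     Y \<otimes>\<^bsub>mat_ring (res_ring v m) n\<^esub> red_mat v m \<beta> = red_mat v m \<beta> \<otimes>\<^bsub>mat_ring (res_ring v m) n\<^esub> Y}"

definition g_cent_chars ::
  "('f::field \<Rightarrow> int) \<Rightarrow> nat \<Rightarrow> 'f mat \<Rightarrow> ('f set mat \<Rightarrow> complex) set" where
  "g_cent_chars v n \<beta> =
     mult_chars ((add_monoid (mat_ring (res_ring v 1) n))\<lparr>carrier := g_cent v n 1 \<beta>\<rparr>)"

definition Zgrp :: "('f::field \<Rightarrow> int) \<Rightarrow> 'f \<Rightarrow> nat \<Rightarrow> nat \<Rightarrow> nat \<Rightarrow> 'f mat \<Rightarrow> 'f set mat set" where
  "Zgrp v \<omega> n l l' \<beta> = {red_mat v (l + l') (1\<^sub>m n + \<omega> ^ (l - 1) \<cdot>\<^sub>m Y) | Y.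
     Y \<in> int_mats v n \<and> red_mat v 1 Y \<in> g_cent v n 1 \<beta>}"

definition psi_rho ::
  "('f::field \<Rightarrow> int) \<Rightarrow> 'f \<Rightarrow> ('f \<Rightarrow> complex) \<Rightarrow> nat \<Rightarrow> nat \<Rightarrow> nat \<Rightarrow> 'f mat \<Rightarrow>
    ('f set mat \<Rightarrow> complex) \<Rightarrow> 'f set mat \<Rightarrow> complex" where
  "psi_rho v \<omega> \<tau> n l l' \<beta> \<rho> g = (THE c. \<exists>Y\<in>int_mats v n.
     red_mat v 1 Y \<in> g_cent v n 1 \<beta> \<and>
     g = red_mat v (l + l') (1\<^sub>m n + \<omega> ^ (l - 1) \<cdot>\<^sub>m Y) \<and>
     c = \<tau> (mtrace (Y * \<beta>) / \<omega> ^ l - mtrace (Y * Y * \<beta>) / (2 * \<omega>)) * \<rho> (red_mat v 1 Y))"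

definition theta_set ::
  "('f::field \<Rightarrow> int) \<Rightarrow> 'f \<Rightarrow> ('f \<Rightarrow> complex) \<Rightarrow> nat \<Rightarrow> nat \<Rightarrow> nat \<Rightarrow> 'f mat \<Rightarrow>
    ('f mat \<Rightarrow> complex) set" where
  "theta_set v \<omega> \<tau> n l l' \<beta> = {\<theta> \<in> mult_chars (units_of (OK v n \<beta>)).
     (\<exists>\<theta>'\<in>mult_chars (units_of (OK v n \<beta> Quot pK_pow v \<omega> n \<beta> (l + l'))).
        \<forall>x\<in>Units (OK v n \<beta>). \<theta> x = \<theta>' (pK_pow v \<omega> n \<beta> (l + l') +>\<^bsub>OK v n \<beta>\<^esub> x)) \<and>
     (\<forall>x\<in>carrier (OK v n \<beta>).
        \<theta> (1\<^sub>m n + \<omega> ^ l \<cdot>\<^sub>m x) = \<tau> (field_trace n \<beta> (\<beta> * x) / \<omega> ^ l'))}"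

text \<open>\<open>\<theta>\<close> as a character of \<open>G\<^sub>\<beta>(O\<^sub>r)\<close>, through the identification of the class of \<open>x\<close> modulo
  \<open>\<p>\<^sub>K\<^sup>r\<close> with the matrix \<open>x mod \<p>\<^sup>r\<close>.\<close>

definition theta_G :: "('f::field \<Rightarrow> int) \<Rightarrow> nat \<Rightarrow> nat \<Rightarrow> 'f mat \<Rightarrow> ('f mat \<Rightarrow> complex) \<Rightarrow>
    'f set mat \<Rightarrow> complex" where
  "theta_G v n r \<beta> \<theta> g = (THE c. \<exists>x\<in>Units (OK v n \<beta>). g = red_mat v r x \<and> c = \<theta> x)"

definition rho_of ::
  "('f::field \<Rightarrow> int) \<Rightarrow> 'f \<Rightarrow> ('f \<Rightarrow> complex) \<Rightarrow> nat \<Rightarrow> nat \<Rightarrow> nat \<Rightarrow> 'f mat \<Rightarrow>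
    ('f mat \<Rightarrow> complex) \<Rightarrow> 'f set mat \<Rightarrow> complex" where
  "rho_of v \<omega> \<tau> n l l' \<beta> \<theta> = (THE \<rho>. \<rho> \<in> g_cent_chars v n \<beta> \<and>
     (\<forall>x \<in> G_cent v n (l + l') \<beta> \<inter> cong_subgroup v n (l + l') (l - 1).
        theta_G v n (l + l') \<beta> \<theta> x = psi_rho v \<omega> \<tau> n l l' \<beta> \<rho> x))"

text \<open>The families \<open>P\<close> and \<open>U\<close> supply, for each \<open>\<rho>\<close>, the representation \<open>\<pi>\<^sub>\<beta>\<^sub>,\<^sub>\<rho>\<close> and the
  homomorphism \<open>U\<^sub>\<beta>\<^sub>,\<^sub>\<rho>\<close>; they play no role if \<open>r = 2 l\<close>.\<close>

definition sigma ::
  "('f::field \<Rightarrow> int) \<Rightarrow> 'f \<Rightarrow> ('f \<Rightarrow> complex) \<Rightarrow> nat \<Rightarrow> nat \<Rightarrow> nat \<Rightarrow> 'f mat \<Rightarrow>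
    (('f set mat \<Rightarrow> complex) \<Rightarrow> 'f set mat matrix_rep) \<Rightarrow>
    (('f set mat \<Rightarrow> complex) \<Rightarrow> 'f set mat \<Rightarrow> complex mat) \<Rightarrow>
    ('f mat \<Rightarrow> complex) \<Rightarrow> 'f set mat matrix_rep" where
  "sigma v \<omega> \<tau> n l l' \<beta> P U \<theta> =
    (if l' = l then
       (1, \<lambda>x. THE A. \<exists>g\<in>G_cent v n (l + l') \<beta>. \<exists>h\<in>cong_subgroup v n (l + l') l.
          x = g \<otimes>\<^bsub>GL_res v n (l + l')\<^esub> h \<and>
          A = (theta_G v n (l + l') \<beta> \<theta> g * psi v \<omega> \<tau> n l l' \<beta> h) \<cdot>\<^sub>m 1\<^sub>m 1)
     else
       (let \<rho> = rho_of v \<omega> \<tau> n l l' \<beta> \<theta> in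
       (fst (P \<rho>), \<lambda>x. THE A. \<exists>g\<in>G_cent v n (l + l') \<beta>. \<exists>h\<in>cong_subgroup v n (l + l') (l - 1).
          x = g \<otimes>\<^bsub>GL_res v n (l + l')\<^esub> h \<and>
          A = theta_G v n (l + l') \<beta> \<theta> g \<cdot>\<^sub>m (U \<rho> g * snd (P \<rho>) h))))"

text \<open>The requirements on \<open>\<pi>\<^sub>\<beta>\<^sub>,\<^sub>\<rho>\<close> and \<open>U\<^sub>\<beta>\<^sub>,\<^sub>\<rho>\<close> for one \<open>\<rho>\<close> (\<open>r = 2 l - 1\<close>).\<close>

definition is_pi_rho ::
  "('f::field \<Rightarrow> int) \<Rightarrow> 'f \<Rightarrow> ('f \<Rightarrow> complex) \<Rightarrow> nat \<Rightarrow> nat \<Rightarrow> nat \<Rightarrow> 'f mat \<Rightarrow>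
    ('f set mat \<Rightarrow> complex) \<Rightarrow> 'f set mat matrix_rep \<Rightarrow> bool" where
  "is_pi_rho v \<omega> \<tau> n l l' \<beta> \<rho> R \<longleftrightarrow>
     irreducible_rep ((GL_res v n (l + l'))\<lparr>carrier := cong_subgroup v n (l + l') (l - 1)\<rparr>) R \<and>
     contains_char (Zgrp v \<omega> n l l' \<beta>) (psi_rho v \<omega> \<tau> n l l' \<beta> \<rho>) R"

definition is_U_rho ::
  "('f::field \<Rightarrow> int) \<Rightarrow> nat \<Rightarrow> nat \<Rightarrow> nat \<Rightarrow> 'f mat \<Rightarrow>
    'f set mat matrix_rep \<Rightarrow> ('f set mat \<Rightarrow> complex mat) \<Rightarrow> bool" where
  "is_U_rho v n l l' \<beta> R W \<longleftrightarrow>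
     W \<in> hom ((GL_res v n (l + l'))\<lparr>carrier := G_cent v n (l + l') \<beta>\<rparr>) (GLC (fst R)) \<and>
     (\<forall>g \<in> G_cent v n (l + l') \<beta>. \<forall>x \<in> cong_subgroup v n (l + l') (l - 1).
        snd R (inv\<^bsub>GL_res v n (l + l')\<^esub> g \<otimes>\<^bsub>GL_res v n (l + l')\<^esub> x \<otimes>\<^bsub>GL_res v n (l + l')\<^esub> g) =
        inv\<^bsub>GLC (fst R)\<^esub> (W g) \<otimes>\<^bsub>GLC (fst R)\<^esub> snd R x \<otimes>\<^bsub>GLC (fst R)\<^esub> W g) \<and>
     (\<forall>g \<in> G_cent v n (l + l') \<beta> \<inter> cong_subgroup v n (l + l') (l - 1). W g = 1\<^sub>m (fst R))"

end

theory Submission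
  imports Defs
begin

text \<open>Clifford theory over \<open>K\<^sub>l\<close>: inducing from the stabilizer of \<open>\<psi>\<^sub>\<beta>\<close> is a bijection from its irreducible
  representations that are \<open>\<psi>\<^sub>\<beta>\<close>-isotypic on \<open>K\<^sub>l\<close> onto \<open>Irr(G(O\<^sub>r) | \<psi>\<^sub>\<beta>)\<close>. The stabilizer is \<open>G\<^sub>\<beta>(O\<^sub>r) K\<^sub>l\<^sub>'\<close> with
  \<open>G\<^sub>\<beta>(O\<^sub>r)\<close> abelian. The commutator pairing of \<open>K\<^sub>l\<^sub>'\<close> with values in \<open>\<psi>\<^sub>\<beta>\<close> has radical \<open>Z(O\<^sub>r,\<beta>)\<close>, so an
  isotypic irreducible representation restricts on \<open>K\<^sub>l\<^sub>'\<close> to multiples of one \<open>\<pi>\<^sub>\<beta>\<^sub>,\<^sub>\<rho>\<close>; twisting by \<open>U\<^sub>\<beta>\<^sub>,\<^sub>\<rho>\<close> leaves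
  commuting operators for \<open>G\<^sub>\<beta>(O\<^sub>r)\<close>, and a common eigenvector gives \<open>\<theta>\<close>. Since \<open>\<beta>\<close> is cyclic modulo
  \<open>\<p>\<close> with irreducible characteristic polynomial, a matrix commuting with \<open>\<beta>\<close> modulo \<open>\<p>\<^sup>m\<close> is congruent
  to an element of \<open>O[\<beta>]\<close>, which identifies \<open>G\<^sub>\<beta>(O\<^sub>r)\<close> with \<open>(O\<^sub>K/\<p>\<^sub>K\<^sup>r)\<^sup>\<times>\<close>.\<close>

section \<open>Matrix representations\<close>

text \<open>Both parities of \<open>r\<close> are instances of one situation for finite groups,
  \<open>heisenberg_extension\<close>; the arithmetic has to supply its hypotheses. Of
  \<open>\<pi>\<close> the argument uses irreducibility, the scalars by which \<open>Z\<close> acts,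
  and the vanishing of the trace off \<open>Z\<close>. Its dimension is never computed: explicit
  matrices are averaged over a group and the resulting intertwiner is checked to be nonzero. The
  quadratic term is what makes \<open>psi_rho\<close> multiplicative: the product of 1 + \<omega>^l'
  Y and 1 + \<omega>^l' W has the cross term \<omega>^(2l') YW, which adds tr(YW \<beta>)/\<omega>
  to the exponent, and the mixed terms of tr((Y+W)^2 \<beta>)/(2 \<omega>) remove it up to integral
  elements when Y and W commute with \<beta> modulo the maximal ideal. Here 2 has to be a unit. On
  the arithmetic side one normal form does most of the work: a nonzero element of F[\<beta>] is a
  power of \<omega> times a unit of O[\<beta>]. It yields inverses, the integral closure, the
  maximal ideal and the saturation of O[\<beta>] in the integral matrices.\<close>

lemma GLC_simps:
  "carrier (GLC d) = {A \<in> carrier_mat d d. \<exists>B\<in>carrier_mat d d. B * A = 1\<^sub>m d \<and> A * B = 1\<^sub>m d}"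
  "A \<otimes>\<^bsub>GLC d\<^esub> B = A * B" "\<one>\<^bsub>GLC d\<^esub> = 1\<^sub>m d"
  by (auto simp: GLC_def units_of_def Units_def ring_mat_def)

lemma GLC_group: "group (GLC d)"
proof -
  interpret semiring "ring_mat TYPE(complex) d ()" by (rule semiring_mat)
  show ?thesis unfolding GLC_def by (rule units_group)
qed

lemma subspace_module_vec_iff:
  "VectorSpace.subspace class_ring W (module_vec TYPE(complex) d) \<longleftrightarrow>
     W \<subseteq> carrier_vec d \<and> 0\<^sub>v d \<in> W \<and> (\<forall>u\<in>W. \<forall>w\<in>W. u + w \<in> W) \<and> (\<forall>c. \<forall>w\<in>W. c \<cdot>\<^sub>v w \<in> W)"
  using vec_vs[where 'a=complex, of d] vec_module[where 'a=complex, of d]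
  unfolding VectorSpace.subspace_def submodule_def by (auto simp: module_vec_simps)

lemma irreducible_repD:
  assumes "irreducible_rep G R" "W \<subseteq> carrier_vec (fst R)" "0\<^sub>v (fst R) \<in> W"
    "\<And>u w. u \<in> W \<Longrightarrow> w \<in> W \<Longrightarrow> u + w \<in> W" "\<And>c w. w \<in> W \<Longrightarrow> c \<cdot>\<^sub>v w \<in> W"
    "\<And>g w. g \<in> carrier G \<Longrightarrow> w \<in> W \<Longrightarrow> snd R g *\<^sub>v w \<in> W"
  shows "W = {0\<^sub>v (fst R)} \<or> W = carrier_vec (fst R)"
proof -
  have "VectorSpace.subspace class_ring W (module_vec TYPE(complex) (fst R))"
    unfolding subspace_module_vec_iff using assms(2-5) by simp
  then show ?thesis using assms(1,6) unfolding irreducible_rep_def by simp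
qed

lemma is_repD:
  assumes "is_rep G R"
  shows "g \<in> carrier G \<Longrightarrow> snd R g \<in> carrier_mat (fst R) (fst R)"
    "g \<in> carrier G \<Longrightarrow> h \<in> carrier G \<Longrightarrow> snd R (g \<otimes>\<^bsub>G\<^esub> h) = snd R g * snd R h"
  using assms by (auto simp: is_rep_def hom_def GLC_simps Pi_def)

lemma is_rep_one:
  assumes "group G" "is_rep G R"
  shows "snd R \<one>\<^bsub>G\<^esub> = 1\<^sub>m (fst R)"
  using group_hom.hom_one[of G "GLC (fst R)" "snd R"] assms GLC_group
  by (auto simp: group_hom_def group_hom_axioms_def is_rep_def GLC_simps)

lemma is_rep_inv:
  assumes "group G" "is_rep G R" "g \<in> carrier G"
  shows "snd R (inv\<^bsub>G\<^esub> g) * snd R g = 1\<^sub>m (fst R)" "snd R g * snd R (inv\<^bsub>G\<^esub> g) = 1\<^sub>m (fst R)"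
proof -
  interpret group G by fact
  show "snd R (inv\<^bsub>G\<^esub> g) * snd R g = 1\<^sub>m (fst R)" "snd R g * snd R (inv\<^bsub>G\<^esub> g) = 1\<^sub>m (fst R)"
    using is_repD(2)[OF assms(2), of "inv\<^bsub>G\<^esub> g" g] is_repD(2)[OF assms(2), of g "inv\<^bsub>G\<^esub> g"]
      is_rep_one[OF assms(1,2)] assms(3) by auto
qed

text \<open>Invertibility of the values is automatic: the image of \<open>inv g\<close> is a
  two-sided inverse of the image of \<open>g\<close>.\<close>

lemma is_repI:
  assumes "group G" "\<And>g. g \<in> carrier G \<Longrightarrow> snd R g \<in> carrier_mat (fst R) (fst R)"
    "\<And>g h. g \<in> carrier G \<Longrightarrow> h \<in> carrier G \<Longrightarrow> snd R (g \<otimes>\<^bsub>G\<^esub> h) = snd R g * snd R h"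
    "snd R \<one>\<^bsub>G\<^esub> = 1\<^sub>m (fst R)"
  shows "is_rep G R"
proof -
  interpret group G by fact
  have "snd R g \<in> carrier (GLC (fst R))" if "g \<in> carrier G" for g
    using assms(3)[of "inv\<^bsub>G\<^esub> g" g] assms(3)[of g "inv\<^bsub>G\<^esub> g"] assms(2)[of "inv\<^bsub>G\<^esub> g"] assms that
    unfolding GLC_simps by (auto intro!: bexI[of _ "snd R (inv\<^bsub>G\<^esub> g)"])
  then show ?thesis using assms by (auto simp: is_rep_def hom_def GLC_simps)
qed

section \<open>Matrices, traces and linear maps\<close>

lemma mat_eq_if_mult_vec_eq:
  fixes A B :: "'a::comm_ring_1 mat"
  assumes "A \<in> carrier_mat a b" "B \<in> carrier_mat a b"
    "\<And>w. w \<in> carrier_vec b \<Longrightarrow> A *\<^sub>v w = B *\<^sub>v w"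
  shows "A = B"
proof (rule eq_matI)
  fix i j assume ij: "i < dim_row B" "j < dim_col B"
  have "(A *\<^sub>v unit_vec b j) $ i = (B *\<^sub>v unit_vec b j) $ i" using assms(3)[of "unit_vec b j"] by simp
  then show "A $$ (i,j) = B $$ (i,j)" using ij assms(1,2) by (simp add: row_def)
qed (use assms in auto)

lemma zero_mat_mult_vec: "w \<in> carrier_vec b \<Longrightarrow> 0\<^sub>m a b *\<^sub>v w = 0\<^sub>v a"
  by (intro eq_vecI) auto

lemma smult_smult_mat: "c \<cdot>\<^sub>m (d \<cdot>\<^sub>m A) = (c * d) \<cdot>\<^sub>m A" for c :: "'a::semigroup_mult"
  by (intro eq_matI) (auto simp: mult.assoc)

lemma smult_one_mat: "1 \<cdot>\<^sub>m A = A" for A :: "'a::monoid_mult mat"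
  by (intro eq_matI) auto

lemma mtrace_mult_comm:
  fixes A B :: "'a::comm_ring_1 mat"
  assumes "A \<in> carrier_mat a b" "B \<in> carrier_mat b a"
  shows "mtrace (A * B) = mtrace (B * A)"
proof -
  have "mtrace (A * B) = (\<Sum>i<a. \<Sum>j<b. A $$ (i,j) * B $$ (j,i))"
    using assms by (auto simp: mtrace_def scalar_prod_def atLeast0LessThan intro!: sum.cong)
  also have "\<dots> = (\<Sum>j<b. \<Sum>i<a. B $$ (j,i) * A $$ (i,j))"
    by (subst sum.swap) (simp add: mult.commute)
  also have "\<dots> = mtrace (B * A)"
    using assms by (auto simp: mtrace_def scalar_prod_def atLeast0LessThan intro!: sum.cong)
  finally show ?thesis .
qed

lemma mtrace_one: "mtrace (1\<^sub>m n :: 'a::semiring_1 mat) = of_nat n"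
  by (simp add: mtrace_def)

lemma mtrace_smult: "mtrace (c \<cdot>\<^sub>m A) = c * mtrace A" if "A \<in> carrier_mat n n" for c :: "'a::comm_ring_1"
  using that by (simp add: mtrace_def sum_distrib_left)

lemma mtrace_add: "mtrace (A + B) = mtrace A + mtrace B"
  if "A \<in> carrier_mat n n" "B \<in> carrier_mat n n" for A B :: "'a::comm_ring_1 mat"
  using that by (simp add: mtrace_def sum.distrib)

text \<open>Both products have the same trace, and in characteristic zero the trace of an identity
  matrix determines its size. Degrees of equivalent representations are compared this way.\<close>

lemma inverse_mat_square:
  fixes A B :: "complex mat"
  assumes "A \<in> carrier_mat a b" "B \<in> carrier_mat b a" "A * B = 1\<^sub>m a" "B * A = 1\<^sub>m b"
  shows "a = b"
  using mtrace_mult_comm[OF assms(1,2)] unfolding assms(3,4) mtrace_one by simp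

text \<open>Vectors of all lengths share one type, so an empty sum has to be told its length; hence
  the parameter \<open>d\<close>.\<close>

definition vsum :: "nat \<Rightarrow> ('b \<Rightarrow> complex vec) \<Rightarrow> 'b set \<Rightarrow> complex vec" where
  "vsum d f Y = vec d (\<lambda>i. \<Sum>x\<in>Y. f x $ i)"

lemma vsum_carrier [simp]: "vsum d f Y \<in> carrier_vec d" "dim_vec (vsum d f Y) = d"
  by (auto simp: vsum_def)

lemma vsum_index: "i < d \<Longrightarrow> vsum d f Y $ i = (\<Sum>x\<in>Y. f x $ i)"
  by (simp add: vsum_def)

lemma vsum_insert:
  assumes "finite Y" "x \<notin> Y" "f x \<in> carrier_vec d"
  shows "vsum d f (insert x Y) = f x + vsum d f Y"
  using assms by (intro eq_vecI) (auto simp: vsum_index)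

lemma vsum_empty: "vsum d f {} = 0\<^sub>v d"
  by (auto simp: vsum_def)

lemma mult_mat_vec_vsum:
  assumes A: "A \<in> carrier_mat m d" and f: "\<And>x. x \<in> Y \<Longrightarrow> f x \<in> carrier_vec d"
  shows "A *\<^sub>v vsum d f Y = vsum m (\<lambda>x. A *\<^sub>v f x) Y"
proof (rule eq_vecI)
  fix i assume i: "i < dim_vec (vsum m (\<lambda>x. A *\<^sub>v f x) Y)"
  have "(A *\<^sub>v vsum d f Y) $ i = (\<Sum>j<d. \<Sum>x\<in>Y. A $$ (i,j) * f x $ j)"
    using A i by (simp add: scalar_prod_def vsum_index sum_distrib_left atLeast0LessThan)
  also have "\<dots> = (\<Sum>x\<in>Y. \<Sum>j<d. A $$ (i,j) * f x $ j)" by (rule sum.swap)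
  also have "\<dots> = vsum m (\<lambda>x. A *\<^sub>v f x) Y $ i"
    using A i carrier_vecD[OF f] by (simp add: vsum_index scalar_prod_def atLeast0LessThan)
  finally show "(A *\<^sub>v vsum d f Y) $ i = vsum m (\<lambda>x. A *\<^sub>v f x) Y $ i" .
qed (use A in auto)

lemma vec_unit_expansion:
  "w \<in> carrier_vec a \<Longrightarrow> w = vsum a (\<lambda>j. w $ j \<cdot>\<^sub>v unit_vec a j) {..<a}"
proof (rule eq_vecI)
  fix i assume "w \<in> carrier_vec a" and "i < dim_vec (vsum a (\<lambda>j. w $ j \<cdot>\<^sub>v unit_vec a j) {..<a})"
  then show "w $ i = vsum a (\<lambda>j. w $ j \<cdot>\<^sub>v unit_vec a j) {..<a} $ i"
    by (simp add: vsum_index unit_vec_def if_distrib cong: if_cong)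
qed simp

lemma linear_vsum:
  fixes L :: "complex vec \<Rightarrow> complex vec"
  assumes "finite Y"
    and car: "\<And>u. u \<in> carrier_vec a \<Longrightarrow> L u \<in> carrier_vec b"
    and add: "\<And>u w. u \<in> carrier_vec a \<Longrightarrow> w \<in> carrier_vec a \<Longrightarrow> L (u + w) = L u + L w"
    and smult: "\<And>c w. w \<in> carrier_vec a \<Longrightarrow> L (c \<cdot>\<^sub>v w) = c \<cdot>\<^sub>v L w"
    and f: "\<And>x. x \<in> Y \<Longrightarrow> f x \<in> carrier_vec a"
  shows "L (vsum a f Y) = vsum b (\<lambda>x. L (f x)) Y"
  using assms(1) f
proof (induction Y)
  case empty
  have "L (0\<^sub>v a) = L (0 \<cdot>\<^sub>v 0\<^sub>v a)" by (simp add: smult_vec_def zero_vec_def)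
  also have "\<dots> = 0 \<cdot>\<^sub>v L (0\<^sub>v a)" by (rule smult) simp
  also have "\<dots> = 0\<^sub>v b" using car[of "0\<^sub>v a"] by auto
  finally show ?case by (simp add: vsum_empty)
qed (simp add: vsum_insert add car)

text \<open>Intertwiners arise as functions, for instance as averages over the group or as a change
  of coordinates on an induced space; this turns them into matrices. Linearity is demanded only on
  the carrier.\<close>

lemma linear_map_matrix:
  fixes L :: "complex vec \<Rightarrow> complex vec"
  assumes car: "\<And>u. u \<in> carrier_vec a \<Longrightarrow> L u \<in> carrier_vec b"
    and add: "\<And>u w. u \<in> carrier_vec a \<Longrightarrow> w \<in> carrier_vec a \<Longrightarrow> L (u + w) = L u + L w"
    and smult: "\<And>c w. w \<in> carrier_vec a \<Longrightarrow> L (c \<cdot>\<^sub>v w) = c \<cdot>\<^sub>v L w"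
  shows "\<exists>M\<in>carrier_mat b a. \<forall>w\<in>carrier_vec a. M *\<^sub>v w = L w"
proof (intro bexI ballI)
  let ?M = "mat b a (\<lambda>(i,j). L (unit_vec a j) $ i)"
  show "?M \<in> carrier_mat b a" by simp
  fix w :: "complex vec" assume w: "w \<in> carrier_vec a"
  have "L w = L (vsum a (\<lambda>j. w $ j \<cdot>\<^sub>v unit_vec a j) {..<a})" using vec_unit_expansion[OF w] by simp
  also have "\<dots> = vsum b (\<lambda>j. L (w $ j \<cdot>\<^sub>v unit_vec a j)) {..<a}"
    by (rule linear_vsum) (auto intro: car add smult)
  also have "\<dots> = ?M *\<^sub>v w"
  proof (rule eq_vecI)
    fix i assume "i < dim_vec (?M *\<^sub>v w)"
    then have i: "i < b" by simp
    have "(L (w $ j \<cdot>\<^sub>v unit_vec a j)) $ i = L (unit_vec a j) $ i * w $ j" for j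
      using smult[of "unit_vec a j" "w $ j"] car[of "unit_vec a j"] i by auto
    then show "vsum b (\<lambda>j. L (w $ j \<cdot>\<^sub>v unit_vec a j)) {..<a} $ i = (?M *\<^sub>v w) $ i"
      using i w by (simp add: vsum_index scalar_prod_def atLeast0LessThan)
  qed simp
  finally show "?M *\<^sub>v w = L w" by simp
qed

lemma irreducible_is_rep: "irreducible_rep G R \<Longrightarrow> is_rep G R"
  by (simp add: irreducible_rep_def)

text \<open>Schur's lemma for a matrix not yet known to be square. Kernel and image of
  \<open>T\<close> are invariant, and \<open>T\<close> being nonzero leaves only the trivial kernel
  and the full image; equality of the degrees comes out as part of the conclusion.\<close>

lemma intertwiner_equiv:
  assumes R: "irreducible_rep G R" and S: "irreducible_rep G S"
    and T: "T \<in> carrier_mat (fst S) (fst R)" "T \<noteq> 0\<^sub>m (fst S) (fst R)"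
    and tw: "\<And>g. g \<in> carrier G \<Longrightarrow> T * snd R g = snd S g * T"
  shows "rep_equiv G R S"
proof -
  let ?a = "fst R" and ?b = "fst S"
  note Rc = is_repD(1)[OF irreducible_is_rep[OF R]] and Sc = is_repD(1)[OF irreducible_is_rep[OF S]]
  have tw': "T *\<^sub>v (snd R g *\<^sub>v w) = snd S g *\<^sub>v (T *\<^sub>v w)" if "g \<in> carrier G" "w \<in> carrier_vec ?a" for g w
    using assoc_mult_mat_vec[OF T(1) Rc[OF that(1)] that(2)]
      assoc_mult_mat_vec[OF Sc[OF that(1)] T(1) that(2)] tw[OF that(1)] by simp
  let ?K = "{w \<in> carrier_vec ?a. T *\<^sub>v w = 0\<^sub>v ?b}"
  have "?K = {0\<^sub>v ?a} \<or> ?K = carrier_vec ?a"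
  proof (rule irreducible_repD[OF R])
    fix g w assume "g \<in> carrier G" "w \<in> ?K"
    then show "snd R g *\<^sub>v w \<in> ?K" using tw'[of g w] Rc[of g] Sc[of g] by auto
  qed (use T(1) in \<open>auto simp: mult_add_distrib_mat_vec[of T ?b ?a] mult_mat_vec[of T ?b ?a]\<close>)
  moreover have "?K \<noteq> carrier_vec ?a"
  proof
    assume K: "?K = carrier_vec ?a"
    have "T = 0\<^sub>m ?b ?a"
    proof (rule mat_eq_if_mult_vec_eq[OF T(1)])
      fix w :: "complex vec" assume w: "w \<in> carrier_vec ?a"
      then have "w \<in> ?K" using K by simp
      then show "T *\<^sub>v w = 0\<^sub>m ?b ?a *\<^sub>v w" using w by (simp add: zero_mat_mult_vec)
    qed simp
    with T(2) show False by simp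
  qed
  ultimately have ker: "?K = {0\<^sub>v ?a}" by blast
  let ?I = "(\<lambda>w. T *\<^sub>v w) ` carrier_vec ?a"
  have "?I = {0\<^sub>v ?b} \<or> ?I = carrier_vec ?b"
  proof (rule irreducible_repD[OF S])
    show "?I \<subseteq> carrier_vec ?b" using T(1) by auto
    show "0\<^sub>v ?b \<in> ?I" by (rule image_eqI[of _ _ "0\<^sub>v ?a"]) (use T(1) in auto)
    fix u w assume "u \<in> ?I" "w \<in> ?I"
    then obtain u' w' where "u' \<in> carrier_vec ?a" "w' \<in> carrier_vec ?a" "u = T *\<^sub>v u'" "w = T *\<^sub>v w'" by auto
    then show "u + w \<in> ?I"
      by (intro image_eqI[of _ _ "u' + w'"]) (use T(1) in \<open>auto simp: mult_add_distrib_mat_vec[of T ?b ?a]\<close>)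
  next
    fix c w assume "w \<in> ?I"
    then obtain w' where "w' \<in> carrier_vec ?a" "w = T *\<^sub>v w'" by auto
    then show "c \<cdot>\<^sub>v w \<in> ?I"
      by (intro image_eqI[of _ _ "c \<cdot>\<^sub>v w'"]) (use T(1) in \<open>auto simp: mult_mat_vec[of T ?b ?a]\<close>)
  next
    fix g w assume g: "g \<in> carrier G" and "w \<in> ?I"
    then obtain w' where "w' \<in> carrier_vec ?a" "w = T *\<^sub>v w'" by auto
    then show "snd S g *\<^sub>v w \<in> ?I"
      by (intro image_eqI[of _ _ "snd R g *\<^sub>v w'"]) (use T(1) Rc[OF g] tw'[OF g] in auto)
  qed
  moreover have "?I \<noteq> {0\<^sub>v ?b}"
  proof
    assume I: "?I = {0\<^sub>v ?b}"
    have "T = 0\<^sub>m ?b ?a"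
    proof (rule mat_eq_if_mult_vec_eq[OF T(1)])
      fix w :: "complex vec" assume w: "w \<in> carrier_vec ?a"
      then have "T *\<^sub>v w \<in> ?I" by (rule imageI)
      then show "T *\<^sub>v w = 0\<^sub>m ?b ?a *\<^sub>v w" using w I by (simp add: zero_mat_mult_vec)
    qed simp
    with T(2) show False by simp
  qed
  ultimately have im: "?I = carrier_vec ?b" by blast
  \<comment> \<open>Preimages of the unit vectors are the columns of a right inverse of
    \<open>T\<close>.\<close>
  have "\<forall>j. \<exists>u\<in>carrier_vec ?a. T *\<^sub>v u = unit_vec ?b j"
  proof
    fix j have "unit_vec ?b j \<in> ?I" using im by simp
    then show "\<exists>u\<in>carrier_vec ?a. T *\<^sub>v u = unit_vec ?b j" by force
  qed
  then obtain u where u: "\<And>j. u j \<in> carrier_vec ?a" "\<And>j. T *\<^sub>v u j = unit_vec ?b j" by metis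
  define Y where "Y = mat ?a ?b (\<lambda>(i,j). u j $ i)"
  have Y: "Y \<in> carrier_mat ?a ?b" by (simp add: Y_def)
  have TY: "T * Y = 1\<^sub>m ?b"
  proof (rule eq_matI)
    fix i j assume ij: "i < dim_row (1\<^sub>m ?b :: complex mat)" "j < dim_col (1\<^sub>m ?b :: complex mat)"
    have cX: "col Y j = u j" using ij u(1)[of j] by (auto simp: Y_def)
    have "(T * Y) $$ (i,j) = row T i \<bullet> col Y j" using ij T(1) Y by simp
    also have "\<dots> = (T *\<^sub>v u j) $ i" using ij T(1) cX by simp
    finally show "(T * Y) $$ (i,j) = 1\<^sub>m ?b $$ (i,j)" using ij by (auto simp: u(2))
  qed (use T(1) Y in auto)
  have YT: "Y * T = 1\<^sub>m ?a"
  proof (rule mat_eq_if_mult_vec_eq[of _ ?a ?a])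
    fix w :: "complex vec" assume w: "w \<in> carrier_vec ?a"
    \<comment> \<open>The right inverse is also a left inverse: this difference is killed by
      \<open>T\<close>, hence zero by injectivity.\<close>
    let ?d = "Y *\<^sub>v (T *\<^sub>v w) - w"
    have Tw: "T *\<^sub>v w \<in> carrier_vec ?b" using T(1) w by auto
    have XTw: "Y *\<^sub>v (T *\<^sub>v w) \<in> carrier_vec ?a" using Y Tw by auto
    have "T *\<^sub>v (Y *\<^sub>v (T *\<^sub>v w)) = T *\<^sub>v w"
      using assoc_mult_mat_vec[OF T(1) Y Tw] TY Tw by simp
    then have "T *\<^sub>v ?d = 0\<^sub>v ?b"
      using mult_minus_distrib_mat_vec[OF T(1) XTw w] Tw by auto
    then have "?d \<in> ?K" using XTw w by auto
    then have "?d = 0\<^sub>v ?a" using ker by auto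
    then have "Y *\<^sub>v (T *\<^sub>v w) = w" using XTw w by (intro eq_vecI) (use Y in \<open>auto simp: vec_eq_iff\<close>)
    then show "Y * T *\<^sub>v w = 1\<^sub>m ?a *\<^sub>v w" using w assoc_mult_mat_vec[OF Y T(1) w] by simp
  qed (use Y T in auto)
  have ab: "?b = ?a" by (rule inverse_mat_square[OF T(1) Y TY YT])
  have "T \<in> carrier (GLC ?a)" using T(1) Y TY YT unfolding GLC_simps ab by auto
  then show ?thesis unfolding rep_equiv_def using ab tw by auto
qed

text \<open>The characteristic polynomial has positive degree, hence a complex root, and the
  eigenspace of that root is invariant and nonzero, so it is the whole space.\<close>

lemma schur_scalar:
  assumes R: "irreducible_rep G R" and T: "T \<in> carrier_mat (fst R) (fst R)"
    and tw: "\<And>g. g \<in> carrier G \<Longrightarrow> T * snd R g = snd R g * T"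
  shows "\<exists>c. T = c \<cdot>\<^sub>m 1\<^sub>m (fst R)"
proof -
  let ?a = "fst R"
  note Rc = is_repD(1)[OF irreducible_is_rep[OF R]]
  have tw': "T *\<^sub>v (snd R g *\<^sub>v w) = snd R g *\<^sub>v (T *\<^sub>v w)" if "g \<in> carrier G" "w \<in> carrier_vec ?a" for g w
    using assoc_mult_mat_vec[OF T(1) Rc[OF that(1)] that(2)]
      assoc_mult_mat_vec[OF Rc[OF that(1)] T(1) that(2)] tw[OF that(1)] by simp
  have "Polynomial.degree (char_poly T) \<noteq> 0" using R degree_monic_char_poly[OF T] by (simp add: irreducible_rep_def)
  then obtain c where "poly (char_poly T) c = 0"
    using fundamental_theorem_of_algebra constant_degree by metis
  then have "eigenvalue T c" using eigenvalue_root_char_poly[OF T] by simp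
  then obtain w0 where w0: "w0 \<in> carrier_vec ?a" "w0 \<noteq> 0\<^sub>v ?a" "T *\<^sub>v w0 = c \<cdot>\<^sub>v w0"
    using T unfolding eigenvalue_def eigenvector_def by auto
  let ?K = "{w \<in> carrier_vec ?a. T *\<^sub>v w = c \<cdot>\<^sub>v w}"
  have "?K = {0\<^sub>v ?a} \<or> ?K = carrier_vec ?a"
  proof (rule irreducible_repD[OF R])
    fix g w assume "g \<in> carrier G" "w \<in> ?K"
    then show "snd R g *\<^sub>v w \<in> ?K" using tw'[of g w] Rc[of g] by (auto simp: mult_mat_vec)
  qed (use T(1) in \<open>auto simp: mult_add_distrib_mat_vec[of T ?a ?a] mult_mat_vec[of T ?a ?a] 
        smult_add_distrib_vec[of _ ?a] smult_smult_assoc mult.commute[of c]\<close>)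
  then have K: "?K = carrier_vec ?a" using w0 by blast
  have "T = c \<cdot>\<^sub>m 1\<^sub>m ?a"
  proof (rule mat_eq_if_mult_vec_eq[OF T])
    fix w :: "complex vec" assume "w \<in> carrier_vec ?a"
    moreover have "(c \<cdot>\<^sub>m 1\<^sub>m ?a) *\<^sub>v w = c \<cdot>\<^sub>v w" using calculation
      by (intro eq_vecI) (auto simp: row_smult)
    ultimately show "T *\<^sub>v w = (c \<cdot>\<^sub>m 1\<^sub>m ?a) *\<^sub>v w" using K by auto
  qed simp
  then show ?thesis by blast
qed

section \<open>Isomorphism classes of representations\<close>

lemma rep_equiv_sym:
  assumes "is_rep G R" "is_rep G S" "rep_equiv G R S"
  shows "rep_equiv G S R"
proof -
  obtain T where T: "fst R = fst S" "T \<in> carrier (GLC (fst R))"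
    "\<And>g. g \<in> carrier G \<Longrightarrow> T * snd R g = snd S g * T"
    using assms(3) by (auto simp: rep_equiv_def)
  then obtain Y where Y: "Y \<in> carrier_mat (fst R) (fst R)" "Y * T = 1\<^sub>m (fst R)" "T * Y = 1\<^sub>m (fst R)"
    and Tc: "T \<in> carrier_mat (fst R) (fst R)" by (auto simp: GLC_simps)
  have "Y * snd S g = snd R g * Y" if g: "g \<in> carrier G" for g
  proof -
    have Rg: "snd R g \<in> carrier_mat (fst R) (fst R)" and Sg: "snd S g \<in> carrier_mat (fst R) (fst R)"
      using is_repD(1)[OF assms(1) g] is_repD(1)[OF assms(2) g] T(1) by auto
    have "Y * snd S g = Y * (snd S g * (T * Y))" using Y(3) Sg by simp
    also have "\<dots> = Y * ((snd S g * T) * Y)" using Y(1) Sg Tc by (simp add: assoc_mult_mat[of _ "fst R" "fst R" _ "fst R" _ "fst R"])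
    also have "\<dots> = Y * (T * snd R g * Y)" using T(3)[OF g] by simp
    also have "\<dots> = (Y * T) * (snd R g * Y)" using Y(1) Rg Tc by (simp add: assoc_mult_mat[of _ "fst R" "fst R" _ "fst R" _ "fst R"])
    finally show ?thesis using Y Rg by simp
  qed
  moreover have "Y \<in> carrier (GLC (fst S))" using Y Tc T(1) by (auto simp: GLC_simps)
  ultimately show ?thesis using T(1) unfolding rep_equiv_def by auto
qed

lemma rep_equiv_trans:
  assumes "is_rep G R" "is_rep G S" "is_rep G Q" "rep_equiv G R S" "rep_equiv G S Q"
  shows "rep_equiv G R Q"
proof -
  let ?d = "fst R"
  obtain T where T: "fst R = fst S" "T \<in> carrier (GLC ?d)"
    "\<And>g. g \<in> carrier G \<Longrightarrow> T * snd R g = snd S g * T"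
    using assms(4) by (auto simp: rep_equiv_def)
  obtain Y where Y: "fst S = fst Q" "Y \<in> carrier (GLC ?d)"
    "\<And>g. g \<in> carrier G \<Longrightarrow> Y * snd S g = snd Q g * Y"
    using assms(5) T(1) by (auto simp: rep_equiv_def)
  interpret GL: group "GLC ?d" by (rule GLC_group)
  have YT: "Y * T \<in> carrier (GLC ?d)" using GL.m_closed[OF Y(2) T(2)] by (simp add: GLC_simps)
  have "(Y * T) * snd R g = snd Q g * (Y * T)" if g: "g \<in> carrier G" for g
  proof -
    have c: "snd R g \<in> carrier_mat ?d ?d" "snd S g \<in> carrier_mat ?d ?d" "snd Q g \<in> carrier_mat ?d ?d"
      "Y \<in> carrier_mat ?d ?d" "T \<in> carrier_mat ?d ?d"
      using is_repD(1)[OF assms(1) g] is_repD(1)[OF assms(2) g] is_repD(1)[OF assms(3) g] T(1,2) Y(1,2)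
      by (auto simp: GLC_simps)
    show ?thesis
      using T(3)[OF g] Y(3)[OF g] assoc_mult_mat[OF c(4,5,1)] assoc_mult_mat[OF c(4,2,5)]
        assoc_mult_mat[OF c(3,4,5)] by metis
  qed
  then show ?thesis unfolding rep_equiv_def using YT T(1) Y(1) by auto
qed

lemma rep_class_eqI:
  assumes "is_rep G R" "is_rep G S" "rep_equiv G R S"
  shows "rep_class G R = rep_class G S"
  unfolding rep_class_def
  using assms rep_equiv_trans[OF assms(1,2) _ assms(3)]
    rep_equiv_trans[OF assms(2,1) _ rep_equiv_sym[OF assms]] by blast

section \<open>Joint eigenvectors of commuting operators of finite order\<close>

definition msum :: "nat \<Rightarrow> nat \<Rightarrow> ('b \<Rightarrow> complex mat) \<Rightarrow> 'b set \<Rightarrow> complex mat" where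
  "msum a b f Y = mat a b (\<lambda>ij. \<Sum>x\<in>Y. f x $$ ij)"

lemma msum_carrier [simp]: "msum a b f Y \<in> carrier_mat a b" "dim_row (msum a b f Y) = a" "dim_col (msum a b f Y) = b"
  by (auto simp: msum_def)

lemma msum_index: "i < a \<Longrightarrow> j < b \<Longrightarrow> msum a b f Y $$ (i,j) = (\<Sum>x\<in>Y. f x $$ (i,j))"
  by (simp add: msum_def)

lemma msum_insert:
  assumes "finite Y" "x \<notin> Y" "f x \<in> carrier_mat a b"
  shows "msum a b f (insert x Y) = f x + msum a b f Y"
  using assms by (intro eq_matI) (auto simp: msum_index)

lemma msum_empty: "msum a b f {} = 0\<^sub>m a b"
  by (auto simp: msum_def)

text \<open>The eigenvector is \<open>\<Sum>\<^sub>k \<zeta>\<^sup>t\<^sup>k L\<^sup>k J\<close> for a suitable \<open>t\<close>, where \<open>\<zeta>\<close> is a primitive \<open>m\<close>-th root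
  of unity: the sum of these vectors over \<open>t\<close> is \<open>m J\<close>.\<close>

lemma finite_order_eigenvector:
  fixes L :: "complex mat \<Rightarrow> complex mat"
  assumes E: "E \<subseteq> carrier_mat a b" "0\<^sub>m a b \<in> E" "\<And>j k. j \<in> E \<Longrightarrow> k \<in> E \<Longrightarrow> j + k \<in> E"
    "\<And>c j. j \<in> E \<Longrightarrow> c \<cdot>\<^sub>m j \<in> E"
    and L: "\<And>j. j \<in> E \<Longrightarrow> L j \<in> E" "\<And>j k. j \<in> E \<Longrightarrow> k \<in> E \<Longrightarrow> L (j + k) = L j + L k"
    "\<And>c j. j \<in> E \<Longrightarrow> L (c \<cdot>\<^sub>m j) = c \<cdot>\<^sub>m L j"
    and m: "0 < m" "\<And>j. j \<in> E \<Longrightarrow> (L ^^ m) j = j"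
    and J: "J \<in> E" "J \<noteq> 0\<^sub>m a b"
  shows "\<exists>J'\<in>E. J' \<noteq> 0\<^sub>m a b \<and> (\<exists>c. L J' = c \<cdot>\<^sub>m J')"
proof -
  define \<zeta> where "\<zeta> = cis (2 * pi / m)"
  have zm: "\<zeta> ^ m = 1" using m by (simp add: \<zeta>_def DeMoivre)
  have z1: "\<zeta> ^ k \<noteq> 1" if "0 < k" "k < m" for k
  proof -
    have "\<zeta> ^ k = cis (2 * pi * (real k / m))" by (simp add: \<zeta>_def DeMoivre field_simps)
    moreover have "0 < 2 * pi * (real k / m)" "2 * pi * (real k / m) < 2 * pi"
      using that mult_strict_left_mono[of "real k / m" 1 "2 * pi"] by auto
    moreover have "cis x \<noteq> 1" if "0 < x" "x < 2 * pi" for x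
    proof
      assume "cis x = 1"
      then have "cos x = 1" by (simp add: complex_eq_iff)
      then obtain i :: int where "x = i * 2 * pi" using cos_one_2pi_int by auto
      with that have "0 < i" "i < 1" by (auto simp: zero_less_mult_iff)
      then show False by simp
    qed
    ultimately show ?thesis by metis
  qed
  define Lk where "Lk k = (L ^^ k) J" for k
  have Lk: "Lk k \<in> E" for k by (induction k) (auto simp: Lk_def J L)
  have Lkc: "Lk k \<in> carrier_mat a b" for k using Lk E(1) by auto
  define u where "u t = msum a b (\<lambda>k. \<zeta> ^ (t * k) \<cdot>\<^sub>m Lk k) {..<m}" for t
  have lin: "msum a b f Y \<in> E \<and> L (msum a b f Y) = msum a b (\<lambda>x. L (f x)) Y"
    if "finite Y" "\<And>x. x \<in> Y \<Longrightarrow> f x \<in> E" for f :: "nat \<Rightarrow> complex mat" and Y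
    using that
  proof (induction Y)
    case empty
    have "L (0\<^sub>m a b) = L (0 \<cdot>\<^sub>m 0\<^sub>m a b)" by simp
    also have "\<dots> = 0 \<cdot>\<^sub>m L (0\<^sub>m a b)" by (rule L(3)) (rule E)
    also have "\<dots> = 0\<^sub>m a b" by (intro eq_matI) (use L(1)[OF E(2)] E(1) in auto)
    finally show ?case using E(2) by (simp add: msum_empty)
  next
    case (insert x Y)
    then have "f x \<in> E" "L (f x) \<in> E" using L(1) by auto
    with insert show ?case using E L(2) by (auto simp: msum_insert subset_iff)
  qed
  have uE: "u t \<in> E" for t unfolding u_def using lin[of "{..<m}"] E(4) Lk by auto
  have eig: "\<zeta> ^ t \<cdot>\<^sub>m L (u t) = u t" for t
  proof (rule eq_matI)
    fix i j assume "i < dim_row (u t)" "j < dim_col (u t)"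
    then have ij: "i < a" "j < b" by (auto simp: u_def)
    define F where "F k = \<zeta> ^ (t * k) * Lk k $$ (i,j)" for k
    have "L (u t) = msum a b (\<lambda>k. L (\<zeta> ^ (t * k) \<cdot>\<^sub>m Lk k)) {..<m}"
      unfolding u_def using lin[of "{..<m}"] E(4) Lk by auto
    also have "\<dots> = msum a b (\<lambda>k. \<zeta> ^ (t * k) \<cdot>\<^sub>m Lk (Suc k)) {..<m}"
      using L(3) Lk by (simp add: Lk_def)
    finally have "(\<zeta> ^ t \<cdot>\<^sub>m L (u t)) $$ (i,j) = (\<Sum>k<m. F (Suc k))"
      using ij Lkc[THEN carrier_matD(1)] Lkc[THEN carrier_matD(2)]
      by (simp add: msum_index sum_distrib_left F_def power_add algebra_simps)
    \<comment> \<open>A cyclic shift of the summands: the term for k = m equals the term for k = 0,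
      because both the root of unity and the operator have m-th power one.\<close>
    also have "\<dots> = (\<Sum>k<m. F k)"
    proof -
      have "F m = F 0" using m(2)[OF J(1)] zm
        by (simp add: F_def Lk_def mult.commute[of t] power_mult)
      moreover have "F 0 + (\<Sum>k<m. F (Suc k)) = (\<Sum>k<m. F k) + F m"
        using sum.lessThan_Suc_shift[of F m] by simp
      ultimately show ?thesis by simp
    qed
    also have "\<dots> = u t $$ (i,j)" 
      using ij Lkc[THEN carrier_matD(1)] Lkc[THEN carrier_matD(2)] by (simp add: u_def msum_index F_def)
    finally show "(\<zeta> ^ t \<cdot>\<^sub>m L (u t)) $$ (i,j) = u t $$ (i,j)" .
  qed (use uE[of t] L(1)[OF uE[of t]] E(1) in auto)
  have eig': "L (u t) = inverse (\<zeta> ^ t) \<cdot>\<^sub>m u t" for t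
  proof -
    have "\<zeta> ^ t \<noteq> 0" by (simp add: \<zeta>_def)
    then have "inverse (\<zeta> ^ t) * \<zeta> ^ t = 1" by simp
    then have "inverse (\<zeta> ^ t) \<cdot>\<^sub>m (\<zeta> ^ t \<cdot>\<^sub>m L (u t)) = 1 \<cdot>\<^sub>m L (u t)"
      by (simp only: smult_smult_mat)
    also have "\<dots> = L (u t)" by (intro eq_matI) auto
    finally have "inverse (\<zeta> ^ t) \<cdot>\<^sub>m (\<zeta> ^ t \<cdot>\<^sub>m L (u t)) = L (u t)" .
    then show ?thesis by (simp add: eig)
  qed
  have "\<exists>t<m. u t \<noteq> 0\<^sub>m a b"
  proof (rule ccontr)
    assume "\<not> ?thesis"
    then have u0: "u t = 0\<^sub>m a b" if "t < m" for t using that by auto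
    have "J = 0\<^sub>m a b"
    proof (rule eq_matI)
      fix i j assume "i < dim_row (0\<^sub>m a b :: complex mat)" "j < dim_col (0\<^sub>m a b :: complex mat)"
      then have ij: "i < a" "j < b" by auto
      have "0 = (\<Sum>t<m. u t $$ (i,j))" using u0 ij by simp
      also have "\<dots> = (\<Sum>t<m. \<Sum>k<m. (\<zeta> ^ k) ^ t * Lk k $$ (i,j))"
        using ij Lkc[THEN carrier_matD(1)] Lkc[THEN carrier_matD(2)]
        by (simp add: u_def msum_index power_mult[symmetric] mult.commute)
      also have "\<dots> = (\<Sum>k<m. (\<Sum>t<m. (\<zeta> ^ k) ^ t) * Lk k $$ (i,j))"
        by (subst sum.swap) (simp add: sum_distrib_right)
      also have "\<dots> = (\<Sum>k<m. if k = 0 then of_nat m * J $$ (i,j) else 0)"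
      proof (rule sum.cong[OF refl])
        fix k assume k: "k \<in> {..<m}"
        have "(\<Sum>t<m. (\<zeta> ^ k) ^ t) = 0" if "k \<noteq> 0"
        proof -
          have "(\<zeta> ^ k) ^ m = 1" by (metis mult.commute power_mult power_one zm)
          then show ?thesis using z1[of k] k that by (simp add: geometric_sum)
        qed
        then show "(\<Sum>t<m. (\<zeta> ^ k) ^ t) * Lk k $$ (i,j) = (if k = 0 then of_nat m * J $$ (i,j) else 0)"
          by (auto simp: Lk_def)
      qed
      also have "\<dots> = of_nat m * J $$ (i,j)" using m by simp
      finally show "J $$ (i,j) = 0\<^sub>m a b $$ (i,j)" using m ij by simp
    qed (use J(1) E(1) in auto)
    with J(2) show False by simp
  qed
  then show ?thesis using uE eig' by blast
qed

text \<open>Induction on \<open>Y\<close>: the joint eigenspace of the operators already treated,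
  with their eigenvalues \<open>c\<close> fixed, is stable under the next operator by commutation,
  and that operator still has finite order on it. The operators act on matrices so that the same
  lemma serves for spaces of intertwiners and, with a single column, for vectors.\<close>

lemma common_eigenvector:
  fixes L :: "'g \<Rightarrow> complex mat \<Rightarrow> complex mat"
  assumes E: "E \<subseteq> carrier_mat a b" "0\<^sub>m a b \<in> E" "\<And>j k. j \<in> E \<Longrightarrow> k \<in> E \<Longrightarrow> j + k \<in> E"
    "\<And>c j. j \<in> E \<Longrightarrow> c \<cdot>\<^sub>m j \<in> E"
    and Y: "finite Y"
    and L: "\<And>x j. x \<in> Y \<Longrightarrow> j \<in> E \<Longrightarrow> L x j \<in> E"
    "\<And>x j k. x \<in> Y \<Longrightarrow> j \<in> E \<Longrightarrow> k \<in> E \<Longrightarrow> L x (j + k) = L x j + L x k"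
    "\<And>x c j. x \<in> Y \<Longrightarrow> j \<in> E \<Longrightarrow> L x (c \<cdot>\<^sub>m j) = c \<cdot>\<^sub>m L x j"
    and m: "\<And>x. x \<in> Y \<Longrightarrow> \<exists>m>0. \<forall>j\<in>E. (L x ^^ m) j = j"
    and comm: "\<And>x y j. x \<in> Y \<Longrightarrow> y \<in> Y \<Longrightarrow> j \<in> E \<Longrightarrow> L x (L y j) = L y (L x j)"
    and J: "J \<in> E" "J \<noteq> 0\<^sub>m a b"
  shows "\<exists>J'\<in>E. J' \<noteq> 0\<^sub>m a b \<and> (\<forall>x\<in>Y. \<exists>c. L x J' = c \<cdot>\<^sub>m J')"
  using Y L m comm
proof (induction Y)
  case empty
  then show ?case using J by auto
next
  case (insert x Y)
  obtain J1 where J1: "J1 \<in> E" "J1 \<noteq> 0\<^sub>m a b" "\<forall>y\<in>Y. \<exists>c. L y J1 = c \<cdot>\<^sub>m J1"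
    using insert.IH[OF insert.prems] by auto
  then obtain c where c: "\<And>y. y \<in> Y \<Longrightarrow> L y J1 = c y \<cdot>\<^sub>m J1" by metis
  let ?E = "{j \<in> E. \<forall>y\<in>Y. L y j = c y \<cdot>\<^sub>m j}"
  obtain k where k: "0 < k" "\<And>j. j \<in> E \<Longrightarrow> (L x ^^ k) j = j" using insert.prems(4)[of x] by auto
  have L0: "L y (0\<^sub>m a b) = 0\<^sub>m a b" if "y \<in> Y" for y
  proof -
    have "L y (0\<^sub>m a b) = L y (0 \<cdot>\<^sub>m 0\<^sub>m a b)" by simp
    also have "\<dots> = 0 \<cdot>\<^sub>m L y (0\<^sub>m a b)" by (rule insert.prems(3)) (use that E in auto)
    also have "\<dots> = 0\<^sub>m a b"
      by (intro eq_matI) (use insert.prems(1)[of y, OF _ E(2)] E(1) that in auto)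
    finally show ?thesis .
  qed
  have "\<exists>J'\<in>?E. J' \<noteq> 0\<^sub>m a b \<and> (\<exists>c. L x J' = c \<cdot>\<^sub>m J')"
  proof (rule finite_order_eigenvector[of ?E a b "L x" k J1])
    show "?E \<subseteq> carrier_mat a b" using E by auto
    show "0\<^sub>m a b \<in> ?E" using E L0 by auto
    fix j l assume jl: "j \<in> ?E" "l \<in> ?E"
    then show "j + l \<in> ?E" using E insert.prems(2) add_smult_distrib_left_mat[of j a b l]
      by (auto simp: subset_iff)
    show "L x (j + l) = L x j + L x l" using jl insert.prems(2) by auto
  next
    fix j d assume j: "j \<in> ?E"
    then show "d \<cdot>\<^sub>m j \<in> ?E" using E insert.prems(3) by (auto simp: smult_smult_mat mult.commute)
    show "L x (d \<cdot>\<^sub>m j) = d \<cdot>\<^sub>m L x j" using j insert.prems(3) by auto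
    show "L x j \<in> ?E"
    proof (intro CollectI conjI ballI)
      fix y assume y: "y \<in> Y"
      have "L y (L x j) = L x (L y j)" using insert.prems(5)[of y x j] y j by auto
      then show "L y (L x j) = c y \<cdot>\<^sub>m L x j" using j y insert.prems(3)[of x] by auto
    qed (use j insert.prems(1) in auto)
  qed (use J1 c k in auto)
  then obtain J' where "J' \<in> ?E" "J' \<noteq> 0\<^sub>m a b" "\<exists>c. L x J' = c \<cdot>\<^sub>m J'" by blast
  then show ?case by (intro bexI[of _ J']) auto
qed

section \<open>Clifford theory\<close>

text \<open>The condition on \<open>\<Phi>\<close> inside \<open>Ind_class\<close>, isolated so that
  the isomorphism can be named and its inverse used.\<close>

definition ind_iso ::
  "('g, 'b) monoid_scheme \<Rightarrow> 'g set \<Rightarrow> 'g matrix_rep \<Rightarrow> 'g matrix_rep \<Rightarrow> (complex vec \<Rightarrow> 'g \<Rightarrow> complex vec) \<Rightarrow> bool"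
  where "ind_iso G H \<sigma> R \<Phi> \<longleftrightarrow> bij_betw \<Phi> (carrier_vec (fst R)) (Ind_space G H \<sigma>) \<and>
        (\<forall>u\<in>carrier_vec (fst R). \<forall>w\<in>carrier_vec (fst R).
           \<Phi> (u + w) = (\<lambda>x\<in>carrier G. \<Phi> u x + \<Phi> w x)) \<and>
        (\<forall>c. \<forall>w\<in>carrier_vec (fst R). \<Phi> (c \<cdot>\<^sub>v w) = (\<lambda>x\<in>carrier G. c \<cdot>\<^sub>v \<Phi> w x)) \<and>
        (\<forall>g\<in>carrier G. \<forall>w\<in>carrier_vec (fst R).
           \<Phi> (snd R g *\<^sub>v w) = (\<lambda>x\<in>carrier G. \<Phi> w (x \<otimes>\<^bsub>G\<^esub> g)))"

lemma Ind_class_iff: "R \<in> Ind_class G H \<sigma> \<longleftrightarrow> is_rep G R \<and> (\<exists>\<Phi>. ind_iso G H \<sigma> R \<Phi>)"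
  by (simp add: Ind_class_def ind_iso_def)

lemma ind_isoD:
  assumes "ind_iso G H \<sigma> R \<Phi>"
  shows "bij_betw \<Phi> (carrier_vec (fst R)) (Ind_space G H \<sigma>)"
    "u \<in> carrier_vec (fst R) \<Longrightarrow> w \<in> carrier_vec (fst R) \<Longrightarrow> \<Phi> (u + w) = (\<lambda>x\<in>carrier G. \<Phi> u x + \<Phi> w x)"
    "w \<in> carrier_vec (fst R) \<Longrightarrow> \<Phi> (c \<cdot>\<^sub>v w) = (\<lambda>x\<in>carrier G. c \<cdot>\<^sub>v \<Phi> w x)"
    "g \<in> carrier G \<Longrightarrow> w \<in> carrier_vec (fst R) \<Longrightarrow> \<Phi> (snd R g *\<^sub>v w) = (\<lambda>x\<in>carrier G. \<Phi> w (x \<otimes>\<^bsub>G\<^esub> g))"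
    "w \<in> carrier_vec (fst R) \<Longrightarrow> \<Phi> w \<in> Ind_space G H \<sigma>"
  using assms unfolding ind_iso_def by (blast dest: bij_betw_apply)+

lemma ind_iso_inv:
  assumes "ind_iso G H \<sigma> R \<Phi>"
  obtains \<Psi> where "\<And>f. f \<in> Ind_space G H \<sigma> \<Longrightarrow> \<Psi> f \<in> carrier_vec (fst R)"
    "\<And>f. f \<in> Ind_space G H \<sigma> \<Longrightarrow> \<Phi> (\<Psi> f) = f" "\<And>w. w \<in> carrier_vec (fst R) \<Longrightarrow> \<Psi> (\<Phi> w) = w"
proof
  note b = ind_isoD(1)[OF assms]
  show "inv_into (carrier_vec (fst R)) \<Phi> f \<in> carrier_vec (fst R)" if "f \<in> Ind_space G H \<sigma>" for f
    using bij_betw_apply[OF bij_betw_inv_into[OF b] that] .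
  show "\<Phi> (inv_into (carrier_vec (fst R)) \<Phi> f) = f" if "f \<in> Ind_space G H \<sigma>" for f
    using bij_betw_inv_into_right[OF b that] .
  show "inv_into (carrier_vec (fst R)) \<Phi> (\<Phi> w) = w" if "w \<in> carrier_vec (fst R)" for w
    using bij_betw_inv_into_left[OF b that] .
qed

lemma Ind_spaceD:
  assumes "f \<in> Ind_space G H \<sigma>"
  shows "x \<in> carrier G \<Longrightarrow> f x \<in> carrier_vec (fst \<sigma>)"
    "h \<in> H \<Longrightarrow> x \<in> carrier G \<Longrightarrow> f (h \<otimes>\<^bsub>G\<^esub> x) = snd \<sigma> h *\<^sub>v f x"
    "f \<in> extensional (carrier G)"
  using assms by (auto simp: Ind_space_def PiE_def Pi_def)

lemma Ind_spaceI:
  assumes "\<And>x. x \<in> carrier G \<Longrightarrow> f x \<in> carrier_vec (fst \<sigma>)"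
    "\<And>h x. h \<in> H \<Longrightarrow> x \<in> carrier G \<Longrightarrow> f (h \<otimes>\<^bsub>G\<^esub> x) = snd \<sigma> h *\<^sub>v f x"
    "f \<in> extensional (carrier G)"
  shows "f \<in> Ind_space G H \<sigma>"
  using assms by (auto simp: Ind_space_def PiE_def Pi_def)

lemma Ind_space_eqI:
  assumes "f \<in> Ind_space G H \<sigma>" "f' \<in> Ind_space G H \<sigma>'" "\<And>x. x \<in> carrier G \<Longrightarrow> f x = f' x"
  shows "f = f'"
  using assms by (meson Ind_spaceD(3) extensionalityI)

lemma smult_zero_vec: "w \<in> carrier_vec d \<Longrightarrow> 0 \<cdot>\<^sub>v w = (0\<^sub>v d :: 'a::mult_zero vec)"
  by (intro eq_vecI) auto

lemma mult_mat_zero_vec: "A \<in> carrier_mat a b \<Longrightarrow> A *\<^sub>v 0\<^sub>v b = (0\<^sub>v a :: 'a::semiring_0 vec)"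
  by (intro eq_vecI) auto

lemma (in group) mult_inv_cancel [simp]:
  "x \<in> carrier G \<Longrightarrow> y \<in> carrier G \<Longrightarrow> x \<otimes> (inv x \<otimes> y) = y"
  "x \<in> carrier G \<Longrightarrow> y \<in> carrier G \<Longrightarrow> inv x \<otimes> (x \<otimes> y) = y"
  by (simp_all add: m_assoc[symmetric])

section \<open>Clifford theory for a linear character of a normal subgroup\<close>

locale character_stabilizer = group G for G (structure) +
  fixes N :: "'a set" and \<psi> :: "'a \<Rightarrow> complex" and S :: "'a set"
  assumes fin: "finite (carrier G)"
    and N: "subgroup N G" and N_normal: "\<And>g h. g \<in> carrier G \<Longrightarrow> h \<in> N \<Longrightarrow> g \<otimes> h \<otimes> inv g \<in> N"
    and \<psi>_mult: "\<And>h k. h \<in> N \<Longrightarrow> k \<in> N \<Longrightarrow> \<psi> (h \<otimes> k) = \<psi> h * \<psi> k"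
    and \<psi>_nz: "\<And>h. h \<in> N \<Longrightarrow> \<psi> h \<noteq> 0"
    and S_eq: "S = {g \<in> carrier G. \<forall>h\<in>N. \<psi> (g \<otimes> h \<otimes> inv g) = \<psi> h}"
begin

lemma N_carrier [simp]: "h \<in> N \<Longrightarrow> h \<in> carrier G"
  using subgroup.mem_carrier[OF N] .

lemma S_carrier: "s \<in> S \<Longrightarrow> s \<in> carrier G"
  by (simp add: S_eq)

lemma N_one [simp]: "\<one> \<in> N"
  using subgroup.one_closed[OF N] .

lemma \<psi>_one [simp]: "\<psi> \<one> = 1"
  using \<psi>_mult[of \<one> \<one>] \<psi>_nz[of \<one>] by simp

lemma \<psi>_inv: "h \<in> N \<Longrightarrow> \<psi> (inv h) = inverse (\<psi> h)"
  using \<psi>_mult[of "inv h" h] subgroup.m_inv_closed[OF N] \<psi>_nz[of h]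
  by (simp add: field_simps)

lemma conj_inv: "g \<in> carrier G \<Longrightarrow> h \<in> carrier G \<Longrightarrow> inv g \<otimes> (g \<otimes> h \<otimes> inv g) \<otimes> g = h"
  by (simp add: m_assoc)

lemma S_subgroup: "subgroup S G"
proof (rule subgroupI)
  show "S \<subseteq> carrier G" using S_carrier by auto
  show "S \<noteq> {}" by (auto simp: S_eq intro!: exI[of _ \<one>])
  fix a assume a: "a \<in> S"
  note aG = S_carrier[OF a]
  show "inv a \<in> S"
    unfolding S_eq
  proof (intro CollectI conjI ballI)
    fix h assume h: "h \<in> N"
    let ?k = "inv a \<otimes> h \<otimes> inv (inv a)"
    have "?k \<in> N" using N_normal[of "inv a" h] aG h by simp
    then have "\<psi> (a \<otimes> ?k \<otimes> inv a) = \<psi> ?k" using a by (simp add: S_eq)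
    moreover have "a \<otimes> ?k \<otimes> inv a = h" using conj_inv[of "inv a" h] aG h by simp
    ultimately show "\<psi> ?k = \<psi> h" by simp
  qed (use aG in simp)
  fix b assume b: "b \<in> S"
  note bG = S_carrier[OF b]
  show "a \<otimes> b \<in> S"
    unfolding S_eq
  proof (intro CollectI conjI ballI)
    fix h assume h: "h \<in> N"
    have "a \<otimes> b \<otimes> h \<otimes> inv (a \<otimes> b) = a \<otimes> (b \<otimes> h \<otimes> inv b) \<otimes> inv a"
      using aG bG h by (simp add: m_assoc inv_mult_group)
    then show "\<psi> (a \<otimes> b \<otimes> h \<otimes> inv (a \<otimes> b)) = \<psi> h"
      using a b h N_normal[of b h] bG by (simp add: S_eq)
  qed (use aG bG in simp)
qed

declare S_carrier [simp]

lemma S_group: "group (G\<lparr>carrier := S\<rparr>)"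
  using subgroup.subgroup_is_group[OF S_subgroup is_group] .

lemma N_le_S: "N \<subseteq> S"
proof
  fix g assume g: "g \<in> N"
  show "g \<in> S" unfolding S_eq
  proof (intro CollectI conjI ballI)
    fix h assume h: "h \<in> N"
    have "\<psi> (g \<otimes> h \<otimes> inv g) = \<psi> g * \<psi> h * inverse (\<psi> g)"
      using g h subgroup.m_inv_closed[OF N g] subgroup.m_closed[OF N g h] by (simp add: \<psi>_mult \<psi>_inv)
    then show "\<psi> (g \<otimes> h \<otimes> inv g) = \<psi> h" using \<psi>_nz[OF g] by simp
  qed (use g in simp)
qed

lemma S_one [simp]: "\<one> \<in> S"
  using N_le_S by auto

lemma finite_S: "finite S"
  by (rule finite_subset[OF _ fin]) auto

lemma S_mult_iff: "s \<in> S \<Longrightarrow> x \<in> carrier G \<Longrightarrow> x \<otimes> s \<in> S \<longleftrightarrow> x \<in> S"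
proof
  assume s: "s \<in> S" and x: "x \<in> carrier G" and "x \<otimes> s \<in> S"
  then have "(x \<otimes> s) \<otimes> inv s \<in> S" 
    using subgroup.m_closed[OF S_subgroup] subgroup.m_inv_closed[OF S_subgroup] by blast
  then show "x \<in> S" using s x by (simp add: m_assoc)
qed (use subgroup.m_closed[OF S_subgroup] in blast)

lemma S_mult_iff': "s \<in> S \<Longrightarrow> x \<in> carrier G \<Longrightarrow> s \<otimes> x \<in> S \<longleftrightarrow> x \<in> S"
proof
  assume s: "s \<in> S" and x: "x \<in> carrier G" and "s \<otimes> x \<in> S"
  then have "inv s \<otimes> (s \<otimes> x) \<in> S" 
    using subgroup.m_closed[OF S_subgroup] subgroup.m_inv_closed[OF S_subgroup] by blast
  then show "x \<in> S" using s x by (simp add: m_assoc[symmetric])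
qed (use subgroup.m_closed[OF S_subgroup] in blast)

text \<open>The copy of \<open>\<sigma>\<close> inside its induced representation: the functions
  supported on \<open>S\<close>, determined by their value \<open>u\<close> at the identity.\<close>

definition ind_emb :: "'a matrix_rep \<Rightarrow> complex vec \<Rightarrow> 'a \<Rightarrow> complex vec" where
  "ind_emb \<sigma> u = (\<lambda>x\<in>carrier G. if x \<in> S then snd \<sigma> x *\<^sub>v u else 0\<^sub>v (fst \<sigma>))"

definition isotypic_rep :: "'a matrix_rep \<Rightarrow> bool" where
  "isotypic_rep \<sigma> \<longleftrightarrow> irreducible_rep (G\<lparr>carrier := S\<rparr>) \<sigma> \<and> (\<forall>h\<in>N. snd \<sigma> h = \<psi> h \<cdot>\<^sub>m 1\<^sub>m (fst \<sigma>))"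

context
  fixes \<sigma> :: "'a matrix_rep"
  assumes \<sigma>: "isotypic_rep \<sigma>"
begin

lemma \<sigma>_rep: "is_rep (G\<lparr>carrier := S\<rparr>) \<sigma>"
  using \<sigma> by (simp add: isotypic_rep_def irreducible_rep_def)

lemma \<sigma>_carrier [simp]: "s \<in> S \<Longrightarrow> snd \<sigma> s \<in> carrier_mat (fst \<sigma>) (fst \<sigma>)"
  using is_repD(1)[OF \<sigma>_rep] by simp

lemma \<sigma>_vec [simp]: "s \<in> S \<Longrightarrow> u \<in> carrier_vec (fst \<sigma>) \<Longrightarrow> snd \<sigma> s *\<^sub>v u \<in> carrier_vec (fst \<sigma>)"
  using mult_mat_vec_carrier[OF \<sigma>_carrier] by blast

lemma \<sigma>_mult: "s \<in> S \<Longrightarrow> t \<in> S \<Longrightarrow> u \<in> carrier_vec (fst \<sigma>) \<Longrightarrow>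
    snd \<sigma> (s \<otimes> t) *\<^sub>v u = snd \<sigma> s *\<^sub>v (snd \<sigma> t *\<^sub>v u)"
  using is_repD(2)[OF \<sigma>_rep, of s t] assoc_mult_mat_vec[OF \<sigma>_carrier \<sigma>_carrier] by simp

lemma \<sigma>_one: "u \<in> carrier_vec (fst \<sigma>) \<Longrightarrow> snd \<sigma> \<one> *\<^sub>v u = u"
  using is_rep_one[OF S_group \<sigma>_rep] by simp

lemma \<sigma>_N: "h \<in> N \<Longrightarrow> u \<in> carrier_vec (fst \<sigma>) \<Longrightarrow> snd \<sigma> h *\<^sub>v u = \<psi> h \<cdot>\<^sub>v u"
proof -
  assume h: "h \<in> N" and u: "u \<in> carrier_vec (fst \<sigma>)"
  have "(\<psi> h \<cdot>\<^sub>m 1\<^sub>m (fst \<sigma>)) *\<^sub>v u = \<psi> h \<cdot>\<^sub>v u" using u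
    by (intro eq_vecI) (auto simp: row_smult)
  then show ?thesis using \<sigma> h by (simp add: isotypic_rep_def)
qed

lemma \<sigma>_deg: "fst \<sigma> \<noteq> 0"
  using \<sigma> by (simp add: isotypic_rep_def irreducible_rep_def)

lemma Ind_translate_closed:
  assumes "f \<in> Ind_space G S \<sigma>" "g \<in> carrier G"
  shows "(\<lambda>x\<in>carrier G. f (x \<otimes> g)) \<in> Ind_space G S \<sigma>"
  using Ind_spaceD[OF assms(1)] assms(2) by (intro Ind_spaceI) (auto simp: m_assoc)

lemma ind_emb_in: "u \<in> carrier_vec (fst \<sigma>) \<Longrightarrow> ind_emb \<sigma> u \<in> Ind_space G S \<sigma>"
  by (rule Ind_spaceI)
    (auto simp: ind_emb_def S_mult_iff' \<sigma>_mult mult_mat_vec[OF \<sigma>_carrier] intro!: eq_vecI dest: \<sigma>_carrier)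

lemma ind_emb_translate:
  "u \<in> carrier_vec (fst \<sigma>) \<Longrightarrow> s \<in> S \<Longrightarrow> (\<lambda>x\<in>carrier G. ind_emb \<sigma> u (x \<otimes> s)) = ind_emb \<sigma> (snd \<sigma> s *\<^sub>v u)"
  by (auto simp: ind_emb_def S_mult_iff \<sigma>_mult intro!: restrict_ext)

lemma ind_emb_add: "u \<in> carrier_vec (fst \<sigma>) \<Longrightarrow> w \<in> carrier_vec (fst \<sigma>) \<Longrightarrow>
    ind_emb \<sigma> (u + w) = (\<lambda>x\<in>carrier G. ind_emb \<sigma> u x + ind_emb \<sigma> w x)"
  by (auto simp: ind_emb_def mult_add_distrib_mat_vec[OF \<sigma>_carrier] intro!: restrict_ext)

lemma ind_emb_smult: "u \<in> carrier_vec (fst \<sigma>) \<Longrightarrow>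
    ind_emb \<sigma> (c \<cdot>\<^sub>v u) = (\<lambda>x\<in>carrier G. c \<cdot>\<^sub>v ind_emb \<sigma> u x)"
  by (auto simp: ind_emb_def mult_mat_vec[OF \<sigma>_carrier] intro!: restrict_ext eq_vecI)

text \<open>Writing x h = (x h x^-1) x turns right translation by \<open>N\<close> into the
  conjugate of \<open>\<psi>\<close> by x at the point x. The stabilizer condition then separates
  the identity coset of \<open>S\<close> from all others.\<close>

lemma Ind_N: 
  assumes "f \<in> Ind_space G S \<sigma>" "x \<in> carrier G" "h \<in> N"
  shows "f (x \<otimes> h) = \<psi> (x \<otimes> h \<otimes> inv x) \<cdot>\<^sub>v f x"
proof -
  have k: "x \<otimes> h \<otimes> inv x \<in> N" using N_normal assms by simp
  have "x \<otimes> h = (x \<otimes> h \<otimes> inv x) \<otimes> x" using assms by (simp add: m_assoc)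
  then have "f (x \<otimes> h) = snd \<sigma> (x \<otimes> h \<otimes> inv x) *\<^sub>v f x"
    using Ind_spaceD(2)[OF assms(1), of "x \<otimes> h \<otimes> inv x" x] k N_le_S assms by auto
  then show ?thesis using \<sigma>_N[OF k] Ind_spaceD(1)[OF assms(1,2)] by simp
qed

text \<open>Off \<open>S\<close> some h in \<open>N\<close> has a conjugate with a different value
  of \<open>\<psi>\<close>, so two different scalars act on the same vector \<open>f x\<close> and
  it must vanish. The \<open>\<psi>\<close>-part of the induced representation is therefore exactly
  the embedded copy of \<open>\<sigma>\<close>.\<close>

lemma Ind_isotypic:
  assumes f: "f \<in> Ind_space G S \<sigma>" and N: "\<And>x h. x \<in> carrier G \<Longrightarrow> h \<in> N \<Longrightarrow> f (x \<otimes> h) = \<psi> h \<cdot>\<^sub>v f x"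
  shows "f = ind_emb \<sigma> (f \<one>)"
proof (rule Ind_space_eqI[OF f ind_emb_in])
  show "f \<one> \<in> carrier_vec (fst \<sigma>)" using Ind_spaceD(1)[OF f] by simp
  fix x assume x: "x \<in> carrier G"
  show "f x = ind_emb \<sigma> (f \<one>) x"
  proof (cases "x \<in> S")
    case True
    then show ?thesis using Ind_spaceD(2)[OF f True, of \<one>] x by (simp add: ind_emb_def)
  next
    case False
    then obtain h where h: "h \<in> N" "\<psi> (x \<otimes> h \<otimes> inv x) \<noteq> \<psi> h"
      using x by (auto simp: S_eq simp del: S_carrier)
    have fx: "f x \<in> carrier_vec (fst \<sigma>)" using Ind_spaceD(1)[OF f x] .
    have "\<psi> (x \<otimes> h \<otimes> inv x) \<cdot>\<^sub>v f x = \<psi> h \<cdot>\<^sub>v f x" using N[OF x h(1)] Ind_N[OF f x h(1)] by simp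
    then have "f x $ i = 0" if "i < fst \<sigma>" for i
      using h(2) fx that by (auto simp: vec_eq_iff)
    then have "f x = 0\<^sub>v (fst \<sigma>)" using fx by (intro eq_vecI) auto
    then show ?thesis using False x by (simp add: ind_emb_def)
  qed
qed

lemma Ind_sum_closed:
  assumes W: "W \<subseteq> Ind_space G S \<sigma>"
    "\<And>f f'. f \<in> W \<Longrightarrow> f' \<in> W \<Longrightarrow> (\<lambda>x\<in>carrier G. f x + f' x) \<in> W"
    "(\<lambda>x\<in>carrier G. 0\<^sub>v (fst \<sigma>)) \<in> W" and fin: "finite Y" "\<And>i. i \<in> Y \<Longrightarrow> F i \<in> W"
  shows "(\<lambda>x\<in>carrier G. vsum (fst \<sigma>) (\<lambda>i. F i x) Y) \<in> W"
  using fin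
proof (induction Y)
  case empty then show ?case using W(3) by (simp only: vsum_empty)
next
  case (insert i Y)
  have Fi: "F i x \<in> carrier_vec (fst \<sigma>)" if "x \<in> carrier G" for x
    using insert.prems W(1) Ind_spaceD(1)[of "F i" G S \<sigma> x] that by auto
  have e: "(\<lambda>x\<in>carrier G. vsum (fst \<sigma>) (\<lambda>i. F i x) (insert i Y)) =
    (\<lambda>x\<in>carrier G. F i x + (\<lambda>x\<in>carrier G. vsum (fst \<sigma>) (\<lambda>i. F i x) Y) x)"
    using insert Fi by (auto simp: vsum_insert intro!: restrict_ext)
  show ?case unfolding e
    by (rule W(2)) (rule insert.prems, simp, rule insert.IH, rule insert.prems, simp)
qed

text \<open>Averaging over \<open>N\<close> moves a nonzero function in \<open>W\<close> into the \<open>\<psi>\<close>-isotypic part, which is a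
  copy of \<open>\<sigma>\<close> and generates the induced representation.\<close>

lemma Ind_irreducible:
  assumes W: "W \<subseteq> Ind_space G S \<sigma>"
    "\<And>f f'. f \<in> W \<Longrightarrow> f' \<in> W \<Longrightarrow> (\<lambda>x\<in>carrier G. f x + f' x) \<in> W"
    "\<And>c f. f \<in> W \<Longrightarrow> (\<lambda>x\<in>carrier G. c \<cdot>\<^sub>v f x) \<in> W"
    "\<And>g f. g \<in> carrier G \<Longrightarrow> f \<in> W \<Longrightarrow> (\<lambda>x\<in>carrier G. f (x \<otimes> g)) \<in> W"
    and f: "f \<in> W" "x0 \<in> carrier G" "f x0 \<noteq> 0\<^sub>v (fst \<sigma>)"
  shows "W = Ind_space G S \<sigma>"
proof
  let ?d = "fst \<sigma>"
  have Wc: "F x \<in> carrier_vec ?d" if "F \<in> W" "x \<in> carrier G" for F x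
    using Ind_spaceD(1)[of F G S \<sigma> x] that W(1) by auto
  have "(\<lambda>x\<in>carrier G. 0 \<cdot>\<^sub>v f x) = (\<lambda>x\<in>carrier G. 0\<^sub>v ?d)"
    using Wc[OF f(1)] by (intro restrict_ext) (simp add: smult_zero_vec)
  then have W0: "(\<lambda>x\<in>carrier G. 0\<^sub>v ?d) \<in> W" using W(3)[OF f(1), of 0] by simp
  \<comment> \<open>Translation moves a point where the function is nonzero to the identity, the one
    point where averaging over \<open>N\<close> against \<open>\<psi>\<close> is sure not to destroy
    the value.\<close>
  define f1 where "f1 = (\<lambda>x\<in>carrier G. f (x \<otimes> x0))"
  have f1: "f1 \<in> W" "f1 \<one> \<noteq> 0\<^sub>v ?d" using W(4) f by (auto simp: f1_def)
  \<comment> \<open>The summands of the projector onto the \<open>\<psi>\<close>-part, without its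
    factor 1/|N|.\<close>
  define F where "F h = (\<lambda>x\<in>carrier G. inverse (\<psi> h) \<cdot>\<^sub>v (\<lambda>x\<in>carrier G. f1 (x \<otimes> h)) x)" for h
  have F: "F h \<in> W" if "h \<in> N" for h unfolding F_def by (intro W(3,4) f1) (use that in simp)
  define f2 where "f2 = (\<lambda>x\<in>carrier G. vsum ?d (\<lambda>h. F h x) N)"
  have finN: "finite N" by (rule finite_subset[OF _ fin]) auto
  have f2: "f2 \<in> W" unfolding f2_def by (rule Ind_sum_closed[OF W(1,2) W0 finN F])
  note [simp] = carrier_vecD[OF Wc[OF f1(1)]] carrier_vecD[OF Wc[OF f2]]
  have f2_eq: "f2 x $ i = (\<Sum>h\<in>N. inverse (\<psi> h) * f1 (x \<otimes> h) $ i)" if "x \<in> carrier G" "i < ?d" for x i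
    using that carrier_vecD[OF Wc[OF f1(1)]] by (auto simp: f2_def vsum_index F_def intro!: sum.cong)
  have "f2 (x \<otimes> k) = \<psi> k \<cdot>\<^sub>v f2 x" if x: "x \<in> carrier G" and k: "k \<in> N" for x k
  proof (rule eq_vecI)
    fix i assume "i < dim_vec (\<psi> k \<cdot>\<^sub>v f2 x)"
    then have i: "i < ?d" using Wc[OF f2 x] by simp
    have "f2 (x \<otimes> k) $ i = (\<Sum>h\<in>N. inverse (\<psi> h) * f1 (x \<otimes> k \<otimes> h) $ i)"
      using f2_eq[of "x \<otimes> k" i] x k i by simp
    also have "\<dots> = (\<Sum>h\<in>N. inverse (\<psi> (inv k \<otimes> h)) * f1 (x \<otimes> h) $ i)"
      by (rule sum.reindex_bij_witness[of _ "\<lambda>h. inv k \<otimes> h" "\<lambda>h. k \<otimes> h"])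
        (use x k subgroup.m_closed[OF N] subgroup.m_inv_closed[OF N] in \<open>auto simp: m_assoc[symmetric]\<close>)
    also have "\<dots> = (\<Sum>h\<in>N. \<psi> k * (inverse (\<psi> h) * f1 (x \<otimes> h) $ i))"
      using k subgroup.m_inv_closed[OF N k] \<psi>_nz by (intro sum.cong) (auto simp: \<psi>_mult \<psi>_inv)
    also have "\<dots> = (\<psi> k \<cdot>\<^sub>v f2 x) $ i"
      using f2_eq[OF x i] i Wc[OF f2 x] by (simp add: sum_distrib_left)
    finally show "f2 (x \<otimes> k) $ i = (\<psi> k \<cdot>\<^sub>v f2 x) $ i" .
  qed (use carrier_vecD[OF Wc[OF f2]] x k in simp)
  then have f2_emb: "f2 = ind_emb \<sigma> (f2 \<one>)" using Ind_isotypic[of f2] f2 W(1) by blast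
  \<comment> \<open>At the identity \<open>N\<close> acts through \<open>\<psi>\<close> itself, so
    the weights cancel and all summands are equal.\<close>
  have f2_1: "f2 \<one> = of_nat (card N) \<cdot>\<^sub>v f1 \<one>"
  proof (rule eq_vecI)
    fix i assume "i < dim_vec (of_nat (card N) \<cdot>\<^sub>v f1 \<one>)"
    then have i: "i < ?d" using carrier_vecD[OF Wc[OF f1(1) one_closed]] by simp
    have "f2 \<one> $ i = (\<Sum>h\<in>N. inverse (\<psi> h) * (\<psi> h * f1 \<one> $ i))"
      unfolding f2_eq[OF one_closed i]
    proof (rule sum.cong[OF refl])
      fix h assume h: "h \<in> N"
      have "f1 (\<one> \<otimes> h) = \<psi> h \<cdot>\<^sub>v f1 \<one>"
        using Ind_N[of f1 \<one> h] f1 W(1) h by auto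
      then show "inverse (\<psi> h) * f1 (\<one> \<otimes> h) $ i = inverse (\<psi> h) * (\<psi> h * f1 \<one> $ i)"
        using i Wc[OF f1(1)] by simp
    qed
    also have "\<dots> = (\<Sum>h\<in>N. f1 \<one> $ i)" using \<psi>_nz by (intro sum.cong) auto
    finally show "f2 \<one> $ i = (of_nat (card N) \<cdot>\<^sub>v f1 \<one>) $ i" using i Wc[OF f1(1)] by simp
  qed (use Wc[OF f1(1)] Wc[OF f2] in simp)
  have cardN: "card N \<noteq> 0" using finN N_one by (auto simp: card_eq_0_iff simp del: N_one)
  have f2_nz: "f2 \<one> \<noteq> 0\<^sub>v ?d"
  proof
    assume "f2 \<one> = 0\<^sub>v ?d"
    then have "of_nat (card N) \<cdot>\<^sub>v f1 \<one> = 0\<^sub>v ?d" using f2_1 by simp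
    then have "f1 \<one> $ i = 0" if "i < ?d" for i
      using that cardN Wc[OF f1(1)] by (auto simp: vec_eq_iff)
    then have "f1 \<one> = 0\<^sub>v ?d" using Wc[OF f1(1)] by (intro eq_vecI) auto
    with f1 show False by simp
  qed
  let ?U = "{u \<in> carrier_vec ?d. ind_emb \<sigma> u \<in> W}"
  have U_cases: "?U = {0\<^sub>v ?d} \<or> ?U = carrier_vec ?d"
  proof (rule irreducible_repD)
    show "irreducible_rep (G\<lparr>carrier := S\<rparr>) \<sigma>" using \<sigma> by (simp add: isotypic_rep_def)
    have "ind_emb \<sigma> (0\<^sub>v ?d) = (\<lambda>x\<in>carrier G. 0\<^sub>v ?d)"
      by (auto simp: ind_emb_def mult_mat_zero_vec[OF \<sigma>_carrier] intro!: restrict_ext)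
    then show "0\<^sub>v ?d \<in> ?U" using W0 by simp
    fix u w assume "u \<in> ?U" "w \<in> ?U"
    then show "u + w \<in> ?U" using W(2) by (auto simp: ind_emb_add)
  next
    fix c w assume "w \<in> ?U" then show "c \<cdot>\<^sub>v w \<in> ?U" using W(3) by (auto simp: ind_emb_smult)
  next
    fix g w assume "g \<in> carrier (G\<lparr>carrier := S\<rparr>)" "w \<in> ?U"
    then show "snd \<sigma> g *\<^sub>v w \<in> ?U" using W(4)[of g "ind_emb \<sigma> w"] by (auto simp: ind_emb_translate)
  qed auto
  have U: "ind_emb \<sigma> u \<in> W" if "u \<in> carrier_vec ?d" for u
  proof -
    have "f2 \<one> \<in> ?U" using Wc[OF f2 one_closed] f2 f2_emb[symmetric] by simp
    then have "?U \<noteq> {0\<^sub>v ?d}" using f2_nz by blast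
    with U_cases have "u \<in> ?U" using that by simp
    then show ?thesis by simp
  qed
  show "Ind_space G S \<sigma> \<subseteq> W"
  proof
    fix F assume F: "F \<in> Ind_space G S \<sigma>"
    \<comment> \<open>Rebuilds an arbitrary \<open>F\<close> from embedded vectors: the translate
      for y takes at x the value \<open>F x\<close> if x y^-1 lies in \<open>S\<close>, and zero
      otherwise. For each x this happens for |S| elements y, which explains the factor in
      \<open>H1\<close>.\<close>
    define H where "H y = (\<lambda>x\<in>carrier G. ind_emb \<sigma> (F y) (x \<otimes> inv y))" for y
    have H: "H y \<in> W" if "y \<in> carrier G" for y
      unfolding H_def using W(4) U Ind_spaceD(1)[OF F] that by simp
    define H1 where "H1 = (\<lambda>x\<in>carrier G. inverse (of_nat (card S)) \<cdot>\<^sub>v (\<lambda>x\<in>carrier G. vsum ?d (\<lambda>y. H y x) (carrier G)) x)"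
    have H1: "H1 \<in> W" unfolding H1_def by (intro W(3) Ind_sum_closed[OF W(1,2) W0 fin] H)
    note finS = finite_S
    have cardS: "card S \<noteq> 0" using finS S_one by (auto simp: card_eq_0_iff simp del: S_one)
    have "F = H1"
    proof (rule Ind_space_eqI[OF F])
      show "H1 \<in> Ind_space G S \<sigma>" using H1 W(1) by auto
      fix x assume x: "x \<in> carrier G"
      note Fx = Ind_spaceD(1)[OF F]
      show "F x = H1 x"
      proof (rule eq_vecI)
        fix i assume "i < dim_vec (H1 x)"
        then have i: "i < ?d" using Wc[OF H1 x] by simp
        have "(\<Sum>y\<in>carrier G. H y x $ i) = (\<Sum>y\<in>{y \<in> carrier G. x \<otimes> inv y \<in> S}. F x $ i)"
        proof (rule sum.mono_neutral_cong_right[OF fin])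
          fix y assume y: "y \<in> {y \<in> carrier G. x \<otimes> inv y \<in> S}"
          then have "snd \<sigma> (x \<otimes> inv y) *\<^sub>v F y = F (x \<otimes> inv y \<otimes> y)"
            using Ind_spaceD(2)[OF F, of "x \<otimes> inv y" y] by simp
          then show "H y x $ i = F x $ i" using x y by (simp add: H_def ind_emb_def m_assoc)
        qed (use x i in \<open>auto simp: H_def ind_emb_def\<close>)
        also have "\<dots> = of_nat (card S) * F x $ i"
        proof -
          have "card {y \<in> carrier G. x \<otimes> inv y \<in> S} = card S"
            by (rule bij_betw_same_card[of "\<lambda>y. x \<otimes> inv y"], 
                rule bij_betw_byWitness[of _ "\<lambda>s. inv s \<otimes> x"])
              (use x in \<open>auto simp: inv_mult_group m_assoc\<close>)
          then show ?thesis by simp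
        qed
        finally have "H1 x $ i = inverse (of_nat (card S)) * (of_nat (card S) * F x $ i)"
          using x i by (simp add: H1_def vsum_index)
        then show "F x $ i = H1 x $ i" using cardS by simp
      qed (use Fx[OF x] Wc[OF H1 x] in auto)
    qed
    then show "F \<in> W" using H1 by simp
  qed
qed (rule W(1))

text \<open>A function in the induced space is freely determined by its values at representatives of
  the right cosets of \<open>S\<close>. These values are concatenated: entry j of the value at the
  representative numbered e is entry e d + j of the coordinate vector, where d is the degree of
  \<open>\<sigma>\<close>.\<close>

lemma Ind_coordinates:
  "\<exists>m \<Phi>. bij_betw \<Phi> (carrier_vec m) (Ind_space G S \<sigma>) \<and>
    (\<forall>u\<in>carrier_vec m. \<forall>w\<in>carrier_vec m. \<Phi> (u + w) = (\<lambda>x\<in>carrier G. \<Phi> u x + \<Phi> w x)) \<and>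
    (\<forall>c. \<forall>w\<in>carrier_vec m. \<Phi> (c \<cdot>\<^sub>v w) = (\<lambda>x\<in>carrier G. c \<cdot>\<^sub>v \<Phi> w x))"
proof -
  let ?d = "fst \<sigma>"
  have d: "0 < ?d" using \<sigma>_deg by simp
  \<comment> \<open>The choice is made from the coset as a set, so \<open>t\<close> is constant on
    cosets by construction.\<close>
  define t where "t x = (SOME y. y \<in> S #> x)" for x
  have tS: "t x \<in> S #> x" if "x \<in> carrier G" for x
    unfolding t_def by (rule someI[of _ x]) (simp add: rcos_self[OF that S_subgroup])
  have tc: "t x \<in> carrier G" and xt: "x \<otimes> inv (t x) \<in> S" if x: "x \<in> carrier G" for x
  proof -
    obtain s where s: "s \<in> S" "t x = s \<otimes> x" using tS[OF x] by (auto simp: r_coset_def)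
    show "t x \<in> carrier G" using s x by simp
    have "x \<otimes> inv (t x) = inv s" using s x by (simp add: inv_mult_group m_assoc[symmetric])
    then show "x \<otimes> inv (t x) \<in> S" using subgroup.m_inv_closed[OF S_subgroup s(1)] by simp
  qed
  have t_left: "t (s \<otimes> x) = t x" if "s \<in> S" "x \<in> carrier G" for s x
  proof -
    have "S #> (s \<otimes> x) = S #> x"
      using coset_mult_assoc[of S s x] coset_join2[OF S_carrier S_subgroup, of s] that
      by (auto simp: subset_iff)
    then show ?thesis by (simp add: t_def)
  qed
  have tt: "t (t x) = t x" if "x \<in> carrier G" for x
    using tS[OF that] t_left that by (auto simp: r_coset_def)
  let ?T = "t ` carrier G"
  obtain e where e: "bij_betw e ?T {..<card ?T}"
    using fin ex_bij_betw_finite_nat[of ?T] by (auto simp: atLeast0LessThan)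
  let ?m = "card ?T * ?d"
  \<comment> \<open>The equivariance condition extends the block stored for the representative to
    the whole coset, since x = (x t(x)^-1) t(x).\<close>
  define \<Phi> where "\<Phi> w = (\<lambda>x\<in>carrier G. snd \<sigma> (x \<otimes> inv (t x)) *\<^sub>v vec ?d (\<lambda>j. w $ (e (t x) * ?d + j)))" for w :: "complex vec"
  define \<Psi> where "\<Psi> f = vec ?m (\<lambda>p. f (inv_into ?T e (p div ?d)) $ (p mod ?d))" for f :: "'a \<Rightarrow> complex vec"
  have elt: "e (t x) < card ?T" if "x \<in> carrier G" for x using bij_betw_apply[OF e] that by auto
  have idx: "e (t x) * ?d + j < ?m" if "x \<in> carrier G" "j < ?d" for x j
  proof -
    have "e (t x) * ?d + j < (e (t x) + 1) * ?d" using that by simp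
    also have "\<dots> \<le> ?m" using elt[OF that(1)] by (intro mult_right_mono) auto
    finally show ?thesis .
  qed
  have \<Phi>_at: "\<Phi> w (t x) = vec ?d (\<lambda>j. w $ (e (t x) * ?d + j))" if "x \<in> carrier G" for x w
    using that tc tt by (simp add: \<Phi>_def \<sigma>_one)
  have \<Phi>_in: "\<Phi> w \<in> Ind_space G S \<sigma>" for w
  proof (rule Ind_spaceI)
    fix x assume "x \<in> carrier G" then show "\<Phi> w x \<in> carrier_vec ?d" using xt by (simp add: \<Phi>_def)
  next
    fix s x assume s: "s \<in> S" and x: "x \<in> carrier G"
    have "s \<otimes> x \<otimes> inv (t x) = s \<otimes> (x \<otimes> inv (t x))" using s x tc by (simp add: m_assoc)
    then show "\<Phi> w (s \<otimes> x) = snd \<sigma> s *\<^sub>v \<Phi> w x"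
      using s x xt by (simp add: \<Phi>_def t_left \<sigma>_mult)
  qed (simp add: \<Phi>_def)
  have eT: "inv_into ?T e (e (t x)) = t x" if "x \<in> carrier G" for x
    using bij_betw_inv_into_left[OF e] that by auto
  have "bij_betw \<Phi> (carrier_vec ?m) (Ind_space G S \<sigma>)"
  proof (rule bij_betw_byWitness[of _ \<Psi>])
    show "\<forall>w\<in>carrier_vec ?m. \<Psi> (\<Phi> w) = w"
    proof (intro ballI eq_vecI)
      fix w :: "complex vec" and p assume w: "w \<in> carrier_vec ?m" and "p < dim_vec w"
      then have p: "p < ?m" by simp
      then have pd: "p div ?d < card ?T" using d by (simp add: less_mult_imp_div_less)
      have "e ` ?T = {..<card ?T}" using e by (rule bij_betw_imp_surj_on)
      then have "p div ?d \<in> e ` ?T" using pd by simp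
      then obtain x where x: "x \<in> carrier G" "e (t x) = p div ?d" by auto
      have "\<Psi> (\<Phi> w) $ p = \<Phi> w (t x) $ (p mod ?d)" using p eT[OF x(1)] x by (simp add: \<Psi>_def)
      also have "\<dots> = w $ (p div ?d * ?d + p mod ?d)" using \<Phi>_at[OF x(1)] d x(2) by simp
      finally show "\<Psi> (\<Phi> w) $ p = w $ p" by simp
    qed (simp add: \<Psi>_def)
    show "\<forall>f\<in>Ind_space G S \<sigma>. \<Phi> (\<Psi> f) = f"
    proof
      fix f assume f: "f \<in> Ind_space G S \<sigma>"
      show "\<Phi> (\<Psi> f) = f"
      proof (rule Ind_space_eqI[OF \<Phi>_in f])
        fix x assume x: "x \<in> carrier G"
        have "vec ?d (\<lambda>j. \<Psi> f $ (e (t x) * ?d + j)) = f (t x)"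
          using Ind_spaceD(1)[OF f tc[OF x]] idx[OF x] eT[OF x] d by (intro eq_vecI) (auto simp: \<Psi>_def)
        then have "\<Phi> (\<Psi> f) x = snd \<sigma> (x \<otimes> inv (t x)) *\<^sub>v f (t x)" using x by (simp add: \<Phi>_def)
        also have "\<dots> = f (x \<otimes> inv (t x) \<otimes> t x)" using Ind_spaceD(2)[OF f xt[OF x] tc[OF x]] by simp
        finally show "\<Phi> (\<Psi> f) x = f x" using x tc by (simp add: m_assoc)
      qed
    qed
  qed (auto simp: \<Phi>_in, simp add: \<Psi>_def)
  moreover have "\<Phi> (u + w) = (\<lambda>x\<in>carrier G. \<Phi> u x + \<Phi> w x)" if "u \<in> carrier_vec ?m" "w \<in> carrier_vec ?m" for u w
  proof -
    have "vec ?d (\<lambda>j. (u + w) $ (e (t x) * ?d + j)) =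
        vec ?d (\<lambda>j. u $ (e (t x) * ?d + j)) + vec ?d (\<lambda>j. w $ (e (t x) * ?d + j))" if "x \<in> carrier G" for x
      using idx[OF that] \<open>u \<in> _\<close> \<open>w \<in> _\<close> by (intro eq_vecI) auto
    then show ?thesis using xt
      by (auto simp: \<Phi>_def mult_add_distrib_mat_vec[OF \<sigma>_carrier] intro!: restrict_ext)
  qed
  moreover have "\<Phi> (c \<cdot>\<^sub>v w) = (\<lambda>x\<in>carrier G. c \<cdot>\<^sub>v \<Phi> w x)" if "w \<in> carrier_vec ?m" for c w
  proof -
    have "vec ?d (\<lambda>j. (c \<cdot>\<^sub>v w) $ (e (t x) * ?d + j)) = c \<cdot>\<^sub>v vec ?d (\<lambda>j. w $ (e (t x) * ?d + j))" if "x \<in> carrier G" for x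
      using idx[OF that] \<open>w \<in> _\<close> by (intro eq_vecI) auto
    then show ?thesis using xt
      by (auto simp: \<Phi>_def mult_mat_vec[OF \<sigma>_carrier] intro!: restrict_ext)
  qed
  ultimately show ?thesis by blast
qed

lemma Ind_matrix_rep:
  obtains R \<Phi> where "is_rep G R" "ind_iso G S \<sigma> R \<Phi>"
proof -
  obtain m \<Phi> where \<Phi>0: "bij_betw \<Phi> (carrier_vec m) (Ind_space G S \<sigma>) \<and>
    (\<forall>u\<in>carrier_vec m. \<forall>w\<in>carrier_vec m. \<Phi> (u + w) = (\<lambda>x\<in>carrier G. \<Phi> u x + \<Phi> w x)) \<and>
    (\<forall>c. \<forall>w\<in>carrier_vec m. \<Phi> (c \<cdot>\<^sub>v w) = (\<lambda>x\<in>carrier G. c \<cdot>\<^sub>v \<Phi> w x))"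
    using Ind_coordinates by (elim exE)
  have \<Phi>: "bij_betw \<Phi> (carrier_vec m) (Ind_space G S \<sigma>)"
    "\<And>u w. u \<in> carrier_vec m \<Longrightarrow> w \<in> carrier_vec m \<Longrightarrow> \<Phi> (u + w) = (\<lambda>x\<in>carrier G. \<Phi> u x + \<Phi> w x)"
    "\<And>c w. w \<in> carrier_vec m \<Longrightarrow> \<Phi> (c \<cdot>\<^sub>v w) = (\<lambda>x\<in>carrier G. c \<cdot>\<^sub>v \<Phi> w x)"
    using \<Phi>0 by simp_all
  define L where "L g w = inv_into (carrier_vec m) \<Phi> (\<lambda>x\<in>carrier G. \<Phi> w (x \<otimes> g))" for g w
  have \<Phi>_in: "\<Phi> w \<in> Ind_space G S \<sigma>" if "w \<in> carrier_vec m" for w using bij_betw_apply[OF \<Phi>(1) that] .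
  have Lc: "L g w \<in> carrier_vec m" and \<Phi>L: "\<Phi> (L g w) = (\<lambda>x\<in>carrier G. \<Phi> w (x \<otimes> g))"
    if "g \<in> carrier G" "w \<in> carrier_vec m" for g w
    using Ind_translate_closed[OF \<Phi>_in[OF that(2)] that(1)] bij_betw_apply[OF bij_betw_inv_into[OF \<Phi>(1)]]
      bij_betw_inv_into_right[OF \<Phi>(1)] by (auto simp: L_def)
  have inj: "u = w" if "u \<in> carrier_vec m" "w \<in> carrier_vec m" "\<Phi> u = \<Phi> w" for u w
    using \<Phi>(1) that unfolding bij_betw_def inj_on_def by blast
  have "\<exists>M\<in>carrier_mat m m. \<forall>w\<in>carrier_vec m. M *\<^sub>v w = L g w" if g: "g \<in> carrier G" for g
  proof (rule linear_map_matrix)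
    fix u w :: "complex vec" assume uw: "u \<in> carrier_vec m" "w \<in> carrier_vec m"
    show "L g (u + w) = L g u + L g w"
      by (rule inj) (use uw g Lc in \<open>auto simp: \<Phi>L \<Phi>(2) intro!: restrict_ext\<close>)
  next
    fix c and w :: "complex vec" assume w: "w \<in> carrier_vec m"
    show "L g (c \<cdot>\<^sub>v w) = c \<cdot>\<^sub>v L g w"
      by (rule inj) (use w g Lc in \<open>auto simp: \<Phi>L \<Phi>(3) intro!: restrict_ext\<close>)
  qed (use Lc g in blast)
  then obtain M where M: "\<And>g. g \<in> carrier G \<Longrightarrow> M g \<in> carrier_mat m m"
    "\<And>g w. g \<in> carrier G \<Longrightarrow> w \<in> carrier_vec m \<Longrightarrow> M g *\<^sub>v w = L g w" by metis
  have "is_rep G (m, M)"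
  proof (rule is_repI[OF is_group])
    fix g h assume g: "g \<in> carrier G" and h: "h \<in> carrier G"
    show "snd (m, M) (g \<otimes> h) = snd (m, M) g * snd (m, M) h"
      unfolding snd_conv
    proof (rule mat_eq_if_mult_vec_eq[of _ m m])
      fix w :: "complex vec" assume w: "w \<in> carrier_vec m"
      have "\<Phi> (L (g \<otimes> h) w) = \<Phi> (L g (L h w))"
        using g h w Lc by (auto simp: \<Phi>L m_assoc intro!: restrict_ext)
      then have "L (g \<otimes> h) w = L g (L h w)" using inj Lc g h w by simp
      then show "M (g \<otimes> h) *\<^sub>v w = M g * M h *\<^sub>v w"
        using M g h w Lc by (simp add: assoc_mult_mat_vec[OF M(1) M(1)])
    qed (use M g h in \<open>auto intro!: mult_carrier_mat\<close>)
  next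
    show "snd (m, M) \<one> = 1\<^sub>m (fst (m, M))"
      unfolding snd_conv fst_conv
    proof (rule mat_eq_if_mult_vec_eq[of _ m m])
      fix w :: "complex vec" assume w: "w \<in> carrier_vec m"
      have "\<Phi> (L \<one> w) = \<Phi> w"
        using w \<Phi>_in[OF w] by (auto simp: \<Phi>L intro!: Ind_space_eqI[of _ G S \<sigma>, OF Ind_translate_closed])
      then show "M \<one> *\<^sub>v w = 1\<^sub>m m *\<^sub>v w" using inj Lc w M(2) by simp
    qed (use M in auto)
  qed (use M in auto)
  moreover have "ind_iso G S \<sigma> (m, M) \<Phi>"
    using \<Phi> M(2) by (simp add: ind_iso_def \<Phi>L)
  ultimately show ?thesis using that by blast
qed

text \<open>Two coordinate systems on the same induced space differ by an invertible intertwiner,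
  and composing coordinates with an equivalence gives coordinates again. So the set
  \<open>Ind_class\<close> is one full isomorphism class.\<close>

lemma Ind_class_eq_rep_class:
  assumes R: "is_rep G R" "ind_iso G S \<sigma> R \<Phi>"
  shows "Ind_class G S \<sigma> = rep_class G R"
proof (intro Set.set_eqI iffI)
  note \<Phi> = ind_isoD[OF R(2)]
  obtain \<Psi> where \<Psi>: "\<And>f. f \<in> Ind_space G S \<sigma> \<Longrightarrow> \<Psi> f \<in> carrier_vec (fst R)"
    "\<And>f. f \<in> Ind_space G S \<sigma> \<Longrightarrow> \<Phi> (\<Psi> f) = f" "\<And>w. w \<in> carrier_vec (fst R) \<Longrightarrow> \<Psi> (\<Phi> w) = w"
    using ind_iso_inv[OF R(2)] by blast
  fix Q assume "Q \<in> Ind_class G S \<sigma>"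
  then obtain \<Phi>' where Q: "is_rep G Q" "ind_iso G S \<sigma> Q \<Phi>'" by (auto simp: Ind_class_iff)
  note \<Phi>' = ind_isoD[OF Q(2)]
  obtain \<Psi>' where \<Psi>': "\<And>f. f \<in> Ind_space G S \<sigma> \<Longrightarrow> \<Psi>' f \<in> carrier_vec (fst Q)"
    "\<And>f. f \<in> Ind_space G S \<sigma> \<Longrightarrow> \<Phi>' (\<Psi>' f) = f" "\<And>w. w \<in> carrier_vec (fst Q) \<Longrightarrow> \<Psi>' (\<Phi>' w) = w"
    using ind_iso_inv[OF Q(2)] by blast
  have "\<exists>T\<in>carrier_mat (fst Q) (fst R). \<forall>w\<in>carrier_vec (fst R). T *\<^sub>v w = \<Psi>' (\<Phi> w)"
  proof (rule linear_map_matrix)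
    fix u w :: "complex vec" assume uw: "u \<in> carrier_vec (fst R)" "w \<in> carrier_vec (fst R)"
    have "\<Phi> (u + w) = \<Phi>' (\<Psi>' (\<Phi> u) + \<Psi>' (\<Phi> w))" using uw by (simp add: \<Phi> \<Phi>'(2) \<Psi>')
    then show "\<Psi>' (\<Phi> (u + w)) = \<Psi>' (\<Phi> u) + \<Psi>' (\<Phi> w)" using \<Psi>'(3) \<Psi>'(1) \<Phi>(5) uw by simp
  next
    fix c and w :: "complex vec" assume w: "w \<in> carrier_vec (fst R)"
    have "\<Phi> (c \<cdot>\<^sub>v w) = \<Phi>' (c \<cdot>\<^sub>v \<Psi>' (\<Phi> w))" using w by (simp add: \<Phi> \<Phi>'(3) \<Psi>')
    then show "\<Psi>' (\<Phi> (c \<cdot>\<^sub>v w)) = c \<cdot>\<^sub>v \<Psi>' (\<Phi> w)" using \<Psi>'(3) \<Psi>'(1) \<Phi>(5) w by simp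
  qed (use \<Psi>'(1) \<Phi>(5) in blast)
  then obtain T where T: "T \<in> carrier_mat (fst Q) (fst R)" "\<And>w. w \<in> carrier_vec (fst R) \<Longrightarrow> T *\<^sub>v w = \<Psi>' (\<Phi> w)" by blast
  have "\<exists>T'\<in>carrier_mat (fst R) (fst Q). \<forall>w\<in>carrier_vec (fst Q). T' *\<^sub>v w = \<Psi> (\<Phi>' w)"
  proof (rule linear_map_matrix)
    fix u w :: "complex vec" assume uw: "u \<in> carrier_vec (fst Q)" "w \<in> carrier_vec (fst Q)"
    have "\<Phi>' (u + w) = \<Phi> (\<Psi> (\<Phi>' u) + \<Psi> (\<Phi>' w))" using uw by (simp add: \<Phi>' \<Phi>(2) \<Psi>)
    then show "\<Psi> (\<Phi>' (u + w)) = \<Psi> (\<Phi>' u) + \<Psi> (\<Phi>' w)" using \<Psi>(3) \<Psi>(1) \<Phi>'(5) uw by simp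
  next
    fix c and w :: "complex vec" assume w: "w \<in> carrier_vec (fst Q)"
    have "\<Phi>' (c \<cdot>\<^sub>v w) = \<Phi> (c \<cdot>\<^sub>v \<Psi> (\<Phi>' w))" using w by (simp add: \<Phi>' \<Phi>(3) \<Psi>)
    then show "\<Psi> (\<Phi>' (c \<cdot>\<^sub>v w)) = c \<cdot>\<^sub>v \<Psi> (\<Phi>' w)" using \<Psi>(3) \<Psi>(1) \<Phi>'(5) w by simp
  qed (use \<Psi>(1) \<Phi>'(5) in blast)
  then obtain T' where T': "T' \<in> carrier_mat (fst R) (fst Q)" "\<And>w. w \<in> carrier_vec (fst Q) \<Longrightarrow> T' *\<^sub>v w = \<Psi> (\<Phi>' w)" by blast
  have TT': "T * T' = 1\<^sub>m (fst Q)"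
  proof (rule mat_eq_if_mult_vec_eq[of _ "fst Q" "fst Q"])
    fix w :: "complex vec" assume w: "w \<in> carrier_vec (fst Q)"
    then have "T *\<^sub>v (T' *\<^sub>v w) = w" using T(2) T'(2) \<Psi> \<Psi>' \<Phi>'(5) by simp
    then show "T * T' *\<^sub>v w = 1\<^sub>m (fst Q) *\<^sub>v w" using w assoc_mult_mat_vec[OF T(1) T'(1) w] by simp
  qed (use T T' in auto)
  have T'T: "T' * T = 1\<^sub>m (fst R)"
  proof (rule mat_eq_if_mult_vec_eq[of _ "fst R" "fst R"])
    fix w :: "complex vec" assume w: "w \<in> carrier_vec (fst R)"
    then have "T' *\<^sub>v (T *\<^sub>v w) = w" using T(2) T'(2) \<Psi> \<Psi>' \<Phi>(5) by simp
    then show "T' * T *\<^sub>v w = 1\<^sub>m (fst R) *\<^sub>v w" using w assoc_mult_mat_vec[OF T'(1) T(1) w] by simp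
  qed (use T T' in auto)
  have RQ: "fst Q = fst R" by (rule inverse_mat_square[OF T(1) T'(1) TT' T'T])
  have TG: "T \<in> carrier (GLC (fst R))" using T(1) T'(1) TT' T'T RQ by (auto simp: GLC_simps)
  have "T * snd R g = snd Q g * T" if g: "g \<in> carrier G" for g
  proof (rule mat_eq_if_mult_vec_eq[of _ "fst Q" "fst R"])
    note Rg = is_repD(1)[OF R(1) g] and Qg = is_repD(1)[OF Q(1) g]
    show "T * snd R g \<in> carrier_mat (fst Q) (fst R)" "snd Q g * T \<in> carrier_mat (fst Q) (fst R)"
      using T(1) Rg Qg by auto
    fix w :: "complex vec" assume w: "w \<in> carrier_vec (fst R)"
    have Rw: "snd R g *\<^sub>v w \<in> carrier_vec (fst R)" using Rg w by auto
    have a: "\<Psi>' (\<Phi> w) \<in> carrier_vec (fst Q)" using w \<Phi>(5) \<Psi>'(1) by simp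
    have "\<Phi>' (snd Q g *\<^sub>v \<Psi>' (\<Phi> w)) = \<Phi> (snd R g *\<^sub>v w)"
      using a g w \<Phi>(5) by (simp add: \<Phi>'(4) \<Phi>(4) \<Psi>'(2))
    moreover have "snd Q g *\<^sub>v \<Psi>' (\<Phi> w) \<in> carrier_vec (fst Q)" using a Qg by auto
    ultimately have "\<Psi>' (\<Phi> (snd R g *\<^sub>v w)) = snd Q g *\<^sub>v \<Psi>' (\<Phi> w)" using \<Psi>'(3) by metis
    then show "T * snd R g *\<^sub>v w = snd Q g * T *\<^sub>v w"
      using w T(2) Rw assoc_mult_mat_vec[OF T(1) Rg w] assoc_mult_mat_vec[OF Qg T(1) w] by simp
  qed
  then have "rep_equiv G R Q" using RQ TG unfolding rep_equiv_def by auto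
  then show "Q \<in> rep_class G R" using Q by (simp add: rep_class_def)
next
  note \<Phi> = ind_isoD[OF R(2)]
  fix Q assume "Q \<in> rep_class G R"
  then have Q: "is_rep G Q" "rep_equiv G Q R" using rep_equiv_sym[OF R(1)] by (auto simp: rep_class_def)
  then obtain T T' where dd: "fst Q = fst R" and T: "T \<in> carrier_mat (fst R) (fst R)" "T' \<in> carrier_mat (fst R) (fst R)"
    "T' * T = 1\<^sub>m (fst R)" "T * T' = 1\<^sub>m (fst R)" and tw: "\<And>g. g \<in> carrier G \<Longrightarrow> T * snd Q g = snd R g * T"
    unfolding rep_equiv_def GLC_simps by auto
  have b: "bij_betw (\<lambda>w. T *\<^sub>v w) (carrier_vec (fst R)) (carrier_vec (fst R))"
    by (rule bij_betw_byWitness[of _ "\<lambda>w. T' *\<^sub>v w"])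
      (use T assoc_mult_mat_vec[OF T(1,2)] assoc_mult_mat_vec[OF T(2,1)] in \<open>auto simp: assoc_mult_mat_vec[symmetric]\<close>)
  have Tc: "T *\<^sub>v w \<in> carrier_vec (fst R)" if "w \<in> carrier_vec (fst R)" for w using T(1) that by auto
  have "ind_iso G S \<sigma> Q (\<lambda>w. \<Phi> (T *\<^sub>v w))"
    unfolding ind_iso_def dd
  proof (intro conjI ballI allI)
    show "bij_betw (\<lambda>w. \<Phi> (T *\<^sub>v w)) (carrier_vec (fst R)) (Ind_space G S \<sigma>)"
      using bij_betw_trans[OF b \<Phi>(1)] by (simp add: comp_def)
    fix g and w :: "complex vec" assume g: "g \<in> carrier G" and w: "w \<in> carrier_vec (fst R)"
    have "T *\<^sub>v (snd Q g *\<^sub>v w) = snd R g *\<^sub>v (T *\<^sub>v w)"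
      using tw[OF g] is_repD(1)[OF Q(1) g] is_repD(1)[OF R(1) g] T(1) w dd
      by (metis assoc_mult_mat_vec)
    then show "\<Phi> (T *\<^sub>v (snd Q g *\<^sub>v w)) = (\<lambda>x\<in>carrier G. \<Phi> (T *\<^sub>v w) (x \<otimes> g))"
      using \<Phi>(4)[OF g Tc[OF w]] by simp
  qed (use \<Phi>(2,3) Tc T(1) in \<open>auto simp: mult_add_distrib_mat_vec mult_mat_vec\<close>)
  then show "Q \<in> Ind_class G S \<sigma>" using Q by (auto simp: Ind_class_iff)
qed

text \<open>An invariant subspace of the coordinate space is carried by \<open>\<Phi>\<close> to a
  space of functions to which \<open>Ind_irreducible\<close> applies. The vector on which
  \<open>N\<close> acts by \<open>\<psi>\<close> is the coordinate vector of some
  \<open>ind_emb \<sigma> u\<close>.\<close>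

lemma Ind_rep_irreducible:
  assumes R: "is_rep G R" "ind_iso G S \<sigma> R \<Phi>"
  shows "irreducible_rep G R" "contains_char N \<psi> R"
proof -
  note \<Phi> = ind_isoD[OF R(2)]
  obtain \<Psi> where \<Psi>: "\<And>f. f \<in> Ind_space G S \<sigma> \<Longrightarrow> \<Psi> f \<in> carrier_vec (fst R)"
    "\<And>f. f \<in> Ind_space G S \<sigma> \<Longrightarrow> \<Phi> (\<Psi> f) = f" "\<And>w. w \<in> carrier_vec (fst R) \<Longrightarrow> \<Psi> (\<Phi> w) = w"
    using ind_iso_inv[OF R(2)] by blast
  have \<Phi>0: "\<Phi> (0\<^sub>v (fst R)) = (\<lambda>x\<in>carrier G. 0\<^sub>v (fst \<sigma>))"
  proof -
    have "\<Phi> (0 \<cdot>\<^sub>v 0\<^sub>v (fst R)) = (\<lambda>x\<in>carrier G. 0 \<cdot>\<^sub>v \<Phi> (0\<^sub>v (fst R)) x)" by (rule \<Phi>(3)) simp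
    moreover have "0 \<cdot>\<^sub>v 0\<^sub>v (fst R) = (0\<^sub>v (fst R) :: complex vec)" by (intro eq_vecI) auto
    moreover have "0 \<cdot>\<^sub>v \<Phi> (0\<^sub>v (fst R)) x = 0\<^sub>v (fst \<sigma>)" if "x \<in> carrier G" for x
      using Ind_spaceD(1)[OF \<Phi>(5)[OF zero_carrier_vec] that] by (intro eq_vecI) auto
    ultimately show ?thesis by (auto cong: restrict_cong)
  qed
  have nz: "\<exists>x\<in>carrier G. \<Phi> w x \<noteq> 0\<^sub>v (fst \<sigma>)" if w: "w \<in> carrier_vec (fst R)" "w \<noteq> 0\<^sub>v (fst R)" for w
  proof (rule ccontr)
    assume "\<not> ?thesis"
    then have "\<Phi> w = \<Phi> (0\<^sub>v (fst R))"
      by (intro Ind_space_eqI[OF \<Phi>(5)[OF w(1)] \<Phi>(5)]) (auto simp: \<Phi>0)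
    then show False using \<Psi>(3)[OF w(1)] \<Psi>(3)[of "0\<^sub>v (fst R)"] w(2) by simp
  qed
  obtain u :: "complex vec" where u: "u \<in> carrier_vec (fst \<sigma>)" "u \<noteq> 0\<^sub>v (fst \<sigma>)"
    using \<sigma>_deg by (intro that[of "unit_vec (fst \<sigma>) 0"]) (auto simp: vec_eq_iff)
  let ?w = "\<Psi> (ind_emb \<sigma> u)"
  have w: "?w \<in> carrier_vec (fst R)" using \<Psi>(1) ind_emb_in u by blast
  have \<Phi>w: "\<Phi> ?w = ind_emb \<sigma> u" using \<Psi>(2) ind_emb_in u by blast
  have w0: "?w \<noteq> 0\<^sub>v (fst R)"
  proof
    assume "?w = 0\<^sub>v (fst R)"
    then have "ind_emb \<sigma> u = (\<lambda>x\<in>carrier G. 0\<^sub>v (fst \<sigma>))" using \<Phi>w \<Phi>0 by simp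
    from fun_cong[OF this, of \<one>] have "ind_emb \<sigma> u \<one> = 0\<^sub>v (fst \<sigma>)" by simp
    then show False using u by (simp add: ind_emb_def \<sigma>_one)
  qed
  show "contains_char N \<psi> R" unfolding contains_char_def
  proof (intro bexI[OF _ w] conjI ballI w0)
    fix h assume h: "h \<in> N"
    have "\<Phi> (snd R h *\<^sub>v ?w) = ind_emb \<sigma> (snd \<sigma> h *\<^sub>v u)"
      using h N_le_S w u by (auto simp: \<Phi>(4) \<Phi>w ind_emb_translate)
    also have "\<dots> = \<Phi> (\<psi> h \<cdot>\<^sub>v ?w)" using u w h by (simp add: \<sigma>_N \<Phi>(3) \<Phi>w ind_emb_smult)
    finally show "snd R h *\<^sub>v ?w = \<psi> h \<cdot>\<^sub>v ?w"
      using \<Psi>(3)[of "snd R h *\<^sub>v ?w"] \<Psi>(3)[of "\<psi> h \<cdot>\<^sub>v ?w"] is_repD(1)[OF R(1), of h] h w by auto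
  qed
  have "W = {0\<^sub>v (fst R)} \<or> W = carrier_vec (fst R)"
    if W: "VectorSpace.subspace class_ring W (module_vec TYPE(complex) (fst R))"
      "\<forall>g\<in>carrier G. \<forall>w\<in>W. snd R g *\<^sub>v w \<in> W" for W
  proof (cases "W = {0\<^sub>v (fst R)}")
    case False
    from W(1) have W1: "W \<subseteq> carrier_vec (fst R)" "0\<^sub>v (fst R) \<in> W" "\<And>u w. u \<in> W \<Longrightarrow> w \<in> W \<Longrightarrow> u + w \<in> W"
      "\<And>c w. w \<in> W \<Longrightarrow> c \<cdot>\<^sub>v w \<in> W" unfolding subspace_module_vec_iff by auto
    then have Wc: "w \<in> carrier_vec (fst R)" if "w \<in> W" for w using that by auto
    from False W1(2) obtain w where w: "w \<in> W" "w \<noteq> 0\<^sub>v (fst R)" by auto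
    then obtain x where x: "x \<in> carrier G" "\<Phi> w x \<noteq> 0\<^sub>v (fst \<sigma>)" using nz Wc by blast
    have "\<Phi> ` W = Ind_space G S \<sigma>"
    proof (rule Ind_irreducible[of "\<Phi> ` W" "\<Phi> w" x])
      show "\<Phi> ` W \<subseteq> Ind_space G S \<sigma>" using \<Phi>(5) Wc by auto
      fix f f' assume "f \<in> \<Phi> ` W" "f' \<in> \<Phi> ` W"
      then obtain a b where "a \<in> W" "b \<in> W" "f = \<Phi> a" "f' = \<Phi> b" by auto
      then show "(\<lambda>x\<in>carrier G. f x + f' x) \<in> \<Phi> ` W"
        using \<Phi>(2)[OF Wc Wc, of a b] W1(3) by (metis image_eqI)
    next
      fix c f assume "f \<in> \<Phi> ` W"
      then obtain a where "a \<in> W" "f = \<Phi> a" by auto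
      then show "(\<lambda>x\<in>carrier G. c \<cdot>\<^sub>v f x) \<in> \<Phi> ` W"
        using \<Phi>(3)[OF Wc, of a c] W1(4) by (metis image_eqI)
    next
      fix g f assume "g \<in> carrier G" "f \<in> \<Phi> ` W"
      then obtain a where "a \<in> W" "f = \<Phi> a" by auto
      then show "(\<lambda>x\<in>carrier G. f (x \<otimes> g)) \<in> \<Phi> ` W"
        using \<Phi>(4)[OF \<open>g \<in> carrier G\<close> Wc, of a] W(2) \<open>g \<in> carrier G\<close> by (metis image_eqI)
    qed (use w x in auto)
    have "carrier_vec (fst R) \<subseteq> W"
    proof
      fix b :: "complex vec" assume b: "b \<in> carrier_vec (fst R)"
      then have "\<Phi> b \<in> \<Phi> ` W" unfolding \<open>\<Phi> ` W = _\<close> by (rule \<Phi>(5))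
      then obtain a where a: "\<Phi> b = \<Phi> a" "a \<in> W" by (rule imageE)
      have "b = a" using \<Psi>(3)[OF b] \<Psi>(3)[OF Wc[OF a(2)]] unfolding a(1) by (rule trans[OF sym])
      then show "b \<in> W" using a(2) by simp
    qed
    then show ?thesis using W1(1) by auto
  qed simp
  moreover have "fst R \<noteq> 0"
  proof
    assume "fst R = 0"
    then show False using w w0 by (auto simp: vec_eq_iff)
  qed
  ultimately show "irreducible_rep G R" using R(1) unfolding irreducible_rep_def by blast
qed

lemma Ind_class_in_Irr: "Ind_class G S \<sigma> \<in> Irr_over G N \<psi>"
proof -
  obtain R \<Phi> where R: "is_rep G R" "ind_iso G S \<sigma> R \<Phi>" using Ind_matrix_rep by blast
  then show ?thesis using Ind_rep_irreducible[OF R] Ind_class_eq_rep_class[OF R]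
    unfolding Irr_over_def by blast
qed

text \<open>One half of Frobenius reciprocity, made explicit. The intertwiner \<open>J\<close>
  extends to the map that sends f to the sum over x of V(x)^-1 J f(x). On
  \<open>ind_emb \<sigma> u\<close> each x in \<open>S\<close> contributes \<open>J u\<close> and
  the others nothing, so the extension is nonzero, and Schur's lemma makes it an
  equivalence.\<close>

lemma Ind_class_eq_if_intertwiner:
  assumes V: "irreducible_rep G V" and J: "J \<in> carrier_mat (fst V) (fst \<sigma>)" "J \<noteq> 0\<^sub>m (fst V) (fst \<sigma>)"
    and tw: "\<And>s. s \<in> S \<Longrightarrow> snd V s * J = J * snd \<sigma> s"
  shows "Ind_class G S \<sigma> = rep_class G V"
proof -
  obtain R \<Phi> where R: "is_rep G R" "ind_iso G S \<sigma> R \<Phi>" using Ind_matrix_rep by blast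
  note \<Phi> = ind_isoD[OF R(2)]
  obtain \<Psi> where \<Psi>: "\<And>f. f \<in> Ind_space G S \<sigma> \<Longrightarrow> \<Psi> f \<in> carrier_vec (fst R)"
    "\<And>f. f \<in> Ind_space G S \<sigma> \<Longrightarrow> \<Phi> (\<Psi> f) = f" "\<And>w. w \<in> carrier_vec (fst R) \<Longrightarrow> \<Psi> (\<Phi> w) = w"
    using ind_iso_inv[OF R(2)] by blast
  note Vr = irreducible_is_rep[OF V]
  have Vc: "snd V g \<in> carrier_mat (fst V) (fst V)" if "g \<in> carrier G" for g using is_repD(1)[OF Vr that] .
  define L where "L w = vsum (fst V) (\<lambda>x. snd V (inv x) *\<^sub>v (J *\<^sub>v \<Phi> w x)) (carrier G)" for w
  have \<Phi>c: "\<Phi> w x \<in> carrier_vec (fst \<sigma>)" if "w \<in> carrier_vec (fst R)" "x \<in> carrier G" for w x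
    using Ind_spaceD(1)[OF \<Phi>(5)] that by blast
  have J\<Phi>: "J *\<^sub>v \<Phi> w x \<in> carrier_vec (fst V)" if "w \<in> carrier_vec (fst R)" "x \<in> carrier G" for w x
    using J(1) \<Phi>c[OF that] by auto
  have VJ: "snd V (inv x) *\<^sub>v (J *\<^sub>v \<Phi> w x) \<in> carrier_vec (fst V)" if "w \<in> carrier_vec (fst R)" "x \<in> carrier G" for w x
    using J\<Phi>[OF that] Vc[of "inv x"] that by auto
  have "\<exists>T\<in>carrier_mat (fst V) (fst R). \<forall>w\<in>carrier_vec (fst R). T *\<^sub>v w = L w"
  proof (rule linear_map_matrix)
    fix u w :: "complex vec" assume uw: "u \<in> carrier_vec (fst R)" "w \<in> carrier_vec (fst R)"
    show "L (u + w) = L u + L w"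
    proof (rule eq_vecI)
      fix i assume "i < dim_vec (L u + L w)"
      then have i: "i < fst V" by (simp add: L_def)
      have "snd V (inv x) *\<^sub>v (J *\<^sub>v \<Phi> (u + w) x) =
         snd V (inv x) *\<^sub>v (J *\<^sub>v \<Phi> u x) + snd V (inv x) *\<^sub>v (J *\<^sub>v \<Phi> w x)" if x: "x \<in> carrier G" for x
        using x uw \<Phi>c[OF _ x] J\<Phi>[OF _ x] Vc[of "inv x"] J(1)
        by (simp add: \<Phi>(2) mult_add_distrib_mat_vec[of _ "fst V" "fst \<sigma>"] mult_add_distrib_mat_vec[of _ "fst V" "fst V"])
      then show "L (u + w) $ i = (L u + L w) $ i"
        using i carrier_vecD[OF VJ[OF uw(1)]] carrier_vecD[OF VJ[OF uw(2)]]
        by (simp add: L_def vsum_index sum.distrib)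
    qed (simp add: L_def)
  next
    fix c and w :: "complex vec" assume w: "w \<in> carrier_vec (fst R)"
    show "L (c \<cdot>\<^sub>v w) = c \<cdot>\<^sub>v L w"
    proof (rule eq_vecI)
      fix i assume "i < dim_vec (c \<cdot>\<^sub>v L w)"
      then have i: "i < fst V" by (simp add: L_def)
      have "snd V (inv x) *\<^sub>v (J *\<^sub>v \<Phi> (c \<cdot>\<^sub>v w) x) = c \<cdot>\<^sub>v (snd V (inv x) *\<^sub>v (J *\<^sub>v \<Phi> w x))" if x: "x \<in> carrier G" for x
        using x w \<Phi>c[OF _ x] J\<Phi>[OF _ x] Vc[of "inv x"] J(1)
        by (simp add: \<Phi>(3) mult_mat_vec[of _ "fst V" "fst \<sigma>"] mult_mat_vec[of _ "fst V" "fst V"])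
      then show "L (c \<cdot>\<^sub>v w) $ i = (c \<cdot>\<^sub>v L w) $ i"
        using i carrier_vecD[OF VJ[OF w]] by (simp add: L_def vsum_index sum_distrib_left)
    qed (simp add: L_def)
  qed (simp add: L_def)
  then obtain T where T: "T \<in> carrier_mat (fst V) (fst R)" "\<And>w. w \<in> carrier_vec (fst R) \<Longrightarrow> T *\<^sub>v w = L w" by blast
  have TR: "T * snd R g = snd V g * T" if g: "g \<in> carrier G" for g
  proof (rule mat_eq_if_mult_vec_eq[of _ "fst V" "fst R"])
    note Rg = is_repD(1)[OF R(1) g] and Vg = Vc[OF g]
    show "T * snd R g \<in> carrier_mat (fst V) (fst R)" "snd V g * T \<in> carrier_mat (fst V) (fst R)"
      using T(1) Rg Vg by auto
    fix w :: "complex vec" assume w: "w \<in> carrier_vec (fst R)"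
    have Rw: "snd R g *\<^sub>v w \<in> carrier_vec (fst R)" using Rg w by auto
    have "L (snd R g *\<^sub>v w) = snd V g *\<^sub>v L w"
    proof (rule eq_vecI)
      fix i assume "i < dim_vec (snd V g *\<^sub>v L w)"
      then have i: "i < fst V" using Vg by simp
      have "L (snd R g *\<^sub>v w) $ i = (\<Sum>x\<in>carrier G. (snd V (inv x) *\<^sub>v (J *\<^sub>v \<Phi> w (x \<otimes> g))) $ i)"
        using i g w by (simp add: L_def vsum_index \<Phi>(4))
      \<comment> \<open>Substituting x g for x carries the right translation of the function over to
        left multiplication by V(g).\<close>
      also have "\<dots> = (\<Sum>x\<in>carrier G. (snd V (g \<otimes> inv x) *\<^sub>v (J *\<^sub>v \<Phi> w x)) $ i)"
        by (rule sum.reindex_bij_witness[of _ "\<lambda>x. x \<otimes> inv g" "\<lambda>x. x \<otimes> g"])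
          (use g in \<open>auto simp: m_assoc inv_mult_group\<close>)
      also have "\<dots> = (\<Sum>x\<in>carrier G. (snd V g *\<^sub>v (snd V (inv x) *\<^sub>v (J *\<^sub>v \<Phi> w x))) $ i)"
        using g w J\<Phi> Vc by (intro sum.cong) (auto simp: is_repD(2)[OF Vr] assoc_mult_mat_vec[of _ "fst V" "fst V" _ "fst V"])
      also have "\<dots> = (snd V g *\<^sub>v L w) $ i"
        using i VJ[OF w] by (simp add: L_def mult_mat_vec_vsum[OF Vg] vsum_index)
      finally show "L (snd R g *\<^sub>v w) $ i = (snd V g *\<^sub>v L w) $ i" .
    qed (use Vg in \<open>simp add: L_def\<close>)
    then show "T * snd R g *\<^sub>v w = snd V g * T *\<^sub>v w"
      using w T(2) Rw assoc_mult_mat_vec[OF T(1) Rg w] assoc_mult_mat_vec[OF Vg T(1) w] by simp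
  qed
  have "T \<noteq> 0\<^sub>m (fst V) (fst R)"
  proof
    assume T0: "T = 0\<^sub>m (fst V) (fst R)"
    have "J = 0\<^sub>m (fst V) (fst \<sigma>)"
    proof (rule mat_eq_if_mult_vec_eq[OF J(1)])
      fix u :: "complex vec" assume u: "u \<in> carrier_vec (fst \<sigma>)"
      let ?w = "\<Psi> (ind_emb \<sigma> u)"
      have w: "?w \<in> carrier_vec (fst R)" and \<Phi>w: "\<Phi> ?w = ind_emb \<sigma> u" using \<Psi> ind_emb_in u by blast+
      have Ju: "J *\<^sub>v u \<in> carrier_vec (fst V)" using J(1) u by auto
      note finS = finite_S
      have cardS: "card S \<noteq> 0" using finS S_one by (auto simp: card_eq_0_iff simp del: S_one)
      have "(J *\<^sub>v u) $ i = 0" if i: "i < fst V" for i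
      proof -
        have "0 = (T *\<^sub>v ?w) $ i" using T0 w i by simp
        also have "\<dots> = (\<Sum>x\<in>carrier G. (snd V (inv x) *\<^sub>v (J *\<^sub>v ind_emb \<sigma> u x)) $ i)"
          using T(2)[OF w] i by (simp add: L_def vsum_index \<Phi>w)
        also have "\<dots> = (\<Sum>x\<in>S. (J *\<^sub>v u) $ i)"
        proof (rule sum.mono_neutral_cong_right[OF fin])
          show "\<forall>x\<in>carrier G - S. (snd V (inv x) *\<^sub>v (J *\<^sub>v ind_emb \<sigma> u x)) $ i = 0"
          proof
            fix x assume x: "x \<in> carrier G - S"
            have "J *\<^sub>v 0\<^sub>v (fst \<sigma>) = 0\<^sub>v (fst V)" using J(1) by (intro eq_vecI) auto
            moreover have "snd V (inv x) *\<^sub>v 0\<^sub>v (fst V) = 0\<^sub>v (fst V)"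
              using Vc[of "inv x"] x by (intro eq_vecI) auto
            ultimately show "(snd V (inv x) *\<^sub>v (J *\<^sub>v ind_emb \<sigma> u x)) $ i = 0"
              using x i by (simp add: ind_emb_def)
          qed
          fix x assume x: "x \<in> S"
          have "J *\<^sub>v (snd \<sigma> x *\<^sub>v u) = snd V x *\<^sub>v (J *\<^sub>v u)"
            using tw[OF x] assoc_mult_mat_vec[OF J(1) \<sigma>_carrier[OF x] u]
              assoc_mult_mat_vec[OF Vc[OF S_carrier[OF x]] J(1) u] by simp
          moreover have "snd V (inv x) *\<^sub>v (snd V x *\<^sub>v (J *\<^sub>v u)) = J *\<^sub>v u"
            using is_rep_inv(1)[OF is_group Vr S_carrier[OF x]] Ju
              assoc_mult_mat_vec[OF Vc[of "inv x"] Vc[OF S_carrier[OF x]] Ju] x by simp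
          ultimately show "(snd V (inv x) *\<^sub>v (J *\<^sub>v ind_emb \<sigma> u x)) $ i = (J *\<^sub>v u) $ i"
            using x by (simp add: ind_emb_def)
        qed auto
        finally show ?thesis using cardS by simp
      qed
      then show "J *\<^sub>v u = 0\<^sub>m (fst V) (fst \<sigma>) *\<^sub>v u"
        using carrier_vecD[OF Ju] u by (intro eq_vecI) (simp_all add: zero_mat_mult_vec)
    qed simp
    with J(2) show False by simp
  qed
  from intertwiner_equiv[OF Ind_rep_irreducible(1)[OF R] V T(1) this TR]
  have "rep_equiv G R V" .
  then show ?thesis using Ind_class_eq_rep_class[OF R] rep_class_eqI[OF R(1) Vr] by simp
qed

end

text \<open>The inducing representation is recovered as the \<open>\<psi>\<close>-part of the
  induced one. A common coordinate space for both inductions lets one embed \<open>\<sigma>\<close>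
  by the first isomorphism, leave by the second, and evaluate at the identity.\<close>

lemma Ind_class_inj:
  assumes \<sigma>: "isotypic_rep \<sigma>" and \<sigma>': "isotypic_rep \<sigma>'"
    and eq: "Ind_class G S \<sigma> = Ind_class G S \<sigma>'"
  shows "rep_equiv (G\<lparr>carrier := S\<rparr>) \<sigma> \<sigma>'"
proof -
  obtain R \<Phi> where R: "is_rep G R" "ind_iso G S \<sigma> R \<Phi>" using Ind_matrix_rep[OF \<sigma>] by blast
  then have "R \<in> Ind_class G S \<sigma>'" unfolding eq[symmetric] Ind_class_iff by blast
  then obtain \<Phi>' where R': "ind_iso G S \<sigma>' R \<Phi>'" by (auto simp: Ind_class_iff)
  note \<Phi> = ind_isoD[OF R(2)] and \<Phi>' = ind_isoD[OF R']
  obtain \<Psi> where \<Psi>: "\<And>f. f \<in> Ind_space G S \<sigma> \<Longrightarrow> \<Psi> f \<in> carrier_vec (fst R)"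
    "\<And>f. f \<in> Ind_space G S \<sigma> \<Longrightarrow> \<Phi> (\<Psi> f) = f" "\<And>w. w \<in> carrier_vec (fst R) \<Longrightarrow> \<Psi> (\<Phi> w) = w"
    using ind_iso_inv[OF R(2)] by blast
  let ?w = "\<lambda>u. \<Psi> (ind_emb \<sigma> u)"
  have w: "?w u \<in> carrier_vec (fst R)" and \<Phi>w: "\<Phi> (?w u) = ind_emb \<sigma> u" if "u \<in> carrier_vec (fst \<sigma>)" for u
    using \<Psi> ind_emb_in[OF \<sigma>] that by blast+
  have w_add: "?w (u + u') = ?w u + ?w u'" if "u \<in> carrier_vec (fst \<sigma>)" "u' \<in> carrier_vec (fst \<sigma>)" for u u'
  proof -
    have "ind_emb \<sigma> (u + u') = \<Phi> (?w u + ?w u')" using that w by (simp add: \<Phi>(2) \<Phi>w ind_emb_add[OF \<sigma>])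
    then show ?thesis using \<Psi>(3)[of "?w u + ?w u'"] w that by simp
  qed
  have w_smult: "?w (c \<cdot>\<^sub>v u) = c \<cdot>\<^sub>v ?w u" if "u \<in> carrier_vec (fst \<sigma>)" for u c
  proof -
    have "ind_emb \<sigma> (c \<cdot>\<^sub>v u) = \<Phi> (c \<cdot>\<^sub>v ?w u)" using that w by (simp add: \<Phi>(3) \<Phi>w ind_emb_smult[OF \<sigma>])
    then show ?thesis using \<Psi>(3)[of "c \<cdot>\<^sub>v ?w u"] w that by simp
  qed
  have w_S: "?w (snd \<sigma> s *\<^sub>v u) = snd R s *\<^sub>v ?w u" if "u \<in> carrier_vec (fst \<sigma>)" "s \<in> S" for u s
  proof -
    have "ind_emb \<sigma> (snd \<sigma> s *\<^sub>v u) = \<Phi> (snd R s *\<^sub>v ?w u)"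
      using that w by (simp add: \<Phi>(4) \<Phi>w ind_emb_translate[OF \<sigma>])
    then show ?thesis using \<Psi>(3)[of "snd R s *\<^sub>v ?w u"] w that is_repD(1)[OF R(1), of s] by auto
  qed
  \<comment> \<open>Evaluation at the identity commutes with \<open>S\<close>, by comparing right
    translation with the equivariance of the functions.\<close>
  let ?L = "\<lambda>u. \<Phi>' (?w u) \<one>"
  have \<Phi>'c: "\<Phi>' v x \<in> carrier_vec (fst \<sigma>')" if "v \<in> carrier_vec (fst R)" "x \<in> carrier G" for v x
    using Ind_spaceD(1)[OF \<Phi>'(5)] that by blast
  have "\<exists>T\<in>carrier_mat (fst \<sigma>') (fst \<sigma>). \<forall>u\<in>carrier_vec (fst \<sigma>). T *\<^sub>v u = ?L u"
    by (rule linear_map_matrix) (auto simp: w_add w_smult \<Phi>' w \<Phi>'c)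
  then obtain T where T: "T \<in> carrier_mat (fst \<sigma>') (fst \<sigma>)" "\<And>u. u \<in> carrier_vec (fst \<sigma>) \<Longrightarrow> T *\<^sub>v u = ?L u"
    by blast
  have tw: "T * snd \<sigma> s = snd \<sigma>' s * T" if s: "s \<in> S" for s
  proof (rule mat_eq_if_mult_vec_eq[of _ "fst \<sigma>'" "fst \<sigma>"])
    note c = \<sigma>_carrier[OF \<sigma> s] and c' = \<sigma>_carrier[OF \<sigma>' s]
    show "T * snd \<sigma> s \<in> carrier_mat (fst \<sigma>') (fst \<sigma>)" "snd \<sigma>' s * T \<in> carrier_mat (fst \<sigma>') (fst \<sigma>)"
      using T(1) c c' by auto
    fix u :: "complex vec" assume u: "u \<in> carrier_vec (fst \<sigma>)"
    have "?L (snd \<sigma> s *\<^sub>v u) = \<Phi>' (?w u) s" using u s w by (simp add: w_S \<Phi>'(4))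
    also have "\<dots> = snd \<sigma>' s *\<^sub>v ?L u" using Ind_spaceD(2)[OF \<Phi>'(5)[OF w[OF u]] s one_closed] s by simp
    finally show "T * snd \<sigma> s *\<^sub>v u = snd \<sigma>' s * T *\<^sub>v u"
      using u T(2) \<sigma>_vec[OF \<sigma> s u] assoc_mult_mat_vec[OF T(1) c u] assoc_mult_mat_vec[OF c' T(1) u] by simp
  qed
  have T0: "T \<noteq> 0\<^sub>m (fst \<sigma>') (fst \<sigma>)"
  proof
    assume T0: "T = 0\<^sub>m (fst \<sigma>') (fst \<sigma>)"
    obtain u :: "complex vec" where u: "u \<in> carrier_vec (fst \<sigma>)" "u \<noteq> 0\<^sub>v (fst \<sigma>)"
      using \<sigma>_deg[OF \<sigma>] by (intro that[of "unit_vec (fst \<sigma>) 0"]) (auto simp: vec_eq_iff)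
    have L0: "?L u = 0\<^sub>v (fst \<sigma>')" using T(2)[OF u(1)] T0 u(1) by (simp add: zero_mat_mult_vec)
    \<comment> \<open>The image of an embedded vector is again \<open>\<psi>\<close>-isotypic, hence
      determined by its value at the identity. If that value is zero, the function is zero, and
      injectivity of both isomorphisms forces u = 0.\<close>
    have "\<Phi>' (?w u) (x \<otimes> h) = \<psi> h \<cdot>\<^sub>v \<Phi>' (?w u) x" if x: "x \<in> carrier G" and h: "h \<in> N" for x h
    proof -
      have hS: "h \<in> S" using h N_le_S by auto
      have "\<Phi>' (?w u) (x \<otimes> h) = \<Phi>' (?w (snd \<sigma> h *\<^sub>v u)) x"
        using w_S[OF u(1) hS] \<Phi>'(4)[of h "?w u"] x h w[OF u(1)] by simp
      also have "\<dots> = \<Phi>' (\<psi> h \<cdot>\<^sub>v ?w u) x" using \<sigma>_N[OF \<sigma> h u(1)] w_smult[OF u(1)] by simp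
      finally show ?thesis using \<Phi>'(3)[OF w[OF u(1)]] x by simp
    qed
    then have "\<Phi>' (?w u) = ind_emb \<sigma>' (?L u)" by (rule Ind_isotypic[OF \<sigma>' \<Phi>'(5)[OF w[OF u(1)]]])
    also have "\<dots> = ind_emb \<sigma>' (0 \<cdot>\<^sub>v 0\<^sub>v (fst \<sigma>'))"
      unfolding L0 by (simp add: smult_zero_vec[of _ "fst \<sigma>'"])
    also have "\<dots> = (\<lambda>x\<in>carrier G. 0 \<cdot>\<^sub>v \<Phi>' (?w u) x)"
      using ind_emb_in[OF \<sigma>', of "0\<^sub>v (fst \<sigma>')", THEN Ind_spaceD(1)] \<Phi>'c[OF w[OF u(1)]]
      unfolding ind_emb_smult[OF \<sigma>' zero_carrier_vec]
      by (intro restrict_ext) (simp add: smult_zero_vec[of _ "fst \<sigma>'"])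
    also have "\<dots> = \<Phi>' (0 \<cdot>\<^sub>v ?w u)" using \<Phi>'(3)[OF w[OF u(1)]] by simp
    finally have "?w u = 0 \<cdot>\<^sub>v ?w u"
      using \<Phi>'(1) w[OF u(1)] unfolding bij_betw_def inj_on_def by auto
    then have "\<Phi> (?w u) \<one> = 0 \<cdot>\<^sub>v \<Phi> (?w u) \<one>"
      using fun_cong[OF \<Phi>(3)[OF w[OF u(1)], of 0], of \<one>] by simp
    then have "u = 0 \<cdot>\<^sub>v u" using u(1) unfolding \<Phi>w[OF u(1)] by (simp add: ind_emb_def \<sigma>_one[OF \<sigma>])
    also have "\<dots> = 0\<^sub>v (fst \<sigma>)" using u by (intro eq_vecI) auto
    finally show False using u by simp
  qed
  show ?thesis
    by (rule intertwiner_equiv[OF _ _ T(1) T0]) (use \<sigma> \<sigma>' tw in \<open>auto simp: isotypic_rep_def\<close>)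
qed

end

section \<open>Heisenberg extensions\<close>

text \<open>The data of the theorem for \<open>\<sigma>\<^sub>\<beta>\<^sub>,\<^sub>\<theta>\<close>: \<open>N = K\<^sub>l\<close>, \<open>A = G\<^sub>\<beta>(O\<^sub>r)\<close> and \<open>H = K\<^sub>l\<^sub>'\<close>, where \<open>\<chi> \<rho> = \<psi>\<^sub>\<beta>\<^sub>,\<^sub>\<rho>\<close> on
  \<open>Z = Z(O\<^sub>r,\<beta>)\<close>. For \<open>r = 2l\<close> one takes \<open>H = Z = N\<close>, a single \<open>\<rho>\<close> and trivial \<open>U\<close>.\<close>

locale heisenberg_extension = character_stabilizer G N \<psi> S
  for G (structure) and N :: "'a set" and \<psi> S +
  fixes Z H A :: "'a set" and I :: "'i set" and \<chi> :: "'i \<Rightarrow> 'a \<Rightarrow> complex"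
    and \<pi> :: "'i \<Rightarrow> 'a matrix_rep" and U :: "'i \<Rightarrow> 'a \<Rightarrow> complex mat"
  assumes Z: "subgroup Z G" and H: "subgroup H G" and A: "subgroup A G"
    and NZ: "N \<subseteq> Z" and ZH: "Z \<subseteq> H"
    and A_comm: "\<And>a b. a \<in> A \<Longrightarrow> b \<in> A \<Longrightarrow> a \<otimes> b = b \<otimes> a"
    and S_AH: "S = {a \<otimes> h | a h. a \<in> A \<and> h \<in> H}"
    and H_norm: "\<And>a h. a \<in> A \<Longrightarrow> h \<in> H \<Longrightarrow> inv a \<otimes> h \<otimes> a \<in> H"
    and AH_Z: "A \<inter> H \<subseteq> Z"
    and Z_AN: "\<And>z. z \<in> Z \<Longrightarrow> \<exists>a\<in>A \<inter> H. \<exists>n\<in>N. z = a \<otimes> n"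
    and \<chi>_mult: "\<And>i y z. i \<in> I \<Longrightarrow> y \<in> Z \<Longrightarrow> z \<in> Z \<Longrightarrow> \<chi> i (y \<otimes> z) = \<chi> i y * \<chi> i z"
    and \<chi>_N: "\<And>i n. i \<in> I \<Longrightarrow> n \<in> N \<Longrightarrow> \<chi> i n = \<psi> n"
    and \<chi>_inj: "\<And>i j. i \<in> I \<Longrightarrow> j \<in> I \<Longrightarrow> (\<And>z. z \<in> Z \<Longrightarrow> \<chi> i z = \<chi> j z) \<Longrightarrow> i = j"
    and \<chi>_surj: "\<And>\<chi>'. (\<And>y z. y \<in> Z \<Longrightarrow> z \<in> Z \<Longrightarrow> \<chi>' (y \<otimes> z) = \<chi>' y * \<chi>' z) \<Longrightarrow>
        (\<And>n. n \<in> N \<Longrightarrow> \<chi>' n = \<psi> n) \<Longrightarrow> \<exists>i\<in>I. \<forall>z\<in>Z. \<chi>' z = \<chi> i z"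
    and Z_comm: "\<And>y z. y \<in> Z \<Longrightarrow> z \<in> Z \<Longrightarrow> \<exists>n\<in>N. y \<otimes> z = z \<otimes> y \<otimes> n \<and> \<psi> n = 1"
    and Z_norm: "\<And>s z. s \<in> S \<Longrightarrow> z \<in> Z \<Longrightarrow> s \<otimes> z \<otimes> inv s \<in> Z"
    and \<chi>_inv: "\<And>i s z. i \<in> I \<Longrightarrow> s \<in> S \<Longrightarrow> z \<in> Z \<Longrightarrow> \<chi> i (s \<otimes> z \<otimes> inv s) = \<chi> i z"
    and nondeg: "\<And>h. h \<in> H \<Longrightarrow> h \<notin> Z \<Longrightarrow> \<exists>y\<in>H. \<exists>n\<in>N. y \<otimes> h \<otimes> inv y = n \<otimes> h \<and> \<psi> n \<noteq> 1"
    and \<pi>_irr: "\<And>i. i \<in> I \<Longrightarrow> irreducible_rep (G\<lparr>carrier := H\<rparr>) (\<pi> i)"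
    and \<pi>_char: "\<And>i. i \<in> I \<Longrightarrow> contains_char Z (\<chi> i) (\<pi> i)"
    and U_hom: "\<And>i. i \<in> I \<Longrightarrow> U i \<in> hom (G\<lparr>carrier := A\<rparr>) (GLC (fst (\<pi> i)))"
    and U_twist: "\<And>i a h. i \<in> I \<Longrightarrow> a \<in> A \<Longrightarrow> h \<in> H \<Longrightarrow> snd (\<pi> i) (inv a \<otimes> h \<otimes> a) =
        inv\<^bsub>GLC (fst (\<pi> i))\<^esub> (U i a) \<otimes>\<^bsub>GLC (fst (\<pi> i))\<^esub> snd (\<pi> i) h \<otimes>\<^bsub>GLC (fst (\<pi> i))\<^esub> U i a"
    and U_triv: "\<And>i a. i \<in> I \<Longrightarrow> a \<in> A \<Longrightarrow> a \<in> H \<Longrightarrow> U i a = 1\<^sub>m (fst (\<pi> i))"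
begin

lemma H_carrier [simp]: "h \<in> H \<Longrightarrow> h \<in> carrier G"
  using subgroup.mem_carrier[OF H] .

lemma A_carrier [simp]: "a \<in> A \<Longrightarrow> a \<in> carrier G"
  using subgroup.mem_carrier[OF A] .

lemma Z_H [simp]: "z \<in> Z \<Longrightarrow> z \<in> H"
  using ZH by auto

lemma N_H [simp]: "n \<in> N \<Longrightarrow> n \<in> H"
  using NZ by auto

lemma H_one [simp]: "\<one> \<in> H" and A_one [simp]: "\<one> \<in> A"
  using subgroup.one_closed H A by auto

lemma H_closed [simp]: "h \<in> H \<Longrightarrow> k \<in> H \<Longrightarrow> h \<otimes> k \<in> H" "h \<in> H \<Longrightarrow> inv h \<in> H"
  using subgroup.m_closed[OF H] subgroup.m_inv_closed[OF H] by auto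

lemma A_closed [simp]: "h \<in> A \<Longrightarrow> k \<in> A \<Longrightarrow> h \<otimes> k \<in> A" "h \<in> A \<Longrightarrow> inv h \<in> A"
  using subgroup.m_closed[OF A] subgroup.m_inv_closed[OF A] by auto

lemma A_S: "a \<in> A \<Longrightarrow> a \<in> S"
proof -
  assume a: "a \<in> A"
  then have "a = a \<otimes> \<one>" by simp
  then show "a \<in> S" unfolding S_AH using a H_one by blast
qed

lemma H_S: "h \<in> H \<Longrightarrow> h \<in> S"
proof -
  assume h: "h \<in> H"
  then have "h = \<one> \<otimes> h" by simp
  then show "h \<in> S" unfolding S_AH using h A_one by blast
qed

lemma finite_H: "finite H"
  by (rule finite_subset[OF _ fin]) auto

lemma H_group: "group (G\<lparr>carrier := H\<rparr>)"
  by (rule subgroup.subgroup_is_group[OF H is_group])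

section \<open>The representations \<open>\<pi> i\<close> and their intertwiners\<close>

context
  fixes i assumes i: "i \<in> I"
begin

abbreviation "d \<equiv> fst (\<pi> i)"
abbreviation "p \<equiv> snd (\<pi> i)"

lemma p_rep: "is_rep (G\<lparr>carrier := H\<rparr>) (\<pi> i)"
  using \<pi>_irr[OF i] by (rule irreducible_is_rep)

lemma p_carrier [simp]: "h \<in> H \<Longrightarrow> p h \<in> carrier_mat d d"
  using is_repD(1)[OF p_rep] by simp

lemma p_mult: "h \<in> H \<Longrightarrow> k \<in> H \<Longrightarrow> p (h \<otimes> k) = p h * p k"
  using is_repD(2)[OF p_rep] by simp

lemma p_one: "p \<one> = 1\<^sub>m d"
  using is_rep_one[OF H_group p_rep] by simp

lemma p_inv: "h \<in> H \<Longrightarrow> p (inv h) * p h = 1\<^sub>m d" "h \<in> H \<Longrightarrow> p h * p (inv h) = 1\<^sub>m d"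
  using p_mult[of "inv h" h] p_mult[of h "inv h"] p_one by auto

lemma d_pos: "d \<noteq> 0"
  using \<pi>_irr[OF i] by (simp add: irreducible_rep_def)

lemma U_rep: "is_rep (G\<lparr>carrier := A\<rparr>) (d, U i)"
  using U_hom[OF i] by (simp add: is_rep_def)

lemma U_carrier [simp]: "a \<in> A \<Longrightarrow> U i a \<in> carrier_mat d d"
  using is_repD(1)[OF U_rep] by simp

lemma U_mult: "a \<in> A \<Longrightarrow> b \<in> A \<Longrightarrow> U i (a \<otimes> b) = U i a * U i b"
  using is_repD(2)[OF U_rep] by simp

lemma U_inv: "a \<in> A \<Longrightarrow> U i (inv a) * U i a = 1\<^sub>m d" "a \<in> A \<Longrightarrow> U i a * U i (inv a) = 1\<^sub>m d"
  using U_mult[of "inv a" a] U_mult[of a "inv a"] U_triv[OF i A_one H_one] by auto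

lemma U_p: "a \<in> A \<Longrightarrow> h \<in> H \<Longrightarrow> p (inv a \<otimes> h \<otimes> a) = U i (inv a) * p h * U i a"
proof -
  assume a: "a \<in> A" and h: "h \<in> H"
  have g: "U i a \<in> carrier (GLC d)" "U i (inv a) \<in> carrier (GLC d)"
    using U_hom[OF i] a by (auto simp: hom_def)
  have "inv\<^bsub>GLC d\<^esub> (U i a) = U i (inv a)"
    by (rule group.inv_equality[OF GLC_group _ g]) (use U_inv(1)[OF a] in \<open>simp add: GLC_simps\<close>)
  then show ?thesis using U_twist[OF i a h] by (simp add: GLC_simps)
qed

text \<open>The twisting relation with one factor moved to the other side. In this form it is used
  whenever an element of \<open>H\<close> has to pass an element of \<open>A\<close>.\<close>

lemma p_U: "a \<in> A \<Longrightarrow> h \<in> H \<Longrightarrow> U i a * p (inv a \<otimes> h \<otimes> a) = p h * U i a"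
proof -
  assume a: "a \<in> A" and h: "h \<in> H"
  note c = U_carrier[OF a] U_carrier[of "inv a"] p_carrier[OF h]
  have "U i a * (U i (inv a) * p h * U i a) = U i a * U i (inv a) * p h * U i a"
    using a c by (simp add: assoc_mult_mat[of _ d d _ d _ d] mult_carrier_mat[of _ d d _ d])
  then show ?thesis using a h c by (simp add: U_p U_inv)
qed

text \<open>Conjugation by \<open>H\<close> fixes \<open>\<chi> i\<close>, so the eigenspace of
  \<open>Z\<close> for this character is invariant under \<open>H\<close>. It is nonzero by
  \<open>\<pi>_char\<close> and therefore everything.\<close>

lemma p_Z: "z \<in> Z \<Longrightarrow> p z = \<chi> i z \<cdot>\<^sub>m 1\<^sub>m d"
proof -
  let ?W = "{w \<in> carrier_vec d. \<forall>z\<in>Z. p z *\<^sub>v w = \<chi> i z \<cdot>\<^sub>v w}"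
  have "?W = {0\<^sub>v d} \<or> ?W = carrier_vec d"
  proof (rule irreducible_repD[OF \<pi>_irr[OF i]])
    fix u w assume "u \<in> ?W" "w \<in> ?W"
    then show "u + w \<in> ?W" 
      by (auto simp: mult_add_distrib_mat_vec[OF p_carrier] smult_add_distrib_vec[of _ d])
  next
    fix c w assume "w \<in> ?W"
    then show "c \<cdot>\<^sub>v w \<in> ?W" by (auto simp: mult_mat_vec[OF p_carrier] smult_smult_assoc mult.commute[of c])
  next
    fix g w assume "g \<in> carrier (G\<lparr>carrier := H\<rparr>)" and w: "w \<in> ?W"
    then have g: "g \<in> H" by simp
    have wc: "w \<in> carrier_vec d" using w by simp
    have pw: "p h *\<^sub>v w \<in> carrier_vec d" if "h \<in> H" for h using p_carrier[OF that] wc by auto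
    have "p z *\<^sub>v (p g *\<^sub>v w) = \<chi> i z \<cdot>\<^sub>v (p g *\<^sub>v w)" if z: "z \<in> Z" for z
    proof -
      let ?z = "inv g \<otimes> z \<otimes> g"
      have z': "?z \<in> Z" "\<chi> i ?z = \<chi> i z"
        using Z_norm[of "inv g" z] \<chi>_inv[OF i, of "inv g" z] H_S[of "inv g"] g z by auto
      have "z \<otimes> g = g \<otimes> ?z" using g z by (simp add: m_assoc[symmetric])
      then have "p z *\<^sub>v (p g *\<^sub>v w) = p g *\<^sub>v (p ?z *\<^sub>v w)"
        using p_mult[of z g] p_mult[of g ?z] g z z' wc
          assoc_mult_mat_vec[OF p_carrier p_carrier wc, of z g] assoc_mult_mat_vec[OF p_carrier p_carrier wc, of g ?z] by simp
      also have "\<dots> = \<chi> i z \<cdot>\<^sub>v (p g *\<^sub>v w)" using w z' g by (auto simp: mult_mat_vec[OF p_carrier])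
      finally show ?thesis .
    qed
    then show "p g *\<^sub>v w \<in> ?W" using pw[OF g] by simp
  qed (auto intro!: eq_vecI dest: p_carrier[OF Z_H])
  moreover obtain w where "w \<in> ?W" "w \<noteq> 0\<^sub>v d" using \<pi>_char[OF i] by (auto simp: contains_char_def)
  ultimately have W: "?W = carrier_vec d" by blast
  assume z: "z \<in> Z"
  show "p z = \<chi> i z \<cdot>\<^sub>m 1\<^sub>m d"
  proof (rule mat_eq_if_mult_vec_eq[of _ d d])
    fix w :: "complex vec" assume w: "w \<in> carrier_vec d"
    have "(\<chi> i z \<cdot>\<^sub>m 1\<^sub>m d) *\<^sub>v w = \<chi> i z \<cdot>\<^sub>v w" using w by (intro eq_vecI) (auto simp: row_smult)
    moreover have "w \<in> ?W" using w unfolding W .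
    ultimately show "p z *\<^sub>v w = (\<chi> i z \<cdot>\<^sub>m 1\<^sub>m d) *\<^sub>v w" using z by simp
  qed (use z in auto)
qed

text \<open>Nondegeneracy provides a conjugate of h of the form n h with \<psi>(n) different from 1.
  Conjugation preserves the trace while n multiplies it by \<psi>(n).\<close>

lemma p_trace: "h \<in> H \<Longrightarrow> h \<notin> Z \<Longrightarrow> mtrace (p h) = 0"
proof -
  assume h: "h \<in> H" "h \<notin> Z"
  then obtain y n where y: "y \<in> H" and n: "n \<in> N" "y \<otimes> h \<otimes> inv y = n \<otimes> h" "\<psi> n \<noteq> 1"
    using nondeg by blast
  have "mtrace (p (y \<otimes> h \<otimes> inv y)) = mtrace (p y * (p h * p (inv y)))"
    using y h by (simp add: p_mult assoc_mult_mat[of _ d d _ d _ d] mult_carrier_mat[of _ d d _ d])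
  also have "\<dots> = mtrace (p h * p (inv y) * p y)"
    using y h by (intro mtrace_mult_comm[of _ d d] mult_carrier_mat[of _ d d]) auto
  also have "p h * p (inv y) * p y = p h"
    using y h by (simp add: p_inv assoc_mult_mat[of _ d d _ d _ d] right_mult_one_mat[of _ d d])
  finally have "mtrace (p h) = mtrace (p (n \<otimes> h))" using n by simp
  also have "p (n \<otimes> h) = \<psi> n \<cdot>\<^sub>m p h"
  proof -
    have "p n = \<psi> n \<cdot>\<^sub>m 1\<^sub>m d" using p_Z[of n] \<chi>_N[OF i] n NZ by auto
    then have "p (n \<otimes> h) = \<psi> n \<cdot>\<^sub>m 1\<^sub>m d * p h" using n h by (simp add: p_mult)
    also have "\<dots> = \<psi> n \<cdot>\<^sub>m p h"
      using mult_smult_assoc_mat[OF one_carrier_mat p_carrier[OF h(1)]] left_mult_one_mat[OF p_carrier[OF h(1)]] by simp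
    finally show ?thesis .
  qed
  finally have "mtrace (p h) = \<psi> n * mtrace (p h)" using mtrace_smult[OF p_carrier[OF h(1)]] by simp
  then show "mtrace (p h) = 0" using n(3) by simp
qed

context
  fixes V assumes V: "is_rep G V"
begin

lemma V_carrier [simp]: "g \<in> carrier G \<Longrightarrow> snd V g \<in> carrier_mat (fst V) (fst V)"
  using is_repD(1)[OF V] .

lemma V_mult: "g \<in> carrier G \<Longrightarrow> h \<in> carrier G \<Longrightarrow> snd V (g \<otimes> h) = snd V g * snd V h"
  using is_repD(2)[OF V] .

text \<open>Evaluating \<open>\<Sum>\<^sub>c J\<^sub>c e\<^sub>c\<close> for \<open>J\<^sub>c = \<Sum>\<^sub>h V(h) w e\<^sub>c\<^sup>T \<pi>(h)\<^sup>-\<^sup>1\<close> gives \<open>\<Sum>\<^sub>h tr \<pi>(h)\<^sup>-\<^sup>1 V(h) w\<close>, and the trace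
  of \<open>\<pi>\<close> vanishes off \<open>Z\<close>; hence some intertwiner \<open>J\<^sub>c\<close> is nonzero.\<close>

lemma exists_H_intertwiner:
  assumes w: "w \<in> carrier_vec (fst V)" "w \<noteq> 0\<^sub>v (fst V)" "\<And>z. z \<in> Z \<Longrightarrow> snd V z *\<^sub>v w = \<chi> i z \<cdot>\<^sub>v w"
  shows "\<exists>J\<in>carrier_mat (fst V) d. J \<noteq> 0\<^sub>m (fst V) d \<and> (\<forall>h\<in>H. snd V h * J = J * p h)"
proof -
  let ?m = "fst V"
  define J where "J c = mat ?m d (\<lambda>(a,b). \<Sum>h\<in>H. (snd V h *\<^sub>v w) $ a * p (inv h) $$ (c,b))" for c
  have Jc: "J c \<in> carrier_mat ?m d" for c by (simp add: J_def)
  have Vw: "snd V h *\<^sub>v w \<in> carrier_vec ?m" if "h \<in> H" for h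
    using mult_mat_vec_carrier[OF V_carrier w(1), of h] that by simp
  have tw: "snd V k * J c = J c * p k" if k: "k \<in> H" and c: "c < d" for k c
  proof (rule eq_matI)
    fix a b assume "a < dim_row (J c * p k)" "b < dim_col (J c * p k)"
    then have ab: "a < ?m" "b < d" using p_carrier[OF k] by (auto simp: J_def)
    note Vk = V_carrier[OF H_carrier[OF k]]
    have "(snd V k * J c) $$ (a,b) = (\<Sum>r<?m. \<Sum>h\<in>H. snd V k $$ (a,r) * ((snd V h *\<^sub>v w) $ r * p (inv h) $$ (c,b)))"
      using ab Vk by (simp add: J_def scalar_prod_def sum_distrib_left atLeast0LessThan)
    also have "\<dots> = (\<Sum>h\<in>H. (\<Sum>r<?m. snd V k $$ (a,r) * (snd V h *\<^sub>v w) $ r) * p (inv h) $$ (c,b))"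
      by (subst sum.swap) (simp add: sum_distrib_right mult.assoc)
    also have "\<dots> = (\<Sum>h\<in>H. (snd V (k \<otimes> h) *\<^sub>v w) $ a * p (inv h) $$ (c,b))"
    proof (rule sum.cong[OF refl])
      fix h assume h: "h \<in> H"
      have "snd V (k \<otimes> h) *\<^sub>v w = snd V k *\<^sub>v (snd V h *\<^sub>v w)"
        using h k w(1) by (simp add: V_mult assoc_mult_mat_vec[of _ ?m ?m _ ?m])
      then show "(\<Sum>r<?m. snd V k $$ (a,r) * (snd V h *\<^sub>v w) $ r) * p (inv h) $$ (c,b) =
          (snd V (k \<otimes> h) *\<^sub>v w) $ a * p (inv h) $$ (c,b)"
        using ab Vk carrier_vecD[OF Vw[OF h]] by (simp add: scalar_prod_def atLeast0LessThan)
    qed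
    also have "\<dots> = (\<Sum>h\<in>H. (snd V h *\<^sub>v w) $ a * p (inv h \<otimes> k) $$ (c,b))"
      by (rule sum.reindex_bij_witness[of _ "\<lambda>h. inv k \<otimes> h" "\<lambda>h. k \<otimes> h"])
        (use k in \<open>auto simp: m_assoc inv_mult_group\<close>)
    also have "\<dots> = (\<Sum>h\<in>H. \<Sum>r<d. (snd V h *\<^sub>v w) $ a * (p (inv h) $$ (c,r) * p k $$ (r,b)))"
      using ab c k p_carrier[OF k] 
      by (intro sum.cong) (auto simp: p_mult scalar_prod_def sum_distrib_left atLeast0LessThan
          carrier_matD[OF p_carrier] intro!: sum.cong)
    also have "\<dots> = (J c * p k) $$ (a,b)"
      using ab p_carrier[OF k]
      by (subst sum.swap) (simp add: J_def scalar_prod_def sum_distrib_right atLeast0LessThan mult.assoc)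
    finally show "(snd V k * J c) $$ (a,b) = (J c * p k) $$ (a,b)" .
  qed (use V_carrier[OF H_carrier[OF k]] p_carrier[OF k] in \<open>auto simp: J_def\<close>)
  obtain a where a: "a < ?m" "w $ a \<noteq> 0" using w(1,2) by (auto simp: vec_eq_iff)
  have "(\<Sum>c<d. J c $$ (a,c)) = (\<Sum>h\<in>H. (snd V h *\<^sub>v w) $ a * mtrace (p (inv h)))"
  proof -
    have "(\<Sum>c<d. J c $$ (a,c)) = (\<Sum>c<d. \<Sum>h\<in>H. (snd V h *\<^sub>v w) $ a * p (inv h) $$ (c,c))"
      using a by (simp add: J_def)
    also have "\<dots> = (\<Sum>h\<in>H. \<Sum>c<d. (snd V h *\<^sub>v w) $ a * p (inv h) $$ (c,c))" by (rule sum.swap)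
    also have "\<dots> = (\<Sum>h\<in>H. (snd V h *\<^sub>v w) $ a * mtrace (p (inv h)))"
      by (intro sum.cong) (auto simp: mtrace_def sum_distrib_left carrier_matD[OF p_carrier])
    finally show ?thesis .
  qed
  \<comment> \<open>For h in \<open>Z\<close> the scalar of V(h) on w and the scalar of \<pi>(h^-1)
    are inverse to each other, so each such h contributes the same amount d w_a.\<close>
  also have "\<dots> = (\<Sum>h\<in>Z. of_nat d * w $ a)"
  proof (rule sum.mono_neutral_cong_right[OF finite_H ZH])
    show "\<forall>h\<in>H - Z. (snd V h *\<^sub>v w) $ a * mtrace (p (inv h)) = 0"
    proof
      fix h assume h: "h \<in> H - Z"
      have "inv h \<notin> Z" using subgroup.m_inv_closed[OF Z, of "inv h"] h by auto
      then show "(snd V h *\<^sub>v w) $ a * mtrace (p (inv h)) = 0" using p_trace[of "inv h"] h by simp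
    qed
    fix h assume h: "h \<in> Z"
    have ih: "inv h \<in> Z" using subgroup.m_inv_closed[OF Z h] .
    have "\<chi> i h * \<chi> i (inv h) = 1"
      using \<chi>_mult[OF i h ih] \<chi>_N[OF i, of \<one>] h by simp
    then show "(snd V h *\<^sub>v w) $ a * mtrace (p (inv h)) = of_nat d * w $ a"
      using w(1) w(3)[OF h] a p_Z[OF ih] mtrace_smult[of "1\<^sub>m d" d "\<chi> i (inv h)"] mtrace_one[of d, where 'a=complex]
      by simp
  qed
  finally have "(\<Sum>c<d. J c $$ (a,c)) = of_nat (card Z) * (of_nat d * w $ a)" by simp
  moreover have "card Z \<noteq> 0"
    using finite_subset[OF ZH finite_H] subgroup.one_closed[OF Z] by (auto simp: card_eq_0_iff)
  ultimately have "(\<Sum>c<d. J c $$ (a,c)) \<noteq> 0" using a d_pos by simp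
  then obtain c where c: "c < d" "J c $$ (a,c) \<noteq> 0" by (meson lessThan_iff sum.neutral)
  have "J c \<noteq> 0\<^sub>m ?m d" using c a by auto
  then show ?thesis using Jc tw c by blast
qed

lemma V_one: "snd V \<one> = 1\<^sub>m (fst V)"
  using is_rep_one[OF is_group V] .

text \<open>The operator of a sends J to V(a) J U(a)^-1. The twisting relation says exactly that it
  preserves the space of \<open>H\<close>-intertwiners; the operators multiply like elements of the
  abelian group \<open>A\<close>, and raising one to the order of \<open>G\<close> gives the
  identity, so \<open>common_eigenvector\<close> applies.\<close>

lemma exists_A_eigen_intertwiner:
  assumes J: "J \<in> carrier_mat (fst V) d" "J \<noteq> 0\<^sub>m (fst V) d" "\<forall>h\<in>H. snd V h * J = J * p h"
  shows "\<exists>J'\<in>carrier_mat (fst V) d. \<exists>\<theta>. J' \<noteq> 0\<^sub>m (fst V) d \<and> (\<forall>h\<in>H. snd V h * J' = J' * p h) \<and>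
     (\<forall>a\<in>A. snd V a * J' = \<theta> a \<cdot>\<^sub>m (J' * U i a))"
proof -
  let ?m = "fst V"
  define E where "E = {J \<in> carrier_mat ?m d. \<forall>h\<in>H. snd V h * J = J * p h}"
  define L where "L a J = snd V a * J * U i (inv a)" for a J
  have L_mult: "L a (L b j) = L (a \<otimes> b) j" if "a \<in> A" "b \<in> A" "j \<in> carrier_mat ?m d" for a b j
  proof -
    have c: "snd V a \<in> carrier_mat ?m ?m" "snd V b \<in> carrier_mat ?m ?m" "U i (inv a) \<in> carrier_mat d d"
      "U i (inv b) \<in> carrier_mat d d" using that by auto
    have "inv (a \<otimes> b) = inv b \<otimes> inv a" using that by (simp add: inv_mult_group)
    then have "L (a \<otimes> b) j = snd V a * snd V b * j * (U i (inv b) * U i (inv a))"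
      using that by (simp add: L_def V_mult U_mult)
    also have "\<dots> = L a (L b j)"
      unfolding L_def using c that(3)
      by (simp add: assoc_mult_mat[of _ ?m ?m _ ?m _ d] assoc_mult_mat[of _ ?m ?m _ d _ d] assoc_mult_mat[of _ ?m d _ d _ d]
          mult_carrier_mat[of _ ?m ?m _ d] mult_carrier_mat[of _ ?m d _ d] mult_carrier_mat[of _ d d _ d] mult_carrier_mat[of _ ?m ?m _ ?m])
    finally show ?thesis ..
  qed
  have LE: "L a j \<in> E" if a: "a \<in> A" and j: "j \<in> E" for a j
    unfolding E_def
  proof (intro CollectI conjI ballI)
    have jc: "j \<in> carrier_mat ?m d" using j by (simp add: E_def)
    have c: "snd V a \<in> carrier_mat ?m ?m" "U i (inv a) \<in> carrier_mat d d" using a by auto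
    show "L a j \<in> carrier_mat ?m d" using c jc by (simp add: L_def)
    fix h assume h: "h \<in> H"
    let ?k = "inv a \<otimes> h \<otimes> a"
    have k: "?k \<in> H" using H_norm a h by simp
    note ch = V_carrier[OF H_carrier[OF h]] p_carrier[OF h] V_carrier[OF H_carrier[OF k]] p_carrier[OF k]
    note assoc = assoc_mult_mat[of _ ?m ?m _ ?m _ d] assoc_mult_mat[of _ ?m ?m _ d _ d] assoc_mult_mat[of _ ?m d _ d _ d]
      mult_carrier_mat[of _ ?m ?m _ d] mult_carrier_mat[of _ ?m d _ d] mult_carrier_mat[of _ d d _ d] mult_carrier_mat[of _ ?m ?m _ ?m]
    have "h \<otimes> a = a \<otimes> ?k" using a h by (simp add: m_assoc[symmetric])
    then have VV: "snd V h * snd V a = snd V a * snd V ?k"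
      using V_mult[of h a] V_mult[of a ?k] a h k by simp
    have Uk: "p ?k * U i (inv a) = U i (inv a) * p h"
      using p_U[of "inv a" ?k] a h k by (simp add: m_assoc)
    have "snd V h * L a j = snd V h * snd V a * j * U i (inv a)"
      unfolding L_def using c jc ch by (simp add: assoc)
    also have "\<dots> = snd V a * (snd V ?k * j) * U i (inv a)"
      unfolding VV using c jc ch by (simp add: assoc)
    also have "\<dots> = snd V a * j * (p ?k * U i (inv a))"
      using j k c jc ch by (simp add: E_def assoc)
    also have "\<dots> = L a j * p h" unfolding Uk L_def using c jc ch by (simp add: assoc)
    finally show "snd V h * L a j = L a j * p h" .
  qed
  have Lpow: "(L a ^^ k) j = L (a [^] k) j" if "a \<in> A" "j \<in> carrier_mat ?m d" for a j and k :: nat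
  proof (induction k)
    case 0
    have "U i \<one> = 1\<^sub>m d" using U_triv[OF i] by simp
    then show ?case using that by (simp add: L_def V_one)
  next
    case (Suc k)
    have ak: "a [^] k \<in> A" using that by (induction k) auto
    have "a \<otimes> a [^] k = a [^] Suc k" using nat_pow_Suc2[of a k] that by simp
    then show ?case using Suc that ak L_mult[of a "a [^] k" j] by simp
  qed
  have "\<exists>J'\<in>E. J' \<noteq> 0\<^sub>m ?m d \<and> (\<forall>a\<in>A. \<exists>c. L a J' = c \<cdot>\<^sub>m J')"
  proof (rule common_eigenvector)
    show "E \<subseteq> carrier_mat ?m d" by (auto simp: E_def)
    show "0\<^sub>m ?m d \<in> E" by (auto simp: E_def left_mult_zero_mat[OF p_carrier] right_mult_zero_mat[OF V_carrier])
    fix j k assume jk: "j \<in> E" "k \<in> E"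
    then show "j + k \<in> E"
      by (auto simp: E_def mult_add_distrib_mat[OF V_carrier] add_mult_distrib_mat[OF _ _ p_carrier])
  next
    fix c j assume j: "j \<in> E"
    then show "c \<cdot>\<^sub>m j \<in> E"
      by (auto simp: E_def mult_smult_distrib[OF V_carrier] mult_smult_assoc_mat[OF _ p_carrier])
  next
    show "finite A" by (rule finite_subset[OF _ fin]) auto
    fix a assume a: "a \<in> A"
    have c: "snd V a \<in> carrier_mat ?m ?m" "U i (inv a) \<in> carrier_mat d d" using a by auto
    show "\<exists>m>0. \<forall>j\<in>E. (L a ^^ m) j = j"
    proof (intro exI conjI ballI)
      show "order G > 0" using fin by (auto simp: order_def card_gt_0_iff)
      fix j assume "j \<in> E"
      then have "j \<in> carrier_mat ?m d" by (simp add: E_def)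
      then show "(L a ^^ order G) j = j"
        using Lpow[OF a, of j "order G"] Lpow[OF a, of j 0] pow_order_eq_1[of a] a by simp
    qed
    fix j assume j: "j \<in> E"
    then have jc: "j \<in> carrier_mat ?m d" by (simp add: E_def)
    show "L a j \<in> E" using LE a j by simp
    show "L a (c \<cdot>\<^sub>m j) = c \<cdot>\<^sub>m L a j" for c unfolding L_def using c jc
      by (simp add: mult_smult_distrib[OF c(1) jc] mult_smult_assoc_mat[OF _ c(2), of _ ?m] mult_carrier_mat[OF c(1)])
    show "L a (j + k) = L a j + L a k" if "k \<in> E" for k
    proof -
      have kc: "k \<in> carrier_mat ?m d" using that by (simp add: E_def)
      show ?thesis unfolding L_def mult_add_distrib_mat[OF c(1) jc kc]
        by (rule add_mult_distrib_mat[OF mult_carrier_mat[OF c(1) jc] mult_carrier_mat[OF c(1) kc] c(2)])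
    qed
    fix b assume b: "b \<in> A"
    show "L a (L b j) = L b (L a j)" using L_mult[OF a b jc] L_mult[OF b a jc] A_comm[OF a b] by simp
  qed (use J in \<open>auto simp: E_def\<close>)
  then obtain J' \<theta> where J': "J' \<in> E" "J' \<noteq> 0\<^sub>m ?m d" "\<And>a. a \<in> A \<Longrightarrow> L a J' = \<theta> a \<cdot>\<^sub>m J'" by metis
  have J'c: "J' \<in> carrier_mat ?m d" using J' by (simp add: E_def)
  have "snd V a * J' = \<theta> a \<cdot>\<^sub>m (J' * U i a)" if a: "a \<in> A" for a
  proof -
    have c: "snd V a \<in> carrier_mat ?m ?m" "U i (inv a) \<in> carrier_mat d d" "U i a \<in> carrier_mat d d" using a by auto
    have "L a J' * U i a = snd V a * J' * (U i (inv a) * U i a)"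
      unfolding L_def by (rule assoc_mult_mat[OF mult_carrier_mat[OF c(1) J'c] c(2,3)])
    also have "\<dots> = snd V a * J'" using U_inv[OF a] right_mult_one_mat[OF mult_carrier_mat[OF c(1) J'c]] by simp
    finally show ?thesis using J'(3)[OF a] mult_smult_assoc_mat[OF J'c c(3)] by simp
  qed
  then show ?thesis using J' J'c by (auto simp: E_def)
qed

end

end

text \<open>\<open>Z\<close> may be non-abelian, but its commutators lie in \<open>N\<close> with
  value 1 under \<open>\<psi>\<close>, so on vectors where \<open>N\<close> acts by
  \<open>\<psi>\<close> the elements of \<open>Z\<close> commute. A joint eigenvector gives a
  character of \<open>Z\<close> extending \<open>\<psi>\<close>, and \<open>\<chi>_surj\<close>
  identifies it. Vectors are kept as one-column matrices to fit
  \<open>common_eigenvector\<close>.\<close>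

lemma exists_Z_eigenvector:
  assumes V: "is_rep G V" and w: "contains_char N \<psi> V"
  shows "\<exists>i\<in>I. \<exists>w\<in>carrier_vec (fst V). w \<noteq> 0\<^sub>v (fst V) \<and> (\<forall>z\<in>Z. snd V z *\<^sub>v w = \<chi> i z \<cdot>\<^sub>v w)"
proof -
  let ?m = "fst V"
  note Vc = is_repD(1)[OF V] and Vm = is_repD(2)[OF V]
  have ZG: "z \<in> carrier G" if "z \<in> Z" for z using that by simp
  define E where "E = {j \<in> carrier_mat ?m 1. \<forall>h\<in>N. snd V h * j = \<psi> h \<cdot>\<^sub>m j}"
  define L where "L z j = snd V z * j" for z and j :: "complex mat"
  obtain w where w: "w \<in> carrier_vec ?m" "w \<noteq> 0\<^sub>v ?m" "\<And>h. h \<in> N \<Longrightarrow> snd V h *\<^sub>v w = \<psi> h \<cdot>\<^sub>v w"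
    using w by (auto simp: contains_char_def)
  have L_mult: "L y (L z j) = L (y \<otimes> z) j" if "y \<in> carrier G" "z \<in> carrier G" "j \<in> carrier_mat ?m 1" for y z j
    using that Vc by (simp add: L_def Vm assoc_mult_mat[of _ ?m ?m _ ?m _ 1])
  have Lpow: "(L z ^^ k) j = L (z [^] k) j" if "z \<in> Z" "j \<in> carrier_mat ?m 1" for z j and k :: nat
  proof (induction k)
    case 0
    then show ?case using that is_rep_one[OF is_group V] by (simp add: L_def)
  next
    case (Suc k)
    have "z \<otimes> z [^] k = z [^] Suc k" using nat_pow_Suc2[of z k] that by simp
    then show ?case using Suc that L_mult[of z "z [^] k" j] by simp
  qed
  define J where "J = mat ?m 1 (\<lambda>(a,b). w $ a)"
  have J: "J \<in> E" "J \<noteq> 0\<^sub>m ?m 1"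
  proof -
    obtain a where "a < ?m" "w $ a \<noteq> 0" using w(1,2) by (auto simp: vec_eq_iff)
    then have "J $$ (a, 0) \<noteq> 0\<^sub>m ?m 1 $$ (a, 0)" by (simp add: J_def)
    then show "J \<noteq> 0\<^sub>m ?m 1" by auto
    have cJ: "col J 0 = w" using w(1) by (auto simp: J_def)
    have "snd V h * J = \<psi> h \<cdot>\<^sub>m J" if h: "h \<in> N" for h
    proof (rule eq_matI)
      fix a b assume "a < dim_row (\<psi> h \<cdot>\<^sub>m J)" "b < dim_col (\<psi> h \<cdot>\<^sub>m J)"
      then have ab: "a < ?m" "b = 0" by (auto simp: J_def)
      have "(snd V h * J) $$ (a,b) = row (snd V h) a \<bullet> col J b"
        using ab Vc[of h] h by (simp add: J_def)
      also have "\<dots> = (snd V h *\<^sub>v w) $ a" using ab Vc[of h] h cJ by simp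
      also have "\<dots> = (\<psi> h \<cdot>\<^sub>m J) $$ (a,b)" using w(3)[OF h] w(1) ab by (simp add: J_def)
      finally show "(snd V h * J) $$ (a,b) = (\<psi> h \<cdot>\<^sub>m J) $$ (a,b)" .
    qed (use Vc[of h] h in \<open>auto simp: J_def\<close>)
    then show "J \<in> E" by (simp add: E_def J_def)
  qed
  have "\<exists>J'\<in>E. J' \<noteq> 0\<^sub>m ?m 1 \<and> (\<forall>z\<in>Z. \<exists>c. L z J' = c \<cdot>\<^sub>m J')"
  proof (rule common_eigenvector)
    show "E \<subseteq> carrier_mat ?m 1" by (auto simp: E_def)
    show "0\<^sub>m ?m 1 \<in> E" by (auto simp: E_def right_mult_zero_mat[OF Vc])
    fix j k assume jk: "j \<in> E" "k \<in> E"
    then show "j + k \<in> E"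
      by (auto simp: E_def mult_add_distrib_mat[OF Vc] add_smult_distrib_left_mat[of _ ?m 1])
  next
    fix c j assume j: "j \<in> E"
    then show "c \<cdot>\<^sub>m j \<in> E"
      by (auto simp: E_def mult_smult_distrib[OF Vc] smult_smult_mat mult.commute[of c])
  next
    show "finite Z" by (rule finite_subset[OF _ fin]) auto
    fix z assume z: "z \<in> Z"
    note c = Vc[OF ZG[OF z]]
    show "\<exists>m>0. \<forall>j\<in>E. (L z ^^ m) j = j"
    proof (intro exI conjI ballI)
      show "order G > 0" using fin by (auto simp: order_def card_gt_0_iff)
      fix j assume "j \<in> E"
      then have "j \<in> carrier_mat ?m 1" by (simp add: E_def)
      then show "(L z ^^ order G) j = j"
        using Lpow[OF z, of j "order G"] Lpow[OF z, of j 0] pow_order_eq_1[of z] z by simp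
    qed
    fix j assume j: "j \<in> E"
    then have jc: "j \<in> carrier_mat ?m 1" by (simp add: E_def)
    show "L z (c \<cdot>\<^sub>m j) = c \<cdot>\<^sub>m L z j" for c unfolding L_def
      by (simp add: mult_smult_distrib[OF c jc])
    show "L z (j + k) = L z j + L z k" if "k \<in> E" for k
      using mult_add_distrib_mat[OF c jc, of k] that by (simp add: E_def L_def)
    show "L z j \<in> E" unfolding E_def
    proof (intro CollectI conjI ballI)
      show "L z j \<in> carrier_mat ?m 1" using c jc by (simp add: L_def)
      fix h assume h: "h \<in> N"
      \<comment> \<open>Stability of the isotypic space under z: moving h past z replaces it by a
        conjugate on which \<psi> has the same value, because \<open>Z\<close> lies in the
        stabilizer.\<close>
      let ?k = "inv z \<otimes> h \<otimes> z"
      have iz: "inv z \<in> S" using H_S[of "inv z"] z by simp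
      have k: "?k \<in> N" using N_normal[of "inv z" h] h z by simp
      have pk: "\<psi> ?k = \<psi> h" using iz h z unfolding S_eq by auto
      have "h \<otimes> z = z \<otimes> ?k" using h z by (simp add: m_assoc[symmetric])
      then have "snd V h * L z j = L z (snd V ?k * j)"
        using L_mult[of h z j] L_mult[of z ?k j] h z k jc by (simp add: L_def)
      also have "\<dots> = \<psi> h \<cdot>\<^sub>m L z j" using j k pk by (simp add: E_def L_def mult_smult_distrib[OF c jc])
      finally show "snd V h * L z j = \<psi> h \<cdot>\<^sub>m L z j" .
    qed
    fix y assume y: "y \<in> Z"
    obtain n where n: "n \<in> N" "z \<otimes> y = y \<otimes> z \<otimes> n" "\<psi> n = 1" using Z_comm[OF z y] by blast
    have "L z (L y j) = L (y \<otimes> z) (L n j)"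
      using L_mult[of z y j] L_mult[of "y \<otimes> z" n j] z y n jc by simp
    also have "L n j = j" using j n jc by (simp add: E_def L_def smult_one_mat)
    finally show "L z (L y j) = L y (L z j)" using L_mult[of y z j] z y jc by simp
  qed (use J in auto)
  then obtain J' c where J': "J' \<in> E" "J' \<noteq> 0\<^sub>m ?m 1" "\<And>z. z \<in> Z \<Longrightarrow> L z J' = c z \<cdot>\<^sub>m J'" by metis
  have J'c: "J' \<in> carrier_mat ?m 1" using J' by (simp add: E_def)
  obtain a where a: "a < ?m" "J' $$ (a,0) \<noteq> 0"
  proof -
    have "\<not> (\<forall>a<?m. J' $$ (a,0) = 0)"
    proof
      assume "\<forall>a<?m. J' $$ (a,0) = 0"
      then have "J' = 0\<^sub>m ?m 1" using J'c by (intro eq_matI) auto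
      with J'(2) show False by simp
    qed
    then show ?thesis using that by blast
  qed
  have cancel: "x = y" if "x \<cdot>\<^sub>m J' = y \<cdot>\<^sub>m J'" for x y
  proof -
    have "(x \<cdot>\<^sub>m J') $$ (a,0) = (y \<cdot>\<^sub>m J') $$ (a,0)" using that by simp
    then show ?thesis using a J'c by simp
  qed
  have "\<exists>i\<in>I. \<forall>z\<in>Z. c z = \<chi> i z"
  proof (rule \<chi>_surj)
    fix y z assume yz: "y \<in> Z" "z \<in> Z"
    have "c (y \<otimes> z) \<cdot>\<^sub>m J' = L y (L z J')"
      using J'(3)[of "y \<otimes> z"] L_mult[of y z J'] yz J'c subgroup.m_closed[OF Z yz] by simp
    also have "\<dots> = (c y * c z) \<cdot>\<^sub>m J'"
      using J'(3) yz Vc[OF ZG[OF yz(1)]] J'c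
      by (simp add: L_def mult_smult_distrib[OF Vc[OF ZG[OF yz(1)]] J'c] smult_smult_mat mult.commute)
    finally show "c (y \<otimes> z) = c y * c z" by (rule cancel)
  next
    fix n assume n: "n \<in> N"
    have "c n \<cdot>\<^sub>m J' = L n J'" using J'(3)[of n] n NZ by auto
    also have "\<dots> = \<psi> n \<cdot>\<^sub>m J'" using J'(1) n by (simp add: E_def L_def)
    finally have "c n \<cdot>\<^sub>m J' = \<psi> n \<cdot>\<^sub>m J'" .
    then show "c n = \<psi> n" by (rule cancel)
  qed
  then obtain i where i: "i \<in> I" "\<And>z. z \<in> Z \<Longrightarrow> c z = \<chi> i z" by blast
  let ?w = "col J' 0"
  have "?w \<in> carrier_vec ?m" using col_carrier_vec[of 0 1 J' ?m] J'c by simp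
  moreover have "?w \<noteq> 0\<^sub>v ?m"
  proof
    assume "?w = 0\<^sub>v ?m"
    then have "?w $ a = 0" using a by simp
    then show False using a J'c by simp
  qed
  moreover have "snd V z *\<^sub>v ?w = \<chi> i z \<cdot>\<^sub>v ?w" if z: "z \<in> Z" for z
  proof -
    have "snd V z *\<^sub>v ?w = col (snd V z * J') 0"
      using Vc[OF ZG[OF z]] J'c by (intro eq_vecI) auto
    also have "\<dots> = \<chi> i z \<cdot>\<^sub>v ?w" using J'(3)[OF z] i(2)[OF z] J'c by (simp add: L_def)
    finally show ?thesis .
  qed
  ultimately show ?thesis using i(1) by blast
qed

section \<open>Representations of the stabilizer attached to characters of \<open>A\<close>\<close>

definition char_index :: "('a \<Rightarrow> complex) \<Rightarrow> 'i" where
  "char_index \<theta> = (THE i. i \<in> I \<and> (\<forall>a\<in>A \<inter> H. \<theta> a = \<chi> i a))"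

text \<open>The abstract counterpart of \<open>sigma\<close>. That the description singles out a
  value, independent of the factorization of x, is \<open>extension_eq\<close>.\<close>

definition extension :: "('a \<Rightarrow> complex) \<Rightarrow> 'a matrix_rep" where
  "extension \<theta> = (fst (\<pi> (char_index \<theta>)), \<lambda>x. THE M. \<exists>g\<in>A. \<exists>h\<in>H. x = g \<otimes> h \<and>
     M = \<theta> g \<cdot>\<^sub>m (U (char_index \<theta>) g * snd (\<pi> (char_index \<theta>)) h))"

definition A_chars :: "('a \<Rightarrow> complex) set" where
  "A_chars = {\<theta> \<in> mult_chars (G\<lparr>carrier := A\<rparr>). \<forall>h\<in>A \<inter> N. \<theta> h = \<psi> h}"

lemma A_charsD:
  assumes "\<theta> \<in> A_chars"
  shows "a \<in> A \<Longrightarrow> b \<in> A \<Longrightarrow> \<theta> (a \<otimes> b) = \<theta> a * \<theta> b" "a \<in> A \<Longrightarrow> \<theta> a \<noteq> 0"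
    "a \<in> A \<Longrightarrow> a \<in> N \<Longrightarrow> \<theta> a = \<psi> a" "\<theta> \<in> extensional A"
  using assms by (auto simp: A_chars_def mult_chars_def hom_def units_of_def Units_def Pi_def)

text \<open>\<open>Z\<close> is generated by A \<inter> H and \<open>N\<close>, and on
  \<open>N\<close> all characters of the family agree with \<open>\<psi>\<close>.\<close>

lemma char_index_unique:
  assumes "i \<in> I" "j \<in> I" "\<And>a. a \<in> A \<Longrightarrow> a \<in> H \<Longrightarrow> \<chi> i a = \<chi> j a"
  shows "i = j"
proof (rule \<chi>_inj[OF assms(1,2)])
  fix z assume "z \<in> Z"
  then obtain a n where "a \<in> A" "a \<in> H" "n \<in> N" "z = a \<otimes> n" using Z_AN by blast
  then show "\<chi> i z = \<chi> j z" using assms AH_Z NZ by (auto simp: \<chi>_mult \<chi>_N subset_iff)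
qed

text \<open>Glue \<theta> on A \<inter> H and \<open>\<psi>\<close> on \<open>N\<close> to a
  character of \<open>Z\<close>. The two agree on A \<inter> N, so the value at a product is well
  defined; it is multiplicative because conjugation by \<open>A\<close> does not change
  \<open>\<psi>\<close>.\<close>

lemma char_index_exists:
  assumes \<theta>: "\<theta> \<in> A_chars"
  shows "\<exists>i\<in>I. \<forall>a\<in>A \<inter> H. \<theta> a = \<chi> i a"
proof -
  note \<theta>D = A_charsD[OF \<theta>]
  define \<chi>' where "\<chi>' z = (SOME c. \<exists>a\<in>A \<inter> H. \<exists>n\<in>N. z = a \<otimes> n \<and> c = \<theta> a * \<psi> n)" for z
  have \<chi>': "\<chi>' (a \<otimes> n) = \<theta> a * \<psi> n" if a: "a \<in> A" "a \<in> H" and n: "n \<in> N" for a n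
  proof -
    have "\<exists>a'\<in>A \<inter> H. \<exists>n'\<in>N. a \<otimes> n = a' \<otimes> n' \<and> \<chi>' (a \<otimes> n) = \<theta> a' * \<psi> n'"
      unfolding \<chi>'_def by (rule someI_ex) (use that in blast)
    then obtain a' n' where a': "a' \<in> A" "a' \<in> H" and n': "n' \<in> N" and e: "a \<otimes> n = a' \<otimes> n'"
      and v: "\<chi>' (a \<otimes> n) = \<theta> a' * \<psi> n'" by blast
    let ?b = "inv a' \<otimes> a"
    have b: "?b \<in> A" using a a' by simp
    have "?b \<otimes> n = n'" using e a a' n n' by (simp add: m_assoc)
    then have bN: "?b = n' \<otimes> inv n" using a a' n n' by (auto simp: m_assoc)
    then have "?b \<in> N" using subgroup.m_closed[OF N n' subgroup.m_inv_closed[OF N n]] by simp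
    then have "\<theta> ?b = \<psi> n' * inverse (\<psi> n)"
      using \<theta>D(3)[OF b] bN n n' subgroup.m_inv_closed[OF N n] by (simp add: \<psi>_mult \<psi>_inv)
    moreover have "\<theta> a = \<theta> a' * \<theta> ?b" using \<theta>D(1)[OF a'(1) b] a a' by (simp add: m_assoc[symmetric])
    ultimately show ?thesis using v \<psi>_nz[OF n] by simp
  qed
  have "\<exists>i\<in>I. \<forall>z\<in>Z. \<chi>' z = \<chi> i z"
  proof (rule \<chi>_surj)
    fix y z assume "y \<in> Z" "z \<in> Z"
    then obtain a n b k where a: "a \<in> A" "a \<in> H" "n \<in> N" "y = a \<otimes> n" and b: "b \<in> A" "b \<in> H" "k \<in> N" "z = b \<otimes> k"
      using Z_AN[of y] Z_AN[of z] by blast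
    \<comment> \<open>The conjugate of n that appears when n is moved past b, so that the product
      again has a factor from \<open>A\<close> followed by one from \<open>N\<close>.\<close>
    let ?n = "inv b \<otimes> n \<otimes> b"
    have n: "?n \<in> N" using N_normal[of "inv b" n] a b by simp
    have "inv b \<in> S" using A_S[of "inv b"] b by simp
    then have pn: "\<psi> ?n = \<psi> n" using a b unfolding S_eq by auto
    have "y \<otimes> z = (a \<otimes> b) \<otimes> (?n \<otimes> k)" using a b by (simp add: m_assoc)
    then have "\<chi>' (y \<otimes> z) = \<theta> (a \<otimes> b) * \<psi> (?n \<otimes> k)"
      using \<chi>'[of "a \<otimes> b" "?n \<otimes> k"] a b subgroup.m_closed[OF N n b(3)] by simp
    then show "\<chi>' (y \<otimes> z) = \<chi>' y * \<chi>' z"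
      using a b n pn \<chi>' by (simp add: \<theta>D \<psi>_mult)
  next
    fix n assume "n \<in> N"
    then show "\<chi>' n = \<psi> n" using \<chi>'[of \<one> n] \<theta>D(3)[of \<one>] by simp
  qed
  then obtain i where i: "i \<in> I" "\<And>z. z \<in> Z \<Longrightarrow> \<chi>' z = \<chi> i z" by blast
  have "\<theta> a = \<chi> i a" if "a \<in> A" "a \<in> H" for a
    using \<chi>'[OF that N_one] i(2)[of a] AH_Z that by (auto simp: subset_iff)
  then show ?thesis using i(1) by blast
qed

lemma char_index_eqI:
  assumes "\<theta> \<in> A_chars" "i \<in> I" "\<And>a. a \<in> A \<Longrightarrow> a \<in> H \<Longrightarrow> \<theta> a = \<chi> i a"
  shows "char_index \<theta> = i"
  unfolding char_index_def
  by (rule the_equality) (use assms char_index_unique in auto)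

lemma char_index:
  assumes "\<theta> \<in> A_chars"
  shows "char_index \<theta> \<in> I" "a \<in> A \<Longrightarrow> a \<in> H \<Longrightarrow> \<theta> a = \<chi> (char_index \<theta>) a"
proof -
  obtain i where i: "i \<in> I" "\<And>a. a \<in> A \<Longrightarrow> a \<in> H \<Longrightarrow> \<theta> a = \<chi> i a" using char_index_exists[OF assms] by blast
  then have "char_index \<theta> = i" by (rule char_index_eqI[OF assms])
  then show "char_index \<theta> \<in> I" "a \<in> A \<Longrightarrow> a \<in> H \<Longrightarrow> \<theta> a = \<chi> (char_index \<theta>) a" using i by auto
qed

text \<open>Two factorizations of the same element differ by some b in A \<inter> H. There U is
  trivial and, b being in \<open>Z\<close>, \<pi>(b) is the scalar \<chi>(b) = \<theta>(b); this
  scalar is moved from one factor to the other.\<close>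

lemma extension_eq:
  assumes \<theta>: "\<theta> \<in> A_chars" and a: "a \<in> A" and h: "h \<in> H"
  shows "snd (extension \<theta>) (a \<otimes> h) = \<theta> a \<cdot>\<^sub>m (U (char_index \<theta>) a * snd (\<pi> (char_index \<theta>)) h)"
  unfolding extension_def snd_conv
proof (rule the_equality)
  let ?i = "char_index \<theta>"
  note i = char_index(1)[OF \<theta>]
  let ?d = "fst (\<pi> ?i)"
  show "\<exists>g\<in>A. \<exists>k\<in>H. a \<otimes> h = g \<otimes> k \<and> \<theta> a \<cdot>\<^sub>m (U ?i a * snd (\<pi> ?i) h) = \<theta> g \<cdot>\<^sub>m (U ?i g * snd (\<pi> ?i) k)"
    using a h by blast
  fix M assume "\<exists>g\<in>A. \<exists>k\<in>H. a \<otimes> h = g \<otimes> k \<and> M = \<theta> g \<cdot>\<^sub>m (U ?i g * snd (\<pi> ?i) k)"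
  then obtain g k where g: "g \<in> A" and k: "k \<in> H" and e: "a \<otimes> h = g \<otimes> k"
    and M: "M = \<theta> g \<cdot>\<^sub>m (U ?i g * snd (\<pi> ?i) k)" by blast
  let ?b = "inv a \<otimes> g"
  have b: "?b \<in> A" using a g by simp
  have bk: "?b \<otimes> k = h" using e[symmetric] a h g k by (simp add: m_assoc)
  then have "?b = h \<otimes> inv k" using a g h k by (auto simp: m_assoc)
  then have bH: "?b \<in> H" using h k by simp
  have bZ: "?b \<in> Z" using AH_Z b bH by auto
  have ge: "g = a \<otimes> ?b" using a g by (simp add: m_assoc[symmetric])
  have \<theta>g: "\<theta> g = \<theta> a * \<theta> ?b" using A_charsD(1)[OF \<theta> a b] ge by simp
  have Ug: "U ?i g = U ?i a" using U_mult[OF i a b] U_triv[OF i b bH] U_carrier[OF i a] ge by simp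
  have "snd (\<pi> ?i) h = \<theta> ?b \<cdot>\<^sub>m snd (\<pi> ?i) k"
    using p_mult[OF i bH k] bk p_Z[OF i bZ] char_index(2)[OF \<theta> b bH]
      mult_smult_assoc_mat[OF one_carrier_mat p_carrier[OF i k]] left_mult_one_mat[OF p_carrier[OF i k]] by simp
  then have "\<theta> a \<cdot>\<^sub>m (U ?i a * snd (\<pi> ?i) h) = (\<theta> a * \<theta> ?b) \<cdot>\<^sub>m (U ?i a * snd (\<pi> ?i) k)"
    by (simp add: mult_smult_distrib[OF U_carrier[OF i a] p_carrier[OF i k]] smult_smult_mat)
  then show "M = \<theta> a \<cdot>\<^sub>m (U ?i a * snd (\<pi> ?i) h)" using M \<theta>g Ug by simp
qed

lemma extension_deg: "fst (extension \<theta>) = fst (\<pi> (char_index \<theta>))"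
  by (simp add: extension_def)

lemma A_chars_one: "\<theta> \<in> A_chars \<Longrightarrow> \<theta> \<one> = 1"
  using A_charsD(3)[of \<theta> \<one>] by simp

lemma extension_H:
  assumes \<theta>: "\<theta> \<in> A_chars" and h: "h \<in> H"
  shows "snd (extension \<theta>) h = snd (\<pi> (char_index \<theta>)) h"
proof -
  have "1 \<cdot>\<^sub>m snd (\<pi> (char_index \<theta>)) h = snd (\<pi> (char_index \<theta>)) h" by (intro eq_matI) auto
  then show ?thesis
    using extension_eq[OF \<theta> A_one h] A_chars_one[OF \<theta>] U_triv[OF char_index(1)[OF \<theta>] A_one H_one]
      p_carrier[OF char_index(1)[OF \<theta>] h] h by simp
qed

lemma extension_A:
  assumes \<theta>: "\<theta> \<in> A_chars" and a: "a \<in> A"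
  shows "snd (extension \<theta>) a = \<theta> a \<cdot>\<^sub>m U (char_index \<theta>) a"
  using extension_eq[OF \<theta> a H_one] p_one[OF char_index(1)[OF \<theta>]]
    U_carrier[OF char_index(1)[OF \<theta>] a] a by simp

text \<open>Multiplicativity comes from \<open>p_U\<close>, used to move h past b. Irreducibility
  needs only the subgroup \<open>H\<close>, on which the extension is \<open>\<pi>\<close>
  itself.\<close>

lemma extension_isotypic:
  assumes \<theta>: "\<theta> \<in> A_chars"
  shows "isotypic_rep (extension \<theta>)"
proof -
  let ?i = "char_index \<theta>" and ?\<sigma> = "extension \<theta>"
  note i = char_index(1)[OF \<theta>]
  let ?d = "fst (\<pi> ?i)" and ?p = "snd (\<pi> ?i)"
  have SE: "\<exists>a\<in>A. \<exists>h\<in>H. s = a \<otimes> h" if "s \<in> S" for s using that unfolding S_AH by blast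
  have rep: "is_rep (G\<lparr>carrier := S\<rparr>) ?\<sigma>"
  proof (rule is_repI[OF S_group])
    fix s assume "s \<in> carrier (G\<lparr>carrier := S\<rparr>)"
    then have "s \<in> S" by simp
    then obtain a h where ah: "a \<in> A" "h \<in> H" "s = a \<otimes> h" using SE by blast
    then show "snd ?\<sigma> s \<in> carrier_mat (fst ?\<sigma>) (fst ?\<sigma>)"
      using smult_carrier_mat[OF mult_carrier_mat[OF U_carrier[OF i ah(1)] p_carrier[OF i ah(2)]]]
      by (simp add: extension_eq[OF \<theta>] extension_deg)
  next
    fix s t assume "s \<in> carrier (G\<lparr>carrier := S\<rparr>)" "t \<in> carrier (G\<lparr>carrier := S\<rparr>)"
    then have "s \<in> S" "t \<in> S" by simp_all
    then obtain a h b k where ah: "a \<in> A" "h \<in> H" "s = a \<otimes> h" and bk: "b \<in> A" "k \<in> H" "t = b \<otimes> k"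
      using SE by meson
    let ?h = "inv b \<otimes> h \<otimes> b"
    have h': "?h \<in> H" using H_norm bk ah by simp
    note c = U_carrier[OF i ah(1)] U_carrier[OF i bk(1)] p_carrier[OF i ah(2)] p_carrier[OF i bk(2)] p_carrier[OF i h']
    have st: "s \<otimes> t = (a \<otimes> b) \<otimes> (?h \<otimes> k)" using ah bk by (simp add: m_assoc)
    have "snd ?\<sigma> (s \<otimes> t) = (\<theta> a * \<theta> b) \<cdot>\<^sub>m (U ?i a * U ?i b * (?p ?h * ?p k))"
      unfolding st using ah bk h' extension_eq[OF \<theta>, of "a \<otimes> b" "?h \<otimes> k"]
      by (simp add: A_charsD(1)[OF \<theta>] U_mult[OF i] p_mult[OF i])
    also have "U ?i a * U ?i b * (?p ?h * ?p k) = U ?i a * (U ?i b * ?p ?h) * ?p k"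
      using c by (simp add: assoc_mult_mat[of _ ?d ?d _ ?d _ ?d])
    also have "\<dots> = U ?i a * ?p h * (U ?i b * ?p k)"
      unfolding p_U[OF i bk(1) ah(2)] using c by (simp add: assoc_mult_mat[of _ ?d ?d _ ?d _ ?d])
    also have "(\<theta> a * \<theta> b) \<cdot>\<^sub>m \<dots> = snd ?\<sigma> s * snd ?\<sigma> t"
      unfolding ah(3) bk(3) extension_eq[OF \<theta> ah(1,2)] extension_eq[OF \<theta> bk(1,2)]
      using c by (simp add: mult_smult_distrib[of _ ?d ?d _ ?d] mult_smult_assoc_mat[of _ ?d ?d _ ?d] smult_smult_mat mult.commute)
    finally show "snd ?\<sigma> (s \<otimes>\<^bsub>G\<lparr>carrier := S\<rparr>\<^esub> t) = snd ?\<sigma> s * snd ?\<sigma> t" by simp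
  next
    show "snd ?\<sigma> \<one>\<^bsub>G\<lparr>carrier := S\<rparr>\<^esub> = 1\<^sub>m (fst ?\<sigma>)"
      using extension_H[OF \<theta> H_one] p_one[OF i] by (simp add: extension_deg)
  qed
  have "irreducible_rep (G\<lparr>carrier := S\<rparr>) ?\<sigma>"
    unfolding irreducible_rep_def
  proof (intro conjI allI impI)
    show "fst ?\<sigma> \<noteq> 0" using d_pos[OF i] by (simp add: extension_deg)
    fix W assume W: "VectorSpace.subspace class_ring W (module_vec TYPE(complex) (fst ?\<sigma>))"
      "\<forall>g\<in>carrier (G\<lparr>carrier := S\<rparr>). \<forall>w\<in>W. snd ?\<sigma> g *\<^sub>v w \<in> W"
    have "\<forall>g\<in>carrier (G\<lparr>carrier := H\<rparr>). \<forall>w\<in>W. ?p g *\<^sub>v w \<in> W"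
      using W(2) H_S by (auto simp: extension_H[OF \<theta>, symmetric])
    then show "W = {0\<^sub>v (fst ?\<sigma>)} \<or> W = carrier_vec (fst ?\<sigma>)"
      using W(1) \<pi>_irr[OF i] unfolding irreducible_rep_def extension_deg by blast
  qed (rule rep)
  moreover have "snd ?\<sigma> n = \<psi> n \<cdot>\<^sub>m 1\<^sub>m (fst ?\<sigma>)" if n: "n \<in> N" for n
    using extension_H[OF \<theta>, of n] p_Z[OF i, of n] \<chi>_N[OF i n] NZ n by (auto simp: extension_deg)
  ultimately show ?thesis by (simp add: isotypic_rep_def)
qed

text \<open>Comparison on \<open>Z\<close> shows that both characters have the same index, so the
  two extensions share \<open>\<pi>\<close> and U. By Schur's lemma the equivalence is a scalar, and
  comparison on \<open>A\<close> then leaves the characters themselves.\<close>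

lemma extension_inj:
  assumes \<theta>: "\<theta> \<in> A_chars" and \<theta>': "\<theta>' \<in> A_chars"
    and eq: "rep_equiv (G\<lparr>carrier := S\<rparr>) (extension \<theta>) (extension \<theta>')"
  shows "\<theta> = \<theta>'"
proof -
  let ?i = "char_index \<theta>"
  note i = char_index(1)[OF \<theta>] and i' = char_index(1)[OF \<theta>']
  let ?d = "fst (\<pi> ?i)"
  obtain T where dd: "fst (\<pi> (char_index \<theta>')) = ?d" and T: "T \<in> carrier (GLC ?d)"
    and tw: "\<And>s. s \<in> S \<Longrightarrow> T * snd (extension \<theta>) s = snd (extension \<theta>') s * T"
    using eq unfolding rep_equiv_def extension_deg by auto
  have Tc: "T \<in> carrier_mat ?d ?d" using T by (simp add: GLC_simps)
  obtain a b where ab: "a < ?d" "b < ?d" "T $$ (a,b) \<noteq> 0"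
  proof -
    have "\<not> (\<forall>a<?d. \<forall>b<?d. T $$ (a,b) = 0)"
    proof
      assume "\<forall>a<?d. \<forall>b<?d. T $$ (a,b) = 0"
      then have "T = 0\<^sub>m ?d ?d" using Tc by (intro eq_matI) auto
      then have "1\<^sub>m ?d = (0\<^sub>m ?d ?d :: complex mat)" using T by (auto simp: GLC_simps)
      then have "(1\<^sub>m ?d :: complex mat) $$ (0,0) = 0\<^sub>m ?d ?d $$ (0,0)" by simp
      then show False using d_pos[OF i] by simp
    qed
    then show ?thesis using that by blast
  qed
  have cancel: "x = y" if "x \<cdot>\<^sub>m T = y \<cdot>\<^sub>m T" for x y
  proof -
    have "(x \<cdot>\<^sub>m T) $$ (a,b) = (y \<cdot>\<^sub>m T) $$ (a,b)" using that by simp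
    then show ?thesis using ab Tc by simp
  qed
  have ii: "?i = char_index \<theta>'"
  proof (rule \<chi>_inj[OF i i'])
    fix z assume z: "z \<in> Z"
    have "T * snd (\<pi> ?i) z = snd (\<pi> (char_index \<theta>')) z * T"
      using tw[of z] H_S[of z] z extension_H[OF \<theta>, of z] extension_H[OF \<theta>', of z] by simp
    then have "\<chi> ?i z \<cdot>\<^sub>m T = \<chi> (char_index \<theta>') z \<cdot>\<^sub>m T"
      unfolding p_Z[OF i z] p_Z[OF i' z] dd
      using mult_smult_distrib[OF Tc one_carrier_mat] mult_smult_assoc_mat[OF one_carrier_mat Tc] Tc by simp
    then show "\<chi> ?i z = \<chi> (char_index \<theta>') z" by (rule cancel)
  qed
  have "\<exists>c. T = c \<cdot>\<^sub>m 1\<^sub>m ?d"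
  proof (rule schur_scalar[OF \<pi>_irr[OF i] Tc])
    fix h assume "h \<in> carrier (G\<lparr>carrier := H\<rparr>)"
    then show "T * snd (\<pi> ?i) h = snd (\<pi> ?i) h * T"
      using tw[of h] H_S[of h] extension_H[OF \<theta>, of h] extension_H[OF \<theta>', of h] ii by simp
  qed
  then obtain c where c: "T = c \<cdot>\<^sub>m 1\<^sub>m ?d" by blast
  have c0: "c \<noteq> 0" using ab c by auto
  show ?thesis
  proof (rule extensionalityI[OF A_charsD(4)[OF \<theta>] A_charsD(4)[OF \<theta>']])
    fix x assume x: "x \<in> A"
    note Ux = U_carrier[OF i x]
    obtain e f where ef: "e < ?d" "f < ?d" "U ?i x $$ (e,f) \<noteq> 0"
    proof -
      have "\<not> (\<forall>a<?d. \<forall>b<?d. U ?i x $$ (a,b) = 0)"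
      proof
        assume "\<forall>a<?d. \<forall>b<?d. U ?i x $$ (a,b) = 0"
        then have "U ?i x = 0\<^sub>m ?d ?d" using Ux by (intro eq_matI) auto
        then have "1\<^sub>m ?d = (0\<^sub>m ?d ?d :: complex mat)"
          using U_inv(1)[OF i x] U_carrier[OF i, of "inv x"] x by simp
        then have "(1\<^sub>m ?d :: complex mat) $$ (0,0) = 0\<^sub>m ?d ?d $$ (0,0)" by simp
        then show False using d_pos[OF i] by simp
      qed
      then show ?thesis using that by blast
    qed
    have Uc: "U ?i x * (c \<cdot>\<^sub>m 1\<^sub>m ?d) = c \<cdot>\<^sub>m U ?i x" "(c \<cdot>\<^sub>m 1\<^sub>m ?d) * U ?i x = c \<cdot>\<^sub>m U ?i x"
      using mult_smult_distrib[OF Ux one_carrier_mat] mult_smult_assoc_mat[OF one_carrier_mat Ux] Ux by auto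
    have "T * (\<theta> x \<cdot>\<^sub>m U ?i x) = (\<theta>' x \<cdot>\<^sub>m U ?i x) * T"
      using tw[OF A_S[OF x]] extension_A[OF \<theta> x] extension_A[OF \<theta>' x] ii by simp
    then have "\<theta> x \<cdot>\<^sub>m (c \<cdot>\<^sub>m U ?i x) = \<theta>' x \<cdot>\<^sub>m (c \<cdot>\<^sub>m U ?i x)"
      using mult_smult_distrib[OF Tc Ux] mult_smult_assoc_mat[OF Ux Tc] Uc unfolding c by simp
    then have "(\<theta> x \<cdot>\<^sub>m (c \<cdot>\<^sub>m U ?i x)) $$ (e,f) = (\<theta>' x \<cdot>\<^sub>m (c \<cdot>\<^sub>m U ?i x)) $$ (e,f)" by simp
    then show "\<theta> x = \<theta>' x" using ef Ux c0 by simp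
  qed
qed

text \<open>The eigenvalues of \<open>A\<close> on an eigen-intertwiner J form the required
  character; since J is nonzero, identities between scalars can be tested after multiplication with
  J.\<close>

lemma extension_surj:
  assumes V: "irreducible_rep G V" and ch: "contains_char N \<psi> V"
  shows "\<exists>\<theta>\<in>A_chars. rep_class G V = Ind_class G S (extension \<theta>)"
proof -
  note Vr = irreducible_is_rep[OF V]
  obtain i w where i: "i \<in> I" and w: "w \<in> carrier_vec (fst V)" "w \<noteq> 0\<^sub>v (fst V)"
    "\<And>z. z \<in> Z \<Longrightarrow> snd V z *\<^sub>v w = \<chi> i z \<cdot>\<^sub>v w" using exists_Z_eigenvector[OF Vr ch] by blast
  let ?d = "fst (\<pi> i)"
  obtain J0 where "J0 \<in> carrier_mat (fst V) ?d" "J0 \<noteq> 0\<^sub>m (fst V) ?d" "\<forall>h\<in>H. snd V h * J0 = J0 * snd (\<pi> i) h"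
    using exists_H_intertwiner[OF i Vr w] by blast
  from exists_A_eigen_intertwiner[OF i Vr this]
  obtain J \<theta>0 where J: "J \<in> carrier_mat (fst V) ?d" "J \<noteq> 0\<^sub>m (fst V) ?d" "\<And>h. h \<in> H \<Longrightarrow> snd V h * J = J * snd (\<pi> i) h"
    "\<And>a. a \<in> A \<Longrightarrow> snd V a * J = \<theta>0 a \<cdot>\<^sub>m (J * U i a)" by blast
  \<comment> \<open>Characters are extensional functions, so the eigenvalue function is cut down to
    \<open>A\<close>.\<close>
  define \<theta> where "\<theta> = restrict \<theta>0 A"
  obtain a b where ab: "a < fst V" "b < ?d" "J $$ (a,b) \<noteq> 0"
  proof -
    have "\<not> (\<forall>a<fst V. \<forall>b<?d. J $$ (a,b) = 0)"
    proof
      assume "\<forall>a<fst V. \<forall>b<?d. J $$ (a,b) = 0"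
      then have "J = 0\<^sub>m (fst V) ?d" using J(1) by (intro eq_matI) auto
      with J(2) show False by simp
    qed
    then show ?thesis using that by blast
  qed
  have cancel: "x = y" if "x \<cdot>\<^sub>m J = y \<cdot>\<^sub>m J" for x y
  proof -
    have "(x \<cdot>\<^sub>m J) $$ (a,b) = (y \<cdot>\<^sub>m J) $$ (a,b)" using that by simp
    then show ?thesis using ab J(1) by simp
  qed
  have Vc: "snd V g \<in> carrier_mat (fst V) (fst V)" if "g \<in> carrier G" for g using is_repD(1)[OF Vr that] .
  have cU: "U i (inv x) \<in> carrier_mat ?d ?d" "U i x \<in> carrier_mat ?d ?d" if "x \<in> A" for x
    using U_carrier[OF i] that by auto
  \<comment> \<open>The eigenvalue equation with U on the left-hand side, which makes the
    composition of the actions of x and y visible in the next step.\<close>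
  have key: "snd V x * J * U i (inv x) = \<theta>0 x \<cdot>\<^sub>m J" if x: "x \<in> A" for x
  proof -
    have "snd V x * J * U i (inv x) = \<theta>0 x \<cdot>\<^sub>m (J * U i x * U i (inv x))"
      unfolding J(4)[OF x] by (rule mult_smult_assoc_mat[OF mult_carrier_mat[OF J(1) cU(2)[OF x]] cU(1)[OF x]])
    also have "J * U i x * U i (inv x) = J"
      using assoc_mult_mat[OF J(1) cU(2)[OF x] cU(1)[OF x]] U_inv(2)[OF i x] J(1) by simp
    finally show ?thesis .
  qed
  have mult: "\<theta>0 (x \<otimes> y) = \<theta>0 x * \<theta>0 y" if x: "x \<in> A" and y: "y \<in> A" for x y
  proof (rule cancel)
    note c = cU[OF x] cU[OF y] Vc[OF A_carrier[OF x]] Vc[OF A_carrier[OF y]] J(1)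
    have yx: "inv (x \<otimes> y) = inv y \<otimes> inv x" using x y by (simp add: inv_mult_group)
    have "\<theta>0 (x \<otimes> y) \<cdot>\<^sub>m J = (snd V x * snd V y) * J * (U i (inv y) * U i (inv x))"
      using key[of "x \<otimes> y"] x y is_repD(2)[OF Vr, of x y] U_mult[OF i, of "inv y" "inv x"] yx by simp
    also have "\<dots> = snd V x * (snd V y * J * U i (inv y)) * U i (inv x)"
      using c by (simp add: assoc_mult_mat[of _ "fst V" "fst V" _ "fst V" _ ?d] assoc_mult_mat[of _ "fst V" "fst V" _ ?d _ ?d]
        assoc_mult_mat[of _ "fst V" ?d _ ?d _ ?d] mult_carrier_mat[of _ "fst V" "fst V" _ ?d] mult_carrier_mat[of _ "fst V" ?d _ ?d]
        mult_carrier_mat[of _ ?d ?d _ ?d])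
    also have "\<dots> = \<theta>0 y \<cdot>\<^sub>m (snd V x * J * U i (inv x))"
      unfolding key[OF y] mult_smult_distrib[OF c(5) J(1)]
      by (rule mult_smult_assoc_mat[OF mult_carrier_mat[OF c(5) J(1)] c(1)])
    also have "\<dots> = (\<theta>0 x * \<theta>0 y) \<cdot>\<^sub>m J" unfolding key[OF x] by (simp add: smult_smult_mat mult.commute)
    finally show "\<theta>0 (x \<otimes> y) \<cdot>\<^sub>m J = (\<theta>0 x * \<theta>0 y) \<cdot>\<^sub>m J" .
  qed
  \<comment> \<open>On A \<inter> H the operator U is trivial, so the eigenvalue is the scalar by
    which \<open>\<pi>\<close> acts. This identifies the index of the new character as i.\<close>
  have onAH: "\<theta>0 x = \<chi> i x" if x: "x \<in> A" "x \<in> H" for x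
  proof (rule cancel)
    have xZ: "x \<in> Z" using AH_Z x by auto
    have "\<theta>0 x \<cdot>\<^sub>m J = snd V x * J" using J(4)[OF x(1)] U_triv[OF i x] J(1) by simp
    also have "\<dots> = \<chi> i x \<cdot>\<^sub>m J"
      unfolding J(3)[OF x(2)] p_Z[OF i xZ] using mult_smult_distrib[OF J(1) one_carrier_mat] J(1) by simp
    finally show "\<theta>0 x \<cdot>\<^sub>m J = \<chi> i x \<cdot>\<^sub>m J" .
  qed
  have onAN: "\<theta>0 x = \<psi> x" if "x \<in> A" "x \<in> N" for x
    using onAH[of x] \<chi>_N[OF i] that by simp
  have nz: "\<theta>0 x \<noteq> 0" if "x \<in> A" for x
    using mult[of x "inv x"] onAN[of \<one>] that by auto
  have inv: "\<exists>y. y * \<theta>0 x = 1 \<and> \<theta>0 x * y = 1" if "x \<in> A" for x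
    using nz[OF that] by (intro exI[of _ "inverse (\<theta>0 x)"]) simp
  have \<theta>: "\<theta> \<in> A_chars"
    unfolding A_chars_def mult_chars_def
    using mult inv onAN by (auto simp: \<theta>_def hom_def units_of_def Units_def)
  have idx: "char_index \<theta> = i"
    by (rule char_index_eqI[OF \<theta> i]) (simp add: \<theta>_def onAH)
  have "Ind_class G S (extension \<theta>) = rep_class G V"
  proof (rule Ind_class_eq_if_intertwiner[OF extension_isotypic[OF \<theta>] V])
    show "J \<in> carrier_mat (fst V) (fst (extension \<theta>))" "J \<noteq> 0\<^sub>m (fst V) (fst (extension \<theta>))"
      using J(1,2) by (simp_all add: extension_deg idx)
    fix s assume "s \<in> S"
    then obtain x h where x: "x \<in> A" and h: "h \<in> H" and s: "s = x \<otimes> h" unfolding S_AH by blast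
    note c = Vc[OF A_carrier[OF x]] Vc[OF H_carrier[OF h]] cU[OF x] p_carrier[OF i h]
    have "snd V s * J = snd V x * (snd V h * J)"
      using is_repD(2)[OF Vr, of x h] x h s assoc_mult_mat[OF c(1,2) J(1)] by simp
    also have "\<dots> = snd V x * J * snd (\<pi> i) h"
      unfolding J(3)[OF h] using assoc_mult_mat[OF c(1) J(1) c(5)] by simp
    also have "\<dots> = \<theta> x \<cdot>\<^sub>m (J * U i x * snd (\<pi> i) h)"
      unfolding J(4)[OF x] using mult_smult_assoc_mat[OF mult_carrier_mat[OF J(1) c(4)] c(5)] x by (simp add: \<theta>_def)
    also have "\<dots> = J * (\<theta> x \<cdot>\<^sub>m (U i x * snd (\<pi> i) h))"
      using assoc_mult_mat[OF J(1) c(4,5)] mult_smult_distrib[OF J(1) mult_carrier_mat[OF c(4,5)]] by simp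
    finally show "snd V s * J = J * snd (extension \<theta>) s"
      unfolding s extension_eq[OF \<theta> x h] idx .
  qed
  then show ?thesis using \<theta> by auto
qed

theorem Ind_extension_bij:
  "bij_betw (\<lambda>\<theta>. Ind_class G S (extension \<theta>)) A_chars (Irr_over G N \<psi>)"
  unfolding bij_betw_def
proof
  show "inj_on (\<lambda>\<theta>. Ind_class G S (extension \<theta>)) A_chars"
    by (rule inj_onI) (blast intro: extension_inj Ind_class_inj extension_isotypic)
  show "(\<lambda>\<theta>. Ind_class G S (extension \<theta>)) ` A_chars = Irr_over G N \<psi>"
  proof
    show "(\<lambda>\<theta>. Ind_class G S (extension \<theta>)) ` A_chars \<subseteq> Irr_over G N \<psi>"
      using Ind_class_in_Irr[OF extension_isotypic] by auto
    show "Irr_over G N \<psi> \<subseteq> (\<lambda>\<theta>. Ind_class G S (extension \<theta>)) ` A_chars"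
      unfolding Irr_over_def using extension_surj by blast
  qed
qed

end

section \<open>Matrices over the ring of integers\<close>

definition mat_ideal :: "('f::field \<Rightarrow> int) \<Rightarrow> nat \<Rightarrow> nat \<Rightarrow> 'f mat set" where
  "mat_ideal v m n = {A \<in> carrier_mat n n. \<forall>i<n. \<forall>j<n. A $$ (i,j) \<in> pow_ideal v m}"

section \<open>Powers of the maximal ideal\<close>

locale prime_element = nonarch_local_field v for v :: "'f::field \<Rightarrow> int" +
  fixes \<omega> :: 'f
  assumes \<omega>_nz [simp]: "\<omega> \<noteq> 0" and v_\<omega> [simp]: "v \<omega> = 1"
begin

lemma v_one [simp]: "v 1 = 0"
  using val_mult[of 1 1] by simp

lemma v_minus_one: "v (-1) = 0"
  using val_mult[of "-1" "-1"] by simp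

lemma v_uminus [simp]: "v (- x) = v x"
  by (cases "x = 0") (use val_mult[of "-1" x] v_minus_one in auto)

lemma v_inverse: "x \<noteq> 0 \<Longrightarrow> v (inverse x) = - v x"
  using val_mult[of x "inverse x"] by simp

lemma v_power: "x \<noteq> 0 \<Longrightarrow> v (x ^ k) = int k * v x"
  by (induction k) (auto simp: val_mult algebra_simps)

lemma v_power_int: "x \<noteq> 0 \<Longrightarrow> v (x powi k) = k * v x"
  by (auto simp: power_int_def v_power v_inverse)

abbreviation \<P> :: "nat \<Rightarrow> 'f set" where "\<P> \<equiv> pow_ideal v"

lemma int_ring_simps [simp]:
  "carrier (int_ring v) = \<P> 0" "mult (int_ring v) = (*)" "one (int_ring v) = 1"
  "zero (int_ring v) = 0" "add (int_ring v) = (+)"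
  by (auto simp: int_ring_def pow_ideal_def)

lemma P_iff: "x \<in> \<P> m \<longleftrightarrow> x = 0 \<or> int m \<le> v x"
  by (simp add: pow_ideal_def)

lemma P_zero [simp]: "0 \<in> \<P> m" and P_one [simp]: "1 \<in> \<P> 0"
  by (auto simp: P_iff)

lemma P_uminus [simp]: "x \<in> \<P> m \<Longrightarrow> - x \<in> \<P> m"
  by (auto simp: P_iff)

lemma P_add [simp]: "x \<in> \<P> m \<Longrightarrow> y \<in> \<P> m \<Longrightarrow> x + y \<in> \<P> m"
  using val_add[of x y] by (cases "x = 0"; cases "y = 0"; cases "x + y = 0") (auto simp: P_iff)

lemma P_diff [simp]: "x \<in> \<P> m \<Longrightarrow> y \<in> \<P> m \<Longrightarrow> x - y \<in> \<P> m"
  using P_add[of x m "- y"] by simp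

lemma P_mult_add: "x \<in> \<P> a \<Longrightarrow> y \<in> \<P> b \<Longrightarrow> x * y \<in> \<P> (a + b)"
  using val_mult[of x y] by (cases "x = 0"; cases "y = 0") (auto simp: P_iff)

lemma P_mult [simp]: "x \<in> \<P> 0 \<Longrightarrow> y \<in> \<P> m \<Longrightarrow> x * y \<in> \<P> m"
  using P_mult_add[of x 0 y m] by simp

lemma P_mult' [simp]: "x \<in> \<P> m \<Longrightarrow> y \<in> \<P> 0 \<Longrightarrow> x * y \<in> \<P> m"
  using P_mult_add[of x m y 0] by simp

lemma P_mono: "m \<le> k \<Longrightarrow> x \<in> \<P> k \<Longrightarrow> x \<in> \<P> m"
  by (auto simp: P_iff)

lemma P_int: "x \<in> \<P> m \<Longrightarrow> x \<in> \<P> 0"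
  using P_mono by blast

lemma \<omega>_P [simp]: "\<omega> ^ m \<in> \<P> m"
  by (auto simp: P_iff v_power)

lemma \<omega>_P1 [simp]: "\<omega> \<in> \<P> 1" "\<omega> \<in> \<P> (Suc 0)"
  by (auto simp: P_iff)

lemma P_sum [simp]: "(\<And>i. i \<in> Y \<Longrightarrow> f i \<in> \<P> m) \<Longrightarrow> sum f Y \<in> \<P> m"
  by (induction Y rule: infinite_finite_induct) auto

lemma P_prod [simp]: "(\<And>i. i \<in> Y \<Longrightarrow> f i \<in> \<P> 0) \<Longrightarrow> prod f Y \<in> \<P> 0"
  by (induction Y rule: infinite_finite_induct) auto

lemma P_power [simp]: "x \<in> \<P> 0 \<Longrightarrow> x ^ k \<in> \<P> 0"
  by (induction k) auto

text \<open>Arguments of \<tau> are traces divided by a power of \<omega>; this converts their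
  integrality into a congruence.\<close>

lemma P_divide_iff: "x / \<omega> ^ k \<in> \<P> m \<longleftrightarrow> x \<in> \<P> (m + k)"
proof (cases "x = 0")
  case False
  then have "v (x / \<omega> ^ k) = v x - int k"
    using val_mult[of x "inverse (\<omega> ^ k)"] v_inverse[of "\<omega> ^ k"] by (simp add: divide_inverse v_power)
  then show ?thesis using False by (auto simp: P_iff)
qed simp

lemma P_eq: "\<P> m = {\<omega> ^ m * y | y. y \<in> \<P> 0}"
proof -
  have "x = \<omega> ^ m * (x / \<omega> ^ m)" for x by simp
  moreover have "x / \<omega> ^ m \<in> \<P> 0" if "x \<in> \<P> m" for x using that by (simp add: P_divide_iff)
  ultimately show ?thesis using P_mult_add[OF \<omega>_P, of _ 0 m] by fastforce
qed

lemma P_inverse: "x \<in> \<P> 0 \<Longrightarrow> x \<notin> \<P> 1 \<Longrightarrow> inverse x \<in> \<P> 0 \<and> v x = 0 \<and> x \<noteq> 0"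
  by (cases "x = 0") (auto simp: P_iff v_inverse)

lemma P_unit_mult: "x \<in> \<P> 0 \<Longrightarrow> x \<notin> \<P> 1 \<Longrightarrow> x * y \<in> \<P> m \<longleftrightarrow> y \<in> \<P> m"
proof
  assume x: "x \<in> \<P> 0" "x \<notin> \<P> 1" and xy: "x * y \<in> \<P> m"
  have "inverse x * (x * y) \<in> \<P> m" by (rule P_mult[OF _ xy]) (use P_inverse[OF x] in blast)
  moreover have "inverse x * (x * y) = y" using P_inverse[OF x] by simp
  ultimately show "y \<in> \<P> m" by (simp only:)
qed simp

lemma P_prime: "x * y \<in> \<P> 1 \<Longrightarrow> x \<in> \<P> 0 \<Longrightarrow> y \<in> \<P> 0 \<Longrightarrow> x \<in> \<P> 1 \<or> y \<in> \<P> 1"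
  using P_unit_mult[of x y 1] by blast

lemma one_notin_P1 [simp]: "1 \<notin> \<P> 1" "1 \<notin> \<P> (Suc 0)"
  by (auto simp: P_iff)

section \<open>Residue rings\<close>

lemma int_ring_cring: "cring (int_ring v)"
proof (rule cringI)
  show "abelian_group (int_ring v)"
    by (rule abelian_groupI) (auto intro: exI[of _ "- _"] bexI[of _ "- _"])
  show "Group.comm_monoid (int_ring v)"
    by (rule comm_monoidI) (auto simp: mult.commute)
qed (auto simp: distrib_right)

lemma P_ideal: "ideal (\<P> m) (int_ring v)"
proof (rule idealI)
  interpret cring "int_ring v" by (rule int_ring_cring)
  show "ring (int_ring v)" by (rule ring_axioms)
  have neg: "\<ominus>\<^bsub>int_ring v\<^esub> x = - x" if "x \<in> \<P> 0" for x
    by (rule minus_equality) (use that in auto)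
  show "subgroup (\<P> m) (add_monoid (int_ring v))"
  proof (rule add.subgroupI)
    fix a assume "a \<in> \<P> m"
    then show "\<ominus>\<^bsub>int_ring v\<^esub> a \<in> \<P> m" using neg[OF P_int] P_uminus[of a m] by simp
  next
    show "\<P> m \<noteq> {}" using P_zero by blast
  qed (auto intro: P_int)
qed auto

lemma red_eq: "red v m a = {x. x - a \<in> \<P> m}"
proof -
  have "x \<in> red v m a \<longleftrightarrow> x - a \<in> \<P> m" for x
    unfolding red_def a_r_coset_def' by (auto intro: bexI[of _ "x - a"])
  then show ?thesis by blast
qed

lemma red_eq_iff: "red v m a = red v m b \<longleftrightarrow> a - b \<in> \<P> m"
proof
  assume "red v m a = red v m b"
  moreover have "a \<in> red v m a" by (simp add: red_eq)
  ultimately have "a \<in> red v m b" by simp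
  then show "a - b \<in> \<P> m" by (simp add: red_eq)
next
  assume ab: "a - b \<in> \<P> m"
  have "x - b \<in> \<P> m" if "x - a \<in> \<P> m" for x
    using P_add[OF that ab] by simp
  moreover have "x - a \<in> \<P> m" if "x - b \<in> \<P> m" for x
    using P_diff[OF that ab] by simp
  ultimately show "red v m a = red v m b" by (auto simp: red_eq)
qed

lemma res_ring_cring: "cring (res_ring v m)"
  unfolding res_ring_def by (rule ideal.quotient_is_cring[OF P_ideal int_ring_cring])

lemma res_ring_carrier: "carrier (res_ring v m) = red v m ` \<P> 0"
  by (auto simp: res_ring_def FactRing_def A_RCOSETS_def' red_def)

lemma red_carrier [simp]: "a \<in> \<P> 0 \<Longrightarrow> red v m a \<in> carrier (res_ring v m)"
  by (simp add: res_ring_carrier)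

lemma red_mult: "a \<in> \<P> 0 \<Longrightarrow> b \<in> \<P> 0 \<Longrightarrow> red v m a \<otimes>\<^bsub>res_ring v m\<^esub> red v m b = red v m (a * b)"
  using ideal.rcoset_mult_add[OF P_ideal, of a b m] by (simp add: res_ring_def FactRing_def red_def)

lemma red_add: "a \<in> \<P> 0 \<Longrightarrow> b \<in> \<P> 0 \<Longrightarrow> red v m a \<oplus>\<^bsub>res_ring v m\<^esub> red v m b = red v m (a + b)"
  using abelian_subgroup.a_rcos_sum[OF abelian_subgroupI3[of "\<P> m" "int_ring v"], of a b]
    ideal.axioms(1)[OF P_ideal] cring.axioms(1)[OF int_ring_cring] ring.is_abelian_group[of "int_ring v"]
  by (simp add: res_ring_def FactRing_def red_def additive_subgroup_def)

lemma red_one: "\<one>\<^bsub>res_ring v m\<^esub> = red v m 1"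
  by (simp add: res_ring_def FactRing_def red_def)

lemma red_zero: "\<zero>\<^bsub>res_ring v m\<^esub> = red v m 0"
proof -
  have "red v m 0 = \<P> m" by (auto simp: red_eq)
  then show ?thesis by (simp add: res_ring_def FactRing_def)
qed

lemma red_sum:
  assumes "finite Y" "\<And>i. i \<in> Y \<Longrightarrow> f i \<in> \<P> 0"
  shows "(\<Oplus>\<^bsub>res_ring v m\<^esub>i\<in>Y. red v m (f i)) = red v m (sum f Y)"
  using assms
proof (induction Y)
  case empty
  interpret cring "res_ring v m" by (rule res_ring_cring)
  show ?case by (simp add: red_zero)
next
  case (insert x Y)
  interpret cring "res_ring v m" by (rule res_ring_cring)
  from insert show ?case by (simp add: finsum_insert Pi_def red_add)
qed

lemma red_coarsen:
  assumes "m \<le> k"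
  shows "red v k a <+>\<^bsub>int_ring v\<^esub> \<P> m = red v m a"
proof -
  have "x \<in> red v k a <+>\<^bsub>int_ring v\<^esub> \<P> m \<longleftrightarrow> x \<in> red v m a" for x
  proof
    assume "x \<in> red v k a <+>\<^bsub>int_ring v\<^esub> \<P> m"
    then obtain y z where "y - a \<in> \<P> k" "z \<in> \<P> m" "x = y + z" by (auto simp: set_add_def' red_eq)
    then show "x \<in> red v m a" using P_add[OF P_mono[OF assms, of "y - a"], of z] by (simp add: red_eq algebra_simps)
  next
    assume "x \<in> red v m a"
    then have "x - a \<in> \<P> m" by (simp add: red_eq)
    moreover have "a \<in> red v k a" by (simp add: red_eq)
    moreover have "x = a + (x - a)" by simp
    ultimately show "x \<in> red v k a <+>\<^bsub>int_ring v\<^esub> \<P> m"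
      unfolding set_add_def' int_ring_simps by blast
  qed
  then show ?thesis by blast
qed

text \<open>Induction on m: subtract from a the chosen representative of its class modulo the
  maximal ideal and divide by \<omega>; the class of a modulo the next power is recovered from that
  first class and the class of the quotient modulo the m-th power.\<close>

lemma finite_red: "finite (red v m ` \<P> 0)"
proof (induction m)
  case 0
  have "red v 0 ` \<P> 0 \<subseteq> {\<P> 0}"
  proof
    fix C assume "C \<in> red v 0 ` \<P> 0"
    then obtain a where "a \<in> \<P> 0" "C = red v 0 a" by blast
    then have "C = red v 0 0" by (simp add: red_eq_iff)
    then show "C \<in> {\<P> 0}" by (auto simp: red_eq)
  qed
  then show ?case using finite_subset by blast
next
  case (Suc m)
  let ?rep = "\<lambda>C. SOME a. a \<in> \<P> 0 \<and> C = red v 1 a"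
  let ?rep' = "\<lambda>C. SOME a. a \<in> \<P> 0 \<and> C = red v m a"
  have "finite (red v 1 ` \<P> 0)" using finite_residue_field by (simp add: res_ring_carrier)
  moreover have "red v (Suc m) ` \<P> 0 \<subseteq>
     (\<lambda>(C, D). red v (Suc m) (?rep C + \<omega> * ?rep' D)) ` ((red v 1 ` \<P> 0) \<times> (red v m ` \<P> 0))"
  proof
    fix E assume "E \<in> red v (Suc m) ` \<P> 0"
    then obtain a where a: "a \<in> \<P> 0" "E = red v (Suc m) a" by blast
    define b where "b = ?rep (red v 1 a)"
    have b: "b \<in> \<P> 0 \<and> red v 1 a = red v 1 b" unfolding b_def by (rule someI[of _ a]) (use a in simp)
    then have "a - b \<in> \<P> 1" by (simp add: red_eq_iff)
    then obtain y where y: "y \<in> \<P> 0" "a - b = \<omega> * y" using P_eq[of 1] by auto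
    define c where "c = ?rep' (red v m y)"
    have c: "c \<in> \<P> 0 \<and> red v m y = red v m c" unfolding c_def by (rule someI[of _ y]) (use y in simp)
    have "a - (b + \<omega> * c) = \<omega> * (y - c)" using y by (simp add: algebra_simps)
    also have "\<dots> \<in> \<P> (Suc m)" using P_mult_add[of \<omega> 1 "y - c" m] c by (simp add: red_eq_iff)
    finally have "E = red v (Suc m) (b + \<omega> * c)" using a by (simp add: red_eq_iff)
    then show "E \<in> (\<lambda>(C, D). red v (Suc m) (?rep C + \<omega> * ?rep' D)) ` ((red v 1 ` \<P> 0) \<times> (red v m ` \<P> 0))"
      using a y unfolding b_def c_def by (intro image_eqI[of _ _ "(red v 1 a, red v m y)"]) auto
  qed
  ultimately show ?case using Suc finite_subset by blast
qed

section \<open>Congruences of matrices\<close>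

abbreviation MP :: "nat \<Rightarrow> nat \<Rightarrow> 'f mat set" where "MP m n \<equiv> mat_ideal v m n"

lemma int_mats_eq [simp]: "carrier (mat_ring (int_ring v) n) = MP 0 n"
  by (simp add: mat_ring_def mat_ideal_def)

lemma MP_carrier: "A \<in> MP m n \<Longrightarrow> A \<in> carrier_mat n n"
  by (simp add: mat_ideal_def)

lemma MP_entry: "A \<in> MP m n \<Longrightarrow> i < n \<Longrightarrow> j < n \<Longrightarrow> A $$ (i,j) \<in> \<P> m"
  by (simp add: mat_ideal_def)

lemma MP_I: "A \<in> carrier_mat n n \<Longrightarrow> (\<And>i j. i < n \<Longrightarrow> j < n \<Longrightarrow> A $$ (i,j) \<in> \<P> m) \<Longrightarrow> A \<in> MP m n"
  by (simp add: mat_ideal_def)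

lemma MP_mono: "m \<le> k \<Longrightarrow> A \<in> MP k n \<Longrightarrow> A \<in> MP m n"
  using P_mono by (auto simp: mat_ideal_def)

lemma MP_int: "A \<in> MP m n \<Longrightarrow> A \<in> MP 0 n"
  using MP_mono[of 0 m] by simp

lemma MP_add [simp]: "A \<in> MP m n \<Longrightarrow> B \<in> MP m n \<Longrightarrow> A + B \<in> MP m n"
  by (auto simp: mat_ideal_def)

lemma MP_uminus [simp]: "A \<in> MP m n \<Longrightarrow> - A \<in> MP m n"
  by (auto simp: mat_ideal_def)

lemma MP_diff [simp]: "A \<in> MP m n \<Longrightarrow> B \<in> MP m n \<Longrightarrow> A - B \<in> MP m n"
  by (auto simp: mat_ideal_def)

lemma MP_mult_add: "A \<in> MP a n \<Longrightarrow> B \<in> MP b n \<Longrightarrow> A * B \<in> MP (a + b) n"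
  by (auto simp: mat_ideal_def scalar_prod_def intro!: P_sum P_mult_add)

lemma MP_mult [simp]: "A \<in> MP 0 n \<Longrightarrow> B \<in> MP m n \<Longrightarrow> A * B \<in> MP m n"
  using MP_mult_add[of A 0 n B m] by simp

lemma MP_mult' [simp]: "A \<in> MP m n \<Longrightarrow> B \<in> MP 0 n \<Longrightarrow> A * B \<in> MP m n"
  using MP_mult_add[of A m n B 0] by simp

lemma MP_smult: "c \<in> \<P> a \<Longrightarrow> A \<in> MP b n \<Longrightarrow> c \<cdot>\<^sub>m A \<in> MP (a + b) n"
  by (auto simp: mat_ideal_def intro!: P_mult_add)

lemma MP_smult0 [simp]: "c \<in> \<P> 0 \<Longrightarrow> A \<in> MP m n \<Longrightarrow> c \<cdot>\<^sub>m A \<in> MP m n"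
  using MP_smult[of c 0 A m n] by simp

lemma MP_smult_\<omega> [simp]: "A \<in> MP 0 n \<Longrightarrow> \<omega> ^ m \<cdot>\<^sub>m A \<in> MP m n"
  using MP_smult[of "\<omega> ^ m" m A 0 n] by simp

lemma MP_one [simp]: "1\<^sub>m n \<in> MP 0 n" and MP_zero [simp]: "0\<^sub>m n n \<in> MP m n"
  by (auto simp: mat_ideal_def)

lemma MP_eq: "A \<in> MP m n \<Longrightarrow> \<exists>Y\<in>MP 0 n. A = \<omega> ^ m \<cdot>\<^sub>m Y"
proof
  assume A: "A \<in> MP m n"
  show "inverse (\<omega> ^ m) \<cdot>\<^sub>m A \<in> MP 0 n"
  proof (rule MP_I)
    fix i j assume ij: "i < n" "j < n"
    have "A $$ (i,j) / \<omega> ^ m \<in> \<P> 0" using MP_entry[OF A ij] by (simp add: P_divide_iff)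
    then show "(inverse (\<omega> ^ m) \<cdot>\<^sub>m A) $$ (i,j) \<in> \<P> 0" using ij MP_carrier[OF A] by (simp add: divide_inverse mult.commute)
  qed (use MP_carrier[OF A] in simp)
  show "A = \<omega> ^ m \<cdot>\<^sub>m (inverse (\<omega> ^ m) \<cdot>\<^sub>m A)" by (simp add: smult_smult_mat smult_one_mat)
qed

lemma MP_smult_\<omega>_iff: "A \<in> carrier_mat n n \<Longrightarrow> \<omega> ^ k \<cdot>\<^sub>m A \<in> MP (m + k) n \<longleftrightarrow> A \<in> MP m n"
proof -
  assume A: "A \<in> carrier_mat n n"
  have "\<omega> ^ k * x \<in> \<P> (m + k) \<longleftrightarrow> x \<in> \<P> m" for x
    using P_divide_iff[of "\<omega> ^ k * x" k m] by simp
  then show ?thesis using A by (simp add: mat_ideal_def)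
qed

lemma mtrace_P: "A \<in> MP m n \<Longrightarrow> mtrace A \<in> \<P> m"
  using MP_carrier[of A m n] by (auto simp: mtrace_def intro!: P_sum MP_entry)

lemma MP_congr_mult:
  assumes "A \<in> MP 0 n" "A' \<in> MP 0 n" "B \<in> MP 0 n" "B' \<in> MP 0 n" "A - A' \<in> MP m n" "B - B' \<in> MP m n"
  shows "A * B - A' * B' \<in> MP m n"
proof -
  have c: "A \<in> carrier_mat n n" "A' \<in> carrier_mat n n" "B \<in> carrier_mat n n" "B' \<in> carrier_mat n n"
    using assms by (auto intro: MP_carrier)
  have e1: "(A - A') * B = A * B - A' * B" by (rule minus_mult_distrib_mat[OF c(1,2,3)])
  have e2: "A' * (B - B') = A' * B - A' * B'" by (rule mult_minus_distrib_mat[OF c(2,3,4)])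
  have "A * B - A' * B' = (A - A') * B + A' * (B - B')"
    unfolding e1 e2 using c by (intro eq_matI) auto
  also have "\<dots> \<in> MP m n" using assms by auto
  finally show ?thesis .
qed

lemma red_mat_eq_iff: "A \<in> carrier_mat n n \<Longrightarrow> B \<in> carrier_mat n n \<Longrightarrow>
    red_mat v m A = red_mat v m B \<longleftrightarrow> A - B \<in> MP m n"
  by (auto simp: mat_ideal_def mat_eq_iff red_eq_iff)

lemma res_mat_carrier: "carrier (mat_ring (res_ring v m) n) = red_mat v m ` MP 0 n"
proof (intro Set.set_eqI iffI)
  fix C assume "C \<in> carrier (mat_ring (res_ring v m) n)"
  then have C: "C \<in> carrier_mat n n" "\<And>i j. i < n \<Longrightarrow> j < n \<Longrightarrow> C $$ (i,j) \<in> red v m ` \<P> 0"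
    by (auto simp: mat_ring_def res_ring_carrier)
  define f where "f C = (SOME a. a \<in> \<P> 0 \<and> C = red v m a)" for C
  have f: "f D \<in> \<P> 0 \<and> D = red v m (f D)" if "D \<in> red v m ` \<P> 0" for D
    unfolding f_def by (rule someI_ex) (use that in blast)
  have "map_mat f C \<in> MP 0 n" using C f by (auto simp: mat_ideal_def)
  moreover have "C = red_mat v m (map_mat f C)" using C f by (intro eq_matI) auto
  ultimately show "C \<in> red_mat v m ` MP 0 n" by blast
qed (auto simp: mat_ring_def mat_ideal_def)

lemma red_mat_mult: "A \<in> MP 0 n \<Longrightarrow> B \<in> MP 0 n \<Longrightarrow>
    red_mat v m A \<otimes>\<^bsub>mat_ring (res_ring v m) n\<^esub> red_mat v m B = red_mat v m (A * B)"
proof (rule eq_matI)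
  assume A: "A \<in> MP 0 n" and B: "B \<in> MP 0 n"
  note c = MP_carrier[OF A] MP_carrier[OF B]
  fix i j assume "i < dim_row (red_mat v m (A * B))" "j < dim_col (red_mat v m (A * B))"
  then have ij: "i < n" "j < n" using c by auto
  interpret cring "res_ring v m" by (rule res_ring_cring)
  have "(red_mat v m A \<otimes>\<^bsub>mat_ring (res_ring v m) n\<^esub> red_mat v m B) $$ (i,j) =
     (\<Oplus>\<^bsub>res_ring v m\<^esub>k\<in>{..<n}. red v m (A $$ (i,k)) \<otimes>\<^bsub>res_ring v m\<^esub> red v m (B $$ (k,j)))"
    using ij c by (simp add: mat_ring_def) (intro finsum_cong'; auto simp: MP_entry[OF A] MP_entry[OF B])
  also have "\<dots> = (\<Oplus>\<^bsub>res_ring v m\<^esub>k\<in>{..<n}. red v m (A $$ (i,k) * B $$ (k,j)))"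
    using ij by (intro finsum_cong') (auto simp: MP_entry[OF A] MP_entry[OF B] red_mult)
  also have "\<dots> = red v m (\<Sum>k<n. A $$ (i,k) * B $$ (k,j))"
    using ij by (intro red_sum) (auto simp: MP_entry[OF A] MP_entry[OF B])
  also have "\<dots> = red_mat v m (A * B) $$ (i,j)"
    using ij c by (simp add: scalar_prod_def atLeast0LessThan)
  finally show "(red_mat v m A \<otimes>\<^bsub>mat_ring (res_ring v m) n\<^esub> red_mat v m B) $$ (i,j) = red_mat v m (A * B) $$ (i,j)" .
qed (auto simp: mat_ring_def mat_ideal_def)

lemma red_mat_add: "A \<in> MP 0 n \<Longrightarrow> B \<in> MP 0 n \<Longrightarrow>
    red_mat v m A \<oplus>\<^bsub>mat_ring (res_ring v m) n\<^esub> red_mat v m B = red_mat v m (A + B)"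
  by (rule eq_matI) (auto simp: mat_ring_def mat_ideal_def red_add)

lemma red_mat_one: "\<one>\<^bsub>mat_ring (res_ring v m) n\<^esub> = red_mat v m (1\<^sub>m n)"
  by (rule eq_matI) (auto simp: mat_ring_def red_one red_zero)

lemma res_mat_monoid: "Group.monoid (mat_ring (res_ring v m) n)"
proof (rule monoidI)
  fix x y assume "x \<in> carrier (mat_ring (res_ring v m) n)" "y \<in> carrier (mat_ring (res_ring v m) n)"
  then show "x \<otimes>\<^bsub>mat_ring (res_ring v m) n\<^esub> y \<in> carrier (mat_ring (res_ring v m) n)"
    unfolding res_mat_carrier by (auto simp: red_mat_mult)
  fix z assume "z \<in> carrier (mat_ring (res_ring v m) n)"
  then show "x \<otimes>\<^bsub>mat_ring (res_ring v m) n\<^esub> y \<otimes>\<^bsub>mat_ring (res_ring v m) n\<^esub> z =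
     x \<otimes>\<^bsub>mat_ring (res_ring v m) n\<^esub> (y \<otimes>\<^bsub>mat_ring (res_ring v m) n\<^esub> z)"
    using \<open>x \<in> _\<close> \<open>y \<in> _\<close> unfolding res_mat_carrier
    by (auto simp: red_mat_mult assoc_mult_mat[OF MP_carrier MP_carrier MP_carrier])
next
  show "\<one>\<^bsub>mat_ring (res_ring v m) n\<^esub> \<in> carrier (mat_ring (res_ring v m) n)"
    by (simp add: red_mat_one res_mat_carrier)
  fix x assume "x \<in> carrier (mat_ring (res_ring v m) n)"
  then obtain A where A: "A \<in> MP 0 n" "x = red_mat v m A" by (auto simp: res_mat_carrier)
  then show "\<one>\<^bsub>mat_ring (res_ring v m) n\<^esub> \<otimes>\<^bsub>mat_ring (res_ring v m) n\<^esub> x = x"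
    "x \<otimes>\<^bsub>mat_ring (res_ring v m) n\<^esub> \<one>\<^bsub>mat_ring (res_ring v m) n\<^esub> = x"
    by (simp_all add: red_mat_one red_mat_mult left_mult_one_mat[OF MP_carrier] right_mult_one_mat[OF MP_carrier])
qed

section \<open>Determinants and invertible integral matrices\<close>

lemma MP_carrier_0 [simp]: "A \<in> MP 0 n \<Longrightarrow> A \<in> carrier_mat n n"
  by (rule MP_carrier)

text \<open>The Leibniz formula uses only sums, products and signs. The closed set is kept arbitrary
  because the lemma is applied both to integral entries and to polynomials with integral
  coefficients.\<close>

lemma det_closed:
  fixes C :: "'b::comm_ring_1 set"
  assumes A: "A \<in> carrier_mat n n" "\<And>i j. i < n \<Longrightarrow> j < n \<Longrightarrow> A $$ (i,j) \<in> C"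
    and C: "0 \<in> C" "1 \<in> C" "\<And>x y. x \<in> C \<Longrightarrow> y \<in> C \<Longrightarrow> x + y \<in> C" "\<And>x y. x \<in> C \<Longrightarrow> y \<in> C \<Longrightarrow> x * y \<in> C"
      "\<And>x. x \<in> C \<Longrightarrow> - x \<in> C"
  shows "det A \<in> C"
proof -
  have s: "sum f Y \<in> C" if "\<And>i. i \<in> Y \<Longrightarrow> f i \<in> C" for f :: "(nat \<Rightarrow> nat) \<Rightarrow> 'b" and Y
    using that by (induction Y rule: infinite_finite_induct) (auto simp: C)
  have p: "prod f Y \<in> C" if "\<And>i. i \<in> Y \<Longrightarrow> f i \<in> C" for f :: "nat \<Rightarrow> 'b" and Y
    using that by (induction Y rule: infinite_finite_induct) (auto simp: C)
  show ?thesis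
    unfolding det_def'[OF A(1)]
  proof (rule s)
    fix q assume q: "q \<in> {q. q permutes {0..<n}}"
    have "(\<Prod>i = 0..<n. A $$ (i, q i)) \<in> C"
      by (rule p) (use q A(2) permutes_in_image[of q "{0..<n}"] in auto)
    then show "signof q * (\<Prod>i = 0..<n. A $$ (i, q i)) \<in> C"
      using C by (auto simp: sign_def)
  qed
qed

lemma det_P: "A \<in> MP 0 n \<Longrightarrow> det A \<in> \<P> 0"
  by (rule det_closed[of A n]) (auto simp: MP_entry)

text \<open>The Leibniz expansions of the two determinants are compared permutation by permutation,
  each product being unchanged modulo the maximal ideal.\<close>

lemma det_one_plus:
  assumes Y: "Y \<in> MP 1 n"
  shows "det (1\<^sub>m n + Y) - 1 \<in> \<P> 1"
proof -
  let ?A = "1\<^sub>m n + Y"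
  have prod1: "prod f I - prod g I \<in> \<P> 1" if "\<And>i. i \<in> I \<Longrightarrow> f i \<in> \<P> 0 \<and> g i \<in> \<P> 0 \<and> f i - g i \<in> \<P> 1" "finite I"
    for f g :: "nat \<Rightarrow> 'f" and I
    using that(2,1)
  proof (induction I)
    case (insert x I)
    have "prod f (insert x I) - prod g (insert x I) = f x * (prod f I - prod g I) + (f x - g x) * prod g I"
      using insert by (simp add: algebra_simps)
    also have "\<dots> \<in> \<P> 1" using insert by (intro P_add P_mult P_mult' P_prod) auto
    finally show ?case .
  qed simp
  have Yc: "Y \<in> carrier_mat n n" using Y by (rule MP_carrier)
  have "det ?A - det (1\<^sub>m n) = (\<Sum>q\<in>{q. q permutes {0..<n}}. signof q * ((\<Prod>i = 0..<n. ?A $$ (i, q i)) - (\<Prod>i = 0..<n. 1\<^sub>m n $$ (i, q i))))"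
    using Yc by (simp add: det_def'[of _ n] sum_subtractf right_diff_distrib del: det_one)
  also have "\<dots> \<in> \<P> 1"
  proof (rule P_sum)
    fix q assume "q \<in> {q. q permutes {0..<n}}"
    then have q: "q i < n" if "i < n" for i using that permutes_in_image[of q "{0..<n}" i] by auto
    have "(\<Prod>i = 0..<n. ?A $$ (i, q i)) - (\<Prod>i = 0..<n. 1\<^sub>m n $$ (i, q i)) \<in> \<P> 1"
    proof (rule prod1)
      fix i assume "i \<in> {0..<n}"
      then have i: "i < n" "q i < n" using q by auto
      then show "?A $$ (i, q i) \<in> \<P> 0 \<and> 1\<^sub>m n $$ (i, q i) \<in> \<P> 0 \<and> ?A $$ (i, q i) - 1\<^sub>m n $$ (i, q i) \<in> \<P> 1"
        using MP_entry[OF Y i] P_int[OF MP_entry[OF Y i]] Yc by auto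
    qed simp
    then show "signof q * ((\<Prod>i = 0..<n. ?A $$ (i, q i)) - (\<Prod>i = 0..<n. 1\<^sub>m n $$ (i, q i))) \<in> \<P> 1"
      using P_uminus by (fastforce simp: sign_def)
  qed
  finally show ?thesis by simp
qed

definition GLO :: "nat \<Rightarrow> 'f mat set" where
  "GLO n = {A \<in> MP 0 n. \<exists>B\<in>MP 0 n. A * B = 1\<^sub>m n \<and> B * A = 1\<^sub>m n}"

lemma GLO_MP: "A \<in> GLO n \<Longrightarrow> A \<in> MP 0 n"
  by (simp add: GLO_def)

text \<open>Cramer's rule: cofactors of an integral matrix are integral, and an integral element
  outside the maximal ideal has an integral inverse.\<close>

lemma GLO_det: "A \<in> GLO n \<longleftrightarrow> A \<in> MP 0 n \<and> det A \<notin> \<P> 1"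
proof
  assume "A \<in> GLO n"
  then obtain B where A: "A \<in> MP 0 n" and B: "B \<in> MP 0 n" "A * B = 1\<^sub>m n" by (auto simp: GLO_def)
  have "det A * det B = 1" using det_mult[OF MP_carrier[OF A] MP_carrier[OF B(1)]] B by simp
  then have "det A \<notin> \<P> 1" using P_mult'[of "det A" 1 "det B"] det_P[OF B(1)] one_notin_P1 by metis
  then show "A \<in> MP 0 n \<and> det A \<notin> \<P> 1" using A by simp
next
  assume A: "A \<in> MP 0 n \<and> det A \<notin> \<P> 1"
  then have d: "inverse (det A) \<in> \<P> 0" "det A \<noteq> 0" using P_inverse[OF det_P] by auto
  note adj = adj_mat[OF MP_carrier[OF conjunct1[OF A]]]
  have "adj_mat A \<in> MP 0 n"
  proof (rule MP_I)
    show "adj_mat A \<in> carrier_mat n n" using adj A by simp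
    fix i j assume ij: "i < n" "j < n"
    have "det (mat_delete A j i) \<in> \<P> 0"
    proof (rule det_P[of _ "n - 1"], rule MP_I)
      show "mat_delete A j i \<in> carrier_mat (n - 1) (n - 1)" using A by (intro mat_delete_carrier) simp
      fix a b assume "a < n - 1" "b < n - 1"
      then show "mat_delete A j i $$ (a, b) \<in> \<P> 0"
        using carrier_matD[OF MP_carrier[OF conjunct1[OF A]]]
          by (simp add: mat_delete_def) (auto intro!: MP_entry[OF conjunct1[OF A]])
    qed
    moreover have "(- 1) ^ (j + i) \<in> \<P> 0" by (intro P_power P_uminus) simp
    ultimately show "adj_mat A $$ (i, j) \<in> \<P> 0"
      using ij carrier_matD[OF MP_carrier[OF conjunct1[OF A]]] by (simp add: adj_mat_def cofactor_def)
  qed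
  then have "inverse (det A) \<cdot>\<^sub>m adj_mat A \<in> MP 0 n" using d by simp
  moreover have "A * (inverse (det A) \<cdot>\<^sub>m adj_mat A) = 1\<^sub>m n"
    using adj(2) A d mult_smult_distrib[OF MP_carrier[OF conjunct1[OF A]] adj(1)]
    by (simp add: smult_smult_mat smult_one_mat)
  moreover have "(inverse (det A) \<cdot>\<^sub>m adj_mat A) * A = 1\<^sub>m n"
    using adj(3) A d mult_smult_assoc_mat[OF adj(1) MP_carrier[OF conjunct1[OF A]]]
    by (simp add: smult_smult_mat smult_one_mat)
  ultimately show "A \<in> GLO n" using A by (auto simp: GLO_def)
qed

lemma GLO_one_plus: "Y \<in> MP 1 n \<Longrightarrow> 1\<^sub>m n + Y \<in> GLO n"
  using det_one_plus[of Y n] MP_int[of Y 1 n] P_diff[of "det (1\<^sub>m n + Y)" 1 "det (1\<^sub>m n + Y) - 1"]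
  by (auto simp: GLO_det)

text \<open>Invertibility modulo the maximal ideal lifts, and a one-sided inverse suffices: the
  determinant of the product is a unit, hence so is the first factor of it.\<close>

lemma GLO_of_product:
  assumes "A \<in> MP 0 n" "B \<in> MP 0 n" "A * B - 1\<^sub>m n \<in> MP 1 n"
  shows "A \<in> GLO n"
proof -
  note c = MP_carrier[OF assms(1)] MP_carrier[OF assms(2)]
  have "A * B = 1\<^sub>m n + (A * B - 1\<^sub>m n)" using c by (intro eq_matI) auto
  then have "A * B \<in> GLO n" using GLO_one_plus[OF assms(3)] by simp
  then have "det A * det B \<notin> \<P> 1" using det_mult[OF c] by (simp add: GLO_det)
  then have "det A \<notin> \<P> 1" using P_mult'[of "det A" 1 "det B"] det_P[OF assms(2)] by auto
  then show ?thesis using assms by (simp add: GLO_det)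
qed

definition minv :: "nat \<Rightarrow> 'f mat \<Rightarrow> 'f mat" where
  "minv n A = (SOME B. B \<in> MP 0 n \<and> A * B = 1\<^sub>m n \<and> B * A = 1\<^sub>m n)"

lemma minv:
  assumes "A \<in> GLO n"
  shows "minv n A \<in> MP 0 n" "A * minv n A = 1\<^sub>m n" "minv n A * A = 1\<^sub>m n" "minv n A \<in> GLO n"
proof -
  have "minv n A \<in> MP 0 n \<and> A * minv n A = 1\<^sub>m n \<and> minv n A * A = 1\<^sub>m n"
    unfolding minv_def by (rule someI_ex) (use assms in \<open>auto simp: GLO_def\<close>)
  then show "minv n A \<in> MP 0 n" "A * minv n A = 1\<^sub>m n" "minv n A * A = 1\<^sub>m n" "minv n A \<in> GLO n"
    using assms by (auto simp: GLO_def)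
qed

lemma GLO_mult: "A \<in> GLO n \<Longrightarrow> B \<in> GLO n \<Longrightarrow> A * B \<in> GLO n"
proof -
  assume A: "A \<in> GLO n" and B: "B \<in> GLO n"
  have "det (A * B) = det A * det B"
    using det_mult[of A n B] A B MP_carrier[OF GLO_MP] by blast
  then show ?thesis using A B P_prime[of "det A" "det B"] det_P by (auto simp: GLO_det)
qed

section \<open>General linear groups over residue rings and their congruence subgroups\<close>

lemma GL_res_carrier:
  assumes m: "1 \<le> m"
  shows "carrier (GL_res v n m) = red_mat v m ` GLO n"
proof (intro Set.set_eqI iffI)
  fix g assume "g \<in> carrier (GL_res v n m)"
  then obtain h where gh: "g \<in> carrier (mat_ring (res_ring v m) n)" "h \<in> carrier (mat_ring (res_ring v m) n)"
    "g \<otimes>\<^bsub>mat_ring (res_ring v m) n\<^esub> h = \<one>\<^bsub>mat_ring (res_ring v m) n\<^esub>"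
    by (auto simp: GL_res_def units_of_def Units_def)
  then obtain A B where A: "A \<in> MP 0 n" "g = red_mat v m A" and B: "B \<in> MP 0 n" "h = red_mat v m B"
    by (auto simp: res_mat_carrier)
  have "A * B - 1\<^sub>m n \<in> MP m n"
    using gh(3) A B by (simp add: red_mat_mult red_mat_one red_mat_eq_iff[THEN iffD1, of _ n])
  then show "g \<in> red_mat v m ` GLO n" using GLO_of_product[OF A(1) B(1)] MP_mono[OF m] A by blast
next
  fix g assume "g \<in> red_mat v m ` GLO n"
  then obtain A where A: "A \<in> GLO n" "g = red_mat v m A" by blast
  then show "g \<in> carrier (GL_res v n m)"
    using minv[OF A(1)] GLO_MP[OF A(1)]
    by (auto simp: GL_res_def units_of_def Units_def red_mat_one res_mat_carrier red_mat_mult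
        intro!: bexI[of _ "minv n A"])
qed

lemma GL_res_group: "group (GL_res v n m)"
  unfolding GL_res_def by (rule monoid.units_group[OF res_mat_monoid])

lemma GL_res_simps:
  "A \<in> MP 0 n \<Longrightarrow> B \<in> MP 0 n \<Longrightarrow> red_mat v m A \<otimes>\<^bsub>GL_res v n m\<^esub> red_mat v m B = red_mat v m (A * B)"
  "\<one>\<^bsub>GL_res v n m\<^esub> = red_mat v m (1\<^sub>m n)"
  by (simp_all add: GL_res_def units_of_def red_mat_mult red_mat_one)

lemma GL_res_inv:
  assumes "1 \<le> m" "A \<in> GLO n"
  shows "inv\<^bsub>GL_res v n m\<^esub> (red_mat v m A) = red_mat v m (minv n A)"
proof -
  interpret group "GL_res v n m" by (rule GL_res_group)
  show ?thesis using minv[OF assms(2)] GLO_MP[OF assms(2)] assms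
    by (intro inv_equality) (auto simp: GL_res_simps GL_res_carrier)
qed

lemma GL_res_finite: "finite (carrier (GL_res v n m))"
proof -
  let ?F = "red v m ` \<P> 0"
  have "carrier (GL_res v n m) \<subseteq> carrier (mat_ring (res_ring v m) n)"
    by (auto simp: GL_res_def units_of_def Units_def)
  also have "\<dots> \<subseteq> (\<lambda>f. mat n n f) ` (({..<n} \<times> {..<n}) \<rightarrow>\<^sub>E ?F)"
  proof
    fix C assume "C \<in> carrier (mat_ring (res_ring v m) n)"
    then have C: "C \<in> carrier_mat n n" "\<And>i j. i < n \<Longrightarrow> j < n \<Longrightarrow> C $$ (i,j) \<in> ?F"
      by (auto simp: mat_ring_def res_ring_carrier)
    show "C \<in> (\<lambda>f. mat n n f) ` (({..<n} \<times> {..<n}) \<rightarrow>\<^sub>E ?F)"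
      by (rule image_eqI[of _ _ "\<lambda>ij\<in>{..<n} \<times> {..<n}. C $$ ij"]) (use C in \<open>auto intro!: eq_matI\<close>)
  qed
  finally show ?thesis
    by (rule finite_subset) (intro finite_imageI finite_PiE finite_red finite_cartesian_product finite_lessThan)
qed

lemma coarsen_red_mat: "m \<le> r \<Longrightarrow> map_mat (\<lambda>C. C <+>\<^bsub>int_ring v\<^esub> \<P> m) (red_mat v r A) = red_mat v m A"
  by (intro eq_matI) (auto simp: red_coarsen)

text \<open>For m at least 1 every matrix 1 + \<omega>^m Y with integral Y is invertible, so the
  parameter Y ranges over all integral matrices.\<close>

lemma cong_subgroup_eq:
  assumes m: "1 \<le> m" "m \<le> r"
  shows "cong_subgroup v n r m = {red_mat v r (1\<^sub>m n + \<omega> ^ m \<cdot>\<^sub>m Y) | Y. Y \<in> MP 0 n}"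
proof (intro Set.set_eqI iffI)
  fix g assume g: "g \<in> cong_subgroup v n r m"
  then obtain A where A: "A \<in> GLO n" "g = red_mat v r A"
    using GL_res_carrier[of r n] m by (auto simp: cong_subgroup_def kernel_def)
  note Ac = MP_carrier[OF GLO_MP[OF A(1)]]
  have "A - 1\<^sub>m n \<in> MP m n"
    using g A m Ac by (simp add: cong_subgroup_def kernel_def coarsen_red_mat GL_res_simps red_mat_eq_iff[of _ n])
  then obtain Y where Y: "Y \<in> MP 0 n" "A - 1\<^sub>m n = \<omega> ^ m \<cdot>\<^sub>m Y" using MP_eq by blast
  have "A = 1\<^sub>m n + (A - 1\<^sub>m n)" using Ac by (intro eq_matI) auto
  then have "A = 1\<^sub>m n + \<omega> ^ m \<cdot>\<^sub>m Y" using Y by simp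
  then show "g \<in> {red_mat v r (1\<^sub>m n + \<omega> ^ m \<cdot>\<^sub>m Y) | Y. Y \<in> MP 0 n}" using A Y by blast
next
  fix g assume "g \<in> {red_mat v r (1\<^sub>m n + \<omega> ^ m \<cdot>\<^sub>m Y) | Y. Y \<in> MP 0 n}"
  then obtain Y where Y: "Y \<in> MP 0 n" "g = red_mat v r (1\<^sub>m n + \<omega> ^ m \<cdot>\<^sub>m Y)" by blast
  have "1\<^sub>m n + \<omega> ^ m \<cdot>\<^sub>m Y \<in> GLO n" using MP_mono[OF m(1) MP_smult_\<omega>[OF Y(1)]] by (rule GLO_one_plus)
  moreover have "1\<^sub>m n + \<omega> ^ m \<cdot>\<^sub>m Y - 1\<^sub>m n = \<omega> ^ m \<cdot>\<^sub>m Y" using MP_carrier[OF Y(1)] by (intro eq_matI) auto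
  ultimately show "g \<in> cong_subgroup v n r m"
    using Y m GL_res_carrier[of r n] MP_smult_\<omega>[OF Y(1), of m] MP_carrier[OF Y(1)]
    by (auto simp: cong_subgroup_def kernel_def coarsen_red_mat GL_res_simps red_mat_eq_iff[of _ n])
qed

end

section \<open>Polynomials in a matrix\<close>

abbreviation lc :: "'a::zero poly \<Rightarrow> 'a" where
  "lc q \<equiv> Polynomial.coeff q (Polynomial.degree q)"

lemma poly_mat_carrier [simp]: "poly_mat n q A \<in> carrier_mat n n"
  by (simp add: poly_mat_def)

text \<open>Allowing any bound \<open>N\<close> for the degree lets polynomials of different degrees
  be added termwise.\<close>

lemma poly_mat_index:
  assumes "Polynomial.degree q \<le> N" "i < n" "j < n"
  shows "poly_mat n q A $$ (i,j) = (\<Sum>k\<le>N. Polynomial.coeff q k * (A ^\<^sub>m k) $$ (i,j))"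
proof -
  have "(\<Sum>k\<le>Polynomial.degree q. Polynomial.coeff q k * (A ^\<^sub>m k) $$ (i,j)) =
      (\<Sum>k\<le>N. Polynomial.coeff q k * (A ^\<^sub>m k) $$ (i,j))"
    by (rule sum.mono_neutral_left) (use assms(1) in \<open>auto simp: coeff_eq_0\<close>)
  then show ?thesis using assms by (simp add: poly_mat_def)
qed

lemma poly_mat_add: "poly_mat n (p + q) A = poly_mat n p A + poly_mat n q A"
proof (rule eq_matI)
  fix i j assume "i < dim_row (poly_mat n p A + poly_mat n q A)" "j < dim_col (poly_mat n p A + poly_mat n q A)"
  then have ij: "i < n" "j < n" by (auto simp: poly_mat_def)
  let ?N = "max (Polynomial.degree p) (Polynomial.degree q)"
  have "Polynomial.degree (p + q) \<le> ?N" by (rule degree_add_le_max)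
  then show "poly_mat n (p + q) A $$ (i,j) = (poly_mat n p A + poly_mat n q A) $$ (i,j)"
    using ij poly_mat_index[of "p + q" ?N i n j A] poly_mat_index[of p ?N i n j A] poly_mat_index[of q ?N i n j A]
      carrier_matD[OF poly_mat_carrier[of n q A]]
    by (simp add: sum.distrib algebra_simps)
qed (auto simp: poly_mat_def)

lemma poly_mat_smult: "poly_mat n (Polynomial.smult c q) A = c \<cdot>\<^sub>m poly_mat n q A"
proof (rule eq_matI)
  fix i j assume "i < dim_row (c \<cdot>\<^sub>m poly_mat n q A)" "j < dim_col (c \<cdot>\<^sub>m poly_mat n q A)"
  then have ij: "i < n" "j < n" by (auto simp: poly_mat_def)
  have "Polynomial.degree (Polynomial.smult c q) \<le> Polynomial.degree q" by simp
  then show "poly_mat n (Polynomial.smult c q) A $$ (i,j) = (c \<cdot>\<^sub>m poly_mat n q A) $$ (i,j)"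
    using ij poly_mat_index[of "Polynomial.smult c q" "Polynomial.degree q" i n j A] poly_mat_index[of q "Polynomial.degree q" i n j A]
      carrier_matD[OF poly_mat_carrier[of n q A]]
    by (simp add: sum_distrib_left algebra_simps)
qed (auto simp: poly_mat_def)

lemma poly_mat_0: "poly_mat n 0 A = 0\<^sub>m n n"
  by (rule eq_matI) (auto simp: poly_mat_def)

lemma poly_mat_uminus: "poly_mat n (- q) A = - poly_mat n q A"
proof -
  have "poly_mat n (- q) A = (-1) \<cdot>\<^sub>m poly_mat n q A" using poly_mat_smult[of n "-1" q A] by simp
  also have "\<dots> = - poly_mat n q A" by (rule eq_matI) auto
  finally show ?thesis .
qed

lemma poly_mat_diff: "poly_mat n (p - q) A = poly_mat n p A - poly_mat n q A"
proof -
  have "poly_mat n (p - q) A = poly_mat n p A + - poly_mat n q A"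
    using poly_mat_add[of n p "- q" A] by (simp add: poly_mat_uminus)
  also have "\<dots> = poly_mat n p A - poly_mat n q A"
    using poly_mat_carrier[of n q A] by (intro eq_matI) auto
  finally show ?thesis .
qed

text \<open>The Horner recursion; with it, facts about evaluation follow by induction on the
  polynomial rather than from double sums.\<close>

lemma poly_mat_pCons:
  assumes A: "A \<in> carrier_mat n n"
  shows "poly_mat n (pCons a q) A = a \<cdot>\<^sub>m 1\<^sub>m n + poly_mat n q A * A"
proof (rule eq_matI)
  fix i j assume "i < dim_row (a \<cdot>\<^sub>m 1\<^sub>m n + poly_mat n q A * A)" "j < dim_col (a \<cdot>\<^sub>m 1\<^sub>m n + poly_mat n q A * A)"
  then have ij: "i < n" "j < n" using A by (auto simp: poly_mat_def)
  let ?N = "Polynomial.degree q"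
  have Ak: "A ^\<^sub>m k \<in> carrier_mat n n" for k using A by simp
  have "poly_mat n (pCons a q) A $$ (i,j) = (\<Sum>k\<le>Suc ?N. Polynomial.coeff (pCons a q) k * (A ^\<^sub>m k) $$ (i,j))"
    using ij by (intro poly_mat_index) (auto simp: degree_pCons_le)
  also have "\<dots> = a * (A ^\<^sub>m 0) $$ (i,j) + (\<Sum>k\<le>?N. Polynomial.coeff q k * (A ^\<^sub>m Suc k) $$ (i,j))"
    by (subst sum.atMost_Suc_shift) simp
  also have "(\<Sum>k\<le>?N. Polynomial.coeff q k * (A ^\<^sub>m Suc k) $$ (i,j)) =
      (\<Sum>k\<le>?N. \<Sum>l<n. Polynomial.coeff q k * (A ^\<^sub>m k) $$ (i,l) * A $$ (l,j))"
    using ij A carrier_matD[OF Ak] by (simp add: scalar_prod_def sum_distrib_left atLeast0LessThan mult.assoc)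
  also have "\<dots> = (\<Sum>l<n. (\<Sum>k\<le>?N. Polynomial.coeff q k * (A ^\<^sub>m k) $$ (i,l)) * A $$ (l,j))"
    by (subst sum.swap) (simp add: sum_distrib_right)
  also have "\<dots> = (\<Sum>l<n. poly_mat n q A $$ (i,l) * A $$ (l,j))"
    using ij poly_mat_index[of q ?N i n _ A] by (intro sum.cong) auto
  also have "\<dots> = (poly_mat n q A * A) $$ (i,j)"
    using ij A carrier_matD[OF poly_mat_carrier[of n q A]] by (simp add: scalar_prod_def atLeast0LessThan)
  finally show "poly_mat n (pCons a q) A $$ (i,j) = (a \<cdot>\<^sub>m 1\<^sub>m n + poly_mat n q A * A) $$ (i,j)"
    using ij A carrier_matD[OF poly_mat_carrier[of n q A]] by simp
qed (use A in \<open>auto simp: poly_mat_def\<close>)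

lemma poly_mat_const: "A \<in> carrier_mat n n \<Longrightarrow> poly_mat n [:c:] A = c \<cdot>\<^sub>m 1\<^sub>m n"
  by (simp add: poly_mat_pCons poly_mat_0)

lemma poly_mat_1: "A \<in> carrier_mat n n \<Longrightarrow> poly_mat n 1 A = 1\<^sub>m n"
  using poly_mat_const[of A n 1] by (simp add: one_pCons[symmetric] smult_one_mat)

lemma poly_mat_X: "A \<in> carrier_mat n n \<Longrightarrow> poly_mat n [:0,1:] A = A"
  by (simp add: poly_mat_pCons poly_mat_0 smult_one_mat) (intro eq_matI, auto)

lemma poly_mat_commute_base:
  assumes A: "A \<in> carrier_mat n n"
  shows "A * poly_mat n q A = poly_mat n q A * A"
proof (induction q)
  case 0
  then show ?case using A by (simp add: poly_mat_0)
next
  case (pCons a q)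
  let ?Q = "poly_mat n q A"
  have "A * (a \<cdot>\<^sub>m 1\<^sub>m n + ?Q * A) = A * (a \<cdot>\<^sub>m 1\<^sub>m n) + A * (?Q * A)"
    by (rule mult_add_distrib_mat[OF A _ mult_carrier_mat[OF poly_mat_carrier A]]) simp
  also have "A * (?Q * A) = ?Q * A * A" using assoc_mult_mat[OF A poly_mat_carrier[of n q A] A] pCons(2) by simp
  also have "A * (a \<cdot>\<^sub>m 1\<^sub>m n) = a \<cdot>\<^sub>m 1\<^sub>m n * A"
    using mult_smult_distrib[OF A one_carrier_mat] mult_smult_assoc_mat[OF one_carrier_mat A] A by simp
  also have "a \<cdot>\<^sub>m 1\<^sub>m n * A + ?Q * A * A = (a \<cdot>\<^sub>m 1\<^sub>m n + ?Q * A) * A"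
    by (rule add_mult_distrib_mat[symmetric, OF _ mult_carrier_mat[OF poly_mat_carrier A]]) (use A in auto)
  finally show ?case by (simp add: poly_mat_pCons[OF A])
qed

lemma poly_mat_mult:
  assumes A: "A \<in> carrier_mat n n"
  shows "poly_mat n (p * q) A = poly_mat n p A * poly_mat n q A"
proof (induction p)
  case 0
  then show ?case using left_mult_zero_mat[OF poly_mat_carrier, of n n q A] by (simp add: poly_mat_0)
next
  case (pCons a p)
  let ?P = "poly_mat n p A" and ?Q = "poly_mat n q A"
  have "poly_mat n (pCons a p * q) A = a \<cdot>\<^sub>m ?Q + (0 \<cdot>\<^sub>m 1\<^sub>m n + ?P * ?Q * A)"
    using pCons by (simp add: poly_mat_add poly_mat_smult poly_mat_pCons[OF A])
  also have "0 \<cdot>\<^sub>m 1\<^sub>m n + ?P * ?Q * A = ?P * ?Q * A"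
    using A carrier_matD[OF poly_mat_carrier[of n p A]] by (intro eq_matI) auto
  also have "?P * ?Q * A = ?P * A * ?Q"
    using assoc_mult_mat[OF poly_mat_carrier poly_mat_carrier A] assoc_mult_mat[OF poly_mat_carrier A poly_mat_carrier]
      poly_mat_commute_base[OF A, of q] by simp
  also have "a \<cdot>\<^sub>m ?Q = a \<cdot>\<^sub>m 1\<^sub>m n * ?Q"
    using mult_smult_assoc_mat[OF one_carrier_mat poly_mat_carrier] left_mult_one_mat[OF poly_mat_carrier] by metis
  also have "a \<cdot>\<^sub>m 1\<^sub>m n * ?Q + ?P * A * ?Q = (a \<cdot>\<^sub>m 1\<^sub>m n + ?P * A) * ?Q"
    by (rule add_mult_distrib_mat[symmetric, OF _ mult_carrier_mat[OF poly_mat_carrier A] poly_mat_carrier]) simp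
  finally show ?case by (simp add: poly_mat_pCons[OF A])
qed

lemma poly_mat_sum_index:
  assumes "i < n" "j < n"
  shows "poly_mat n (sum f Y) A $$ (i,j) = (\<Sum>y\<in>Y. poly_mat n (f y) A $$ (i,j))"
proof (induction Y rule: infinite_finite_induct)
  case (insert x Y)
  then show ?case using assms carrier_matD[OF poly_mat_carrier[of n "sum f Y" A]] by (simp add: poly_mat_add)
qed (use assms in \<open>simp_all add: poly_mat_0\<close>)

text \<open>With \<open>M = char_poly_matrix A\<close> one has \<open>\<Sum>\<^sub>i M\<^sub>i\<^sub>j(A) e\<^sub>i = 0\<close>; multiply by the adjugate of \<open>M\<close>.\<close>

lemma cayley_hamilton:
  fixes A :: "'a::field mat"
  assumes A: "A \<in> carrier_mat n n"
  shows "poly_mat n (char_poly A) A = 0\<^sub>m n n"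
proof (rule eq_matI)
  fix a k assume "a < dim_row (0\<^sub>m n n :: 'a mat)" "k < dim_col (0\<^sub>m n n :: 'a mat)"
  then have a: "a < n" and k: "k < n" by auto
  let ?M = "char_poly_matrix A"
  let ?Adj = "adj_mat ?M"
  have M: "?M \<in> carrier_mat n n" using A by simp
  note adj = adj_mat[OF M]
  have Mij: "?M $$ (i,j) = (if i = j then [:0,1:] else 0) - [: A $$ (i,j) :]" if "i < n" "j < n" for i j
    using that A by (auto simp: char_poly_matrix_def)
  have MA: "poly_mat n (?M $$ (i,j)) A $$ (b,i) = (if i = j then A $$ (b,i) else 0) - (if b = i then A $$ (i,j) else 0)"
    if "i < n" "j < n" "b < n" for i j b
  proof -
    have "poly_mat n (if i = j then [:0,1:] else 0) A $$ (b,i) = (if i = j then A $$ (b,i) else 0)"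
      using that A by (simp add: poly_mat_X poly_mat_0)
    then show ?thesis
      using that A unfolding Mij[OF that(1,2)] poly_mat_diff by (simp add: poly_mat_const)
  qed
  have zero: "(\<Sum>i<n. poly_mat n (?M $$ (i,j)) A $$ (b,i)) = 0" if "j < n" "b < n" for j b
    using that by (simp add: MA sum_subtractf)
  \<comment> \<open>\<open>?M * ?Adj\<close> is \<open>char_poly A\<close> times the identity, so in
    the sum over i only i = k survives. Expanding the product instead brings in the vanishing sums
    \<open>zero\<close>.\<close>
  have "poly_mat n (char_poly A) A $$ (a,k) = (\<Sum>i<n. poly_mat n ((?M * ?Adj) $$ (i,k)) A $$ (a,i))"
  proof -
    have "(?M * ?Adj) $$ (i,k) = (if i = k then char_poly A else 0)" if "i < n" for i
      unfolding adj(2) using that k by (simp add: char_poly_def)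
    then have "(\<Sum>i<n. poly_mat n ((?M * ?Adj) $$ (i,k)) A $$ (a,i)) =
       (\<Sum>i<n. if i = k then poly_mat n (char_poly A) A $$ (a,k) else 0)"
      using a by (intro sum.cong) (auto simp: poly_mat_0)
    then show ?thesis using k by simp
  qed
  also have "\<dots> = (\<Sum>i<n. \<Sum>j<n. \<Sum>b<n. poly_mat n (?Adj $$ (j,k)) A $$ (a,b) * poly_mat n (?M $$ (i,j)) A $$ (b,i))"
  proof (rule sum.cong[OF refl])
    fix i assume "i \<in> {..<n}"
    then have i: "i < n" by simp
    have "(?M * ?Adj) $$ (i,k) = (\<Sum>j<n. ?Adj $$ (j,k) * ?M $$ (i,j))"
      using i k M adj(1) by (simp add: scalar_prod_def atLeast0LessThan mult.commute)
    then have "poly_mat n ((?M * ?Adj) $$ (i,k)) A $$ (a,i) =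
       (\<Sum>j<n. (poly_mat n (?Adj $$ (j,k)) A * poly_mat n (?M $$ (i,j)) A) $$ (a,i))"
      using a i by (simp add: poly_mat_sum_index poly_mat_mult[OF A])
    also have "\<dots> = (\<Sum>j<n. \<Sum>b<n. poly_mat n (?Adj $$ (j,k)) A $$ (a,b) * poly_mat n (?M $$ (i,j)) A $$ (b,i))"
      using a i by (intro sum.cong)
        (simp_all add: carrier_matD[OF poly_mat_carrier] scalar_prod_def atLeast0LessThan)
    finally show "poly_mat n ((?M * ?Adj) $$ (i,k)) A $$ (a,i) =
       (\<Sum>j<n. \<Sum>b<n. poly_mat n (?Adj $$ (j,k)) A $$ (a,b) * poly_mat n (?M $$ (i,j)) A $$ (b,i))" .
  qed
  also have "\<dots> = (\<Sum>j<n. \<Sum>i<n. \<Sum>b<n. poly_mat n (?Adj $$ (j,k)) A $$ (a,b) * poly_mat n (?M $$ (i,j)) A $$ (b,i))"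
    by (rule sum.swap)
  also have "\<dots> = (\<Sum>j<n. \<Sum>b<n. poly_mat n (?Adj $$ (j,k)) A $$ (a,b) * (\<Sum>i<n. poly_mat n (?M $$ (i,j)) A $$ (b,i)))"
    unfolding sum_distrib_left by (intro sum.cong refl sum.swap)
  also have "\<dots> = 0" using zero by simp
  finally show "poly_mat n (char_poly A) A $$ (a,k) = 0\<^sub>m n n $$ (a,k)" using a k by simp
qed (auto simp: poly_mat_def)

lemma pow_mat_smult:
  "A \<in> carrier_mat n n \<Longrightarrow> (c \<cdot>\<^sub>m A) ^\<^sub>m k = c ^ k \<cdot>\<^sub>m (A ^\<^sub>m k)" for c :: "'a::comm_ring_1"
proof (induction k)
  case (Suc k)
  have "c ^ k \<cdot>\<^sub>m A ^\<^sub>m k * (c \<cdot>\<^sub>m A) = c \<cdot>\<^sub>m (c ^ k \<cdot>\<^sub>m A ^\<^sub>m k * A)"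
    by (rule mult_smult_distrib) (use Suc(2) in auto)
  also have "c ^ k \<cdot>\<^sub>m A ^\<^sub>m k * A = c ^ k \<cdot>\<^sub>m (A ^\<^sub>m k * A)"
    by (rule mult_smult_assoc_mat) (use Suc(2) in auto)
  finally show ?case using Suc by (simp add: smult_smult_mat)
qed (simp add: smult_one_mat)

section \<open>Integral polynomials and divisibility modulo the maximal ideal\<close>

context prime_element
begin

text \<open>Polynomials over the residue field are handled as integral polynomials up to congruence:
  \<open>polP 0\<close> is integrality and \<open>polP 1\<close> is vanishing modulo the maximal
  ideal.\<close>

definition polP :: "nat \<Rightarrow> 'f poly \<Rightarrow> bool" where
  "polP m q \<longleftrightarrow> (\<forall>i. Polynomial.coeff q i \<in> \<P> m)"

lemma int_poly_iff: "int_poly v q \<longleftrightarrow> polP 0 q"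
  by (simp add: int_poly_def polP_def)

lemma polP_0 [simp]: "polP m 0" and polP_1 [simp]: "polP 0 1"
  by (auto simp: polP_def coeff_pCons one_pCons split: nat.splits)

lemma polP_add: "polP m p \<Longrightarrow> polP m q \<Longrightarrow> polP m (p + q)"
  by (simp add: polP_def)

lemma polP_diff: "polP m p \<Longrightarrow> polP m q \<Longrightarrow> polP m (p - q)"
  by (simp add: polP_def)

lemma polP_uminus: "polP m p \<Longrightarrow> polP m (- p)"
  by (simp add: polP_def)

lemma polP_mult: "polP 0 p \<Longrightarrow> polP m q \<Longrightarrow> polP m (p * q)"
  by (simp add: polP_def coeff_mult)

lemma polP_smult: "c \<in> \<P> 0 \<Longrightarrow> polP m q \<Longrightarrow> polP m (Polynomial.smult c q)"
  by (simp add: polP_def)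

lemma polP_pCons: "polP m (pCons a q) \<longleftrightarrow> a \<in> \<P> m \<and> polP m q"
  unfolding polP_def by (metis coeff_pCons_0 coeff_pCons_Suc not0_implies_Suc)

lemma poly_mat_MP: "A \<in> MP 0 n \<Longrightarrow> polP m q \<Longrightarrow> poly_mat n q A \<in> MP m n"
proof (induction q)
  case (pCons a q)
  have "a \<cdot>\<^sub>m 1\<^sub>m n \<in> MP m n" using MP_smult[of a m "1\<^sub>m n" 0 n] pCons by (simp add: polP_pCons)
  then show ?case using pCons MP_carrier[OF pCons(3)] by (simp add: poly_mat_pCons polP_pCons)
qed (simp add: poly_mat_0)

lemma char_poly_polP: "A \<in> MP 0 n \<Longrightarrow> polP 0 (char_poly A)"
proof -
  assume A: "A \<in> MP 0 n"
  have "det (char_poly_matrix A) \<in> {q. polP 0 q}"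
  proof (rule det_closed[of _ n])
    show "char_poly_matrix A \<in> carrier_mat n n" using A by simp
    fix i j assume ij: "i < n" "j < n"
    have "- A $$ (i,j) \<in> \<P> 0" using MP_entry[OF A ij] by simp
    moreover have "char_poly_matrix A $$ (i,j) = (if i = j then [:0,1:] else 0) + [:- A $$ (i,j):]"
      using ij MP_carrier[OF A] by (auto simp: char_poly_matrix_def)
    ultimately show "char_poly_matrix A $$ (i,j) \<in> {q. polP 0 q}"
      by (auto simp: polP_pCons intro!: polP_add)
  qed (auto intro: polP_add polP_mult polP_uminus)
  then show ?thesis by (simp add: char_poly_def)
qed

text \<open>Long division by a monic polynomial never divides by a coefficient, so it stays
  integral. The induction removes the leading term of the dividend.\<close>

lemma monic_division:
  assumes d: "polP 0 d" "lc d = 1"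
  shows "polP 0 f \<Longrightarrow> \<exists>s t. polP 0 s \<and> polP 0 t \<and> f = d * s + t \<and> (t = 0 \<or> Polynomial.degree t < Polynomial.degree d)"
proof (induction "Polynomial.degree f" arbitrary: f rule: less_induct)
  case less
  show ?case
  proof (cases "f = 0 \<or> Polynomial.degree f < Polynomial.degree d")
    case True
    then show ?thesis using less.prems by (intro exI[of _ 0] exI[of _ f]) auto
  next
    case False
    then have f: "f \<noteq> 0" "Polynomial.degree d \<le> Polynomial.degree f" by auto
    define m where "m = Polynomial.monom (lc f) (Polynomial.degree f - Polynomial.degree d)"
    define g where "g = f - d * m"
    have m: "polP 0 m" using less.prems by (auto simp: m_def polP_def)
    have g: "polP 0 g" unfolding g_def by (intro polP_diff polP_mult less.prems d m)
    have lcf: "lc f \<noteq> 0" using f by simp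
    have m0: "m \<noteq> 0" and dm: "Polynomial.degree m = Polynomial.degree f - Polynomial.degree d"
      unfolding m_def Polynomial.degree_monom_eq[OF lcf] using lcf by simp_all
    have d0: "d \<noteq> 0" using d by auto
    have dd: "Polynomial.degree (d * m) = Polynomial.degree f" using m0 d0 dm f by (simp add: degree_mult_eq)
    have lceq: "lc (d * m) = lc f" unfolding lead_coeff_mult dm using d by (simp add: m_def)
    have "g = 0 \<or> Polynomial.degree g < Polynomial.degree f"
    \<comment> \<open>The zero polynomial has degree 0 as well, so cancelling a constant does not
      lower the degree and is treated apart.\<close>
    proof (cases "Polynomial.degree f = 0")
      case True
      then have "f = [:lc f:]" "d * m = [:lc (d * m):]" using dd by (auto elim!: degree_eq_zeroE)
      then have "g = 0" using lceq by (simp add: g_def)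
      then show ?thesis by simp
    next
      case False
      have "Polynomial.degree g \<le> Polynomial.degree f" unfolding g_def using dd by (intro degree_diff_le) auto
      moreover have "Polynomial.coeff g (Polynomial.degree f) = 0" using lceq dd by (simp add: g_def)
      ultimately have "Polynomial.degree g < Polynomial.degree f \<or> g = 0"
        by (metis le_neq_implies_less leading_coeff_0_iff)
      then show ?thesis by blast
    qed
    moreover have ?thesis if "g = 0"
      using that m by (intro exI[of _ m] exI[of _ 0]) (simp add: g_def)
    moreover have ?thesis if "Polynomial.degree g < Polynomial.degree f"
    proof -
      from less.hyps[OF that g] obtain s t where st: "polP 0 s" "polP 0 t" "g = d * s + t"
        "t = 0 \<or> Polynomial.degree t < Polynomial.degree d" by blast
      have "f = d * (s + m) + t" using st(3) by (simp add: g_def algebra_simps)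
      then show ?thesis using st m by (intro exI[of _ "s + m"] exI[of _ t]) (auto intro: polP_add)
    qed
    ultimately show ?thesis by blast
  qed
qed

text \<open>Drop all terms above the highest coefficient that is a unit, and divide by that
  coefficient. The class modulo the maximal ideal changes only by a unit factor, and the result is
  monic over O itself, so that \<open>monic_division\<close> applies to it.\<close>

lemma normalize_mod:
  assumes f: "polP 0 f" "\<not> polP 1 f"
  shows "\<exists>u g. u \<in> \<P> 0 \<and> polP 0 g \<and> lc g = 1 \<and> Polynomial.degree g \<le> Polynomial.degree f \<and>
    polP 1 (g - Polynomial.smult u f)"
proof -
  let ?K = "{k. Polynomial.coeff f k \<notin> \<P> 1}"
  have K: "?K \<subseteq> {..Polynomial.degree f}"
  proof
    fix k assume "k \<in> ?K"
    then have "Polynomial.coeff f k \<noteq> 0" using P_zero by fastforce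
    then show "k \<in> {..Polynomial.degree f}" by (simp add: le_degree)
  qed
  then have finK: "finite ?K" by (rule finite_subset) simp
  have neK: "?K \<noteq> {}" using f(2) by (auto simp: polP_def)
  define k where "k = Max ?K"
  have k: "Polynomial.coeff f k \<notin> \<P> 1" using Max_in[OF finK neK] by (simp add: k_def)
  have kmax: "Polynomial.coeff f i \<in> \<P> 1" if "k < i" for i
    using Max_ge[OF finK, of i] that by (auto simp: k_def)
  define u where "u = inverse (Polynomial.coeff f k)"
  have ck: "Polynomial.coeff f k \<in> \<P> 0" using f(1) by (simp add: polP_def)
  have u: "u \<in> \<P> 0" "u * Polynomial.coeff f k = 1" using P_inverse[OF ck k] by (auto simp: u_def)
  define g where "g = Polynomial.smult u (poly_cutoff (Suc k) f)"
  have cg: "Polynomial.coeff g i = (if i \<le> k then u * Polynomial.coeff f i else 0)" for i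
    by (simp add: g_def coeff_poly_cutoff less_Suc_eq_le)
  have "Polynomial.degree g \<le> k" by (rule degree_le) (simp add: cg)
  moreover have "k \<le> Polynomial.degree g" by (rule le_degree) (simp add: cg u)
  ultimately have dg: "Polynomial.degree g = k" by simp
  have "polP 0 g" using f(1) u by (auto simp: polP_def cg)
  moreover have "lc g = 1" by (simp add: dg cg u)
  moreover have "Polynomial.degree g \<le> Polynomial.degree f" using K k dg by auto
  moreover have "polP 1 (g - Polynomial.smult u f)" unfolding polP_def
  proof
    fix i show "Polynomial.coeff (g - Polynomial.smult u f) i \<in> \<P> 1"
      using kmax[of i] u by (auto simp: cg)
  qed
  ultimately show ?thesis using u by blast
qed

lemma res_ring_domain: "domain (res_ring v 1)"
proof (rule domain.intro[OF res_ring_cring], unfold_locales)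
  show "\<one>\<^bsub>res_ring v 1\<^esub> \<noteq> \<zero>\<^bsub>res_ring v 1\<^esub>" by (simp add: red_one red_zero red_eq_iff)
  fix a b assume "a \<otimes>\<^bsub>res_ring v 1\<^esub> b = \<zero>\<^bsub>res_ring v 1\<^esub>" "a \<in> carrier (res_ring v 1)" "b \<in> carrier (res_ring v 1)"
  then obtain x y where "x \<in> \<P> 0" "y \<in> \<P> 0" "a = red v 1 x" "b = red v 1 y" "x * y \<in> \<P> 1"
    by (auto simp: res_ring_carrier red_mult red_zero red_eq_iff)
  then show "a = \<zero>\<^bsub>res_ring v 1\<^esub> \<or> b = \<zero>\<^bsub>res_ring v 1\<^esub>"
    using P_prime[of x y] by (auto simp: red_zero red_eq_iff)
qed

lemma red_poly_coeff:
  "ring.coeff (res_ring v 1) (red_poly v q) i = red v 1 (Polynomial.coeff q i)"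
proof -
  interpret cring "res_ring v 1" by (rule res_ring_cring)
  have len: "length (red_poly v q) = length (Polynomial.coeffs q)" by (simp add: red_poly_def)
  show ?thesis
  proof (cases "i < length (Polynomial.coeffs q)")
    case True
    then have q0: "q \<noteq> 0" by auto
    have "local.coeff (red_poly v q) i = red_poly v q ! (length (Polynomial.coeffs q) - 1 - i)"
      using coeff_nth[of i "red_poly v q"] True len by simp
    also have "\<dots> = red v 1 (Polynomial.coeffs q ! i)"
      using True by (simp add: red_poly_def rev_nth)
    also have "Polynomial.coeffs q ! i = Polynomial.coeff q i"
      using True q0 by (simp add: coeffs_nth length_coeffs_degree)
    finally show ?thesis .
  next
    case False
    then have "Polynomial.coeff q i = 0"
      by (cases "q = 0") (auto simp: length_coeffs_degree coeff_eq_0)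
    then show ?thesis using coeff_length[of "red_poly v q" i] False len by (simp add: red_zero)
  qed
qed

lemma red_poly_polynomial:
  assumes "polP 0 q" "lc q = 1"
  shows "red_poly v q \<in> carrier (univ_poly (res_ring v 1) (carrier (res_ring v 1)))"
    "length (red_poly v q) = Suc (Polynomial.degree q)"
proof -
  have q0: "q \<noteq> 0" using assms by auto
  show "length (red_poly v q) = Suc (Polynomial.degree q)" using q0 by (simp add: red_poly_def length_coeffs_degree)
  have "set (red_poly v q) \<subseteq> carrier (res_ring v 1)"
    using assms(1) by (auto simp: red_poly_def coeffs_def polP_def)
  moreover have "hd (red_poly v q) = red v 1 1"
    using q0 assms(2) last_coeffs_eq_coeff_degree[OF q0] by (simp add: red_poly_def hd_map hd_rev)
  ultimately show "red_poly v q \<in> carrier (univ_poly (res_ring v 1) (carrier (res_ring v 1)))"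
    by (simp add: univ_poly_carrier[symmetric] polynomial_def red_zero red_eq_iff)
qed

text \<open>The bridge to irreducibility over the residue ring. A monic congruence p = d s reduces
  to a factorization of coefficient lists; units of the polynomial ring are lists of length 1,
  whereas monic factors of positive degree have longer ones.\<close>

lemma red_poly_not_irreducible:
  assumes "polP 0 p" "lc p = 1" "polP 0 d" "lc d = 1" "polP 0 s" "lc s = 1"
    and "0 < Polynomial.degree d" "0 < Polynomial.degree s" "polP 1 (p - d * s)"
  shows "\<not> pirreducible\<^bsub>res_ring v 1\<^esub> (carrier (res_ring v 1)) (red_poly v p)"
proof
  let ?R = "res_ring v 1"
  interpret domain ?R by (rule res_ring_domain)
  assume irr: "pirreducible\<^bsub>?R\<^esub> (carrier ?R) (red_poly v p)"
  note c = red_poly_polynomial[OF assms(1,2)] red_poly_polynomial[OF assms(3,4)] red_poly_polynomial[OF assms(5,6)]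
  have sets: "set (red_poly v d) \<subseteq> carrier ?R" "set (red_poly v s) \<subseteq> carrier ?R"
    using c(3,5) unfolding univ_poly_carrier[symmetric] polynomial_def by auto
  have "red_poly v p = poly_mult (red_poly v d) (red_poly v s)"
  proof (rule iffD2[OF coeff_iff_polynomial_cond[of "carrier ?R"]])
    show "polynomial\<^bsub>?R\<^esub> (carrier ?R) (red_poly v p)" using c(1) by (simp add: univ_poly_carrier)
    show "polynomial\<^bsub>?R\<^esub> (carrier ?R) (poly_mult (red_poly v d) (red_poly v s))"
      by (rule poly_mult_is_polynomial[OF carrier_is_subring sets])
    show "local.coeff (red_poly v p) = local.coeff (poly_mult (red_poly v d) (red_poly v s))"
    proof
      fix i
      have "local.coeff (poly_mult (red_poly v d) (red_poly v s)) i =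
        (\<Oplus>\<^bsub>?R\<^esub>k\<in>{..i}. red v 1 (Polynomial.coeff d k) \<otimes>\<^bsub>?R\<^esub> red v 1 (Polynomial.coeff s (i - k)))"
        by (simp only: poly_mult_coeff[OF sets] red_poly_coeff)
      also have "\<dots> = (\<Oplus>\<^bsub>?R\<^esub>k\<in>{..i}. red v 1 (Polynomial.coeff d k * Polynomial.coeff s (i - k)))"
        using assms(3,5) by (intro finsum_cong') (auto simp: polP_def red_mult)
      also have "\<dots> = red v 1 (\<Sum>k\<le>i. Polynomial.coeff d k * Polynomial.coeff s (i - k))"
        using assms(3,5) by (intro red_sum) (auto simp: polP_def)
      also have "\<dots> = red v 1 (Polynomial.coeff (d * s) i)" by (simp add: coeff_mult)
      also have "\<dots> = red v 1 (Polynomial.coeff p i)"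
      proof -
        have "Polynomial.coeff p i - Polynomial.coeff (d * s) i \<in> \<P> 1" using assms(9) by (simp add: polP_def)
        then show ?thesis by (metis red_eq_iff)
      qed
      finally show "local.coeff (red_poly v p) i = local.coeff (poly_mult (red_poly v d) (red_poly v s)) i"
        by (simp only: red_poly_coeff)
    qed
  qed
  then have "red_poly v d \<in> Units (univ_poly ?R (carrier ?R)) \<or> red_poly v s \<in> Units (univ_poly ?R (carrier ?R))"
    using pirreducibleE(3)[OF carrier_is_subring c(1) irr c(3,5)] by (simp add: univ_poly_mult)
  then show False
    using univ_poly_carrier_units_incl c(4,6) assms(7,8) by auto
qed

text \<open>Euclid's argument by congruences: among the monic integral polynomials congruent to a
  combination of q and p choose d of least degree. Modulo the maximal ideal it divides p, and its
  degree is smaller than that of p, so irreducibility leaves d = 1.\<close>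

lemma bezout_mod:
  assumes p: "polP 0 p" "lc p = 1" "pirreducible\<^bsub>res_ring v 1\<^esub> (carrier (res_ring v 1)) (red_poly v p)"
    and q: "polP 0 q" "\<not> polP 1 q" "Polynomial.degree q < Polynomial.degree p"
  shows "\<exists>a b. polP 0 a \<and> polP 0 b \<and> polP 1 (1 - (a * q + b * p))"
proof -
  define J where "J = {d. polP 0 d \<and> lc d = 1 \<and> (\<exists>a b. polP 0 a \<and> polP 0 b \<and> polP 1 (d - (a * q + b * p)))}"
  obtain u g where g: "u \<in> \<P> 0" "polP 0 g" "lc g = 1" "Polynomial.degree g \<le> Polynomial.degree q"
    "polP 1 (g - Polynomial.smult u q)" using normalize_mod[OF q(1,2)] by blast
  have "g \<in> J"
    unfolding J_def using g polP_smult[OF g(1) polP_1] by (intro CollectI conjI exI[of _ "Polynomial.smult u 1"] exI[of _ 0]) auto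
  then obtain d where d: "d \<in> J" "\<And>d'. d' \<in> J \<Longrightarrow> Polynomial.degree d \<le> Polynomial.degree d'"
    using ex_has_least_nat[of "\<lambda>d. d \<in> J" g Polynomial.degree] by blast
  from d(1) obtain a b where dJ: "polP 0 d" "lc d = 1" "polP 0 a" "polP 0 b" "polP 1 (d - (a * q + b * p))"
    by (auto simp: J_def)
  have "Polynomial.degree d < Polynomial.degree p" using d(2)[OF \<open>g \<in> J\<close>] g(4) q(3) by simp
  obtain s t where st: "polP 0 s" "polP 0 t" "p = d * s + t" "t = 0 \<or> Polynomial.degree t < Polynomial.degree d"
    using monic_division[OF dJ(1,2) p(1)] by blast
  \<comment> \<open>A remainder that does not vanish modulo the maximal ideal could be normalized to
    a member of \<open>J\<close> of smaller degree than d.\<close>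
  have t1: "polP 1 t"
  proof (rule ccontr)
    assume "\<not> polP 1 t"
    then obtain w h where h: "w \<in> \<P> 0" "polP 0 h" "lc h = 1" "Polynomial.degree h \<le> Polynomial.degree t"
      "polP 1 (h - Polynomial.smult w t)" using normalize_mod[OF st(2)] by blast
    have t0: "t \<noteq> 0" using \<open>\<not> polP 1 t\<close> by auto
    define a' where "a' = Polynomial.smult w (- (s * a))"
    define b' where "b' = Polynomial.smult w (1 - s * b)"
    have "h - (a' * q + b' * p) = (h - Polynomial.smult w t) + Polynomial.smult w (- (s * (d - (a * q + b * p))))"
      using st(3) by (simp add: a'_def b'_def algebra_simps smult_add_right smult_diff_right)
    moreover have "polP 1 \<dots>" using h st dJ by (intro polP_add polP_smult polP_uminus polP_mult)
    ultimately have hJ: "polP 1 (h - (a' * q + b' * p))" by (simp only:)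
    have "polP 0 a'" "polP 0 b'" unfolding a'_def b'_def using h st dJ
      by (auto intro!: polP_smult polP_uminus polP_mult polP_diff)
    then have "h \<in> J" using h(2,3) hJ unfolding J_def by blast
    then show False using d(2)[of h] h(4) st(4) t0 by simp
  qed
  \<comment> \<open>Otherwise d and the quotient s, which inherits leading coefficient 1, would be a
    proper factorization of p modulo the maximal ideal.\<close>
  have "Polynomial.degree d = 0"
  proof (rule ccontr)
    assume d0: "Polynomial.degree d \<noteq> 0"
    have s0: "s \<noteq> 0" using st(3,4) \<open>Polynomial.degree d < Polynomial.degree p\<close> p(2) by auto
    have dn: "d \<noteq> 0" using dJ by auto
    have ds: "Polynomial.degree (d * s) = Polynomial.degree d + Polynomial.degree s" using s0 dn by (simp add: degree_mult_eq)
    have "Polynomial.degree t < Polynomial.degree (d * s)" using st(4) d0 ds by auto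
    then have pe: "Polynomial.degree p = Polynomial.degree (d * s)" "lc p = lc (d * s)"
      using st(3) by (simp_all add: degree_add_eq_left lead_coeff_add_le coeff_eq_0)
    have ls: "lc s = 1" using pe(2) p(2) dJ(2) by (simp add: lead_coeff_mult)
    have "0 < Polynomial.degree s" using pe(1) ds \<open>Polynomial.degree d < Polynomial.degree p\<close> by simp
    moreover have "polP 1 (p - d * s)" using t1 st(3) by simp
    ultimately show False
      using red_poly_not_irreducible[OF p(1,2) dJ(1,2) st(1) ls] d0 p(3) by simp
  qed
  then have "d = 1" using dJ(2) by (auto elim!: degree_eq_zeroE simp: one_pCons)
  then show ?thesis using dJ by blast
qed

end

section \<open>The order generated by \<open>\<beta>\<close>\<close>

locale unramified = prime_element v \<omega> for v :: "'f::field \<Rightarrow> int" and \<omega> :: 'f +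
  fixes n :: nat and p :: "'f poly" and \<beta> :: "'f mat"
  assumes n_pos: "1 \<le> n"
    and p: "polP 0 p" "lc p = 1" "Polynomial.degree p = n"
    and p_irred: "pirreducible\<^bsub>res_ring v 1\<^esub> (carrier (res_ring v 1)) (red_poly v p)"
    and beta: "\<beta> \<in> MP 0 n"
    and char_beta: "polP 1 (char_poly \<beta> - p)"
begin

lemma beta_carrier: "\<beta> \<in> carrier_mat n n"
  using MP_carrier[OF beta] .

abbreviation ev :: "'f poly \<Rightarrow> 'f mat" where "ev q \<equiv> poly_mat n q \<beta>"

definition Kc :: "'f mat set" where "Kc = range ev"

definition Ob :: "'f mat set" where "Ob = {ev q | q. polP 0 q}"

lemma Ob_Kc: "x \<in> Ob \<Longrightarrow> x \<in> Kc"
  by (auto simp: Ob_def Kc_def)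

lemma ev_Kc [simp]: "ev q \<in> Kc"
  by (simp add: Kc_def)

lemma ev_Ob: "polP 0 q \<Longrightarrow> ev q \<in> Ob"
  by (auto simp: Ob_def)

lemma Kc_carrier: "x \<in> Kc \<Longrightarrow> x \<in> carrier_mat n n"
  by (auto simp: Kc_def)

lemma Ob_carrier: "x \<in> Ob \<Longrightarrow> x \<in> carrier_mat n n"
  using Kc_carrier Ob_Kc by blast

lemma Ob_MP: "x \<in> Ob \<Longrightarrow> x \<in> MP 0 n"
  using poly_mat_MP[OF beta] by (auto simp: Ob_def)

lemma ev_mult: "ev (q * r) = ev q * ev r"
  by (rule poly_mat_mult[OF beta_carrier])

lemma Kc_closed:
  assumes "x \<in> Kc" "y \<in> Kc"
  shows "x + y \<in> Kc" "x * y \<in> Kc" "c \<cdot>\<^sub>m x \<in> Kc" "- x \<in> Kc" "x - y \<in> Kc" "x * y = y * x"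
proof -
  obtain q r where e: "x = ev q" "y = ev r" using assms by (auto simp: Kc_def)
  show "x + y \<in> Kc" "x * y \<in> Kc" "c \<cdot>\<^sub>m x \<in> Kc" "- x \<in> Kc" "x - y \<in> Kc" "x * y = y * x"
    unfolding e poly_mat_add[symmetric] ev_mult[symmetric] poly_mat_smult[symmetric]
      poly_mat_uminus[symmetric] poly_mat_diff[symmetric] by (simp_all add: mult.commute)
qed

lemma Ob_closed:
  assumes "x \<in> Ob" "y \<in> Ob"
  shows "x + y \<in> Ob" "x * y \<in> Ob" "c \<in> \<P> 0 \<Longrightarrow> c \<cdot>\<^sub>m x \<in> Ob" "- x \<in> Ob" "x - y \<in> Ob"
proof -
  obtain q r where e: "x = ev q" "y = ev r" "polP 0 q" "polP 0 r" using assms by (auto simp: Ob_def)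
  show "x + y \<in> Ob" "x * y \<in> Ob" "c \<in> \<P> 0 \<Longrightarrow> c \<cdot>\<^sub>m x \<in> Ob" "- x \<in> Ob" "x - y \<in> Ob"
    unfolding e poly_mat_add[symmetric] ev_mult[symmetric] poly_mat_smult[symmetric]
      poly_mat_uminus[symmetric] poly_mat_diff[symmetric]
    using e(3,4) by (auto intro!: ev_Ob polP_add polP_mult polP_smult polP_uminus polP_diff)
qed

lemma Ob_one: "1\<^sub>m n \<in> Ob"
  using ev_Ob[OF polP_1] poly_mat_1[OF beta_carrier] by simp

lemma Ob_zero: "0\<^sub>m n n \<in> Ob"
  using ev_Ob[OF polP_0] poly_mat_0 by metis

lemma Ob_beta: "\<beta> \<in> Ob"
  using ev_Ob[of "[:0,1:]"] poly_mat_X[OF beta_carrier] by (simp add: polP_pCons)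

lemma Kc_one: "1\<^sub>m n \<in> Kc" and Kc_zero: "0\<^sub>m n n \<in> Kc" and Kc_beta: "\<beta> \<in> Kc"
  using Ob_one Ob_zero Ob_beta Ob_Kc by auto

lemma Ob_poly:
  assumes x: "x \<in> Ob"
  shows "polP 0 g \<Longrightarrow> poly_mat n g x \<in> Ob"
proof (induction g)
  case 0
  then show ?case by (simp add: poly_mat_0 Ob_zero)
next
  case (pCons a g)
  then show ?case
    using Ob_closed(1)[OF Ob_closed(3)[OF Ob_one Ob_one] Ob_closed(2)[OF _ x]]
    by (simp add: polP_pCons poly_mat_pCons[OF Ob_carrier[OF x]])
qed

text \<open>\<beta> is a root of its own characteristic polynomial, and \<open>p\<close> is only
  congruent to that polynomial; hence a congruence is all that can be expected.\<close>

lemma ev_p: "ev p \<in> MP 1 n"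
proof -
  have "ev (char_poly \<beta> - p) = 0\<^sub>m n n - ev p"
    by (simp add: poly_mat_diff cayley_hamilton[OF beta_carrier])
  then have "0\<^sub>m n n - ev p \<in> MP 1 n" using poly_mat_MP[OF beta char_beta] by simp
  then have "- (0\<^sub>m n n - ev p) \<in> MP 1 n" by (rule MP_uminus)
  moreover have "- (0\<^sub>m n n - ev p) = ev p"
    using carrier_matD[OF poly_mat_carrier[of n p \<beta>]] by (intro eq_matI) auto
  ultimately show ?thesis by simp
qed

text \<open>Substitute \<beta> into the Bezout identity. Since p(\<beta>) vanishes modulo the
  maximal ideal, q(\<beta>) has an inverse there, and the inverse lifts.\<close>

lemma primitive_unit:
  assumes q: "polP 0 q" "\<not> polP 1 q" "Polynomial.degree q < n"
  shows "ev q \<in> GLO n"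
proof -
  obtain a b where ab: "polP 0 a" "polP 0 b" "polP 1 (1 - (a * q + b * p))"
    using bezout_mod[OF p(1,2) p_irred q(1,2)] q(3) p(3) by auto
  have "ev (1 - (a * q + b * p)) \<in> MP 1 n" by (rule poly_mat_MP[OF beta ab(3)])
  moreover have "ev b * ev p \<in> MP 1 n" using poly_mat_MP[OF beta ab(2)] ev_p by (rule MP_mult)
  ultimately have "- (ev (1 - (a * q + b * p)) + ev b * ev p) \<in> MP 1 n" by (intro MP_uminus MP_add)
  moreover have "- (ev (1 - (a * q + b * p)) + ev b * ev p) = ev q * ev a - 1\<^sub>m n"
    unfolding ev_mult[symmetric] poly_mat_add[symmetric] poly_mat_uminus[symmetric] poly_mat_1[OF beta_carrier, symmetric]
      poly_mat_diff[symmetric] by (simp add: algebra_simps)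
  ultimately show ?thesis
    using GLO_of_product[of "ev q" n "ev a"] poly_mat_MP[OF beta] q(1) ab(1) by simp
qed

lemma GLO_nonzero: "x \<in> GLO n \<Longrightarrow> x \<notin> MP 1 n"
proof
  assume "x \<in> GLO n" "x \<in> MP 1 n"
  have "x * minv n x \<in> MP 1 n"
    by (rule MP_mult'[OF \<open>x \<in> MP 1 n\<close> minv(1)[OF \<open>x \<in> GLO n\<close>]])
  then have "1\<^sub>m n \<in> MP 1 n" using minv(2)[OF \<open>x \<in> GLO n\<close>] by simp
  then show False using MP_entry[of "1\<^sub>m n" 1 n 0 0] n_pos by simp
qed

lemma smult_power_int:
  "(\<omega> powi a) \<cdot>\<^sub>m ((\<omega> powi b) \<cdot>\<^sub>m x) = (\<omega> powi (a + b)) \<cdot>\<^sub>m x"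
  by (simp add: smult_smult_mat power_int_add)

text \<open>Divide q by \<omega>^k, where k is the least valuation among its nonzero coefficients.
  The quotient is integral with a unit coefficient, and \<open>primitive_unit\<close> turns its
  value at \<beta> into an invertible integral matrix.\<close>

lemma small_poly:
  assumes q: "q \<noteq> 0" "Polynomial.degree q < n"
  shows "\<exists>k x. x \<in> Ob \<and> x \<in> GLO n \<and> ev q = (\<omega> powi k) \<cdot>\<^sub>m x"
proof -
  let ?V = "(\<lambda>i. v (Polynomial.coeff q i)) ` {i. Polynomial.coeff q i \<noteq> 0}"
  have fin: "finite {i. Polynomial.coeff q i \<noteq> 0}"
    by (rule finite_subset[of _ "{..Polynomial.degree q}"]) (auto simp: le_degree)
  have ne: "{i. Polynomial.coeff q i \<noteq> 0} \<noteq> {}" using q(1) by (auto simp: poly_eq_iff)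
  define k where "k = Min ?V"
  have "k \<in> ?V" unfolding k_def using fin ne by (intro Min_in) auto
  then obtain i where i: "Polynomial.coeff q i \<noteq> 0" "v (Polynomial.coeff q i) = k" by auto
  have kle: "k \<le> v (Polynomial.coeff q j)" if "Polynomial.coeff q j \<noteq> 0" for j
    unfolding k_def using fin that by (intro Min_le) auto
  define t where "t = Polynomial.smult (\<omega> powi (- k)) q"
  have vt: "v (Polynomial.coeff t j) = v (Polynomial.coeff q j) - k" if "Polynomial.coeff q j \<noteq> 0" for j
    using that by (simp add: t_def val_mult v_power_int)
  have t: "polP 0 t" unfolding polP_def
  proof
    fix j show "Polynomial.coeff t j \<in> \<P> 0"
    proof (cases "Polynomial.coeff q j = 0")
      case True then show ?thesis by (simp add: t_def)
    next
      case False then show ?thesis using vt[OF False] kle[OF False] by (simp add: P_iff)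
    qed
  qed
  have "Polynomial.coeff t i \<notin> \<P> 1" using i vt[OF i(1)] by (simp add: P_iff t_def)
  then have "\<not> polP 1 t" by (auto simp: polP_def)
  then have "ev t \<in> GLO n" using primitive_unit[OF t] q(2) by (simp add: t_def)
  moreover have "ev q = (\<omega> powi k) \<cdot>\<^sub>m ev t"
    unfolding t_def poly_mat_smult smult_power_int by (simp add: smult_one_mat)
  ultimately show ?thesis using ev_Ob[OF t] by blast
qed

text \<open>Division with remainder by the exact characteristic polynomial of \<beta>, over F and
  without regard to integrality.\<close>

lemma Kc_small: "y \<in> Kc \<Longrightarrow> \<exists>t. y = ev t \<and> (t = 0 \<or> Polynomial.degree t < n)"
proof -
  assume "y \<in> Kc"
  then obtain q where q: "y = ev q" by (auto simp: Kc_def)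
  have d: "Polynomial.degree (char_poly \<beta>) = n" "char_poly \<beta> \<noteq> 0"
    using degree_monic_char_poly[OF beta_carrier] by auto
  have "ev q = ev (q div char_poly \<beta> * char_poly \<beta> + q mod char_poly \<beta>)" by simp
  also have "\<dots> = ev (q div char_poly \<beta>) * 0\<^sub>m n n + ev (q mod char_poly \<beta>)"
    unfolding poly_mat_add ev_mult cayley_hamilton[OF beta_carrier] ..
  also have "\<dots> = ev (q mod char_poly \<beta>)"
    using right_mult_zero_mat[OF poly_mat_carrier[of n "q div char_poly \<beta>" \<beta>], of n]
      left_add_zero_mat[OF poly_mat_carrier[of n "q mod char_poly \<beta>" \<beta>]] by simp
  finally show ?thesis using q degree_mod_less[OF d(2), of q] d(1) by auto
qed

lemma Kc_decomp:
  assumes "y \<in> Kc" "y \<noteq> 0\<^sub>m n n"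
  shows "\<exists>k x. x \<in> Ob \<and> x \<in> GLO n \<and> y = (\<omega> powi k) \<cdot>\<^sub>m x"
proof -
  obtain t where t: "y = ev t" "t = 0 \<or> Polynomial.degree t < n" using Kc_small[OF assms(1)] by blast
  have "t \<noteq> 0" using t(1) assms(2) by (auto simp: poly_mat_0)
  then show ?thesis using small_poly[of t] t by auto
qed

text \<open>A negative exponent in the normal form would make the unit x vanish modulo the maximal
  ideal. This saturation of O[\<beta>] is what allows division by \<omega> without leaving
  it.\<close>

lemma Kc_int:
  assumes "y \<in> Kc" "y \<in> MP 0 n"
  shows "y \<in> Ob"
proof (cases "y = 0\<^sub>m n n")
  case True then show ?thesis by (simp add: Ob_zero)
next
  case False
  then obtain k x where x: "x \<in> Ob" "x \<in> GLO n" "y = (\<omega> powi k) \<cdot>\<^sub>m x" using Kc_decomp[OF assms(1)] by blast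
  have "0 \<le> k"
  proof (rule ccontr)
    assume k: "\<not> 0 \<le> k"
    have "x = (\<omega> powi (- k)) \<cdot>\<^sub>m y" unfolding x(3) smult_power_int by (simp add: smult_one_mat)
    moreover have "\<omega> powi (- k) \<in> \<P> 1" using k by (simp add: P_iff v_power_int)
    ultimately have "x \<in> MP 1 n" using MP_smult[of _ 1 y 0 n] assms(2) by simp
    then show False using GLO_nonzero[OF x(2)] by simp
  qed
  then have "\<omega> powi k \<in> \<P> 0" by (simp add: P_iff v_power_int)
  then show ?thesis unfolding x(3) by (rule Ob_closed(3)[OF x(1) x(1)])
qed

text \<open>Split the characteristic polynomial of x as c + t g(t). Cayley-Hamilton gives c + g(x) x
  = 0, and c = det(-x) is a unit of O, so the inverse of x is -g(x)/c.\<close>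

lemma minv_Ob:
  assumes x: "x \<in> Ob" "x \<in> GLO n"
  shows "minv n x \<in> Ob"
proof -
  note xc = Ob_carrier[OF x(1)]
  obtain c g where cg: "char_poly x = pCons c g" by (cases "char_poly x")
  have pol: "c \<in> \<P> 0" "polP 0 g" using char_poly_polP[OF Ob_MP[OF x(1)]] by (simp_all add: cg polP_pCons)
  have "c = poly (char_poly x) 0" by (simp add: cg)
  also have "\<dots> = det (- (char_matrix x 0))" by (rule char_poly_matrix[OF xc])
  also have "- (char_matrix x 0) = - x" using xc by (intro eq_matI) (auto simp: char_matrix_def)
  finally have "c = det (- x)" .
  moreover have "- x \<in> GLO n"
  proof -
    have "(- x) * (- minv n x) = 1\<^sub>m n" "(- minv n x) * (- x) = 1\<^sub>m n"
      using minv(2,3)[OF x(2)] carrier_matD[OF xc] carrier_matD[OF MP_carrier[OF minv(1)[OF x(2)]]] by simp_all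
    then show ?thesis using minv[OF x(2)] Ob_MP[OF x(1)] unfolding GLO_def
      by (auto intro!: bexI[of _ "- minv n x"])
  qed
  ultimately have c: "c \<notin> \<P> 1" by (simp add: GLO_det)
  let ?g = "poly_mat n g x"
  have g: "?g \<in> Ob" by (rule Ob_poly[OF x(1) pol(2)])
  note gc = Ob_carrier[OF g]
  have e: "c \<cdot>\<^sub>m 1\<^sub>m n + ?g * x = 0\<^sub>m n n"
    using cayley_hamilton[OF xc] by (simp add: cg poly_mat_pCons[OF xc])
  let ?m = "minv n x"
  note m = minv[OF x(2)] and mc = MP_carrier[OF minv(1)[OF x(2)]]
  have "(c \<cdot>\<^sub>m 1\<^sub>m n + ?g * x) * ?m = c \<cdot>\<^sub>m ?m + ?g"
  proof -
    have "(c \<cdot>\<^sub>m 1\<^sub>m n + ?g * x) * ?m = c \<cdot>\<^sub>m 1\<^sub>m n * ?m + ?g * x * ?m"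
      by (rule add_mult_distrib_mat[OF _ mult_carrier_mat[OF gc xc] mc]) simp
    also have "c \<cdot>\<^sub>m 1\<^sub>m n * ?m = c \<cdot>\<^sub>m ?m"
      using mult_smult_assoc_mat[OF one_carrier_mat mc] left_mult_one_mat[OF mc] by simp
    also have "?g * x * ?m = ?g" using assoc_mult_mat[OF gc xc mc] m(2) right_mult_one_mat[OF gc] by simp
    finally show ?thesis .
  qed
  then have s: "c \<cdot>\<^sub>m ?m + ?g = 0\<^sub>m n n" unfolding e using left_mult_zero_mat[OF mc] by simp
  have "?m = inverse c \<cdot>\<^sub>m (- ?g)"
  proof (rule eq_matI)
    fix i j assume "i < dim_row (inverse c \<cdot>\<^sub>m - ?g)" "j < dim_col (inverse c \<cdot>\<^sub>m - ?g)"
    then have ij: "i < n" "j < n" using gc by auto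
    have "(c \<cdot>\<^sub>m ?m + ?g) $$ (i,j) = 0" unfolding s using ij by simp
    then have "c * ?m $$ (i,j) = - ?g $$ (i,j)" using ij gc mc by (simp add: eq_neg_iff_add_eq_0)
    moreover have "c \<noteq> 0" using c by auto
    ultimately have "?m $$ (i,j) = inverse c * (- ?g $$ (i,j))" by (simp add: field_simps)
    then show "?m $$ (i,j) = (inverse c \<cdot>\<^sub>m - ?g) $$ (i,j)" using ij carrier_matD[OF gc] by simp
  qed (use carrier_matD[OF gc] carrier_matD[OF mc] in simp_all)
  then show ?thesis using Ob_closed(3)[OF Ob_closed(4)[OF g g] g] P_inverse[OF pol(1) c] by simp
qed

lemma Kc_inverse:
  assumes "y \<in> Kc" "y \<noteq> 0\<^sub>m n n"
  shows "\<exists>z\<in>Kc. y * z = 1\<^sub>m n"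
proof -
  obtain k x where x: "x \<in> Ob" "x \<in> GLO n" "y = (\<omega> powi k) \<cdot>\<^sub>m x" using Kc_decomp[OF assms] by blast
  note xc = Ob_carrier[OF x(1)] and mc = MP_carrier[OF minv(1)[OF x(2)]]
  let ?z = "(\<omega> powi (- k)) \<cdot>\<^sub>m minv n x"
  have "y * ?z = (\<omega> powi (- k)) \<cdot>\<^sub>m (y * minv n x)"
    by (rule mult_smult_distrib[OF Kc_carrier[OF assms(1)] mc])
  also have "y * minv n x = (\<omega> powi k) \<cdot>\<^sub>m 1\<^sub>m n"
    unfolding x(3) mult_smult_assoc_mat[OF xc mc] minv(2)[OF x(2)] ..
  finally have "y * ?z = 1\<^sub>m n" unfolding smult_power_int by (simp add: smult_one_mat)
  moreover have "?z \<in> Kc" using minv_Ob[OF x(1,2)] Ob_Kc Kc_closed(3) by blast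
  ultimately show ?thesis by blast
qed

text \<open>A nonzero element of F[\<beta>] is an invertible matrix and cannot have a zero column.
  Equivalently, evaluation at the first basis vector e_0 is injective on F[\<beta>].\<close>

lemma Kc_col0:
  assumes y: "y \<in> Kc" and z: "\<And>a. a < n \<Longrightarrow> y $$ (a,0) = 0"
  shows "y = 0\<^sub>m n n"
proof (rule ccontr)
  assume "y \<noteq> 0\<^sub>m n n"
  then obtain w where w: "w \<in> Kc" "y * w = 1\<^sub>m n" using Kc_inverse[OF y] by blast
  then have "w * y = 1\<^sub>m n" using Kc_closed(6)[OF y w(1)] by simp
  then have "(w * y) $$ (0,0) = 1" using n_pos by simp
  moreover have "(w * y) $$ (0,0) = (\<Sum>a<n. w $$ (0,a) * y $$ (a,0))"
    using Kc_carrier[OF y] Kc_carrier[OF w(1)] n_pos by (simp add: scalar_prod_def atLeast0LessThan)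
  ultimately show False using z by simp
qed

section \<open>Cyclicity of \<open>\<beta>\<close> and its commutant\<close>

definition vpoly :: "(nat \<Rightarrow> 'f) \<Rightarrow> 'f poly" where
  "vpoly c = (\<Sum>i<n. Polynomial.monom (c i) i)"

lemma coeff_vpoly: "Polynomial.coeff (vpoly c) i = (if i < n then c i else 0)"
  by (simp add: vpoly_def coeff_sum if_distrib cong: if_cong)

lemma degree_vpoly: "Polynomial.degree (vpoly c) < n"
proof -
  have "Polynomial.degree (vpoly c) \<le> n - 1" by (rule degree_le) (auto simp: coeff_vpoly)
  then show ?thesis using n_pos by linarith
qed

lemma ev_vpoly_index:
  assumes "a < n" "b < n"
  shows "ev (vpoly c) $$ (a,b) = (\<Sum>i<n. c i * (\<beta> ^\<^sub>m i) $$ (a,b))"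
proof -
  have "ev (vpoly c) $$ (a,b) = (\<Sum>k\<le>n - 1. Polynomial.coeff (vpoly c) k * (\<beta> ^\<^sub>m k) $$ (a,b))"
    using degree_vpoly[of c] assms by (intro poly_mat_index) auto
  also have "{..n - 1} = {..<n}" using n_pos by auto
  finally show ?thesis by (simp add: coeff_vpoly)
qed

lemma ev_vpoly_zero: "ev (vpoly c) = 0\<^sub>m n n \<Longrightarrow> i < n \<Longrightarrow> c i = 0"
proof (rule ccontr)
  assume z: "ev (vpoly c) = 0\<^sub>m n n" and i: "i < n" and "c i \<noteq> 0"
  then have "vpoly c \<noteq> 0" using coeff_vpoly[of c i] by auto
  then obtain k x where x: "x \<in> Ob" "x \<in> GLO n" "ev (vpoly c) = (\<omega> powi k) \<cdot>\<^sub>m x"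
    using small_poly[OF _ degree_vpoly] by blast
  have "x = (\<omega> powi (- k)) \<cdot>\<^sub>m ev (vpoly c)" unfolding x(3) smult_power_int by (simp add: smult_one_mat)
  also have "\<dots> = 0\<^sub>m n n" unfolding z by (intro eq_matI) auto
  finally show False using GLO_nonzero[OF x(2)] by simp
qed

text \<open>\<open>C\<close> has the columns \<open>b\<^sub>i e\<^sub>0\<close>. As \<open>F[\<beta>]\<close> is a field, it acts freely on \<open>F\<^sup>n\<close>.\<close>

lemma column_matrix_det:
  assumes b: "\<And>i. i < n \<Longrightarrow> b i \<in> Kc"
    and ind: "\<And>c i. (\<And>a d. a < n \<Longrightarrow> d < n \<Longrightarrow> (\<Sum>i<n. c i * b i $$ (a,d)) = 0) \<Longrightarrow> i < n \<Longrightarrow> c i = 0"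
  shows "det (mat n n (\<lambda>(a,i). b i $$ (a,0))) \<noteq> 0"
proof
  let ?C = "mat n n (\<lambda>(a,i). b i $$ (a,0))"
  assume "det ?C = 0"
  then obtain w where w: "w \<in> carrier_vec n" "w \<noteq> 0\<^sub>v n" "?C *\<^sub>v w = 0\<^sub>v n"
    using det_0_iff_vec_prod_zero_field[of ?C n] by auto
  have lin: "\<exists>y\<in>Kc. \<forall>a<n. \<forall>d<n. y $$ (a,d) = (\<Sum>i<m. w $ i * b i $$ (a,d))" if "m \<le> n" for m
    using that
  proof (induction m)
    case 0
    then show ?case using Kc_zero by (intro bexI[of _ "0\<^sub>m n n"]) auto
  next
    case (Suc m)
    then obtain y where y: "y \<in> Kc" "\<forall>a<n. \<forall>d<n. y $$ (a,d) = (\<Sum>i<m. w $ i * b i $$ (a,d))" by auto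
    have bm: "b m \<in> Kc" using b Suc by simp
    have "y + w $ m \<cdot>\<^sub>m b m \<in> Kc" using Kc_closed(1)[OF y(1) Kc_closed(3)[OF bm bm]] .
    moreover have "\<forall>a<n. \<forall>d<n. (y + w $ m \<cdot>\<^sub>m b m) $$ (a,d) = (\<Sum>i<Suc m. w $ i * b i $$ (a,d))"
      using y Kc_carrier[OF y(1)] Kc_carrier[OF bm] by simp
    ultimately show ?case by blast
  qed
  then obtain y where y: "y \<in> Kc" "\<And>a d. a < n \<Longrightarrow> d < n \<Longrightarrow> y $$ (a,d) = (\<Sum>i<n. w $ i * b i $$ (a,d))"
    using lin[OF order_refl] by blast
  have "y = 0\<^sub>m n n"
  proof (rule Kc_col0[OF y(1)])
    fix a assume a: "a < n"
    have "(?C *\<^sub>v w) $ a = (\<Sum>i<n. b i $$ (a,0) * w $ i)"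
      using a w(1) by (simp add: scalar_prod_def atLeast0LessThan)
    then show "y $$ (a,0) = 0" using w(3) a n_pos y(2)[of a 0] by (simp add: mult.commute)
  qed
  then have "w $ i = 0" if "i < n" for i
    using ind[of "\<lambda>i. w $ i" i] y(2) that by simp
  then have "w = 0\<^sub>v n" using w(1) by (intro eq_vecI) auto
  with w(2) show False by simp
qed

lemma beta_pow_Kc: "\<beta> ^\<^sub>m i \<in> Kc"
  by (induction i) (use Kc_one beta_carrier Kc_closed(2) Kc_beta in auto)

text \<open>The vectors \<beta>^i e_0 for i < n form a basis of F^n, so e_0 is a cyclic vector; f is
  written in that basis by Cramer's rule.\<close>

lemma cyclic: "\<exists>y\<in>Kc. \<forall>a<n. y $$ (a,0) = f a"
proof -
  let ?C = "mat n n (\<lambda>(a,i). (\<beta> ^\<^sub>m i) $$ (a,0))"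
  have "det ?C \<noteq> 0"
  proof (rule column_matrix_det[OF beta_pow_Kc])
    fix c :: "nat \<Rightarrow> 'f" and i assume z: "\<And>a d. a < n \<Longrightarrow> d < n \<Longrightarrow> (\<Sum>i<n. c i * (\<beta> ^\<^sub>m i) $$ (a,d)) = 0" and i: "i < n"
    have "ev (vpoly c) = 0\<^sub>m n n"
    proof (rule eq_matI)
      fix a d assume "a < dim_row (0\<^sub>m n n :: 'f mat)" "d < dim_col (0\<^sub>m n n :: 'f mat)"
      then show "ev (vpoly c) $$ (a,d) = 0\<^sub>m n n $$ (a,d)" using z by (simp add: ev_vpoly_index)
    qed (simp_all add: poly_mat_def)
    then show "c i = 0" using i by (rule ev_vpoly_zero)
  qed
  then obtain D where D: "D \<in> carrier_mat n n" "?C * D = 1\<^sub>m n"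
    using adj_mat[of ?C n] mult_smult_distrib[of ?C n n "adj_mat ?C" n "inverse (det ?C)"]
    by (intro that[of "inverse (det ?C) \<cdot>\<^sub>m adj_mat ?C"]) (auto simp: smult_smult_mat smult_one_mat)
  define c where "c = D *\<^sub>v vec n f"
  have c: "c \<in> carrier_vec n" using D by (auto simp: c_def)
  have "?C *\<^sub>v c = vec n f"
    unfolding c_def using assoc_mult_mat_vec[of ?C n n D n "vec n f"] D by simp
  moreover have "ev (vpoly (\<lambda>i. c $ i)) $$ (a,0) = (?C *\<^sub>v c) $ a" if "a < n" for a
    using that n_pos c by (simp add: ev_vpoly_index scalar_prod_def atLeast0LessThan mult.commute)
  ultimately show ?thesis by (intro bexI[of _ "ev (vpoly (\<lambda>i. c $ i))"]) auto
qed

text \<open>The vector e_0 is cyclic over O as well. If the exponent in the normal form of y were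
  negative, an integral first column of y would force the first column of the unit x to vanish
  modulo the maximal ideal.\<close>

lemma cyclic_int:
  assumes f: "\<And>a. a < n \<Longrightarrow> f a \<in> \<P> 0"
  shows "\<exists>y\<in>Ob. \<forall>a<n. y $$ (a,0) = f a"
proof -
  obtain y where y: "y \<in> Kc" "\<And>a. a < n \<Longrightarrow> y $$ (a,0) = f a" using cyclic by blast
  have "y \<in> Ob"
  proof (cases "y = 0\<^sub>m n n")
    case True then show ?thesis by (simp add: Ob_zero)
  next
    case False
    then obtain k x where x: "x \<in> Ob" "x \<in> GLO n" "y = (\<omega> powi k) \<cdot>\<^sub>m x" using Kc_decomp[OF y(1)] by blast
    have xc: "x \<in> carrier_mat n n" using Ob_carrier[OF x(1)] .
    have "0 \<le> k"
    proof (rule ccontr)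
      assume k: "\<not> 0 \<le> k"
      have xa: "x $$ (a,0) \<in> \<P> 1" if "a < n" for a
      proof -
        have "x = (\<omega> powi (- k)) \<cdot>\<^sub>m y" unfolding x(3) smult_power_int by (simp add: smult_one_mat)
        then have "x $$ (a,0) = \<omega> powi (- k) * f a" using that n_pos y(2) Kc_carrier[OF y(1)] by simp
        moreover have "\<omega> powi (- k) \<in> \<P> 1" using k by (simp add: P_iff v_power_int)
        ultimately show ?thesis using f[OF that] by simp
      qed
      have "(minv n x * x) $$ (0,0) = (\<Sum>a<n. minv n x $$ (0,a) * x $$ (a,0))"
        using xc MP_carrier[OF minv(1)[OF x(2)]] n_pos by (simp add: scalar_prod_def atLeast0LessThan)
      also have "\<dots> \<in> \<P> 1" using xa MP_entry[OF minv(1)[OF x(2)], of 0] n_pos by (intro P_sum P_mult) auto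
      finally show False using minv(3)[OF x(2)] n_pos by simp
    qed
    then have "\<omega> powi k \<in> \<P> 0" by (simp add: P_iff v_power_int)
    then show ?thesis unfolding x(3) by (rule Ob_closed(3)[OF x(1) x(1)])
  qed
  then show ?thesis using y by blast
qed

text \<open>Subtract the element x of O[\<beta>] with the same first column as M. The difference D
  kills e_0 and still commutes with O[\<beta>] modulo the m-th power, so it kills y e_0 modulo that
  power for every y in O[\<beta>]; by \<open>cyclic_int\<close> these vectors fill O^n.\<close>

lemma commutant:
  assumes X: "M \<in> MP 0 n" "M * \<beta> - \<beta> * M \<in> MP m n"
  shows "\<exists>x\<in>Ob. M - x \<in> MP m n"
proof -
  obtain x where x: "x \<in> Ob" "\<And>a. a < n \<Longrightarrow> x $$ (a,0) = M $$ (a,0)"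
    using cyclic_int[of "\<lambda>a. M $$ (a,0)"] MP_entry[OF X(1)] n_pos by auto
  define D where "D = M - x"
  have D: "D \<in> MP 0 n" using X Ob_MP[OF x(1)] by (simp add: D_def)
  note c = MP_carrier[OF D] MP_carrier[OF X(1)] Ob_carrier[OF x(1)] beta_carrier
  have D\<beta>: "D * \<beta> - \<beta> * D \<in> MP m n"
  proof -
    have "D * \<beta> - \<beta> * D = (M * \<beta> - x * \<beta>) - (\<beta> * M - \<beta> * x)"
      unfolding D_def minus_mult_distrib_mat[OF c(2,3,4)] mult_minus_distrib_mat[OF c(4,2,3)] ..
    also have "\<dots> = M * \<beta> - \<beta> * M"
      unfolding Kc_closed(6)[OF Ob_Kc[OF x(1)] Kc_beta] using c by (intro eq_matI) auto
    finally show ?thesis using X(2) by simp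
  qed
  \<comment> \<open>Commutation with \<beta> propagates to all integral polynomials in \<beta> along
    the Horner recursion.\<close>
  have Dq: "polP 0 q \<Longrightarrow> D * ev q - ev q * D \<in> MP m n" for q
  proof (induction q)
    case 0
    have "D * 0\<^sub>m n n - 0\<^sub>m n n * D = 0\<^sub>m n n" using c by (intro eq_matI) auto
    then show ?case by (simp add: poly_mat_0)
  next
    case (pCons a q)
    let ?Q = "ev q"
    have Q: "polP 0 q" using pCons by (simp add: polP_pCons)
    have Qc: "?Q \<in> carrier_mat n n" by simp
    note c' = c Qc mult_carrier_mat[OF Qc c(4)] mult_carrier_mat[OF c(1) Qc] mult_carrier_mat[OF Qc c(1)]
      mult_carrier_mat[OF c(1,4)] mult_carrier_mat[OF c(4,1)]
    have 1: "D * (a \<cdot>\<^sub>m 1\<^sub>m n + ?Q * \<beta>) = a \<cdot>\<^sub>m D + D * ?Q * \<beta>"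
      using mult_add_distrib_mat[OF c(1) _ c'(6), of "a \<cdot>\<^sub>m 1\<^sub>m n"] mult_smult_distrib[OF c(1) one_carrier_mat]
        right_mult_one_mat[OF c(1)] assoc_mult_mat[OF c(1) Qc c(4)] by simp
    have 2: "(a \<cdot>\<^sub>m 1\<^sub>m n + ?Q * \<beta>) * D = a \<cdot>\<^sub>m D + ?Q * (\<beta> * D)"
      using add_mult_distrib_mat[OF _ c'(6) c(1), of "a \<cdot>\<^sub>m 1\<^sub>m n"] mult_smult_assoc_mat[OF one_carrier_mat c(1)]
        left_mult_one_mat[OF c(1)] assoc_mult_mat[OF Qc c(4) c(1)] by simp
    have 3: "(D * ?Q - ?Q * D) * \<beta> = D * ?Q * \<beta> - ?Q * (D * \<beta>)"
      using minus_mult_distrib_mat[OF c'(7,8) c(4)] assoc_mult_mat[OF Qc c(1) c(4)] by simp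
    have 4: "?Q * (D * \<beta> - \<beta> * D) = ?Q * (D * \<beta>) - ?Q * (\<beta> * D)"
      by (rule mult_minus_distrib_mat[OF Qc c'(9,10)])
    have "D * ev (pCons a q) - ev (pCons a q) * D = (D * ?Q - ?Q * D) * \<beta> + ?Q * (D * \<beta> - \<beta> * D)"
      unfolding poly_mat_pCons[OF c(4)] 1 2 3 4
      using carrier_matD[OF mult_carrier_mat[OF c'(7) c(4)]] carrier_matD[OF mult_carrier_mat[OF Qc c'(9)]]
        carrier_matD[OF mult_carrier_mat[OF Qc c'(10)]] carrier_matD[OF c(1)]
      by (intro eq_matI) (simp_all del: index_mult_mat)
    also have "\<dots> \<in> MP m n"
      using pCons.IH(1)[OF Q] beta poly_mat_MP[OF beta Q] D\<beta> by (intro MP_add MP_mult MP_mult')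
    finally show ?case .
  qed
  have "D \<in> MP m n"
  proof (rule MP_I[OF c(1)])
    fix i j assume ij: "i < n" "j < n"
    \<comment> \<open>With y e_0 = e_j, the entry D_ij is the entry (i,0) of D y, which is congruent
      to that of y D, and the latter is zero because D has zero first column.\<close>
    have "\<exists>y\<in>Ob. \<forall>a<n. y $$ (a,0) = (if a = j then 1 else 0)" by (rule cyclic_int) simp
    then obtain y where y: "y \<in> Ob" "\<And>a. a < n \<Longrightarrow> y $$ (a,0) = (if a = j then 1 else 0)" by blast
    note yc = Ob_carrier[OF y(1)]
    have "D * y - y * D \<in> MP m n" using y(1) Dq by (auto simp: Ob_def)
    then have "(D * y - y * D) $$ (i,0) \<in> \<P> m" using MP_entry[of _ m n i 0] ij n_pos by simp
    moreover have "(D * y) $$ (i,0) = (\<Sum>a<n. D $$ (i,a) * y $$ (a,0))"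
      using ij n_pos c yc by (simp add: scalar_prod_def atLeast0LessThan)
    moreover have "(\<Sum>a<n. D $$ (i,a) * y $$ (a,0)) = D $$ (i,j)"
    proof -
      have "(\<Sum>a<n. D $$ (i,a) * y $$ (a,0)) = (\<Sum>a<n. if a = j then D $$ (i,j) else 0)"
        using y(2) by (intro sum.cong) auto
      then show ?thesis using ij by simp
    qed
    moreover have "(y * D) $$ (i,0) = (\<Sum>a<n. y $$ (i,a) * D $$ (a,0))"
      using ij n_pos c yc by (simp add: scalar_prod_def atLeast0LessThan)
    moreover have "D $$ (a,0) = 0" if "a < n" for a using x(2)[OF that] that n_pos c by (simp add: D_def)
    ultimately show "D $$ (i,j) \<in> \<P> m" using ij n_pos c yc by simp
  qed
  then show ?thesis using x(1) by (auto simp: D_def)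
qed

end

section \<open>The field generated by \<open>\<beta>\<close>\<close>

context unramified
begin

section \<open>F[\<beta>] as a field and as a vector space\<close>

lemma Kalg_simps [simp]:
  "carrier (Kalg n \<beta>) = Kc" "mult (Kalg n \<beta>) = (*)" "one (Kalg n \<beta>) = 1\<^sub>m n"
  "zero (Kalg n \<beta>) = 0\<^sub>m n n" "add (Kalg n \<beta>) = (+)" "module.smult (Kalg n \<beta>) = (\<cdot>\<^sub>m)"
  by (auto simp: Kalg_def Kc_def)

lemma Kc_assoc: "x \<in> Kc \<Longrightarrow> y \<in> Kc \<Longrightarrow> z \<in> Kc \<Longrightarrow> x * y * z = x * (y * z)"
  by (rule assoc_mult_mat[OF Kc_carrier Kc_carrier Kc_carrier])

lemma Kc_distrib: "x \<in> Kc \<Longrightarrow> y \<in> Kc \<Longrightarrow> z \<in> Kc \<Longrightarrow> (x + y) * z = x * z + y * z"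
  by (rule add_mult_distrib_mat[OF Kc_carrier Kc_carrier Kc_carrier])

lemma Kc_add_assoc: "x \<in> Kc \<Longrightarrow> y \<in> Kc \<Longrightarrow> z \<in> Kc \<Longrightarrow> x + y + z = x + (y + z)"
  by (rule assoc_add_mat[OF Kc_carrier Kc_carrier Kc_carrier])

lemma Kc_add_comm: "x \<in> Kc \<Longrightarrow> y \<in> Kc \<Longrightarrow> x + y = y + x"
  by (rule comm_add_mat[OF Kc_carrier Kc_carrier])

lemma Kc_neutral: "x \<in> Kc \<Longrightarrow> 0\<^sub>m n n + x = x" "x \<in> Kc \<Longrightarrow> 1\<^sub>m n * x = x" "x \<in> Kc \<Longrightarrow> - x + x = 0\<^sub>m n n"
  using Kc_carrier[of x] by auto

text \<open>Stated for a subset so that it yields the ring structure of both \<open>Kalg\<close> and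
  \<open>OK\<close>.\<close>

lemma subring_cring:
  assumes C: "C \<subseteq> Kc" "0\<^sub>m n n \<in> C" "1\<^sub>m n \<in> C" "\<And>x y. x \<in> C \<Longrightarrow> y \<in> C \<Longrightarrow> x + y \<in> C"
    "\<And>x y. x \<in> C \<Longrightarrow> y \<in> C \<Longrightarrow> x * y \<in> C" "\<And>x. x \<in> C \<Longrightarrow> - x \<in> C"
  shows "cring ((Kalg n \<beta>)\<lparr>carrier := C\<rparr>)"
proof (rule cringI)
  have K: "x \<in> Kc" if "x \<in> C" for x using that C(1) by auto
  show "abelian_group ((Kalg n \<beta>)\<lparr>carrier := C\<rparr>)"
  proof (rule abelian_groupI)
    fix x assume "x \<in> carrier ((Kalg n \<beta>)\<lparr>carrier := C\<rparr>)"
    then have "x \<in> C" by simp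
    then show "\<exists>y\<in>carrier ((Kalg n \<beta>)\<lparr>carrier := C\<rparr>).
        y \<oplus>\<^bsub>(Kalg n \<beta>)\<lparr>carrier := C\<rparr>\<^esub> x = \<zero>\<^bsub>(Kalg n \<beta>)\<lparr>carrier := C\<rparr>\<^esub>"
      using Kc_neutral(3)[OF K] C(6) by (intro bexI[of _ "- x"]) simp_all
  qed (use C K Kc_add_assoc Kc_neutral(1) in \<open>auto intro: Kc_add_comm\<close>)
  show "Group.comm_monoid ((Kalg n \<beta>)\<lparr>carrier := C\<rparr>)"
    by (rule comm_monoidI) (use C K Kc_assoc Kc_neutral in \<open>auto intro: Kc_closed(6)\<close>)
  show "\<And>x y z. x \<in> carrier ((Kalg n \<beta>)\<lparr>carrier := C\<rparr>) \<Longrightarrow> y \<in> carrier ((Kalg n \<beta>)\<lparr>carrier := C\<rparr>) \<Longrightarrow>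
      z \<in> carrier ((Kalg n \<beta>)\<lparr>carrier := C\<rparr>) \<Longrightarrow>
      (x \<oplus>\<^bsub>(Kalg n \<beta>)\<lparr>carrier := C\<rparr>\<^esub> y) \<otimes>\<^bsub>(Kalg n \<beta>)\<lparr>carrier := C\<rparr>\<^esub> z =
      x \<otimes>\<^bsub>(Kalg n \<beta>)\<lparr>carrier := C\<rparr>\<^esub> z \<oplus>\<^bsub>(Kalg n \<beta>)\<lparr>carrier := C\<rparr>\<^esub> y \<otimes>\<^bsub>(Kalg n \<beta>)\<lparr>carrier := C\<rparr>\<^esub> z"
    using K Kc_distrib by simp
qed

lemma Kalg_cring: "cring (Kalg n \<beta>)"
proof -
  have "cring ((Kalg n \<beta>)\<lparr>carrier := Kc\<rparr>)"
    by (rule subring_cring) (use Kc_closed Kc_one Kc_zero in auto)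
  then show ?thesis by (simp add: Kalg_def Kc_def)
qed

lemma one_neq_zero: "1\<^sub>m n \<noteq> (0\<^sub>m n n :: 'f mat)"
proof
  assume "1\<^sub>m n = (0\<^sub>m n n :: 'f mat)"
  then have "(1\<^sub>m n :: 'f mat) $$ (0,0) = 0\<^sub>m n n $$ (0,0)" by simp
  then show False using n_pos by simp
qed

lemma Kalg_field: "Ring.field (Kalg n \<beta>)"
  by (rule cring.cring_fieldI2[OF Kalg_cring]) (use one_neq_zero Kc_inverse in auto)

lemma Kalg_vectorspace: "vectorspace class_ring (Kalg n \<beta>)"
proof (rule vectorspace.intro)
  show "module class_ring (Kalg n \<beta>)"
  proof (rule moduleI)
    show "cring (class_ring :: 'f ring)" using class_field[where 'a='f] by (rule field.axioms(1)[THEN domain.axioms(1)])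
    show "abelian_group (Kalg n \<beta>)" using Kalg_cring by (simp add: cring_def ring_def)
  qed (auto simp: Kc_closed(3) add_smult_distrib_right_mat[OF Kc_carrier] add_smult_distrib_left_mat[OF Kc_carrier Kc_carrier]
      smult_smult_mat smult_one_mat)
  show "Ring.field (class_ring :: 'f ring)" by (rule class_field)
qed

lemma Kalg_finsum:
  assumes "finite Y" "\<And>y. y \<in> Y \<Longrightarrow> f y \<in> Kc"
  shows "finsum (Kalg n \<beta>) f Y \<in> Kc \<and>
    (\<forall>a<n. \<forall>d<n. finsum (Kalg n \<beta>) f Y $$ (a,d) = (\<Sum>y\<in>Y. f y $$ (a,d)))"
  using assms
proof (induction Y)
  interpret cring "Kalg n \<beta>" by (rule Kalg_cring)
  case empty
  then show ?case using Kc_zero by simp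
next
  case (insert y Y)
  interpret cring "Kalg n \<beta>" by (rule Kalg_cring)
  have "finsum (Kalg n \<beta>) f (insert y Y) = f y + finsum (Kalg n \<beta>) f Y"
    using insert by (simp add: finsum_insert Pi_def)
  moreover have "finsum (Kalg n \<beta>) f Y \<in> Kc" "f y \<in> Kc" using insert by auto
  ultimately show ?case using insert Kc_closed(1) Kc_carrier[of "finsum (Kalg n \<beta>) f Y"] Kc_carrier[of "f y"]
    by (simp del: finsum_insert)
qed

lemma Kalg_lincomb:
  assumes "finite B" "B \<subseteq> Kc"
  shows "module.lincomb (Kalg n \<beta>) c B \<in> Kc"
    "a < n \<Longrightarrow> d < n \<Longrightarrow> module.lincomb (Kalg n \<beta>) c B $$ (a,d) = (\<Sum>b\<in>B. c b * b $$ (a,d))"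
proof -
  interpret V: vectorspace class_ring "Kalg n \<beta>" by (rule Kalg_vectorspace)
  have f: "V.lincomb c B = finsum (Kalg n \<beta>) (\<lambda>b. c b \<cdot>\<^sub>m b) B" by (simp add: V.lincomb_def)
  have k: "c b \<cdot>\<^sub>m b \<in> Kc" if "b \<in> B" for b using assms(2) that Kc_closed(3) by blast
  have s: "(c b \<cdot>\<^sub>m b) $$ (a,d) = c b * b $$ (a,d)" if "b \<in> B" "a < n" "d < n" for a b d
    using Kc_carrier[of b] assms(2) that by auto
  show "module.lincomb (Kalg n \<beta>) c B \<in> Kc" using Kalg_finsum[OF assms(1) k] f by simp
  show "module.lincomb (Kalg n \<beta>) c B $$ (a,d) = (\<Sum>b\<in>B. c b * b $$ (a,d))" if "a < n" "d < n"
    using Kalg_finsum[OF assms(1) k] f s that by simp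
qed

lemma Kc_eqI: "x \<in> Kc \<Longrightarrow> y \<in> Kc \<Longrightarrow> (\<And>a d. a < n \<Longrightarrow> d < n \<Longrightarrow> x $$ (a,d) = y $$ (a,d)) \<Longrightarrow> x = y"
  using carrier_matD[OF Kc_carrier[of x]] carrier_matD[OF Kc_carrier[of y]] by (intro eq_matI) auto

text \<open>Bases are sets, so the powers must be distinct for the basis to have n elements; two
  equal powers would be a nontrivial relation of degree below n.\<close>

lemma pow_beta_inj: "inj_on (\<lambda>i. \<beta> ^\<^sub>m i) {..<n}"
proof (rule inj_onI)
  fix i j assume ij: "i \<in> {..<n}" "j \<in> {..<n}" and e: "\<beta> ^\<^sub>m i = \<beta> ^\<^sub>m j"
  show "i = j"
  proof (rule ccontr)
    assume ne: "i \<noteq> j"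
    let ?c = "\<lambda>k. if k = i then 1 else if k = j then -1 else (0::'f)"
    have "ev (vpoly ?c) = 0\<^sub>m n n"
    proof (rule Kc_eqI[OF ev_Kc Kc_zero])
      fix a d assume ad: "a < n" "d < n"
      have "ev (vpoly ?c) $$ (a,d) = (\<Sum>k<n. (if k = i then (\<beta> ^\<^sub>m i) $$ (a,d) else 0) - (if k = j then (\<beta> ^\<^sub>m j) $$ (a,d) else 0))"
        unfolding ev_vpoly_index[OF ad] by (intro sum.cong) (use ne in auto)
      also have "\<dots> = 0" using ij e by (simp add: sum_subtractf)
      finally show "ev (vpoly ?c) $$ (a,d) = 0\<^sub>m n n $$ (a,d)" using ad by simp
    qed
    then show False using ev_vpoly_zero[of ?c i] ij by simp
  qed
qed

lemma pow_basis: "vectorspace.basis class_ring (Kalg n \<beta>) ((\<lambda>i. \<beta> ^\<^sub>m i) ` {..<n})"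
proof -
  interpret V: vectorspace class_ring "Kalg n \<beta>" by (rule Kalg_vectorspace)
  let ?B = "(\<lambda>i. \<beta> ^\<^sub>m i) ` {..<n}"
  have B: "finite ?B" "?B \<subseteq> Kc" using beta_pow_Kc by auto
  have lc: "V.lincomb c ?B = ev (vpoly (\<lambda>i. c (\<beta> ^\<^sub>m i)))" for c
    by (rule Kc_eqI[OF Kalg_lincomb(1)[OF B] ev_Kc])
      (simp add: Kalg_lincomb(2)[OF B] ev_vpoly_index sum.reindex[OF pow_beta_inj])
  have "V.lin_indpt ?B"
  proof (rule V.finite_lin_indpt2)
    fix c assume "V.lincomb c ?B = \<zero>\<^bsub>Kalg n \<beta>\<^esub>"
    then have "ev (vpoly (\<lambda>i. c (\<beta> ^\<^sub>m i))) = 0\<^sub>m n n" by (simp add: lc)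
    then show "\<forall>b\<in>?B. c b = \<zero>\<^bsub>class_ring\<^esub>" using ev_vpoly_zero by auto
  qed (use B in auto)
  moreover have "V.span ?B = carrier (Kalg n \<beta>)"
  proof
    show "V.span ?B \<subseteq> carrier (Kalg n \<beta>)" using V.finite_span[OF B(1)] Kalg_lincomb(1)[OF B] B by auto
    show "carrier (Kalg n \<beta>) \<subseteq> V.span ?B"
    proof
      fix y assume "y \<in> carrier (Kalg n \<beta>)"
      then obtain t where t: "y = ev t" "t = 0 \<or> Polynomial.degree t < n" using Kc_small[of y] by auto
      define c where "c b = Polynomial.coeff t (the_inv_into {..<n} (\<lambda>i. \<beta> ^\<^sub>m i) b)" for b
      have "vpoly (\<lambda>i. c (\<beta> ^\<^sub>m i)) = t"
        using t(2) by (auto simp: poly_eq_iff coeff_vpoly c_def the_inv_into_f_f[OF pow_beta_inj] coeff_eq_0)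
      then have "y = V.lincomb c ?B" by (simp add: lc t(1))
      then show "y \<in> V.span ?B" using V.finite_span[OF B(1)] B by auto
    qed
  qed
  ultimately show ?thesis using B by (simp add: V.basis_def)
qed

lemma Kalg_dim: "vectorspace.fin_dim class_ring (Kalg n \<beta>)" "vectorspace.dim class_ring (Kalg n \<beta>) = n"
proof -
  interpret V: vectorspace class_ring "Kalg n \<beta>" by (rule Kalg_vectorspace)
  let ?B = "(\<lambda>i. \<beta> ^\<^sub>m i) ` {..<n}"
  show "V.fin_dim" unfolding V.fin_dim_def
    using pow_basis by (intro exI[of _ ?B]) (simp add: V.basis_def)
  have "V.dim = card ?B" by (rule V.dim_basis[OF _ pow_basis]) simp
  then show "V.dim = n" using card_image[OF pow_beta_inj] by simp
qed

text \<open>Evaluation at e_0 identifies F[\<beta>] with F^n and turns multiplication by x into the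
  matrix x. With \<open>?C\<close> the matrix of columns b e_0 for b in B, and \<open>?N\<close> the
  coordinate matrix of multiplication, x C = C N, so the traces agree. The basis is arbitrary
  because \<open>linear_trace\<close> quantifies over all bases.\<close>

lemma basis_trace:
  assumes B: "finite B" "vectorspace.basis class_ring (Kalg n \<beta>) B"
    and M: "\<And>b. b \<in> B \<Longrightarrow> x * b = module.lincomb (Kalg n \<beta>) (M b) B" and x: "x \<in> Kc"
  shows "(\<Sum>b\<in>B. M b b) = mtrace x"
proof -
  interpret V: vectorspace class_ring "Kalg n \<beta>" by (rule Kalg_vectorspace)
  have BK: "B \<subseteq> Kc" and ind: "V.lin_indpt B" using B(2) by (auto simp: V.basis_def)
  have "card B = n" using V.dim_basis[OF B] Kalg_dim(2) by simp
  then obtain e where e: "bij_betw e {..<n} B"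
    using ex_bij_betw_nat_finite[OF B(1)] by (auto simp: atLeast0LessThan)
  have eB: "e i \<in> B" if "i < n" for i using bij_betw_apply[OF e] that by simp
  have sumB: "(\<Sum>b\<in>B. f b) = (\<Sum>i<n. f (e i))" for f :: "'f mat \<Rightarrow> 'f"
    using sum.reindex_bij_betw[OF e, of f] by simp
  let ?C = "mat n n (\<lambda>(a,i). e i $$ (a,0))"
  have "det ?C \<noteq> 0"
  proof (rule column_matrix_det)
    show "e i \<in> Kc" if "i < n" for i using eB[OF that] BK by auto
    fix c :: "nat \<Rightarrow> 'f" and i
    assume z: "\<And>a d. a < n \<Longrightarrow> d < n \<Longrightarrow> (\<Sum>i<n. c i * e i $$ (a,d)) = 0" and i: "i < n"
    define c' where "c' b = c (the_inv_into {..<n} e b)" for b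
    have c': "c' (e j) = c j" if "j < n" for j
      using e that by (simp add: c'_def the_inv_into_f_f bij_betw_def)
    have "V.lincomb c' B = 0\<^sub>m n n"
    proof (rule Kc_eqI[OF Kalg_lincomb(1)[OF B(1) BK] Kc_zero])
      fix a d assume ad: "a < n" "d < n"
      have "V.lincomb c' B $$ (a,d) = (\<Sum>i<n. c i * e i $$ (a,d))"
        unfolding Kalg_lincomb(2)[OF B(1) BK ad] sumB by (intro sum.cong) (auto simp: c')
      then show "V.lincomb c' B $$ (a,d) = 0\<^sub>m n n $$ (a,d)" using z ad by simp
    qed
    then have "\<not> c' (e i) \<noteq> 0"
      using V.lin_dep_crit[OF B(1) subset_refl, of c' "e i"] ind eB[OF i] by auto
    then show "c i = 0" using c'[OF i] by simp
  qed
  then obtain D where D: "D \<in> carrier_mat n n" "?C * D = 1\<^sub>m n" "D * ?C = 1\<^sub>m n"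
    using adj_mat[of ?C n] mult_smult_distrib[of ?C n n "adj_mat ?C" n "inverse (det ?C)"]
      mult_smult_assoc_mat[of "adj_mat ?C" n n ?C n "inverse (det ?C)"]
    by (intro that[of "inverse (det ?C) \<cdot>\<^sub>m adj_mat ?C"]) (auto simp: smult_smult_mat smult_one_mat)
  let ?N = "mat n n (\<lambda>(j,i). M (e i) (e j))"
  note xc = Kc_carrier[OF x]
  have C: "?C \<in> carrier_mat n n" and N: "?N \<in> carrier_mat n n" by auto
  have xC: "x * ?C = ?C * ?N"
  proof (rule eq_matI)
    fix a i assume "a < dim_row (?C * ?N)" "i < dim_col (?C * ?N)"
    then have ai: "a < n" "i < n" by auto
    have n0: "0 < n" using n_pos by simp
    have ec: "e i \<in> carrier_mat n n" using Kc_carrier eB[OF ai(2)] BK by blast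
    have "(x * ?C) $$ (a,i) = (\<Sum>b<n. x $$ (a,b) * e i $$ (b,0))"
      using ai xc by (simp add: scalar_prod_def atLeast0LessThan)
    also have "\<dots> = (x * e i) $$ (a,0)"
      using ai xc ec n0 by (simp add: scalar_prod_def atLeast0LessThan)
    also have "\<dots> = (\<Sum>j<n. M (e i) (e j) * e j $$ (a,0))"
      unfolding M[OF eB[OF ai(2)]] Kalg_lincomb(2)[OF B(1) BK ai(1) n0] sumB ..
    also have "\<dots> = (?C * ?N) $$ (a,i)"
      using ai by (simp add: scalar_prod_def atLeast0LessThan mult.commute)
    finally show "(x * ?C) $$ (a,i) = (?C * ?N) $$ (a,i)" .
  qed (use xc in auto)
  have "(\<Sum>b\<in>B. M b b) = mtrace ?N" by (simp add: sumB mtrace_def)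
  also have "?N = D * (x * ?C)" unfolding xC using assoc_mult_mat[OF D(1) C N] D(3) N by simp
  also have "mtrace \<dots> = mtrace (x * ?C * D)" by (rule mtrace_mult_comm[OF D(1) mult_carrier_mat[OF xc C]])
  also have "x * ?C * D = x" using assoc_mult_mat[OF xc C D(1)] D(2) xc by simp
  finally show ?thesis .
qed

lemma field_trace_eq:
  assumes x: "x \<in> Kc"
  shows "field_trace n \<beta> x = mtrace x"
proof -
  interpret V: vectorspace class_ring "Kalg n \<beta>" by (rule Kalg_vectorspace)
  let ?B = "(\<lambda>i. \<beta> ^\<^sub>m i) ` {..<n}"
  have BK: "?B \<subseteq> Kc" using beta_pow_Kc by auto
  have "\<exists>M. \<forall>b\<in>?B. x * b = V.lincomb (M b) ?B"
  proof -
    have "\<exists>c. x * b = V.lincomb c ?B" if b: "b \<in> ?B" for b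
    proof -
      have "x * b \<in> V.span ?B" using pow_basis Kc_closed(2)[OF x, of b] BK b by (auto simp: V.basis_def)
      then show ?thesis using V.finite_in_span[of ?B "x * b"] BK by (auto intro: sym)
    qed
    then show ?thesis by metis
  qed
  then obtain M where M: "\<And>b. b \<in> ?B \<Longrightarrow> x * b = V.lincomb (M b) ?B" by blast
  show ?thesis
    unfolding field_trace_def linear_trace_def
  proof (rule the_equality)
    show "\<exists>B M. finite B \<and> V.basis B \<and> (\<forall>b\<in>B. x * b = V.lincomb (M b) B) \<and> mtrace x = (\<Sum>b\<in>B. M b b)"
      using basis_trace[OF _ pow_basis M x] pow_basis M by (intro exI[of _ ?B] exI[of _ M]) auto
    show "\<And>c. \<exists>B M. finite B \<and> V.basis B \<and> (\<forall>b\<in>B. x * b = V.lincomb (M b) B) \<and> c = (\<Sum>b\<in>B. M b b) \<Longrightarrow> c = mtrace x"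
      using basis_trace[OF _ _ _ x] by blast
  qed
qed

text \<open>Let x = \<omega>^k u be the normal form and suppose k < 0. Dividing the monic equation
  of degree D by \<omega>^(kD) expresses u^D by lower powers of u whose coefficients lie in the
  maximal ideal, although u^D is a unit.\<close>

lemma integral_Ob:
  assumes x: "x \<in> Kc" and q: "polP 0 q" "lc q = 1" "poly_mat n q x = 0\<^sub>m n n"
  shows "x \<in> Ob"
proof (cases "x = 0\<^sub>m n n")
  case True then show ?thesis by (simp add: Ob_zero)
next
  case False
  then obtain k u where u: "u \<in> Ob" "u \<in> GLO n" "x = (\<omega> powi k) \<cdot>\<^sub>m u" using Kc_decomp[OF x] by blast
  note uc = Ob_carrier[OF u(1)]
  have "0 \<le> k"
  proof (rule ccontr)
    assume k: "\<not> 0 \<le> k"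
    define w where "w = \<omega> powi k"
    define D where "D = Polynomial.degree q"
    have w0: "w \<noteq> 0" by (simp add: w_def)
    have wi: "inverse w \<in> \<P> 1" using k by (simp add: w_def P_iff v_inverse v_power_int)
    have xp: "x ^\<^sub>m i = w ^ i \<cdot>\<^sub>m (u ^\<^sub>m i)" for i unfolding u(3) w_def by (rule pow_mat_smult[OF uc])
    have up: "u ^\<^sub>m i \<in> MP 0 n" for i by (induction i) (use uc Ob_MP[OF u(1)] carrier_matD[OF uc] in auto)
    have "u ^\<^sub>m D \<in> MP 1 n"
    proof (rule MP_I)
      fix a d assume ad: "a < n" "d < n"
      have ui: "(u ^\<^sub>m i) $$ (a,d) \<in> \<P> 0" for i using MP_entry[OF up ad] .
      have "0 = poly_mat n q x $$ (a,d)" using q(3) ad by simp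
      also have "\<dots> = (\<Sum>i\<le>D. Polynomial.coeff q i * (w ^ i * (u ^\<^sub>m i) $$ (a,d)))"
        unfolding D_def using poly_mat_index[OF order_refl ad, of q x] carrier_matD[OF MP_carrier[OF up]] ad by (simp add: xp)
      also have "\<dots> = w ^ D * (u ^\<^sub>m D) $$ (a,d) + (\<Sum>i<D. Polynomial.coeff q i * (w ^ i * (u ^\<^sub>m i) $$ (a,d)))"
        using q(2) by (simp add: D_def lessThan_Suc_atMost[symmetric])
      finally have "w ^ D * (u ^\<^sub>m D) $$ (a,d) = - (\<Sum>i<D. Polynomial.coeff q i * (w ^ i * (u ^\<^sub>m i) $$ (a,d)))"
        by (simp add: eq_neg_iff_add_eq_0)
      then have "(u ^\<^sub>m D) $$ (a,d) = inverse (w ^ D) * - (\<Sum>i<D. Polynomial.coeff q i * (w ^ i * (u ^\<^sub>m i) $$ (a,d)))"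
        using w0 by (simp add: field_simps)
      also have "\<dots> = - (\<Sum>i<D. Polynomial.coeff q i * (inverse w ^ (D - i) * (u ^\<^sub>m i) $$ (a,d)))"
      proof -
        have ee: "inverse (w ^ D) * (Polynomial.coeff q i * (w ^ i * (u ^\<^sub>m i) $$ (a,d))) =
            Polynomial.coeff q i * (inverse w ^ (D - i) * (u ^\<^sub>m i) $$ (a,d))" if "i < D" for i
        proof -
          have "w ^ D = w ^ i * w ^ (D - i)" using that by (simp add: power_add[symmetric])
          then have "inverse (w ^ D) * w ^ i = inverse w ^ (D - i)" using w0 by (simp add: power_inverse)
          then show ?thesis by (metis (no_types, lifting) mult.assoc mult.commute)
        qed
        show ?thesis unfolding mult_minus_right sum_distrib_left
          by (intro arg_cong[of _ _ uminus] sum.cong refl ee) simp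
      qed
      also have "\<dots> \<in> \<P> 1"
      proof (rule P_uminus[OF P_sum])
        fix i assume "i \<in> {..<D}"
        then obtain j where "D - i = Suc j" by (metis Suc_diff_Suc lessThan_iff)
        moreover have "inverse w ^ Suc j \<in> \<P> 1"
          using wi P_power[OF P_int[OF wi], of j] P_mult'[of "inverse w" 1 "inverse w ^ j"] by simp
        ultimately show "Polynomial.coeff q i * (inverse w ^ (D - i) * (u ^\<^sub>m i) $$ (a,d)) \<in> \<P> 1"
          using q(1) ui by (intro P_mult P_mult') (auto simp: polP_def)
      qed
      finally show "(u ^\<^sub>m D) $$ (a,d) \<in> \<P> 1" .
    qed (use uc in simp)
    moreover have "u ^\<^sub>m i \<in> GLO n" for i
    proof (induction i)
      case 0
      show ?case using GLO_one_plus[of "0\<^sub>m n n" n] uc by simp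
    qed (simp add: GLO_mult u(2))
    ultimately show False using GLO_nonzero by blast
  qed
  then have "\<omega> powi k \<in> \<P> 0" by (simp add: P_iff v_power_int)
  then show ?thesis unfolding u(3) by (rule Ob_closed(3)[OF u(1) u(1)])
qed

lemma OK_carrier: "carrier (OK v n \<beta>) = Ob"
proof (intro Set.set_eqI iffI)
  fix x assume "x \<in> carrier (OK v n \<beta>)"
  then show "x \<in> Ob" using integral_Ob[of x] by (auto simp: OK_def int_poly_iff)
next
  fix x assume x: "x \<in> Ob"
  have "polP 0 (char_poly x)" using char_poly_polP[OF Ob_MP[OF x]] .
  moreover have "lc (char_poly x) = 1" using degree_monic_char_poly[OF Ob_carrier[OF x]] by simp
  moreover have "poly_mat n (char_poly x) x = 0\<^sub>m n n" by (rule cayley_hamilton[OF Ob_carrier[OF x]])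
  ultimately show "x \<in> carrier (OK v n \<beta>)" using Ob_Kc[OF x] by (auto simp: OK_def int_poly_iff)
qed

lemma OK_eq: "OK v n \<beta> = (Kalg n \<beta>)\<lparr>carrier := Ob\<rparr>"
  using OK_carrier unfolding OK_def by simp

lemma OK_simps [simp]:
  "carrier (OK v n \<beta>) = Ob" "mult (OK v n \<beta>) = (*)" "one (OK v n \<beta>) = 1\<^sub>m n"
  "zero (OK v n \<beta>) = 0\<^sub>m n n" "add (OK v n \<beta>) = (+)"
  by (simp_all add: OK_eq)

lemma OK_cring: "cring (OK v n \<beta>)"
  unfolding OK_eq by (rule subring_cring) (use Ob_Kc Ob_closed Ob_one Ob_zero in auto)

text \<open>Membership of x and of the unit u in the integral matrices pins the exponent of the
  normal form: k > 0 would put x into the maximal ideal, k < 0 would put u there. Thus O[\<beta>] is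
  local.\<close>

lemma Ob_unit_iff: "x \<in> Ob \<Longrightarrow> x \<in> GLO n \<longleftrightarrow> x \<notin> MP 1 n"
proof
  assume x: "x \<in> Ob" and nx: "x \<notin> MP 1 n"
  have "x \<noteq> 0\<^sub>m n n" using nx by auto
  then obtain k u where u: "u \<in> Ob" "u \<in> GLO n" "x = (\<omega> powi k) \<cdot>\<^sub>m u" using Kc_decomp[OF Ob_Kc[OF x]] by blast
  have "\<not> 0 < k"
  proof
    assume "0 < k"
    then have "\<omega> powi k \<in> \<P> 1" by (simp add: P_iff v_power_int)
    then show False using nx MP_smult[of _ 1 u 0 n] Ob_MP[OF u(1)] u(3) by simp
  qed
  moreover have "\<not> k < 0"
  proof
    assume "k < 0"
    then have "\<omega> powi (- k) \<in> \<P> 1" by (simp add: P_iff v_power_int)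
    moreover have "u = (\<omega> powi (- k)) \<cdot>\<^sub>m x" unfolding u(3) smult_power_int by (simp add: smult_one_mat)
    ultimately show False using GLO_nonzero[OF u(2)] MP_smult[of _ 1 x 0 n] Ob_MP[OF x] by simp
  qed
  ultimately show "x \<in> GLO n" using u by (simp add: smult_one_mat)
qed (use GLO_nonzero in blast)

lemma Units_OK: "Units (OK v n \<beta>) = Ob \<inter> GLO n"
proof (intro Set.set_eqI iffI)
  fix x assume "x \<in> Units (OK v n \<beta>)"
  then obtain y where "x \<in> Ob" "y \<in> Ob" "x * y = 1\<^sub>m n" "y * x = 1\<^sub>m n" by (auto simp: Units_def)
  then show "x \<in> Ob \<inter> GLO n" using Ob_MP by (auto simp: GLO_def)
next
  fix x assume x: "x \<in> Ob \<inter> GLO n"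
  then show "x \<in> Units (OK v n \<beta>)" using minv[of x n] minv_Ob[of x] by (auto simp: Units_def intro!: bexI[of _ "minv n x"])
qed

text \<open>If an element of O[\<beta>] is divisible by \<omega>^m as an integral matrix, saturation
  puts the quotient into O[\<beta>]. Congruences in the integer ring of F[\<beta>] are therefore
  congruences of matrices.\<close>

lemma pK_pow_eq: "pK_pow v \<omega> n \<beta> m = Ob \<inter> MP m n"
proof -
  have e: "pK_pow v \<omega> n \<beta> m = {x * (\<omega> ^ m \<cdot>\<^sub>m 1\<^sub>m n) | x. x \<in> Ob}"
    by (simp add: pK_pow_def cgenideal_def)
  have xs: "x * (\<omega> ^ m \<cdot>\<^sub>m 1\<^sub>m n) = \<omega> ^ m \<cdot>\<^sub>m x" if "x \<in> Ob" for x
    using mult_smult_distrib[OF Ob_carrier[OF that] one_carrier_mat] right_mult_one_mat[OF Ob_carrier[OF that]] by simp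
  show ?thesis
  proof (intro Set.set_eqI iffI)
    fix y assume "y \<in> pK_pow v \<omega> n \<beta> m"
    then obtain x where x: "x \<in> Ob" "y = \<omega> ^ m \<cdot>\<^sub>m x" using e xs by auto
    have "\<omega> ^ m \<in> \<P> 0" by (rule P_int[OF \<omega>_P])
    then show "y \<in> Ob \<inter> MP m n" using x Ob_closed(3)[OF x(1) x(1)] MP_smult_\<omega>[OF Ob_MP[OF x(1)]] by simp
  next
    fix y assume y: "y \<in> Ob \<inter> MP m n"
    then obtain x where x: "x \<in> MP 0 n" "y = \<omega> ^ m \<cdot>\<^sub>m x" using MP_eq by blast
    have "x = inverse (\<omega> ^ m) \<cdot>\<^sub>m y" unfolding x(2) by (simp add: smult_smult_mat smult_one_mat)
    then have "x \<in> Kc" using Kc_closed(3) Ob_Kc y by blast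
    then have "x \<in> Ob" using Kc_int x(1) by blast
    then show "y \<in> pK_pow v \<omega> n \<beta> m" unfolding e using xs[of x] x(2) by (intro CollectI exI[of _ x]) simp
  qed
qed

lemma pK_pow_ideal: "ideal (pK_pow v \<omega> n \<beta> m) (OK v n \<beta>)"
proof -
  interpret cring "OK v n \<beta>" by (rule OK_cring)
  have "\<omega> ^ m \<cdot>\<^sub>m 1\<^sub>m n \<in> Ob" by (rule Ob_closed(3)[OF Ob_one Ob_one P_int[OF \<omega>_P]])
  then show ?thesis unfolding pK_pow_def by (intro cgenideal_ideal) simp
qed

text \<open>Everything outside this ideal is a unit, so every proper ideal is contained in
  it.\<close>

lemma maximal_ideals_OK: "{M. maximalideal M (OK v n \<beta>)} = {pK_pow v \<omega> n \<beta> 1}"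
proof -
  interpret cring "OK v n \<beta>" by (rule OK_cring)
  let ?P = "pK_pow v \<omega> n \<beta> 1"
  have unit: "J = Ob" if J: "ideal J (OK v n \<beta>)" and x: "x \<in> J" "x \<in> GLO n" for J x
  proof -
    have "x \<in> Ob" using additive_subgroup.a_Hcarr[OF ideal.axioms(1)[OF J] x(1)] by simp
    then have "minv n x * x \<in> J" using ideal.I_l_closed[OF J x(1), of "minv n x"] minv_Ob x(2) by simp
    then have "1\<^sub>m n \<in> J" using minv(3)[OF x(2)] by simp
    then show ?thesis using ideal.one_imp_carrier[OF J] by simp
  qed
  have proper: "?P \<noteq> Ob" using Ob_one GLO_nonzero[of "1\<^sub>m n"] GLO_one_plus[of "0\<^sub>m n n" n] by (auto simp: pK_pow_eq)
  have max: "J = ?P \<or> J = Ob" if J: "ideal J (OK v n \<beta>)" "?P \<subseteq> J" for J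
  proof (cases "J \<subseteq> ?P")
    case False
    then obtain x where x: "x \<in> J" "x \<notin> ?P" by blast
    have "x \<in> Ob" using additive_subgroup.a_Hcarr[OF ideal.axioms(1)[OF J(1)] x(1)] by simp
    then show ?thesis using unit[OF J(1) x(1)] x(2) Ob_unit_iff by (auto simp: pK_pow_eq)
  qed (use J in auto)
  have "maximalideal ?P (OK v n \<beta>)"
    by (rule maximalidealI[OF pK_pow_ideal]) (use proper max in auto)
  moreover have "M = ?P" if M: "maximalideal M (OK v n \<beta>)" for M
  proof -
    have MI: "ideal M (OK v n \<beta>)" and MO: "M \<noteq> Ob"
      using maximalideal.axioms(1)[OF M] maximalideal.I_notcarr[OF M] by auto
    have "M \<subseteq> ?P"
    proof
      fix x assume x: "x \<in> M"
      have "x \<in> Ob" using additive_subgroup.a_Hcarr[OF ideal.axioms(1)[OF MI] x] by simp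
      then show "x \<in> ?P" using unit[OF MI x] MO Ob_unit_iff by (auto simp: pK_pow_eq)
    qed
    then show ?thesis
      using maximalideal.I_maximal[OF M pK_pow_ideal, of 1] proper by (auto simp: pK_pow_eq)
  qed
  ultimately show ?thesis by blast
qed

end

section \<open>The character \<open>\<psi>\<^sub>\<beta>\<close> and its stabilizer\<close>

lemma mtrace_diff: "mtrace (A - B) = mtrace A - mtrace B"
  if "A \<in> carrier_mat n n" "B \<in> carrier_mat n n" for A B :: "'a::comm_ring_1 mat"
  using that by (simp add: mtrace_def sum_subtractf)

locale character_setting = unramified v \<omega> n p \<beta>
  for v :: "'f::field \<Rightarrow> int" and \<omega> :: 'f and n :: nat and p :: "'f poly" and \<beta> :: "'f mat" +
  fixes \<tau> :: "'f \<Rightarrow> complex" and l l' :: nat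
  assumes tau_add: "\<tau> (x + y) = \<tau> x * \<tau> y" and tau_nz: "\<tau> x \<noteq> 0"
    and tau_conductor: "(\<forall>a\<in>pow_ideal v 0. \<tau> (x * a) = 1) \<longleftrightarrow> x \<in> pow_ideal v 0"
    and l': "1 \<le> l'" "l' \<le> l"
begin

lemma tau_P0: "x \<in> \<P> 0 \<Longrightarrow> \<tau> x = 1"
  using tau_conductor[of x] by (metis P_one mult.right_neutral)

lemma tau_congr: "x - y \<in> \<P> 0 \<Longrightarrow> \<tau> x = \<tau> y"
  using tau_add[of y "x - y"] tau_P0[of "x - y"] by simp

text \<open>Test against the matrices \<open>a E\<^sub>j\<^sub>i\<close>.\<close>

lemma tau_trace:
  assumes D: "D \<in> MP 0 n" and t: "\<And>Y. Y \<in> MP 0 n \<Longrightarrow> \<tau> (mtrace (Y * D) / \<omega> ^ k) = 1"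
  shows "D \<in> MP k n"
proof (rule MP_I)
  show "D \<in> carrier_mat n n" using D by simp
  fix i j assume ij: "i < n" "j < n"
  have "\<tau> (D $$ (i,j) / \<omega> ^ k * a) = 1" if a: "a \<in> \<P> 0" for a
  proof -
    let ?Y = "mat n n (\<lambda>(s,t). if s = j \<and> t = i then a else 0)"
    have Y: "?Y \<in> MP 0 n" by (rule MP_I) (use a in auto)
    have "(?Y * D) $$ (s,s) = (if s = j then a * D $$ (i,j) else 0)" if s: "s < n" for s
    proof -
      have "(?Y * D) $$ (s,s) = (\<Sum>t<n. (if s = j \<and> t = i then a else 0) * D $$ (t,s))"
        using s MP_carrier[OF D] by (simp add: scalar_prod_def atLeast0LessThan)
      also have "\<dots> = (\<Sum>t<n. if t = i then (if s = j then a * D $$ (i,j) else 0) else 0)"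
        by (intro sum.cong) auto
      finally show ?thesis using ij by simp
    qed
    then have "mtrace (?Y * D) = a * D $$ (i,j)" using ij by (simp add: mtrace_def)
    then show ?thesis using t[OF Y] by (simp add: mult.commute)
  qed
  then have "D $$ (i,j) / \<omega> ^ k \<in> \<P> 0" using tau_conductor by blast
  then show "D $$ (i,j) \<in> \<P> k" by (simp add: P_divide_iff)
qed

abbreviation r :: nat where "r \<equiv> l + l'"
abbreviation G :: "'f set mat monoid" where "G \<equiv> GL_res v n r"
abbreviation rd :: "'f mat \<Rightarrow> 'f set mat" where "rd \<equiv> red_mat v r"
abbreviation N :: "'f set mat set" where "N \<equiv> cong_subgroup v n r l"
abbreviation H :: "'f set mat set" where "H \<equiv> cong_subgroup v n r l'"
abbreviation S :: "'f set mat set" where "S \<equiv> stab v n l l' \<beta>"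
abbreviation A :: "'f set mat set" where "A \<equiv> G_cent v n r \<beta>"
abbreviation \<psi> :: "'f set mat \<Rightarrow> complex" where "\<psi> \<equiv> psi v \<omega> \<tau> n l l' \<beta>"

definition one_plus :: "nat \<Rightarrow> 'f mat \<Rightarrow> 'f mat" where
  "one_plus m Y = 1\<^sub>m n + \<omega> ^ m \<cdot>\<^sub>m Y"

lemma r_pos: "1 \<le> r"
  using l' by simp

lemma rd_eq_iff: "Y \<in> MP 0 n \<Longrightarrow> Z \<in> MP 0 n \<Longrightarrow> rd Y = rd Z \<longleftrightarrow> Y - Z \<in> MP r n"
  by (rule red_mat_eq_iff[OF MP_carrier MP_carrier])

lemma one_plus_GLO: "1 \<le> m \<Longrightarrow> Y \<in> MP 0 n \<Longrightarrow> one_plus m Y \<in> GLO n"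
  unfolding one_plus_def by (rule GLO_one_plus[OF MP_mono[OF _ MP_smult_\<omega>]])

lemma one_plus_MP: "1 \<le> m \<Longrightarrow> Y \<in> MP 0 n \<Longrightarrow> one_plus m Y \<in> MP 0 n"
  by (rule GLO_MP[OF one_plus_GLO])

lemma one_plus_cong: "Y \<in> MP 0 n \<Longrightarrow> one_plus m Y - 1\<^sub>m n \<in> MP m n"
proof -
  assume Y: "Y \<in> MP 0 n"
  have "one_plus m Y - 1\<^sub>m n = \<omega> ^ m \<cdot>\<^sub>m Y"
    using MP_carrier[OF Y] unfolding one_plus_def by (intro eq_matI) auto
  then show ?thesis using MP_smult_\<omega>[OF Y] by simp
qed

lemma one_plus_mult:
  assumes "Y \<in> MP 0 n" "Z \<in> MP 0 n"
  shows "one_plus m Y * one_plus m Z = one_plus m (Y + Z + \<omega> ^ m \<cdot>\<^sub>m (Y * Z))"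
proof -
  note c = MP_carrier[OF assms(1)] MP_carrier[OF assms(2)]
  have "one_plus m Y * one_plus m Z = 1\<^sub>m n * one_plus m Z + \<omega> ^ m \<cdot>\<^sub>m Y * one_plus m Z"
    unfolding one_plus_def by (rule add_mult_distrib_mat[of _ n n _ _ n]) (use c in auto)
  also have "\<omega> ^ m \<cdot>\<^sub>m Y * one_plus m Z = \<omega> ^ m \<cdot>\<^sub>m (Y * one_plus m Z)"
    unfolding one_plus_def by (rule mult_smult_assoc_mat[of _ n n _ n]) (use c in auto)
  also have "Y * one_plus m Z = Y * 1\<^sub>m n + Y * (\<omega> ^ m \<cdot>\<^sub>m Z)"
    unfolding one_plus_def by (rule mult_add_distrib_mat[of _ n n _ n]) (use c in auto)
  also have "Y * (\<omega> ^ m \<cdot>\<^sub>m Z) = \<omega> ^ m \<cdot>\<^sub>m (Y * Z)" by (rule mult_smult_distrib[OF c])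
  also have "1\<^sub>m n * one_plus m Z + \<omega> ^ m \<cdot>\<^sub>m (Y * 1\<^sub>m n + \<omega> ^ m \<cdot>\<^sub>m (Y * Z)) =
      one_plus m (Y + Z + \<omega> ^ m \<cdot>\<^sub>m (Y * Z))"
    unfolding one_plus_def using c by (intro eq_matI) (auto simp: algebra_simps)
  finally show ?thesis .
qed

text \<open>The parameter of an element of the m-th congruence subgroup is determined modulo the
  power r - m, which is l' for \<open>N\<close> and l for \<open>H\<close>.\<close>

lemma one_plus_eq_iff:
  assumes "1 \<le> m" "m \<le> r" "Y \<in> MP 0 n" "Z \<in> MP 0 n"
  shows "rd (one_plus m Y) = rd (one_plus m Z) \<longleftrightarrow> Y - Z \<in> MP (r - m) n"
proof -
  note c = MP_carrier[OF assms(3)] MP_carrier[OF assms(4)]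
  have "one_plus m Y - one_plus m Z = \<omega> ^ m \<cdot>\<^sub>m (Y - Z)"
    unfolding one_plus_def using c by (intro eq_matI) (auto simp: algebra_simps)
  moreover have "Y - Z \<in> carrier_mat n n" by (rule minus_carrier_mat[OF c(2)])
  ultimately show ?thesis
    using rd_eq_iff[OF one_plus_MP[OF assms(1,3)] one_plus_MP[OF assms(1,4)]]
      MP_smult_\<omega>_iff[of "Y - Z" n m "r - m"] assms(2) by simp
qed

lemma cong_eq: "1 \<le> m \<Longrightarrow> m \<le> r \<Longrightarrow> cong_subgroup v n r m = {rd (one_plus m Y) | Y. Y \<in> MP 0 n}"
  unfolding one_plus_def by (rule cong_subgroup_eq)

lemma cong_iff:
  assumes "1 \<le> m" "m \<le> r" "M \<in> GLO n"
  shows "rd M \<in> cong_subgroup v n r m \<longleftrightarrow> M - 1\<^sub>m n \<in> MP m n"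
proof
  note c = MP_carrier[OF GLO_MP[OF assms(3)]]
  assume "rd M \<in> cong_subgroup v n r m"
  then obtain Y where Y: "Y \<in> MP 0 n" "rd M = rd (one_plus m Y)" by (auto simp: cong_eq[OF assms(1,2)])
  have "M - one_plus m Y \<in> MP m n"
    using MP_mono[OF assms(2)] rd_eq_iff[OF GLO_MP[OF assms(3)] one_plus_MP[OF assms(1) Y(1)]] Y(2) by simp
  then have "(M - one_plus m Y) + (one_plus m Y - 1\<^sub>m n) \<in> MP m n" using one_plus_cong[OF Y(1)] by simp
  moreover have "(M - one_plus m Y) + (one_plus m Y - 1\<^sub>m n) = M - 1\<^sub>m n"
    using c MP_carrier[OF one_plus_MP[OF assms(1) Y(1)]] by (intro eq_matI) auto
  ultimately show "M - 1\<^sub>m n \<in> MP m n" by simp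
next
  note c = MP_carrier[OF GLO_MP[OF assms(3)]]
  assume "M - 1\<^sub>m n \<in> MP m n"
  then obtain Y where Y: "Y \<in> MP 0 n" "M - 1\<^sub>m n = \<omega> ^ m \<cdot>\<^sub>m Y" using MP_eq by blast
  have "M = 1\<^sub>m n + (M - 1\<^sub>m n)" using c by (intro eq_matI) auto
  then have "M = one_plus m Y" using Y(2) by (simp add: one_plus_def)
  then show "rd M \<in> cong_subgroup v n r m" using Y(1) by (auto simp: cong_eq[OF assms(1,2)])
qed

sublocale G: group G by (rule GL_res_group)

lemma G_carrier: "carrier G = rd ` GLO n"
  by (rule GL_res_carrier[OF r_pos])

lemma rd_mult: "W \<in> MP 0 n \<Longrightarrow> Y \<in> MP 0 n \<Longrightarrow> rd W \<otimes>\<^bsub>G\<^esub> rd Y = rd (W * Y)"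
  by (rule GL_res_simps)

lemma rd_inv: "W \<in> GLO n \<Longrightarrow> inv\<^bsub>G\<^esub> (rd W) = rd (minv n W)"
  by (rule GL_res_inv[OF r_pos])

lemma rd_conj: "W \<in> GLO n \<Longrightarrow> Y \<in> MP 0 n \<Longrightarrow> rd W \<otimes>\<^bsub>G\<^esub> rd Y \<otimes>\<^bsub>G\<^esub> inv\<^bsub>G\<^esub> (rd W) = rd (W * Y * minv n W)"
  using minv(1)[of W n] GLO_MP[of W n] by (simp add: rd_inv rd_mult)

lemma conj_one_plus:
  assumes "W \<in> GLO n" "Y \<in> MP 0 n"
  shows "W * one_plus m Y * minv n W = one_plus m (W * Y * minv n W)"
proof -
  note c = MP_carrier[OF GLO_MP[OF assms(1)]] MP_carrier[OF assms(2)] MP_carrier[OF minv(1)[OF assms(1)]]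
  have "W * one_plus m Y = W * 1\<^sub>m n + W * (\<omega> ^ m \<cdot>\<^sub>m Y)"
    unfolding one_plus_def by (rule mult_add_distrib_mat[of _ n n _ n]) (use c in auto)
  also have "\<dots> = W + \<omega> ^ m \<cdot>\<^sub>m (W * Y)" using mult_smult_distrib[OF c(1,2)] c by simp
  finally have "W * one_plus m Y * minv n W = (W + \<omega> ^ m \<cdot>\<^sub>m (W * Y)) * minv n W" by simp
  also have "\<dots> = W * minv n W + \<omega> ^ m \<cdot>\<^sub>m (W * Y) * minv n W"
    by (rule add_mult_distrib_mat[of _ n n]) (use c in \<open>auto intro!: smult_carrier_mat mult_carrier_mat\<close>)
  also have "\<omega> ^ m \<cdot>\<^sub>m (W * Y) * minv n W = \<omega> ^ m \<cdot>\<^sub>m (W * Y * minv n W)"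
    by (rule mult_smult_assoc_mat[OF mult_carrier_mat[OF c(1,2)] c(3)])
  finally show ?thesis using minv(2)[OF assms(1)] by (simp add: one_plus_def)
qed

lemma cong_normal:
  assumes m: "1 \<le> m" "m \<le> r"
  shows "cong_subgroup v n r m \<lhd> G"
proof -
  have "(\<lambda>C. map_mat (\<lambda>C. C <+>\<^bsub>int_ring v\<^esub> \<P> m) C) \<in> hom G (GL_res v n m)"
  proof (rule homI)
    fix x y assume "x \<in> carrier G" "y \<in> carrier G"
    then obtain W Y where W: "W \<in> GLO n" "x = rd W" and Y: "Y \<in> GLO n" "y = rd Y" by (auto simp: G_carrier)
    show "map_mat (\<lambda>C. C <+>\<^bsub>int_ring v\<^esub> \<P> m) x \<in> carrier (GL_res v n m)"
      unfolding W(2) coarsen_red_mat[OF m(2)] using W(1) by (simp add: GL_res_carrier[OF m(1)])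
    show "map_mat (\<lambda>C. C <+>\<^bsub>int_ring v\<^esub> \<P> m) (x \<otimes>\<^bsub>G\<^esub> y) =
        map_mat (\<lambda>C. C <+>\<^bsub>int_ring v\<^esub> \<P> m) x \<otimes>\<^bsub>GL_res v n m\<^esub> map_mat (\<lambda>C. C <+>\<^bsub>int_ring v\<^esub> \<P> m) y"
      unfolding W(2) Y(2) rd_mult[OF GLO_MP[OF W(1)] GLO_MP[OF Y(1)]] coarsen_red_mat[OF m(2)]
      by (simp add: GL_res_simps(1)[OF GLO_MP[OF W(1)] GLO_MP[OF Y(1)]])
  qed
  then have "group_hom G (GL_res v n m) (map_mat (\<lambda>C. C <+>\<^bsub>int_ring v\<^esub> \<P> m))"
    by (intro group_hom.intro GL_res_group group_hom_axioms.intro) simp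
  then show ?thesis unfolding cong_subgroup_def by (rule group_hom.normal_kernel)
qed

lemma l_bounds: "1 \<le> l" "l \<le> r" "l' \<le> r"
  using l' by auto

text \<open>Another parameter for the same element differs by a matrix in the l'-th power, which
  changes the argument of \<tau> by an integral element.\<close>

lemma psi_eq:
  assumes Y: "Y \<in> MP 0 n"
  shows "\<psi> (rd (one_plus l Y)) = \<tau> (mtrace (Y * \<beta>) / \<omega> ^ l')"
  unfolding psi_def one_plus_def[symmetric] int_mats_eq
proof (rule the_equality)
  show "\<exists>Z\<in>MP 0 n. rd (one_plus l Y) = rd (one_plus l Z) \<and> \<tau> (mtrace (Y * \<beta>) / \<omega> ^ l') = \<tau> (mtrace (Z * \<beta>) / \<omega> ^ l')"
    using Y by blast
  fix c assume "\<exists>Z\<in>MP 0 n. rd (one_plus l Y) = rd (one_plus l Z) \<and> c = \<tau> (mtrace (Z * \<beta>) / \<omega> ^ l')"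
  then obtain Z where Z: "Z \<in> MP 0 n" "rd (one_plus l Y) = rd (one_plus l Z)" "c = \<tau> (mtrace (Z * \<beta>) / \<omega> ^ l')" by blast
  have "Z - Y \<in> MP l' n" using one_plus_eq_iff[OF l_bounds(1,2) Z(1) Y] Z(2) by simp
  then have "mtrace ((Z - Y) * \<beta>) \<in> \<P> l'" by (rule mtrace_P[OF MP_mult'[OF _ beta]])
  moreover have "mtrace ((Z - Y) * \<beta>) = mtrace (Z * \<beta>) - mtrace (Y * \<beta>)"
    unfolding minus_mult_distrib_mat[OF MP_carrier[OF Z(1)] MP_carrier[OF Y] beta_carrier]
    by (rule mtrace_diff[OF mult_carrier_mat[OF MP_carrier[OF Z(1)] beta_carrier] mult_carrier_mat[OF MP_carrier[OF Y] beta_carrier]])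
  ultimately have "mtrace (Z * \<beta>) / \<omega> ^ l' - mtrace (Y * \<beta>) / \<omega> ^ l' \<in> \<P> 0"
    by (simp add: diff_divide_distrib[symmetric] P_divide_iff)
  then show "c = \<tau> (mtrace (Y * \<beta>) / \<omega> ^ l')" unfolding Z(3) by (rule tau_congr)
qed

lemma mtrace_add_beta: "W \<in> MP 0 n \<Longrightarrow> Y \<in> MP 0 n \<Longrightarrow> mtrace ((W + Y) * \<beta>) = mtrace (W * \<beta>) + mtrace (Y * \<beta>)"
  by (simp only: add_mult_distrib_mat[OF MP_carrier[of W 0 n] MP_carrier[of Y 0 n] beta_carrier]
      mtrace_add[OF mult_carrier_mat[OF MP_carrier[of W 0 n] beta_carrier]
        mult_carrier_mat[OF MP_carrier[of Y 0 n] beta_carrier]])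

lemma N_elt: "h \<in> N \<Longrightarrow> \<exists>Y\<in>MP 0 n. h = rd (one_plus l Y)"
  unfolding cong_eq[OF l_bounds(1,2)] by blast

text \<open>The cross term \<omega>^l Y Z contributes an integral element to the exponent because l
  is at least l'.\<close>

lemma psi_mult: "h \<in> N \<Longrightarrow> k \<in> N \<Longrightarrow> \<psi> (h \<otimes>\<^bsub>G\<^esub> k) = \<psi> h * \<psi> k"
proof -
  assume "h \<in> N" "k \<in> N"
  then obtain Y Z where Y: "Y \<in> MP 0 n" "h = rd (one_plus l Y)" and Z: "Z \<in> MP 0 n" "k = rd (one_plus l Z)"
    using N_elt by blast
  let ?T = "\<omega> ^ l \<cdot>\<^sub>m (Y * Z)"
  have T: "?T \<in> MP l n" by (rule MP_smult_\<omega>[OF MP_mult[OF Y(1) Z(1)]])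
  note T = T MP_int[OF T]
  have YZ: "Y + Z \<in> MP 0 n" using Y Z by simp
  have "h \<otimes>\<^bsub>G\<^esub> k = rd (one_plus l (Y + Z + ?T))"
    using Y Z one_plus_MP[OF l_bounds(1)] by (simp add: rd_mult one_plus_mult)
  then have "\<psi> (h \<otimes>\<^bsub>G\<^esub> k) = \<tau> (mtrace ((Y + Z + ?T) * \<beta>) / \<omega> ^ l')" using psi_eq[of "Y + Z + ?T"] YZ T by simp
  also have "\<dots> = \<tau> ((mtrace (Y * \<beta>) + mtrace (Z * \<beta>)) / \<omega> ^ l')"
  proof (rule tau_congr)
    have "mtrace (?T * \<beta>) \<in> \<P> l'" by (rule mtrace_P[OF MP_mult'[OF MP_mono[OF l'(2) T(1)] beta]])
    then show "mtrace ((Y + Z + ?T) * \<beta>) / \<omega> ^ l' - (mtrace (Y * \<beta>) + mtrace (Z * \<beta>)) / \<omega> ^ l' \<in> \<P> 0"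
      using mtrace_add_beta[OF YZ T(2)] mtrace_add_beta[OF Y(1) Z(1)]
      by (simp add: diff_divide_distrib[symmetric] P_divide_iff)
  qed
  also have "\<dots> = \<psi> h * \<psi> k" using Y Z psi_eq by (simp add: add_divide_distrib tau_add)
  finally show ?thesis .
qed

text \<open>Multiplication by W or its inverse preserves congruences, so the two conjugation
  conditions and the commutator condition can be exchanged. The first occurs in \<open>stab\<close>,
  the second in conjugating \<psi>.\<close>

lemma commute_iff:
  assumes W: "W \<in> GLO n"
  shows "W * \<beta> * minv n W - \<beta> \<in> MP k n \<longleftrightarrow> W * \<beta> - \<beta> * W \<in> MP k n"
    "minv n W * \<beta> * W - \<beta> \<in> MP k n \<longleftrightarrow> W * \<beta> - \<beta> * W \<in> MP k n"
proof -
  note m = minv[OF W] and XM = GLO_MP[OF W]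
  note c = MP_carrier[OF XM] MP_carrier[OF m(1)] beta_carrier
  have 1: "(W * \<beta> * minv n W - \<beta>) * W = W * \<beta> - \<beta> * W"
  proof -
    have "(W * \<beta> * minv n W - \<beta>) * W = W * \<beta> * minv n W * W - \<beta> * W"
      by (rule minus_mult_distrib_mat[of _ n n]) (use c in \<open>auto intro!: mult_carrier_mat\<close>)
    also have "W * \<beta> * minv n W * W = W * \<beta>"
      using assoc_mult_mat[OF mult_carrier_mat[OF c(1,3)] c(2,1)] m(3) right_mult_one_mat[OF mult_carrier_mat[OF c(1,3)]] by simp
    finally show ?thesis .
  qed
  have 2: "(W * \<beta> - \<beta> * W) * minv n W = W * \<beta> * minv n W - \<beta>"
  proof -
    have "(W * \<beta> - \<beta> * W) * minv n W = W * \<beta> * minv n W - \<beta> * W * minv n W"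
      by (rule minus_mult_distrib_mat[of _ n n]) (use c in \<open>auto intro!: mult_carrier_mat\<close>)
    also have "\<beta> * W * minv n W = \<beta>" using assoc_mult_mat[OF c(3,1,2)] m(2) c(3) by simp
    finally show ?thesis .
  qed
  have 3: "W * (\<beta> - minv n W * \<beta> * W) = W * \<beta> - \<beta> * W"
  proof -
    have "W * (\<beta> - minv n W * \<beta> * W) = W * \<beta> - W * (minv n W * \<beta> * W)"
      by (rule mult_minus_distrib_mat[of _ n n _ n]) (use c in \<open>auto intro!: mult_carrier_mat\<close>)
    also have "W * (minv n W * \<beta> * W) = W * minv n W * (\<beta> * W)"
      using c by (simp add: assoc_mult_mat[of _ n n _ n _ n] mult_carrier_mat[of _ n n _ n])
    also have "\<dots> = \<beta> * W" using m(2) left_mult_one_mat[OF mult_carrier_mat[OF c(3,1)]] by simp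
    finally show ?thesis .
  qed
  have 4: "minv n W * (W * \<beta> - \<beta> * W) = \<beta> - minv n W * \<beta> * W"
  proof -
    have "minv n W * (W * \<beta> - \<beta> * W) = minv n W * (W * \<beta>) - minv n W * (\<beta> * W)"
      by (rule mult_minus_distrib_mat[of _ n n _ n]) (use c in \<open>auto intro!: mult_carrier_mat\<close>)
    also have "minv n W * (W * \<beta>) = \<beta>" using assoc_mult_mat[OF c(2,1,3)] m(3) c(3) by simp
    also have "minv n W * (\<beta> * W) = minv n W * \<beta> * W" using assoc_mult_mat[OF c(2,3,1)] by simp
    finally show ?thesis .
  qed
  show "W * \<beta> * minv n W - \<beta> \<in> MP k n \<longleftrightarrow> W * \<beta> - \<beta> * W \<in> MP k n"
    using 1 2 MP_mult'[OF _ XM, of "W * \<beta> * minv n W - \<beta>" k] MP_mult'[OF _ m(1), of "W * \<beta> - \<beta> * W" k] by auto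
  have neg: "- (\<beta> - minv n W * \<beta> * W) = minv n W * \<beta> * W - \<beta>"
    using c by (intro eq_matI) auto
  have neg': "- (minv n W * \<beta> * W - \<beta>) = \<beta> - minv n W * \<beta> * W"
    using c by (intro eq_matI) auto
  show "minv n W * \<beta> * W - \<beta> \<in> MP k n \<longleftrightarrow> W * \<beta> - \<beta> * W \<in> MP k n"
  proof
    assume "minv n W * \<beta> * W - \<beta> \<in> MP k n"
    then have "\<beta> - minv n W * \<beta> * W \<in> MP k n" using MP_uminus neg' by metis
    then show "W * \<beta> - \<beta> * W \<in> MP k n" using MP_mult[OF XM, of "\<beta> - minv n W * \<beta> * W" k] 3 by simp
  next
    assume "W * \<beta> - \<beta> * W \<in> MP k n"
    then have "\<beta> - minv n W * \<beta> * W \<in> MP k n" using MP_mult[OF m(1), of "W * \<beta> - \<beta> * W" k] 4 by simp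
    then show "minv n W * \<beta> * W - \<beta> \<in> MP k n" using MP_uminus neg by metis
  qed
qed

lemma minv_unique:
  assumes "g \<in> MP 0 n" "h \<in> MP 0 n" "g * h = 1\<^sub>m n" "h * g = 1\<^sub>m n"
  shows "g \<in> GLO n" "h = minv n g"
proof -
  show g: "g \<in> GLO n" using assms by (auto simp: GLO_def)
  note m = minv[OF g]
  have "h = h * (g * minv n g)" by (simp only: m(2) right_mult_one_mat[OF MP_carrier[OF assms(2)]])
  also have "\<dots> = minv n g"
    using assoc_mult_mat[OF MP_carrier[OF assms(2)] MP_carrier[OF assms(1)] MP_carrier[OF m(1)]] assms(4) left_mult_one_mat[OF MP_carrier[OF m(1)]] by simp
  finally show "h = minv n g" .
qed

lemma commutator_congr:
  assumes "W \<in> MP 0 n" "Y \<in> MP 0 n" "W - Y \<in> MP k n"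
  shows "W * \<beta> - \<beta> * W \<in> MP k n \<longleftrightarrow> Y * \<beta> - \<beta> * Y \<in> MP k n"
proof -
  note c = MP_carrier[OF assms(1)] MP_carrier[OF assms(2)] beta_carrier
  let ?E = "(W - Y) * \<beta> - \<beta> * (W - Y)"
  have E: "?E \<in> MP k n" using assms(3) beta by simp
  have e: "?E = (W * \<beta> - Y * \<beta>) - (\<beta> * W - \<beta> * Y)"
    unfolding minus_mult_distrib_mat[OF c] mult_minus_distrib_mat[OF c(3,1,2)] ..
  have "W * \<beta> - \<beta> * W = ?E + (Y * \<beta> - \<beta> * Y)" "Y * \<beta> - \<beta> * Y = (W * \<beta> - \<beta> * W) - ?E"
    unfolding e using c by (auto intro!: eq_matI)
  then show ?thesis using MP_add[OF E] MP_diff[OF _ E] by metis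
qed

lemma stab_eq: "S = {rd W | W. W \<in> GLO n \<and> W * \<beta> - \<beta> * W \<in> MP l' n}"
proof (intro Set.set_eqI iffI)
  fix g assume "g \<in> S"
  then obtain W h where W: "W \<in> MP 0 n" "h \<in> MP 0 n" "W * h = 1\<^sub>m n" "h * W = 1\<^sub>m n" "g = rd W"
    "red_mat v l' (W * \<beta> * h) = red_mat v l' \<beta>" by (auto simp: stab_def)
  note u = minv_unique[OF W(1-4)]
  have "W * \<beta> * minv n W - \<beta> \<in> MP l' n"
    using W(6) unfolding u(2) by (subst (asm) red_mat_eq_iff[of _ n]) (use W minv(1)[OF u(1)] beta in auto)
  then show "g \<in> {rd W | W. W \<in> GLO n \<and> W * \<beta> - \<beta> * W \<in> MP l' n}"
    using W(5) u(1) commute_iff(1)[OF u(1)] by blast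
next
  fix g assume "g \<in> {rd W | W. W \<in> GLO n \<and> W * \<beta> - \<beta> * W \<in> MP l' n}"
  then obtain W where W: "W \<in> GLO n" "g = rd W" "W * \<beta> - \<beta> * W \<in> MP l' n" by blast
  have "red_mat v l' (W * \<beta> * minv n W) = red_mat v l' \<beta>"
    by (subst red_mat_eq_iff[of _ n]) (use W minv(1)[OF W(1)] GLO_MP[OF W(1)] beta commute_iff(1)[OF W(1)] in auto)
  then show "g \<in> S" unfolding stab_def int_mats_eq
    using W minv[OF W(1)] GLO_MP[OF W(1)] by (intro CollectI exI[of _ W] exI[of _ "minv n W"]) auto
qed

text \<open>By cyclicity of the trace, conjugating Y by W amounts to conjugating \<beta> by the
  inverse of W. The extra factor measures how far W is from fixing \<beta>.\<close>

lemma psi_conj: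
  assumes W: "W \<in> GLO n" and Y: "Y \<in> MP 0 n"
  shows "\<psi> (rd W \<otimes>\<^bsub>G\<^esub> rd (one_plus l Y) \<otimes>\<^bsub>G\<^esub> inv\<^bsub>G\<^esub> (rd W)) =
    \<psi> (rd (one_plus l Y)) * \<tau> (mtrace (Y * (minv n W * \<beta> * W - \<beta>)) / \<omega> ^ l')"
proof -
  note m = minv[OF W] and XM = GLO_MP[OF W]
  note c = MP_carrier[OF XM] MP_carrier[OF Y] MP_carrier[OF m(1)] beta_carrier
  have WY: "W * Y * minv n W \<in> MP 0 n" using XM Y m by simp
  have "mtrace (W * Y * minv n W * \<beta>) = mtrace (Y * (minv n W * \<beta> * W))"
  proof -
    have "W * Y * minv n W * \<beta> = W * (Y * (minv n W * \<beta>))"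
      using c by (simp add: assoc_mult_mat[of _ n n _ n _ n] mult_carrier_mat[of _ n n _ n])
    also have "mtrace \<dots> = mtrace (Y * (minv n W * \<beta>) * W)"
      using c by (intro mtrace_mult_comm[of _ n n]) (auto intro!: mult_carrier_mat)
    also have "Y * (minv n W * \<beta>) * W = Y * (minv n W * \<beta> * W)"
      using c by (simp add: assoc_mult_mat[of _ n n _ n _ n] mult_carrier_mat[of _ n n _ n])
    finally show ?thesis .
  qed
  also have "\<dots> = mtrace (Y * \<beta>) + mtrace (Y * (minv n W * \<beta> * W - \<beta>))"
  proof -
    have cc: "minv n W * \<beta> * W \<in> carrier_mat n n" using c by (auto intro!: mult_carrier_mat)
    have "Y * (minv n W * \<beta> * W - \<beta>) = Y * (minv n W * \<beta> * W) - Y * \<beta>"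
      by (rule mult_minus_distrib_mat[OF c(2) cc c(4)])
    then show ?thesis using mtrace_diff[OF mult_carrier_mat[OF c(2) cc] mult_carrier_mat[OF c(2,4)]] by simp
  qed
  finally have tr: "mtrace (W * Y * minv n W * \<beta>) / \<omega> ^ l' =
      mtrace (Y * \<beta>) / \<omega> ^ l' + mtrace (Y * (minv n W * \<beta> * W - \<beta>)) / \<omega> ^ l'"
    by (simp add: add_divide_distrib)
  show ?thesis
    unfolding rd_conj[OF W one_plus_MP[OF l_bounds(1) Y]] conj_one_plus[OF W Y] psi_eq[OF WY] psi_eq[OF Y] tr tau_add ..
qed

text \<open>By \<open>psi_conj\<close>, g fixes \<psi> precisely when \<tau> is trivial on tr(Y
  D)/\<omega>^l' for all integral Y, with D the defect of W. The nondegenerate trace form and the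
  conductor of \<tau> make this the congruence D = 0 modulo the l'-th power.\<close>

lemma stab_iff: "S = {g \<in> carrier G. \<forall>h\<in>N. \<psi> (g \<otimes>\<^bsub>G\<^esub> h \<otimes>\<^bsub>G\<^esub> inv\<^bsub>G\<^esub> g) = \<psi> h}"
proof (intro Set.set_eqI iffI)
  fix g assume "g \<in> S"
  then obtain W where W: "W \<in> GLO n" "g = rd W" "W * \<beta> - \<beta> * W \<in> MP l' n" by (auto simp: stab_eq)
  have D: "minv n W * \<beta> * W - \<beta> \<in> MP l' n" using commute_iff(2)[OF W(1)] W(3) by simp
  have "\<psi> (g \<otimes>\<^bsub>G\<^esub> h \<otimes>\<^bsub>G\<^esub> inv\<^bsub>G\<^esub> g) = \<psi> h" if "h \<in> N" for h
  proof -
    note hN = that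
    obtain Y where Y: "Y \<in> MP 0 n" "h = rd (one_plus l Y)" using N_elt[OF hN] by blast
    have "mtrace (Y * (minv n W * \<beta> * W - \<beta>)) \<in> \<P> l'" by (rule mtrace_P[OF MP_mult[OF Y(1) D]])
    then have "mtrace (Y * (minv n W * \<beta> * W - \<beta>)) / \<omega> ^ l' \<in> \<P> 0" by (simp add: P_divide_iff)
    then show ?thesis using psi_conj[OF W(1) Y(1)] tau_P0 W(2) Y(2) by simp
  qed
  then show "g \<in> {g \<in> carrier G. \<forall>h\<in>N. \<psi> (g \<otimes>\<^bsub>G\<^esub> h \<otimes>\<^bsub>G\<^esub> inv\<^bsub>G\<^esub> g) = \<psi> h}"
    using W by (auto simp: G_carrier)
next
  fix g assume g: "g \<in> {g \<in> carrier G. \<forall>h\<in>N. \<psi> (g \<otimes>\<^bsub>G\<^esub> h \<otimes>\<^bsub>G\<^esub> inv\<^bsub>G\<^esub> g) = \<psi> h}"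
  then obtain W where W: "W \<in> GLO n" "g = rd W" by (auto simp: G_carrier)
  have "minv n W * \<beta> * W - \<beta> \<in> MP l' n"
  proof (rule tau_trace)
    show "minv n W * \<beta> * W - \<beta> \<in> MP 0 n" using minv(1)[OF W(1)] GLO_MP[OF W(1)] beta by simp
    fix Y assume Y: "Y \<in> MP 0 n"
    have "rd (one_plus l Y) \<in> N" using Y cong_eq[OF l_bounds(1,2)] by blast
    then have "\<psi> (rd (one_plus l Y)) = \<psi> (rd (one_plus l Y)) * \<tau> (mtrace (Y * (minv n W * \<beta> * W - \<beta>)) / \<omega> ^ l')"
      using g psi_conj[OF W(1) Y] W(2) by auto
    moreover have "\<psi> (rd (one_plus l Y)) \<noteq> 0" unfolding psi_eq[OF Y] by (rule tau_nz)
    ultimately show "\<tau> (mtrace (Y * (minv n W * \<beta> * W - \<beta>)) / \<omega> ^ l') = 1" by simp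
  qed
  then show "g \<in> S" using W commute_iff(2)[OF W(1)] by (auto simp: stab_eq)
qed

sublocale CS: character_stabilizer G N \<psi> S
proof (intro character_stabilizer.intro character_stabilizer_axioms.intro)
  show "group G" by (rule GL_res_group)
  show "finite (carrier G)" by (rule GL_res_finite)
  show "subgroup N G" using cong_normal[OF l_bounds(1,2)] by (rule normal.axioms(1))
  show "\<And>g h. g \<in> carrier G \<Longrightarrow> h \<in> N \<Longrightarrow> g \<otimes>\<^bsub>G\<^esub> h \<otimes>\<^bsub>G\<^esub> inv\<^bsub>G\<^esub> g \<in> N"
    using normal.inv_op_closed2[OF cong_normal[OF l_bounds(1,2)]] by blast
  show "\<And>h k. h \<in> N \<Longrightarrow> k \<in> N \<Longrightarrow> \<psi> (h \<otimes>\<^bsub>G\<^esub> k) = \<psi> h * \<psi> k" by (rule psi_mult)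
  show "\<psi> h \<noteq> 0" if "h \<in> N" for h using N_elt[OF that] psi_eq tau_nz by auto
  show "S = {g \<in> carrier G. \<forall>h\<in>N. \<psi> (g \<otimes>\<^bsub>G\<^esub> h \<otimes>\<^bsub>G\<^esub> inv\<^bsub>G\<^esub> g) = \<psi> h}" by (rule stab_iff)
qed

section \<open>The centralizer and the factorization of the stabilizer\<close>

lemma Ob_commute: "x \<in> Ob \<Longrightarrow> x * \<beta> - \<beta> * x = 0\<^sub>m n n"
  using Kc_closed(6)[OF Ob_Kc Kc_beta, of x] beta_carrier Ob_carrier[of x] by (intro eq_matI) auto

text \<open>The element of O[\<beta>] supplied by \<open>commutant\<close> is congruent to the
  invertible W modulo the maximal ideal, since k is at least 1, and O[\<beta>] is local, so it is a
  unit.\<close>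

lemma lift_commuting:
  assumes W: "W \<in> GLO n" "W * \<beta> - \<beta> * W \<in> MP k n" and k: "1 \<le> k"
  shows "\<exists>x\<in>Ob \<inter> GLO n. W - x \<in> MP k n"
proof -
  obtain x where x: "x \<in> Ob" "W - x \<in> MP k n" using commutant[OF GLO_MP[OF W(1)] W(2)] by blast
  have "x \<notin> MP 1 n"
  proof
    assume "x \<in> MP 1 n"
    then have "(W - x) + x \<in> MP 1 n" using MP_mono[OF k x(2)] by simp
    moreover have "(W - x) + x = W" using MP_carrier[OF GLO_MP[OF W(1)]] Ob_carrier[OF x(1)] by (intro eq_matI) auto
    ultimately show False using GLO_nonzero[OF W(1)] by simp
  qed
  then show ?thesis using x Ob_unit_iff by blast
qed

lemma A_eq: "A = rd ` (Ob \<inter> GLO n)"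
proof (intro Set.set_eqI iffI)
  fix g assume g: "g \<in> A"
  then obtain W where W: "W \<in> GLO n" "g = rd W" by (auto simp: G_cent_def G_carrier)
  have "W * \<beta> - \<beta> * W \<in> MP r n"
    using g W GLO_MP[OF W(1)] beta by (simp add: G_cent_def red_mat_mult rd_eq_iff)
  then obtain x where x: "x \<in> Ob \<inter> GLO n" "W - x \<in> MP r n" using lift_commuting[OF W(1) _ r_pos] by blast
  then have "g = rd x" using W rd_eq_iff[OF GLO_MP[OF W(1)] Ob_MP, of x] by simp
  then show "g \<in> rd ` (Ob \<inter> GLO n)" using x by blast
next
  fix g assume "g \<in> rd ` (Ob \<inter> GLO n)"
  then obtain x where x: "x \<in> Ob" "x \<in> GLO n" "g = rd x" by blast
  have "x * \<beta> = \<beta> * x" by (rule Kc_closed(6)[OF Ob_Kc[OF x(1)] Kc_beta])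
  then show "g \<in> A" using x beta GLO_MP[OF x(2)] by (auto simp: G_cent_def G_carrier red_mat_mult)
qed

lemma A_subgroup: "subgroup A G"
proof (rule G.subgroupI)
  show "A \<subseteq> carrier G" by (auto simp: A_eq G_carrier)
  have "1\<^sub>m n \<in> Ob \<inter> GLO n" using Ob_one one_plus_GLO[of 1 "0\<^sub>m n n"] by (simp add: one_plus_def)
  then show "A \<noteq> {}" by (auto simp: A_eq)
  fix a assume "a \<in> A"
  then obtain x where x: "x \<in> Ob" "x \<in> GLO n" "a = rd x" by (auto simp: A_eq)
  show "inv\<^bsub>G\<^esub> a \<in> A" unfolding x(3) rd_inv[OF x(2)] A_eq using minv_Ob[OF x(1,2)] minv(4)[OF x(2)] by blast
  fix b assume "b \<in> A"
  then obtain y where y: "y \<in> Ob" "y \<in> GLO n" "b = rd y" by (auto simp: A_eq)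
  show "a \<otimes>\<^bsub>G\<^esub> b \<in> A"
    unfolding x(3) y(3) rd_mult[OF GLO_MP[OF x(2)] GLO_MP[OF y(2)]] A_eq
    using Ob_closed(2)[OF x(1) y(1)] GLO_mult[OF x(2) y(2)] by blast
qed

lemma A_commute: "a \<in> A \<Longrightarrow> b \<in> A \<Longrightarrow> a \<otimes>\<^bsub>G\<^esub> b = b \<otimes>\<^bsub>G\<^esub> a"
  using Kc_closed(6)[OF Ob_Kc Ob_Kc] GLO_MP by (auto simp: A_eq rd_mult)

text \<open>A representative W of a stabilizing element is congruent modulo the l'-th power to a
  unit x of O[\<beta>]; then W = x (x^-1 W), and the second factor reduces into
  \<open>H\<close>.\<close>

lemma S_AH: "S = {a \<otimes>\<^bsub>G\<^esub> h | a h. a \<in> A \<and> h \<in> H}"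
proof (intro Set.set_eqI iffI)
  fix g assume "g \<in> S"
  then obtain W where W: "W \<in> GLO n" "g = rd W" "W * \<beta> - \<beta> * W \<in> MP l' n" by (auto simp: stab_eq)
  obtain x where x: "x \<in> Ob" "x \<in> GLO n" "W - x \<in> MP l' n" using lift_commuting[OF W(1,3) l'(1)] by blast
  note m = minv[OF x(2)]
  note c = MP_carrier[OF GLO_MP[OF W(1)]] Ob_carrier[OF x(1)] MP_carrier[OF m(1)]
  have hG: "minv n x * W \<in> GLO n" by (rule GLO_mult[OF m(4) W(1)])
  have "minv n x * W - 1\<^sub>m n = minv n x * (W - x)"
    using mult_minus_distrib_mat[OF c(3,1,2)] m(3) by simp
  also have "\<dots> \<in> MP l' n" using MP_mult[OF m(1) x(3)] .
  finally have h: "rd (minv n x * W) \<in> H" using cong_iff[OF l'(1) l_bounds(3) hG] by simp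
  have "rd x \<otimes>\<^bsub>G\<^esub> rd (minv n x * W) = rd (x * (minv n x * W))"
    by (rule rd_mult[OF Ob_MP[OF x(1)] GLO_MP[OF hG]])
  also have "x * (minv n x * W) = W" using assoc_mult_mat[OF c(2,3,1)] m(2) c(1) by simp
  finally have "g = rd x \<otimes>\<^bsub>G\<^esub> rd (minv n x * W)" using W(2) by simp
  then show "g \<in> {a \<otimes>\<^bsub>G\<^esub> h | a h. a \<in> A \<and> h \<in> H}" using h x by (auto simp: A_eq)
next
  fix g assume "g \<in> {a \<otimes>\<^bsub>G\<^esub> h | a h. a \<in> A \<and> h \<in> H}"
  then obtain a h where a: "a \<in> A" and h: "h \<in> H" and g: "g = a \<otimes>\<^bsub>G\<^esub> h" by blast
  obtain x where x: "x \<in> Ob" "x \<in> GLO n" "a = rd x" using a by (auto simp: A_eq)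
  obtain Y where Y: "Y \<in> MP 0 n" "h = rd (one_plus l' Y)" using h by (auto simp: cong_eq[OF l'(1) l_bounds(3)])
  have aS: "a \<in> S" unfolding stab_eq using x Ob_commute[OF x(1)] by (intro CollectI exI[of _ x]) simp
  have one: "1\<^sub>m n * \<beta> - \<beta> * 1\<^sub>m n = 0\<^sub>m n n" using Ob_commute[OF Ob_one] .
  have "one_plus l' Y * \<beta> - \<beta> * one_plus l' Y \<in> MP l' n"
    using commutator_congr[OF one_plus_MP[OF l'(1) Y(1)] MP_one one_plus_cong[OF Y(1)]] one by simp
  then have "h \<in> S" unfolding stab_eq using Y one_plus_GLO[OF l'(1) Y(1)] by blast
  then show "g \<in> S" unfolding g using subgroup.m_closed[OF CS.S_subgroup aS] by simp
qed

lemma H_subgroup: "subgroup H G"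
  using cong_normal[OF l'(1) l_bounds(3)] by (rule normal.axioms(1))

lemma H_conj: "g \<in> carrier G \<Longrightarrow> h \<in> H \<Longrightarrow> inv\<^bsub>G\<^esub> g \<otimes>\<^bsub>G\<^esub> h \<otimes>\<^bsub>G\<^esub> g \<in> H"
  using normal.inv_op_closed1[OF cong_normal[OF l'(1) l_bounds(3)]] by blast

section \<open>Characters of the units of the integer ring\<close>

lemma coset_eq: "x \<in> Ob \<Longrightarrow> pK_pow v \<omega> n \<beta> m +>\<^bsub>OK v n \<beta>\<^esub> x = {z \<in> Ob. z - x \<in> MP m n}"
proof (intro Set.set_eqI iffI)
  assume x: "x \<in> Ob"
  fix z assume "z \<in> pK_pow v \<omega> n \<beta> m +>\<^bsub>OK v n \<beta>\<^esub> x"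
  then obtain h where h: "h \<in> Ob" "h \<in> MP m n" "z = h + x" by (auto simp: a_r_coset_def' pK_pow_eq)
  have "z - x = h" unfolding h(3) using Ob_carrier[OF x] Ob_carrier[OF h(1)] by (intro eq_matI) auto
  then show "z \<in> {z \<in> Ob. z - x \<in> MP m n}" using h Ob_closed(1)[OF h(1) x] by simp
next
  assume x: "x \<in> Ob"
  fix z assume z: "z \<in> {z \<in> Ob. z - x \<in> MP m n}"
  then have "z = (z - x) + x" using Ob_carrier[OF x] Ob_carrier[of z] by (intro eq_matI) auto
  moreover have "z - x \<in> Ob" using Ob_closed(5)[of z x] z x by simp
  ultimately show "z \<in> pK_pow v \<omega> n \<beta> m +>\<^bsub>OK v n \<beta>\<^esub> x" using z by (auto simp: a_r_coset_def' pK_pow_eq)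
qed

abbreviation \<Theta> :: "('f mat \<Rightarrow> complex) set" where "\<Theta> \<equiv> theta_set v \<omega> \<tau> n l l' \<beta>"

definition A_chars :: "('f set mat \<Rightarrow> complex) set" where
  "A_chars = {\<theta> \<in> mult_chars (G\<lparr>carrier := A\<rparr>). \<forall>h\<in>A \<inter> N. \<theta> h = \<psi> h}"

lemma mult_chars_iff:
  "\<chi> \<in> mult_chars K \<longleftrightarrow> (\<forall>x\<in>carrier K. \<chi> x \<noteq> 0) \<and>
     (\<forall>x\<in>carrier K. \<forall>y\<in>carrier K. \<chi> (x \<otimes>\<^bsub>K\<^esub> y) = \<chi> x * \<chi> y) \<and> \<chi> \<in> extensional (carrier K)"
proof -
  have "Units (class_ring :: complex ring) = {x. x \<noteq> 0}"
    by (auto simp: Units_def) (metis left_inverse mult.commute)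
  then show ?thesis by (auto simp: mult_chars_def hom_def units_of_def Pi_def)
qed

lemma units_OK: "carrier (units_of (OK v n \<beta>)) = Ob \<inter> GLO n" "mult (units_of (OK v n \<beta>)) = (*)"
  by (simp_all add: units_of_def Units_OK)

lemma theta_congr:
  assumes \<theta>: "\<theta> \<in> \<Theta>" and x: "x \<in> Ob \<inter> GLO n" and y: "y \<in> Ob \<inter> GLO n" and e: "rd x = rd y"
  shows "\<theta> x = \<theta> y"
proof -
  obtain \<theta>' where \<theta>': "\<And>x. x \<in> Ob \<inter> GLO n \<Longrightarrow> \<theta> x = \<theta>' (pK_pow v \<omega> n \<beta> r +>\<^bsub>OK v n \<beta>\<^esub> x)"
    using \<theta> by (auto simp: theta_set_def Units_OK)
  have xy: "x - y \<in> MP r n" using e rd_eq_iff[OF Ob_MP Ob_MP, of x y] x y by simp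
  note c = Ob_carrier[of x] Ob_carrier[of y]
  have "z - x \<in> MP r n \<longleftrightarrow> z - y \<in> MP r n" if "z \<in> Ob" for z
  proof -
    have "z - y = (z - x) + (x - y)" "z - x = (z - y) - (x - y)"
      using c Ob_carrier[OF that] x y by (auto intro!: eq_matI)
    then show ?thesis using MP_add[OF _ xy, of "z - x"] MP_diff[OF _ xy, of "z - y"] by metis
  qed
  then have "pK_pow v \<omega> n \<beta> r +>\<^bsub>OK v n \<beta>\<^esub> x = pK_pow v \<omega> n \<beta> r +>\<^bsub>OK v n \<beta>\<^esub> y"
    using x y by (auto simp: coset_eq)
  then show ?thesis using \<theta>' x y by metis
qed

lemma theta_G_eq:
  assumes \<theta>: "\<theta> \<in> \<Theta>" and x: "x \<in> Ob \<inter> GLO n"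
  shows "theta_G v n r \<beta> \<theta> (rd x) = \<theta> x"
  unfolding theta_G_def Units_OK
proof (rule the_equality)
  show "\<exists>y\<in>Ob \<inter> GLO n. rd x = rd y \<and> \<theta> x = \<theta> y" using x by blast
  fix c assume "\<exists>y\<in>Ob \<inter> GLO n. rd x = rd y \<and> c = \<theta> y"
  then obtain y where y: "y \<in> Ob \<inter> GLO n" "rd x = rd y" "c = \<theta> y" by blast
  show "c = \<theta> x" unfolding y(3) by (rule theta_congr[OF \<theta> x y(1,2), symmetric])
qed

lemma Ob_MP_div: "z \<in> Ob \<Longrightarrow> z \<in> MP m n \<Longrightarrow> \<exists>y\<in>Ob. z = \<omega> ^ m \<cdot>\<^sub>m y"
proof -
  assume z: "z \<in> Ob" "z \<in> MP m n"
  then obtain y where y: "y \<in> MP 0 n" "z = \<omega> ^ m \<cdot>\<^sub>m y" using MP_eq by blast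
  have "y = inverse (\<omega> ^ m) \<cdot>\<^sub>m z" unfolding y(2) by (simp add: smult_smult_mat smult_one_mat)
  then have "y \<in> Kc" using Kc_closed(3)[OF Ob_Kc[OF z(1)] Ob_Kc[OF z(1)]] by simp
  then show ?thesis using Kc_int y by blast
qed

lemma one_plus_Ob: "1 \<le> m \<Longrightarrow> y \<in> Ob \<Longrightarrow> one_plus m y \<in> Ob \<inter> GLO n"
  using one_plus_GLO[OF _ Ob_MP] Ob_closed(1)[OF Ob_one Ob_closed(3)[OF _ _ P_int[OF \<omega>_P]]]
  by (simp add: one_plus_def)

lemma psi_Ob:
  assumes y: "y \<in> Ob"
  shows "\<psi> (rd (one_plus l y)) = \<tau> (field_trace n \<beta> (\<beta> * y) / \<omega> ^ l')"
proof -
  have "field_trace n \<beta> (\<beta> * y) = mtrace (\<beta> * y)" by (rule field_trace_eq[OF Kc_closed(2)[OF Kc_beta Ob_Kc[OF y]]])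
  then show ?thesis by (simp only: psi_eq[OF Ob_MP[OF y]] Kc_closed(6)[OF Kc_beta Ob_Kc[OF y]])
qed

text \<open>For x in O[\<beta>], saturation keeps (x - 1)/\<omega>^m in O[\<beta>], so the parameter
  can be chosen to commute with \<beta>.\<close>

lemma AN_elt:
  assumes "g \<in> A" "g \<in> cong_subgroup v n r m" "1 \<le> m" "m \<le> r"
  shows "\<exists>y\<in>Ob. g = rd (one_plus m y)"
proof -
  obtain x where x: "x \<in> Ob" "x \<in> GLO n" "g = rd x" using assms(1) by (auto simp: A_eq)
  have "x - 1\<^sub>m n \<in> MP m n" using assms x cong_iff[OF assms(3,4) x(2)] by simp
  then obtain y where y: "y \<in> Ob" "x - 1\<^sub>m n = \<omega> ^ m \<cdot>\<^sub>m y" using Ob_MP_div[OF Ob_closed(5)[OF x(1) Ob_one]] by blast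
  have "x = 1\<^sub>m n + (x - 1\<^sub>m n)" using Ob_carrier[OF x(1)] by (intro eq_matI) auto
  then show ?thesis using x y by (auto simp: one_plus_def)
qed

definition to_A :: "('f mat \<Rightarrow> complex) \<Rightarrow> 'f set mat \<Rightarrow> complex" where
  "to_A \<theta> = restrict (theta_G v n r \<beta> \<theta>) A"

text \<open>Under the identification of residue classes, the formula prescribed for \<theta> on 1 +
  \<omega>^l x says that \<theta> agrees with \<psi> on A \<inter> N: by
  \<open>field_trace_eq\<close> the trace of F[\<beta>] over F is the matrix trace, see
  \<open>psi_Ob\<close>.\<close>

lemma theta_set_bij: "bij_betw to_A \<Theta> A_chars"
  unfolding bij_betw_def
proof
  have F: "to_A \<theta> (rd x) = \<theta> x" if "\<theta> \<in> \<Theta>" "x \<in> Ob \<inter> GLO n" for \<theta> x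
    using that theta_G_eq[OF that] by (auto simp: to_A_def A_eq)
  show "inj_on to_A \<Theta>"
  proof (rule inj_onI)
    fix \<theta> \<theta>' assume t: "\<theta> \<in> \<Theta>" "\<theta>' \<in> \<Theta>" "to_A \<theta> = to_A \<theta>'"
    have "\<theta> x = \<theta>' x" if "x \<in> Ob \<inter> GLO n" for x using F[OF t(1) that] F[OF t(2) that] t(3) by simp
    moreover have "\<theta> \<in> extensional (Ob \<inter> GLO n)" "\<theta>' \<in> extensional (Ob \<inter> GLO n)"
      using t by (auto simp: theta_set_def mult_chars_iff units_OK)
    ultimately show "\<theta> = \<theta>'" by (rule extensionalityI[rotated 2])
  qed
  show "to_A ` \<Theta> = A_chars"
  proof (intro Set.set_eqI iffI)
    fix \<phi> assume "\<phi> \<in> to_A ` \<Theta>"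
    then obtain \<theta> where \<theta>: "\<theta> \<in> \<Theta>" "\<phi> = to_A \<theta>" by blast
    have \<theta>m: "\<And>x. x \<in> Ob \<inter> GLO n \<Longrightarrow> \<theta> x \<noteq> 0" "\<And>x y. x \<in> Ob \<inter> GLO n \<Longrightarrow> y \<in> Ob \<inter> GLO n \<Longrightarrow> \<theta> (x * y) = \<theta> x * \<theta> y"
      and \<theta>l: "\<And>y. y \<in> Ob \<Longrightarrow> \<theta> (one_plus l y) = \<tau> (field_trace n \<beta> (\<beta> * y) / \<omega> ^ l')"
      using \<theta>(1) by (auto simp: theta_set_def mult_chars_iff units_OK one_plus_def)
    have "\<phi> \<in> mult_chars (G\<lparr>carrier := A\<rparr>)"
      unfolding mult_chars_iff
    proof (intro conjI ballI)
      fix a assume "a \<in> carrier (G\<lparr>carrier := A\<rparr>)"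
      then obtain x where x: "x \<in> Ob \<inter> GLO n" "a = rd x" by (auto simp: A_eq)
      then show "\<phi> a \<noteq> 0" using F[OF \<theta>(1)] \<theta>m(1) \<theta>(2) by simp
      fix b assume "b \<in> carrier (G\<lparr>carrier := A\<rparr>)"
      then obtain y where y: "y \<in> Ob \<inter> GLO n" "b = rd y" by (auto simp: A_eq)
      have xy: "x * y \<in> Ob \<inter> GLO n" using Ob_closed(2) GLO_mult x y by blast
      have "a \<otimes>\<^bsub>G\<^esub> b = rd (x * y)" using x y rd_mult[OF Ob_MP Ob_MP] by simp
      then show "\<phi> (a \<otimes>\<^bsub>G\<lparr>carrier := A\<rparr>\<^esub> b) = \<phi> a * \<phi> b"
        using F[OF \<theta>(1) xy] F[OF \<theta>(1) x(1)] F[OF \<theta>(1) y(1)] \<theta>m(2)[OF x(1) y(1)] x(2) y(2) \<theta>(2) by simp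
    qed (simp add: \<theta>(2) to_A_def)
    moreover have "\<phi> h = \<psi> h" if h: "h \<in> A" "h \<in> N" for h
    proof -
      obtain y where y: "y \<in> Ob" "h = rd (one_plus l y)" using AN_elt[OF h l_bounds(1,2)] by blast
      show ?thesis unfolding y(2) \<theta>(2) F[OF \<theta>(1) one_plus_Ob[OF l_bounds(1) y(1)]] \<theta>l[OF y(1)] psi_Ob[OF y(1)] ..
    qed
    ultimately show "\<phi> \<in> A_chars" by (simp add: A_chars_def)
  next
    fix \<phi> assume \<phi>: "\<phi> \<in> A_chars"
    then have \<phi>m: "\<And>a. a \<in> A \<Longrightarrow> \<phi> a \<noteq> 0" "\<And>a b. a \<in> A \<Longrightarrow> b \<in> A \<Longrightarrow> \<phi> (a \<otimes>\<^bsub>G\<^esub> b) = \<phi> a * \<phi> b"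
      "\<phi> \<in> extensional A" "\<And>h. h \<in> A \<Longrightarrow> h \<in> N \<Longrightarrow> \<phi> h = \<psi> h"
      by (auto simp: A_chars_def mult_chars_iff)
    let ?I = "pK_pow v \<omega> n \<beta> r"
    let ?Q = "OK v n \<beta> Quot ?I"
    define \<theta> where "\<theta> = (\<lambda>x\<in>Ob \<inter> GLO n. \<phi> (rd x))"
    \<comment> \<open>To descend to the quotient ring a representative of each coset is chosen; only
      its reduction modulo the r-th power is used, and that does not depend on the choice.\<close>
    define rep where "rep C = (SOME x. x \<in> Ob \<and> C = ?I +>\<^bsub>OK v n \<beta>\<^esub> x)" for C
    have rdA: "rd x \<in> A" if "x \<in> Ob \<inter> GLO n" for x using that by (auto simp: A_eq)
    have rep: "rd (rep (?I +>\<^bsub>OK v n \<beta>\<^esub> x)) = rd x" if x: "x \<in> Ob" for x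
    proof -
      let ?y = "rep (?I +>\<^bsub>OK v n \<beta>\<^esub> x)"
      have y: "?y \<in> Ob \<and> ?I +>\<^bsub>OK v n \<beta>\<^esub> x = ?I +>\<^bsub>OK v n \<beta>\<^esub> ?y"
        unfolding rep_def by (rule someI[of _ x]) (use x in simp)
      have "x \<in> ?I +>\<^bsub>OK v n \<beta>\<^esub> x" using x minus_r_inv_mat[OF Ob_carrier[OF x]] by (simp add: coset_eq)
      then have "x - ?y \<in> MP r n" using y coset_eq[of ?y r] by auto
      then show ?thesis using rd_eq_iff[OF Ob_MP[OF x] Ob_MP, of ?y] y by simp
    qed
    have Qc: "carrier ?Q = (\<lambda>x. ?I +>\<^bsub>OK v n \<beta>\<^esub> x) ` Ob" by (auto simp: FactRing_def A_RCOSETS_def')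
    have Qm: "(?I +>\<^bsub>OK v n \<beta>\<^esub> x) \<otimes>\<^bsub>?Q\<^esub> (?I +>\<^bsub>OK v n \<beta>\<^esub> y) = ?I +>\<^bsub>OK v n \<beta>\<^esub> (x * y)" if "x \<in> Ob" "y \<in> Ob" for x y
      using ideal.rcoset_mult_add[OF pK_pow_ideal, of x y r] that by (simp add: FactRing_def)
    have Q1: "\<one>\<^bsub>?Q\<^esub> = ?I +>\<^bsub>OK v n \<beta>\<^esub> 1\<^sub>m n" by (simp add: FactRing_def)
    \<comment> \<open>Units of the quotient lift to units of O[\<beta>], since invertibility modulo
      the maximal ideal suffices; hence the multiplicativity of \<theta>' can be checked on
      lifts.\<close>
    have QU: "\<exists>x\<in>Ob \<inter> GLO n. C = ?I +>\<^bsub>OK v n \<beta>\<^esub> x" if C: "C \<in> Units ?Q" for C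
    proof -
      obtain D where D: "C \<in> carrier ?Q" "D \<in> carrier ?Q" "C \<otimes>\<^bsub>?Q\<^esub> D = \<one>\<^bsub>?Q\<^esub>" using C by (auto simp: Units_def)
      obtain x y where x: "x \<in> Ob" "C = ?I +>\<^bsub>OK v n \<beta>\<^esub> x" and y: "y \<in> Ob" "D = ?I +>\<^bsub>OK v n \<beta>\<^esub> y"
        using D(1,2) by (auto simp: Qc)
      have xy: "x * y \<in> Ob" by (rule Ob_closed(2)[OF x(1) y(1)])
      have "?I +>\<^bsub>OK v n \<beta>\<^esub> (x * y) = ?I +>\<^bsub>OK v n \<beta>\<^esub> 1\<^sub>m n" using D(3) x y Qm Q1 by simp
      then have "rd (x * y) = rd (1\<^sub>m n)" using rep[OF xy] rep[OF Ob_one] by simp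
      then have "x * y - 1\<^sub>m n \<in> MP r n" using rd_eq_iff[OF Ob_MP[OF xy]] by simp
      then have "x \<in> GLO n" using GLO_of_product[OF Ob_MP[OF x(1)] Ob_MP[OF y(1)]] MP_mono[OF r_pos] by simp
      then show ?thesis using x by blast
    qed
    define \<theta>' where "\<theta>' = (\<lambda>C\<in>Units ?Q. \<phi> (rd (rep C)))"
    have UQ: "?I +>\<^bsub>OK v n \<beta>\<^esub> x \<in> Units ?Q" if x: "x \<in> Ob \<inter> GLO n" for x
    proof -
      have m: "minv n x \<in> Ob" "x * minv n x = 1\<^sub>m n" "minv n x * x = 1\<^sub>m n" using minv_Ob minv x by auto
      then show ?thesis using x Qm[of x "minv n x"] Qm[of "minv n x" x] Q1 by (auto simp: Units_def Qc)
    qed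
    have "\<theta>' \<in> mult_chars (units_of ?Q)"
      unfolding mult_chars_iff
    proof (intro conjI ballI)
      fix C assume "C \<in> carrier (units_of ?Q)"
      then obtain x where x: "x \<in> Ob \<inter> GLO n" "C = ?I +>\<^bsub>OK v n \<beta>\<^esub> x" and CU: "C \<in> Units ?Q" using QU by (auto simp: units_of_def)
      have tC: "\<theta>' C = \<phi> (rd x)" using x CU rep by (simp add: \<theta>'_def)
      then show "\<theta>' C \<noteq> 0" using \<phi>m(1) rdA[OF x(1)] by simp
      fix D assume "D \<in> carrier (units_of ?Q)"
      then obtain y where y: "y \<in> Ob \<inter> GLO n" "D = ?I +>\<^bsub>OK v n \<beta>\<^esub> y" and DU: "D \<in> Units ?Q" using QU by (auto simp: units_of_def)
      have tD: "\<theta>' D = \<phi> (rd y)" using y DU rep by (simp add: \<theta>'_def)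
      have xy: "x * y \<in> Ob \<inter> GLO n" using Ob_closed(2) GLO_mult x y by blast
      have "C \<otimes>\<^bsub>units_of ?Q\<^esub> D = ?I +>\<^bsub>OK v n \<beta>\<^esub> (x * y)" using Qm x y by (simp add: units_of_def)
      then have "\<theta>' (C \<otimes>\<^bsub>units_of ?Q\<^esub> D) = \<phi> (rd (x * y))" using rep UQ[OF xy] xy by (simp add: \<theta>'_def)
      also have "rd (x * y) = rd x \<otimes>\<^bsub>G\<^esub> rd y" using rd_mult[OF Ob_MP Ob_MP] x y by simp
      finally show "\<theta>' (C \<otimes>\<^bsub>units_of ?Q\<^esub> D) = \<theta>' C * \<theta>' D" using \<phi>m(2)[OF rdA[OF x(1)] rdA[OF y(1)]] tC tD by simp
    qed (simp add: \<theta>'_def units_of_def)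
    moreover have "\<forall>x\<in>Units (OK v n \<beta>). \<theta> x = \<theta>' (?I +>\<^bsub>OK v n \<beta>\<^esub> x)"
      using rep UQ by (simp add: Units_OK \<theta>_def \<theta>'_def)
    moreover have "\<theta> \<in> mult_chars (units_of (OK v n \<beta>))"
      unfolding mult_chars_iff units_OK
    proof (intro conjI ballI)
      fix x assume x: "x \<in> Ob \<inter> GLO n"
      show "\<theta> x \<noteq> 0" using \<phi>m(1)[OF rdA[OF x]] x by (simp add: \<theta>_def)
      fix y assume y: "y \<in> Ob \<inter> GLO n"
      have xy: "x * y \<in> Ob \<inter> GLO n" using Ob_closed(2) GLO_mult x y by blast
      show "\<theta> (x * y) = \<theta> x * \<theta> y"
        using \<phi>m(2)[OF rdA[OF x] rdA[OF y]] rd_mult[OF Ob_MP Ob_MP, of x y] x y xy by (simp add: \<theta>_def)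
    qed (simp add: \<theta>_def)
    moreover have "\<theta> (one_plus l y) = \<tau> (field_trace n \<beta> (\<beta> * y) / \<omega> ^ l')" if y: "y \<in> Ob" for y
    proof -
      have "rd (one_plus l y) \<in> N" using Ob_MP[OF y] cong_eq[OF l_bounds(1,2)] by blast
      then show ?thesis
        using \<phi>m(4)[OF rdA[OF one_plus_Ob[OF l_bounds(1) y]]] one_plus_Ob[OF l_bounds(1) y] psi_Ob[OF y]
        by (simp add: \<theta>_def)
    qed
    ultimately have \<theta>: "\<theta> \<in> \<Theta>" by (auto simp: theta_set_def one_plus_def)
    have "to_A \<theta> = \<phi>"
    proof (rule extensionalityI[of _ A])
      show "to_A \<theta> \<in> extensional A" "\<phi> \<in> extensional A" using \<phi>m(3) by (simp_all add: to_A_def)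
      fix a assume "a \<in> A"
      then obtain x where x: "x \<in> Ob \<inter> GLO n" "a = rd x" by (auto simp: A_eq)
      show "to_A \<theta> a = \<phi> a" using F[OF \<theta> x(1)] x by (simp add: \<theta>_def)
    qed
    then show "\<phi> \<in> to_A ` \<Theta>" using \<theta> by blast
  qed
qed

end

section \<open>Odd level\<close>

locale odd_setting = character_setting v \<omega> n p \<beta> \<tau> l l'
  for v :: "'f::field \<Rightarrow> int" and \<omega> :: 'f and n :: nat and p :: "'f poly" and \<beta> :: "'f mat"
    and \<tau> :: "'f \<Rightarrow> complex" and l l' :: nat +
  assumes l_eq: "l = Suc l'" and odd_char: "odd (residue_char v)"
begin

section \<open>Traces against \<open>\<beta>\<close> and the centralizer modulo the maximal
  ideal\<close>

abbreviation Zg :: "'f set mat set" where "Zg \<equiv> Zgrp v \<omega> n l l' \<beta>"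
abbreviation \<chi> :: "('f set mat \<Rightarrow> complex) \<Rightarrow> 'f set mat \<Rightarrow> complex" where
  "\<chi> \<equiv> psi_rho v \<omega> \<tau> n l l' \<beta>"
abbreviation Rc :: "('f set mat \<Rightarrow> complex) set" where "Rc \<equiv> g_cent_chars v n \<beta>"
abbreviation rd1 :: "'f mat \<Rightarrow> 'f set mat" where "rd1 \<equiv> red_mat v 1"
abbreviation el :: "'f mat \<Rightarrow> 'f set mat" where "el Y \<equiv> rd (one_plus l' Y)"

definition cent :: "'f mat set" where "cent = {Y \<in> MP 0 n. Y * \<beta> - \<beta> * Y \<in> MP 1 n}"

definition tb :: "'f mat \<Rightarrow> 'f" where "tb Y = mtrace (Y * \<beta>)"

text \<open>The argument of \<tau> in \<open>psi_rho\<close>, without the contribution of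
  \<rho>.\<close>

definition ex :: "'f mat \<Rightarrow> 'f" where "ex Y = tb Y / \<omega> ^ l - tb (Y * Y) / (2 * \<omega>)"

text \<open>If 2 vanished in the residue field, the additive order of 1 would divide 2; being odd it
  would be 1, which gives 1 = 0.\<close>

lemma two_unit: "inverse (2::'f) \<in> \<P> 0" "(2::'f) \<noteq> 0"
proof -
  have 0: "(2::'f) \<in> \<P> 0" using P_add[OF P_one P_one] by simp
  have 1: "(2::'f) \<notin> \<P> 1"
  proof
    assume 2: "(2::'f) \<in> \<P> 1"
    let ?R = "res_ring v 1"
    interpret R: cring ?R by (rule res_ring_cring)
    have "\<one>\<^bsub>?R\<^esub> \<oplus>\<^bsub>?R\<^esub> \<one>\<^bsub>?R\<^esub> = \<zero>\<^bsub>?R\<^esub>"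
      unfolding red_one red_zero red_add[OF P_one P_one] red_eq_iff using 2 by simp
    then have "\<one>\<^bsub>?R\<^esub> [^]\<^bsub>add_monoid ?R\<^esub> (2::nat) = \<one>\<^bsub>add_monoid ?R\<^esub>"
      using R.l_zero[OF R.one_closed] by (simp add: numeral_2_eq_2 del: One_nat_def)
    then have "residue_char v dvd 2"
      unfolding residue_char_def using group.pow_eq_id[OF R.a_group, of "\<one>\<^bsub>?R\<^esub>" 2] R.one_closed by simp
    then have "residue_char v = 1" using odd_char by (metis dvd_refl prime_nat_iff two_is_prime_nat)
    then have "\<one>\<^bsub>?R\<^esub> [^]\<^bsub>add_monoid ?R\<^esub> (1::nat) = \<one>\<^bsub>add_monoid ?R\<^esub>"
      unfolding residue_char_def using group.pow_ord_eq_1[OF R.a_group, of "\<one>\<^bsub>?R\<^esub>"] R.one_closed by simp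
    then have "\<one>\<^bsub>?R\<^esub> = \<zero>\<^bsub>?R\<^esub>" using R.l_zero[OF R.one_closed] by simp
    then have "1 - 0 \<in> \<P> 1" unfolding red_one red_zero red_eq_iff .
    then show False by simp
  qed
  show "inverse (2::'f) \<in> \<P> 0" "(2::'f) \<noteq> 0" using P_inverse[OF 0 1] by auto
qed

lemma half: "x \<in> \<P> 1 \<Longrightarrow> x / (2 * \<omega>) \<in> \<P> 0"
proof -
  assume "x \<in> \<P> 1"
  then have "x / \<omega> ^ 1 \<in> \<P> 0" by (simp only: P_divide_iff) simp
  then have "inverse 2 * (x / \<omega>) \<in> \<P> 0" by (intro P_mult[OF two_unit(1)]) simp
  moreover have "inverse 2 * (x / \<omega>) = x / (2 * \<omega>)" by (simp add: field_simps)
  ultimately show ?thesis by (simp only:)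
qed

lemma tb_P: "Y \<in> MP k n \<Longrightarrow> tb Y \<in> \<P> k"
  unfolding tb_def by (rule mtrace_P[OF MP_mult'[OF _ beta]])

lemma tb_add: "Y \<in> MP 0 n \<Longrightarrow> W \<in> MP 0 n \<Longrightarrow> tb (Y + W) = tb Y + tb W"
  unfolding tb_def by (rule mtrace_add_beta)

lemma tb_diff: "Y \<in> MP 0 n \<Longrightarrow> W \<in> MP 0 n \<Longrightarrow> tb (Y - W) = tb Y - tb W"
  unfolding tb_def minus_mult_distrib_mat[OF MP_carrier MP_carrier beta_carrier]
  by (rule mtrace_diff[OF mult_carrier_mat[OF MP_carrier beta_carrier] mult_carrier_mat[OF MP_carrier beta_carrier]])

lemma tb_smult: "Y \<in> MP 0 n \<Longrightarrow> tb (c \<cdot>\<^sub>m Y) = c * tb Y"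
  unfolding tb_def using mult_smult_assoc_mat[OF MP_carrier beta_carrier, of Y 0 c]
    mtrace_smult[OF mult_carrier_mat[OF MP_carrier beta_carrier], of Y 0 c] by simp

text \<open>Cyclicity of the trace moves the commutator from the pair Y, W to the pair W, \<beta>.
  In this form one sees both that the pairing is integral after division by \<omega> when W
  centralizes \<beta> modulo the maximal ideal, and that nothing else pairs trivially with all
  Y.\<close>

lemma tb_comm:
  assumes Y: "Y \<in> MP 0 n" and W: "W \<in> MP 0 n"
  shows "tb (Y * W) - tb (W * Y) = mtrace (Y * (W * \<beta> - \<beta> * W))"
proof -
  note c = MP_carrier[OF Y] MP_carrier[OF W] beta_carrier
  have "mtrace (W * Y * \<beta>) = mtrace (W * (Y * \<beta>))" using assoc_mult_mat[OF c(2,1,3)] by simp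
  also have "\<dots> = mtrace (Y * \<beta> * W)" by (rule mtrace_mult_comm[OF c(2) mult_carrier_mat[OF c(1,3)]])
  also have "Y * \<beta> * W = Y * (\<beta> * W)" by (rule assoc_mult_mat[OF c(1,3,2)])
  finally have 1: "tb (W * Y) = mtrace (Y * (\<beta> * W))" by (simp add: tb_def)
  have 2: "tb (Y * W) = mtrace (Y * (W * \<beta>))" using assoc_mult_mat[OF c] by (simp add: tb_def)
  have "Y * (W * \<beta> - \<beta> * W) = Y * (W * \<beta>) - Y * (\<beta> * W)"
    by (rule mult_minus_distrib_mat[OF c(1) mult_carrier_mat[OF c(2,3)] mult_carrier_mat[OF c(3,2)]])
  then show ?thesis
    unfolding 1 2
    using mtrace_diff[OF mult_carrier_mat[OF c(1) mult_carrier_mat[OF c(2,3)]] mult_carrier_mat[OF c(1) mult_carrier_mat[OF c(3,2)]]]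
    by simp
qed

lemma cent_MP: "Y \<in> cent \<Longrightarrow> Y \<in> MP 0 n"
  by (simp add: cent_def)

lemma tb_comm_cent:
  assumes "Y \<in> MP 0 n" "W \<in> cent"
  shows "tb (Y * W) - tb (W * Y) \<in> \<P> 1"
  unfolding tb_comm[OF assms(1) cent_MP[OF assms(2)]]
  by (rule mtrace_P[OF MP_mult[OF assms(1)]]) (use assms(2) in \<open>simp add: cent_def\<close>)

text \<open>\<open>commutant\<close> for m = 1. Replacing Y by an element of the commutative ring
  O[\<beta>] makes closure properties of \<open>cent\<close> immediate.\<close>

lemma cent_iff: "Y \<in> cent \<longleftrightarrow> Y \<in> MP 0 n \<and> (\<exists>x\<in>Ob. Y - x \<in> MP 1 n)"
proof
  assume "Y \<in> cent"
  then show "Y \<in> MP 0 n \<and> (\<exists>x\<in>Ob. Y - x \<in> MP 1 n)" using commutant[of Y 1] by (auto simp: cent_def)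
next
  assume "Y \<in> MP 0 n \<and> (\<exists>x\<in>Ob. Y - x \<in> MP 1 n)"
  then obtain x where Y: "Y \<in> MP 0 n" and x: "x \<in> Ob" "Y - x \<in> MP 1 n" by blast
  have "x * \<beta> - \<beta> * x \<in> MP 1 n" unfolding Ob_commute[OF x(1)] by (rule MP_zero)
  then show "Y \<in> cent" unfolding cent_def using commutator_congr[OF Y Ob_MP[OF x(1)] x(2)] Y by simp
qed

lemma Ob_cent: "x \<in> Ob \<Longrightarrow> x \<in> cent"
  unfolding cent_iff using Ob_MP minus_r_inv_mat[OF Ob_carrier[of x]] by (metis MP_zero)

lemma cent_congr: "Y \<in> cent \<Longrightarrow> W \<in> MP 0 n \<Longrightarrow> W - Y \<in> MP 1 n \<Longrightarrow> W \<in> cent"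
  using commutator_congr[of W Y 1] by (simp add: cent_def)

lemma cent_add: "Y \<in> cent \<Longrightarrow> W \<in> cent \<Longrightarrow> Y + W \<in> cent"
proof -
  assume "Y \<in> cent" "W \<in> cent"
  then obtain x y where Y: "Y \<in> MP 0 n" "x \<in> Ob" "Y - x \<in> MP 1 n" and W: "W \<in> MP 0 n" "y \<in> Ob" "W - y \<in> MP 1 n"
    unfolding cent_iff by blast
  have "(Y + W) - (x + y) = (Y - x) + (W - y)"
    using MP_carrier[OF Y(1)] MP_carrier[OF W(1)] Ob_carrier[OF Y(2)] Ob_carrier[OF W(2)] by (intro eq_matI) auto
  then have "(Y + W) - (x + y) \<in> MP 1 n" using MP_add[OF Y(3) W(3)] by simp
  then show ?thesis unfolding cent_iff using MP_add[OF Y(1) W(1)] Ob_closed(1)[OF Y(2) W(2)] by blast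
qed

lemma cent_uminus: "Y \<in> cent \<Longrightarrow> - Y \<in> cent"
proof -
  assume "Y \<in> cent"
  then obtain x where Y: "Y \<in> MP 0 n" "x \<in> Ob" "Y - x \<in> MP 1 n"
    unfolding cent_iff by blast
  have "- Y - - x = - (Y - x)"
    using MP_carrier[OF Y(1)] Ob_carrier[OF Y(2)] by (intro eq_matI) auto
  then have "- Y - - x \<in> MP 1 n" using MP_uminus[OF Y(3)] by simp
  then show ?thesis unfolding cent_iff using MP_uminus[OF Y(1)] Ob_closed(4)[OF Y(2,2)] by blast
qed

lemma rd1_eq_iff: "Y \<in> MP 0 n \<Longrightarrow> W \<in> MP 0 n \<Longrightarrow> rd1 Y = rd1 W \<longleftrightarrow> Y - W \<in> MP 1 n"
  by (rule red_mat_eq_iff[OF MP_carrier MP_carrier])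

lemma g_cent_iff: "Y \<in> MP 0 n \<Longrightarrow> rd1 Y \<in> g_cent v n 1 \<beta> \<longleftrightarrow> Y \<in> cent"
proof -
  assume Y: "Y \<in> MP 0 n"
  have "rd1 Y \<in> carrier (mat_ring (res_ring v 1) n)" unfolding res_mat_carrier using Y by blast
  then show ?thesis
    unfolding g_cent_def cent_def mem_Collect_eq red_mat_mult[OF Y beta] red_mat_mult[OF beta Y]
      rd1_eq_iff[OF MP_mult[OF Y beta] MP_mult[OF beta Y]] using Y by simp
qed

lemma g_cent_eq: "g_cent v n 1 \<beta> = rd1 ` cent"
proof (intro Set.set_eqI iffI)
  fix c assume c: "c \<in> g_cent v n 1 \<beta>"
  then have "c \<in> rd1 ` MP 0 n" by (simp add: g_cent_def res_mat_carrier del: One_nat_def)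
  then show "c \<in> rd1 ` cent" using c g_cent_iff by blast
next
  fix c assume "c \<in> rd1 ` cent"
  then show "c \<in> g_cent v n 1 \<beta>" using g_cent_iff cent_MP by blast
qed

section \<open>The group Z and its characters\<close>

lemma Zg_eq: "Zg = {el Y | Y. Y \<in> cent}"
proof -
  have 1: "l - 1 = l'" using l_eq by simp
  show ?thesis unfolding Zgrp_def 1 one_plus_def[symmetric] int_mats_eq using g_cent_iff cent_MP by blast
qed

lemma H_eq: "H = {el Y | Y. Y \<in> MP 0 n}"
  by (rule cong_eq[OF l'(1) l_bounds(3)])

lemma el_eq_iff: "Y \<in> MP 0 n \<Longrightarrow> W \<in> MP 0 n \<Longrightarrow> el Y = el W \<longleftrightarrow> Y - W \<in> MP l n"
  using one_plus_eq_iff[OF l'(1) l_bounds(3)] by simp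

lemma el_mult: "Y \<in> MP 0 n \<Longrightarrow> W \<in> MP 0 n \<Longrightarrow> el Y \<otimes>\<^bsub>G\<^esub> el W = el (Y + W + \<omega> ^ l' \<cdot>\<^sub>m (Y * W))"
  using rd_mult[OF one_plus_MP[OF l'(1)] one_plus_MP[OF l'(1)]] by (simp add: one_plus_mult)

lemma el_one: "el (0\<^sub>m n n) = \<one>\<^bsub>G\<^esub>"
proof -
  have "one_plus l' (0\<^sub>m n n) = 1\<^sub>m n" by (simp add: one_plus_def)
  then show ?thesis by (simp add: GL_res_simps(2))
qed

text \<open>The linear term is divided by \<omega>^l and needs the full congruence; the quadratic
  term is divided by 2\<omega> only and needs it just modulo the maximal ideal.\<close>

lemma ex_congr:
  assumes "Y \<in> MP 0 n" "W \<in> MP 0 n" "Y - W \<in> MP l n"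
  shows "\<tau> (ex Y) = \<tau> (ex W)"
proof (rule tau_congr)
  have "tb Y - tb W \<in> \<P> (0 + l)" using tb_P[OF assms(3)] tb_diff[OF assms(1,2)] by simp
  then have 1: "(tb Y - tb W) / \<omega> ^ l \<in> \<P> 0" by (simp only: P_divide_iff)
  have "Y * Y - W * W \<in> MP 1 n"
    by (rule MP_mono[OF l_bounds(1) MP_congr_mult[OF assms(1,2,1,2,3,3)]])
  then have "tb (Y * Y) - tb (W * W) \<in> \<P> 1" using tb_P[of "Y * Y - W * W" 1] tb_diff assms(1,2) by simp
  then have 2: "(tb (Y * Y) - tb (W * W)) / (2 * \<omega>) \<in> \<P> 0" by (rule half)
  have "ex Y - ex W = (tb Y - tb W) / \<omega> ^ l - (tb (Y * Y) - tb (W * W)) / (2 * \<omega>)"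
    by (simp add: ex_def diff_divide_distrib)
  then show "ex Y - ex W \<in> \<P> 0" using P_diff[OF 1 2] by simp
qed

lemma psi_rho_eq:
  assumes Y: "Y \<in> cent"
  shows "\<chi> \<rho> (el Y) = \<tau> (ex Y) * \<rho> (rd1 Y)"
proof -
  have 1: "l - 1 = l'" using l_eq by simp
  show ?thesis
    unfolding psi_rho_def 1 one_plus_def[symmetric] int_mats_eq tb_def[symmetric] ex_def[symmetric]
  proof (rule the_equality)
    show "\<exists>W\<in>MP 0 n. rd1 W \<in> g_cent v n 1 \<beta> \<and> el Y = el W \<and> \<tau> (ex Y) * \<rho> (rd1 Y) = \<tau> (ex W) * \<rho> (rd1 W)"
      using Y cent_MP[OF Y] g_cent_iff by blast
    fix c assume "\<exists>W\<in>MP 0 n. rd1 W \<in> g_cent v n 1 \<beta> \<and> el Y = el W \<and> c = \<tau> (ex W) * \<rho> (rd1 W)"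
    then obtain W where W: "W \<in> MP 0 n" "el Y = el W" "c = \<tau> (ex W) * \<rho> (rd1 W)" by blast
    have d: "W - Y \<in> MP l n" using el_eq_iff[OF W(1) cent_MP[OF Y]] W(2) by simp
    have "rd1 W = rd1 Y" using rd1_eq_iff[OF W(1) cent_MP[OF Y]] MP_mono[OF l_bounds(1) d] by simp
    then show "c = \<tau> (ex Y) * \<rho> (rd1 Y)" unfolding W(3) ex_congr[OF W(1) cent_MP[OF Y] d] by simp
  qed
qed

lemma Rc_iff: "\<rho> \<in> Rc \<longleftrightarrow> (\<forall>Y\<in>cent. \<rho> (rd1 Y) \<noteq> 0) \<and>
    (\<forall>Y\<in>cent. \<forall>W\<in>cent. \<rho> (rd1 (Y + W)) = \<rho> (rd1 Y) * \<rho> (rd1 W)) \<and> \<rho> \<in> extensional (rd1 ` cent)"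
  unfolding g_cent_chars_def mult_chars_iff g_cent_eq using red_mat_add[of _ n _ 1] cent_MP by simp

lemma Rc_nz: "\<rho> \<in> Rc \<Longrightarrow> Y \<in> cent \<Longrightarrow> \<rho> (rd1 Y) \<noteq> 0"
  and Rc_add: "\<rho> \<in> Rc \<Longrightarrow> Y \<in> cent \<Longrightarrow> W \<in> cent \<Longrightarrow> \<rho> (rd1 (Y + W)) = \<rho> (rd1 Y) * \<rho> (rd1 W)"
  and Rc_ext: "\<rho> \<in> Rc \<Longrightarrow> \<rho> \<in> extensional (rd1 ` cent)"
  unfolding Rc_iff by blast+

lemma trivial_Rc: "(\<lambda>c\<in>rd1 ` cent. 1) \<in> Rc"
  unfolding Rc_iff using cent_add by auto

text \<open>V is the parameter of the product of the two group elements. Its exponent differs from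
  the sum of the exponents by half of tr((YW - WY)\<beta>)/\<omega> and by the error of replacing
  V^2 by (Y+W)^2. The first is integral on the centralizer, the second because V is congruent to Y +
  W.\<close>

lemma cent_prod:
  assumes Y: "Y \<in> cent" and W: "W \<in> cent"
  defines "V \<equiv> Y + W + \<omega> ^ l' \<cdot>\<^sub>m (Y * W)"
  shows "V \<in> cent" "rd1 V = rd1 (Y + W)" "\<tau> (ex V) = \<tau> (ex Y) * \<tau> (ex W)"
proof -
  note m = cent_MP[OF Y] cent_MP[OF W]
  note c = MP_carrier[OF m(1)] MP_carrier[OF m(2)]
  have YW: "Y * W \<in> MP 0 n" "Y + W \<in> MP 0 n" using m by simp_all
  have T: "\<omega> ^ l' \<cdot>\<^sub>m (Y * W) \<in> MP l' n" by (rule MP_smult_\<omega>[OF YW(1)])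
  have V: "V \<in> MP 0 n" unfolding V_def by (rule MP_add[OF YW(2) MP_int[OF T]])
  have "V - (Y + W) = \<omega> ^ l' \<cdot>\<^sub>m (Y * W)"
    unfolding V_def using c carrier_matD[OF MP_carrier[OF YW(1)]] by (intro eq_matI) auto
  then have d: "V - (Y + W) \<in> MP 1 n" using MP_mono[OF l'(1) T] by simp
  show "V \<in> cent" by (rule cent_congr[OF cent_add[OF Y W] V d])
  show "rd1 V = rd1 (Y + W)" using rd1_eq_iff[OF V YW(2)] d by simp
  have "V * V - (Y + W) * (Y + W) \<in> MP 1 n" by (rule MP_congr_mult[OF V YW(2) V YW(2) d d])
  then have 1: "tb (V * V) - tb ((Y + W) * (Y + W)) \<in> \<P> 1"
    using tb_P[of "V * V - (Y + W) * (Y + W)" 1] tb_diff V YW(2) by simp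
  have "(Y + W) * (Y + W) = Y * (Y + W) + W * (Y + W)"
    by (rule add_mult_distrib_mat[OF c MP_carrier[OF YW(2)]])
  also have "Y * (Y + W) = Y * Y + Y * W" by (rule mult_add_distrib_mat[OF c(1) c])
  also have "W * (Y + W) = W * Y + W * W" by (rule mult_add_distrib_mat[OF c(2) c])
  finally have 2: "tb ((Y + W) * (Y + W)) = tb (Y * Y) + tb (Y * W) + (tb (W * Y) + tb (W * W))"
    using m by (simp add: tb_add)
  have "tb V = tb Y + tb W + \<omega> ^ l' * tb (Y * W)"
    unfolding V_def using m YW MP_int[OF T] by (simp add: tb_add tb_smult)
  then have 3: "tb V / \<omega> ^ l = tb Y / \<omega> ^ l + tb W / \<omega> ^ l + tb (Y * W) / \<omega>"
    unfolding l_eq by (simp add: add_divide_distrib)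
  have "ex V - (ex Y + ex W) =
      (tb (Y * W) - tb (W * Y)) / (2 * \<omega>) - (tb (V * V) - tb ((Y + W) * (Y + W))) / (2 * \<omega>)"
  proof -
    \<comment> \<open>The letters stand for traces: a and b for the linear terms of Y and W, x and y
      for YW and WY, c, d, e for the squares of Y, W and V. Splitting x/\<omega> into two halves is
      the step that needs 2 to be invertible.\<close>
    have "a + b + x / \<omega> - e / (2 * \<omega>) - (a - c / (2 * \<omega>) + (b - d / (2 * \<omega>))) =
        (x - y) / (2 * \<omega>) - (e - (c + x + (y + d))) / (2 * \<omega>)" for a b c d e x y :: 'f
    proof -
      have "x / \<omega> = x / (2 * \<omega>) + x / (2 * \<omega>)"
        using two_unit(2) by (simp add: add_divide_distrib[symmetric] mult_2[symmetric])
      then show ?thesis by (simp only: diff_divide_distrib add_divide_distrib) simp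
    qed
    then show ?thesis unfolding ex_def 2 3 .
  qed
  also have "\<dots> \<in> \<P> 0" by (rule P_diff[OF half[OF tb_comm_cent[OF m(1) W]] half[OF 1]])
  finally show "\<tau> (ex V) = \<tau> (ex Y) * \<tau> (ex W)" using tau_congr tau_add by metis
qed

lemma Zg_el: "Y \<in> cent \<Longrightarrow> el Y \<in> Zg"
  unfolding Zg_eq by blast

lemma Zg_E: "z \<in> Zg \<Longrightarrow> \<exists>Y\<in>cent. z = el Y"
  unfolding Zg_eq by blast

lemma Zg_H: "Zg \<subseteq> H"
  unfolding Zg_eq H_eq using cent_MP by blast

lemma Zg_mult: "y \<in> Zg \<Longrightarrow> z \<in> Zg \<Longrightarrow> y \<otimes>\<^bsub>G\<^esub> z \<in> Zg"
proof -
  assume "y \<in> Zg" "z \<in> Zg"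
  then obtain Y W where Y: "Y \<in> cent" "y = el Y" and W: "W \<in> cent" "z = el W" using Zg_E by blast
  show ?thesis unfolding Y(2) W(2) el_mult[OF cent_MP[OF Y(1)] cent_MP[OF W(1)]] by (rule Zg_el[OF cent_prod(1)[OF Y(1) W(1)]])
qed

lemma Zg_subgroup: "subgroup Zg G"
proof (rule G.subgroupI)
  show "Zg \<subseteq> carrier G" using Zg_H subgroup.subset[OF H_subgroup] by blast
  show "Zg \<noteq> {}" using Zg_el[OF Ob_cent[OF Ob_one]] by blast
  fix z assume z: "z \<in> Zg"
  then obtain Y where Y: "Y \<in> cent" "z = el Y" using Zg_E by blast
  note Ym = cent_MP[OF Y(1)]
  have zH: "z \<in> H" using z Zg_H by blast
  then have "inv\<^bsub>G\<^esub> z \<in> H" by (rule subgroup.m_inv_closed[OF H_subgroup])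
  then obtain W where W: "W \<in> MP 0 n" "inv\<^bsub>G\<^esub> z = el W" unfolding H_eq by blast
  have YW: "Y * W \<in> MP 0 n" using Ym W(1) by simp
  have T: "\<omega> ^ l' \<cdot>\<^sub>m (Y * W) \<in> MP l' n" by (rule MP_smult_\<omega>[OF YW])
  \<comment> \<open>The inverse of z lies in \<open>H\<close> and so has some parameter W. The
    parameter V of the product with z is zero modulo the l-th power, so W is congruent to -Y and
    centralizes \<beta> modulo the maximal ideal.\<close>
  let ?V = "Y + W + \<omega> ^ l' \<cdot>\<^sub>m (Y * W)"
  have V: "?V \<in> MP 0 n" by (rule MP_add[OF MP_add[OF Ym W(1)] MP_int[OF T]])
  have "el ?V = z \<otimes>\<^bsub>G\<^esub> inv\<^bsub>G\<^esub> z" unfolding W(2) unfolding Y(2) by (rule el_mult[OF Ym W(1), symmetric])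
  also have "\<dots> = el (0\<^sub>m n n)" unfolding el_one using subgroup.mem_carrier[OF H_subgroup zH] by simp
  finally have "?V - 0\<^sub>m n n \<in> MP l n" using el_eq_iff[OF V MP_zero] by simp
  then have V1: "?V - 0\<^sub>m n n \<in> MP 1 n" by (rule MP_mono[OF l_bounds(1)])
  have "W - - Y = (?V - 0\<^sub>m n n) - \<omega> ^ l' \<cdot>\<^sub>m (Y * W)"
    using MP_carrier[OF Ym] MP_carrier[OF W(1)] carrier_matD[OF MP_carrier[OF YW]] by (intro eq_matI) auto
  also have "\<dots> \<in> MP 1 n" by (rule MP_diff[OF V1 MP_mono[OF l'(1) T]])
  finally have "W \<in> cent" by (rule cent_congr[OF cent_uminus[OF Y(1)] W(1)])
  then show "inv\<^bsub>G\<^esub> z \<in> Zg" unfolding W(2) by (rule Zg_el)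
qed (rule Zg_mult)

lemma chi_mult:
  assumes "\<rho> \<in> Rc" "y \<in> Zg" "z \<in> Zg"
  shows "\<chi> \<rho> (y \<otimes>\<^bsub>G\<^esub> z) = \<chi> \<rho> y * \<chi> \<rho> z"
proof -
  obtain Y W where Y: "Y \<in> cent" "y = el Y" and W: "W \<in> cent" "z = el W" using Zg_E assms(2,3) by blast
  note V = cent_prod[OF Y(1) W(1)]
  show ?thesis
    unfolding Y(2) W(2) el_mult[OF cent_MP[OF Y(1)] cent_MP[OF W(1)]] psi_rho_eq[OF V(1)] psi_rho_eq[OF Y(1)]
      psi_rho_eq[OF W(1)] V(2,3) Rc_add[OF assms(1) Y(1) W(1)] by simp
qed

lemma Rc_zero: "\<rho> \<in> Rc \<Longrightarrow> Y \<in> MP 1 n \<Longrightarrow> \<rho> (rd1 Y) = 1"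
proof -
  assume \<rho>: "\<rho> \<in> Rc" and Y: "Y \<in> MP 1 n"
  have z: "0\<^sub>m n n \<in> cent" by (rule Ob_cent[OF Ob_zero])
  have "0\<^sub>m n n + 0\<^sub>m n n = (0\<^sub>m n n :: 'f mat)" by simp
  then have "\<rho> (rd1 (0\<^sub>m n n)) = \<rho> (rd1 (0\<^sub>m n n)) * \<rho> (rd1 (0\<^sub>m n n))" using Rc_add[OF \<rho> z z] by simp
  then have "\<rho> (rd1 (0\<^sub>m n n)) = 1" using Rc_nz[OF \<rho> z] by simp
  moreover have "Y - 0\<^sub>m n n = Y" using MP_carrier[OF Y] by (intro eq_matI) auto
  then have "rd1 Y = rd1 (0\<^sub>m n n)" using rd1_eq_iff[OF MP_int[OF Y] MP_zero] Y by simp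
  ultimately show ?thesis by simp
qed

lemma el_N: "one_plus l Y = one_plus l' (\<omega> \<cdot>\<^sub>m Y)"
  unfolding one_plus_def l_eq by (simp add: smult_smult_mat mult.commute)

lemma \<omega>_MP1: "Y \<in> MP 0 n \<Longrightarrow> \<omega> \<cdot>\<^sub>m Y \<in> MP 1 n"
  using MP_smult_\<omega>[of Y n 1] by (simp del: One_nat_def)

lemma MP1_cent: "Y \<in> MP 1 n \<Longrightarrow> Y \<in> cent"
  using cent_congr[OF Ob_cent[OF Ob_zero] MP_int, of Y 1] MP_carrier[of Y 1 n] by (simp del: One_nat_def)

lemma N_Zg: "N \<subseteq> Zg"
proof
  fix h assume "h \<in> N"
  then obtain Y where Y: "Y \<in> MP 0 n" "h = rd (one_plus l Y)" using N_elt by blast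
  show "h \<in> Zg" unfolding Y(2) el_N by (rule Zg_el[OF MP1_cent[OF \<omega>_MP1[OF Y(1)]]])
qed

text \<open>An element of \<open>N\<close> has parameter \<omega> Y at level l'. Its quadratic term
  becomes integral, \<rho> sees the zero class, and in the linear term one power of \<omega>
  cancels.\<close>

lemma chi_N:
  assumes \<rho>: "\<rho> \<in> Rc" and h: "h \<in> N"
  shows "\<chi> \<rho> h = \<psi> h"
proof -
  obtain Y where Y: "Y \<in> MP 0 n" "h = rd (one_plus l Y)" using N_elt h by blast
  note w = \<omega>_MP1[OF Y(1)]
  have "(\<omega> \<cdot>\<^sub>m Y) * (\<omega> \<cdot>\<^sub>m Y) \<in> MP 1 n" by (rule MP_mult'[OF w MP_int[OF w]])
  then have "tb ((\<omega> \<cdot>\<^sub>m Y) * (\<omega> \<cdot>\<^sub>m Y)) / (2 * \<omega>) \<in> \<P> 0" using half tb_P by blast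
  moreover have "tb (\<omega> \<cdot>\<^sub>m Y) / \<omega> ^ l = tb Y / \<omega> ^ l'" unfolding tb_smult[OF Y(1)] l_eq by simp
  ultimately have "tb Y / \<omega> ^ l' - ex (\<omega> \<cdot>\<^sub>m Y) \<in> \<P> 0" by (simp add: ex_def)
  then have "\<tau> (ex (\<omega> \<cdot>\<^sub>m Y)) = \<tau> (tb Y / \<omega> ^ l')" using tau_congr by metis
  then show ?thesis
    using psi_rho_eq[OF MP1_cent[OF w], of \<rho>] Rc_zero[OF \<rho> w] psi_eq[OF Y(1)]
    unfolding Y(2) by (simp add: el_N tb_def)
qed

lemma AH_Zg: "A \<inter> H \<subseteq> Zg"
proof
  fix a assume "a \<in> A \<inter> H"
  then obtain y where y: "y \<in> Ob" "a = el y" using AN_elt[of a l'] l'(1) l_bounds(3) by blast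
  show "a \<in> Zg" unfolding y(2) by (rule Zg_el[OF Ob_cent[OF y(1)]])
qed

text \<open>Here l = l' + 1 enters: a congruence of the parameters modulo the maximal ideal becomes
  one of the group elements modulo the l-th power. So Z modulo \<open>N\<close> is the additive
  group of the centralizer over the residue field.\<close>

lemma el_ratio:
  assumes Y: "Y \<in> MP 0 n" and W: "W \<in> MP 0 n" and d: "Y - W \<in> MP 1 n"
  shows "\<exists>h\<in>N. el Y = el W \<otimes>\<^bsub>G\<^esub> h"
proof -
  let ?a = "one_plus l' W" and ?b = "one_plus l' Y"
  have a: "?a \<in> GLO n" and b: "?b \<in> GLO n" using one_plus_GLO[OF l'(1)] W Y by auto
  note m = minv[OF a]
  note c = MP_carrier[OF GLO_MP[OF a]] MP_carrier[OF GLO_MP[OF b]] MP_carrier[OF m(1)]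
  have h: "minv n ?a * ?b \<in> GLO n" by (rule GLO_mult[OF m(4) b])
  have "?b - ?a = \<omega> ^ l' \<cdot>\<^sub>m (Y - W)"
    unfolding one_plus_def using MP_carrier[OF Y] MP_carrier[OF W] by (intro eq_matI) (auto simp: algebra_simps)
  also have "\<dots> \<in> MP (1 + l') n" using MP_smult[OF \<omega>_P[of l'] d] by (simp add: add.commute)
  finally have "?b - ?a \<in> MP l n" unfolding l_eq by simp
  moreover have "minv n ?a * ?b - 1\<^sub>m n = minv n ?a * (?b - ?a)"
    using mult_minus_distrib_mat[OF c(3,2,1)] m(3) by simp
  ultimately have "minv n ?a * ?b - 1\<^sub>m n \<in> MP l n" using MP_mult[OF m(1)] by simp
  then have "rd (minv n ?a * ?b) \<in> N" using cong_iff[OF l_bounds(1,2) h] by simp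
  moreover have "el Y = el W \<otimes>\<^bsub>G\<^esub> rd (minv n ?a * ?b)"
  proof -
    have "el W \<otimes>\<^bsub>G\<^esub> rd (minv n ?a * ?b) = rd (?a * (minv n ?a * ?b))"
      by (rule rd_mult[OF GLO_MP[OF a] GLO_MP[OF h]])
    also have "?a * (minv n ?a * ?b) = ?b" using assoc_mult_mat[OF c(1,3,2)] m(2) c(2) by simp
    finally show ?thesis by simp
  qed
  ultimately show ?thesis by blast
qed

lemma Zg_AN: "z \<in> Zg \<Longrightarrow> \<exists>a\<in>A \<inter> H. \<exists>h\<in>N. z = a \<otimes>\<^bsub>G\<^esub> h"
proof -
  assume "z \<in> Zg"
  then obtain Y where Y: "Y \<in> cent" "z = el Y" using Zg_E by blast
  then obtain x where x: "x \<in> Ob" "Y - x \<in> MP 1 n" unfolding cent_iff by blast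
  have "el x \<in> A" unfolding A_eq using one_plus_Ob[OF l'(1) x(1)] by blast
  moreover have "el x \<in> H" unfolding H_eq using Ob_MP[OF x(1)] by blast
  ultimately show ?thesis using el_ratio[OF cent_MP[OF Y(1)] Ob_MP[OF x(1)] x(2)] Y(2) by blast
qed

lemma chi_inj:
  assumes "\<rho> \<in> Rc" "\<rho>' \<in> Rc" "\<And>z. z \<in> Zg \<Longrightarrow> \<chi> \<rho> z = \<chi> \<rho>' z"
  shows "\<rho> = \<rho>'"
proof (rule extensionalityI[OF Rc_ext[OF assms(1)] Rc_ext[OF assms(2)]])
  fix c assume "c \<in> rd1 ` cent"
  then obtain Y where Y: "Y \<in> cent" "c = rd1 Y" by blast
  show "\<rho> c = \<rho>' c"
    using assms(3)[OF Zg_el[OF Y(1)]] psi_rho_eq[OF Y(1)] tau_nz Y(2) by simp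
qed

text \<open>For trivial \<rho> the function \<tau>(ex Y) is itself a character of Z extending
  \<psi>. The quotient of \<phi> by it is trivial on \<open>N\<close>, hence depends only on the
  class of Y modulo the maximal ideal, and is additive in that class.\<close>

lemma chi_surj:
  assumes mu: "\<And>y z. y \<in> Zg \<Longrightarrow> z \<in> Zg \<Longrightarrow> \<phi> (y \<otimes>\<^bsub>G\<^esub> z) = \<phi> y * \<phi> z"
    and N: "\<And>h. h \<in> N \<Longrightarrow> \<phi> h = \<psi> h"
  shows "\<exists>\<rho>\<in>Rc. \<forall>z\<in>Zg. \<phi> z = \<chi> \<rho> z"
proof -
  define F where "F Y = \<phi> (el Y) / \<tau> (ex Y)" for Y
  have F: "F Y = F W" if Y: "Y \<in> cent" and W: "W \<in> cent" and d: "rd1 Y = rd1 W" for Y W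
  proof -
    obtain h where h: "h \<in> N" "el Y = el W \<otimes>\<^bsub>G\<^esub> h"
      using el_ratio[OF cent_MP[OF Y] cent_MP[OF W]] d rd1_eq_iff[OF cent_MP[OF Y] cent_MP[OF W]] by blast
    have hZ: "h \<in> Zg" using h(1) N_Zg by blast
    have "\<phi> (el Y) = \<phi> (el W) * \<psi> h" unfolding h(2) mu[OF Zg_el[OF W] hZ] N[OF h(1)] ..
    moreover have "\<tau> (ex Y) = \<tau> (ex W) * \<psi> h"
      using chi_mult[OF trivial_Rc Zg_el[OF W] hZ] chi_N[OF trivial_Rc h(1)] psi_rho_eq[OF W] psi_rho_eq[OF Y] Y W
      unfolding h(2)[symmetric] by simp
    ultimately show ?thesis using CS.\<psi>_nz[OF h(1)] tau_nz by (simp add: F_def)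
  qed
  define \<rho> where "\<rho> = (\<lambda>c\<in>rd1 ` cent. F (SOME Y. Y \<in> cent \<and> c = rd1 Y))"
  have r: "\<rho> (rd1 Y) = F Y" if Y: "Y \<in> cent" for Y
  proof -
    let ?W = "SOME W. W \<in> cent \<and> rd1 Y = rd1 W"
    have "?W \<in> cent \<and> rd1 Y = rd1 ?W" by (rule someI[of _ Y]) (use Y in simp)
    then have "F ?W = F Y" using F[of ?W Y] Y by simp
    then show ?thesis using Y by (simp add: \<rho>_def)
  qed
  have nz: "\<phi> z \<noteq> 0" if z: "z \<in> Zg" for z
  proof -
    have "\<phi> (z \<otimes>\<^bsub>G\<^esub> inv\<^bsub>G\<^esub> z) = \<psi> \<one>\<^bsub>G\<^esub>"
      using N[OF CS.N_one] subgroup.mem_carrier[OF Zg_subgroup z] by simp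
    then have "\<phi> z * \<phi> (inv\<^bsub>G\<^esub> z) = 1" using mu[OF z subgroup.m_inv_closed[OF Zg_subgroup z]] CS.\<psi>_one by simp
    then show ?thesis by auto
  qed
  have "\<rho> \<in> Rc"
    unfolding Rc_iff
  proof (intro conjI ballI)
    fix Y assume Y: "Y \<in> cent"
    show "\<rho> (rd1 Y) \<noteq> 0" using r[OF Y] nz[OF Zg_el[OF Y]] tau_nz by (simp add: F_def)
    fix W assume W: "W \<in> cent"
    note V = cent_prod[OF Y W]
    have "\<rho> (rd1 (Y + W)) = F (Y + W + \<omega> ^ l' \<cdot>\<^sub>m (Y * W))" unfolding V(2)[symmetric] by (rule r[OF V(1)])
    also have "\<dots> = F Y * F W"
      unfolding F_def V(3) el_mult[OF cent_MP[OF Y] cent_MP[OF W], symmetric] mu[OF Zg_el[OF Y] Zg_el[OF W]] by simp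
    finally show "\<rho> (rd1 (Y + W)) = \<rho> (rd1 Y) * \<rho> (rd1 W)" unfolding r[OF Y] r[OF W] .
  qed (simp add: \<rho>_def)
  moreover have "\<phi> z = \<chi> \<rho> z" if z: "z \<in> Zg" for z
  proof -
    obtain Y where Y: "Y \<in> cent" "z = el Y" using Zg_E[OF z] by blast
    show ?thesis unfolding Y(2) psi_rho_eq[OF Y(1)] r[OF Y(1)] using tau_nz by (simp add: F_def)
  qed
  ultimately show ?thesis by blast
qed

text \<open>Write \<open>ab - ba = \<omega>\<^sup>2\<^sup>l\<^sup>' (YW - WY)\<close> for \<open>a = 1 + \<omega>\<^sup>l\<^sup>' Y\<close> and \<open>b = 1 + \<omega>\<^sup>l\<^sup>' W\<close>; since \<open>2l' \<ge> l\<close>, the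
  commutator \<open>ab (ba)\<^sup>-\<^sup>1\<close> lies in \<open>K\<^sub>l\<close>.\<close>

lemma commutator:
  assumes Y: "Y \<in> MP 0 n" and W: "W \<in> MP 0 n"
  shows "\<exists>h\<in>N. el Y \<otimes>\<^bsub>G\<^esub> el W = h \<otimes>\<^bsub>G\<^esub> (el W \<otimes>\<^bsub>G\<^esub> el Y) \<and> \<psi> h = \<tau> ((tb (Y * W) - tb (W * Y)) / \<omega>)"
proof -
  let ?a = "one_plus l' Y" and ?b = "one_plus l' W"
  let ?D = "Y * W - W * Y"
  have a: "?a \<in> GLO n" and b: "?b \<in> GLO n" using one_plus_GLO[OF l'(1)] W Y by auto
  have ba: "?b * ?a \<in> GLO n" by (rule GLO_mult[OF b a])
  define M where "M = minv n (?b * ?a)"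
  note m = minv[OF ba, folded M_def]
  have D: "?D \<in> MP 0 n" using Y W by simp
  have DM: "?D * M \<in> MP 0 n" using D m(1) by simp
  note c = MP_carrier[OF GLO_MP[OF a]] MP_carrier[OF GLO_MP[OF b]] MP_carrier[OF GLO_MP[OF ba]] MP_carrier[OF m(1)]
    MP_carrier[OF D] MP_carrier[OF Y] MP_carrier[OF W]
  have ab: "?a * ?b = ?b * ?a + \<omega> ^ l' \<cdot>\<^sub>m (\<omega> ^ l' \<cdot>\<^sub>m ?D)"
    unfolding one_plus_mult[OF Y W] one_plus_mult[OF W Y] unfolding one_plus_def
    using c(6,7) carrier_matD[OF mult_carrier_mat[OF c(6,7)]] carrier_matD[OF mult_carrier_mat[OF c(7,6)]]
    by (intro eq_matI) (auto simp: algebra_simps simp del: index_mult_mat(1))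
  define T where "T = \<omega> ^ (l' - 1) \<cdot>\<^sub>m (?D * M)"
  have T: "T \<in> MP 0 n" unfolding T_def by (rule MP_int[OF MP_smult_\<omega>[OF DM]])
  \<comment> \<open>2 l' = l + (l' - 1) for l = l' + 1; the truncated subtraction is exact because
    l' is at least 1.\<close>
  have pw: "\<omega> ^ l' * \<omega> ^ l' = \<omega> ^ l * \<omega> ^ (l' - 1)"
    using l'(1) unfolding l_eq by (cases l') simp_all
  have one: "?a * ?b * M = one_plus l T"
  proof -
    have "?a * ?b * M = ?b * ?a * M + \<omega> ^ l' \<cdot>\<^sub>m (\<omega> ^ l' \<cdot>\<^sub>m ?D) * M"
      unfolding ab by (rule add_mult_distrib_mat[OF c(3) _ c(4)]) (use c(5) in simp)
    also have "\<omega> ^ l' \<cdot>\<^sub>m (\<omega> ^ l' \<cdot>\<^sub>m ?D) * M = (\<omega> ^ l' * \<omega> ^ l') \<cdot>\<^sub>m (?D * M)"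
      unfolding smult_smult_mat by (rule mult_smult_assoc_mat[OF c(5,4)])
    finally have "?a * ?b * M = 1\<^sub>m n + (\<omega> ^ l' * \<omega> ^ l') \<cdot>\<^sub>m (?D * M)" unfolding m(2) .
    then show ?thesis unfolding pw one_plus_def[of l] T_def smult_smult_mat .
  qed
  have eq: "one_plus l T * (?b * ?a) = ?a * ?b"
  proof -
    have "?a * ?b * M * (?b * ?a) = ?a * ?b * (M * (?b * ?a))"
      by (rule assoc_mult_mat[OF mult_carrier_mat[OF c(1,2)] c(4,3)])
    then show ?thesis unfolding one m(3) using right_mult_one_mat[OF mult_carrier_mat[OF c(1,2)]] by simp
  qed
  have "rd (one_plus l T) \<in> N" using T cong_eq[OF l_bounds(1,2)] by blast
  moreover have "el Y \<otimes>\<^bsub>G\<^esub> el W = rd (one_plus l T) \<otimes>\<^bsub>G\<^esub> (el W \<otimes>\<^bsub>G\<^esub> el Y)"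
    unfolding rd_mult[OF GLO_MP[OF a] GLO_MP[OF b]] rd_mult[OF GLO_MP[OF b] GLO_MP[OF a]]
      rd_mult[OF one_plus_MP[OF l_bounds(1) T] GLO_MP[OF ba]] eq ..
  moreover have "\<psi> (rd (one_plus l T)) = \<tau> ((tb (Y * W) - tb (W * Y)) / \<omega>)"
  proof -
    \<comment> \<open>Modulo the maximal ideal b a is 1, hence so is its inverse M, and the factor M
      may be dropped from the trace after division by \<omega>.\<close>
    have "?b * ?a - 1\<^sub>m n \<in> MP 1 n"
    proof -
      have YW: "W + Y + \<omega> ^ l' \<cdot>\<^sub>m (W * Y) \<in> MP 0 n"
        by (rule MP_add[OF MP_add[OF W Y] MP_int[OF MP_smult_\<omega>[OF MP_mult[OF W Y]]]])
      show ?thesis unfolding one_plus_mult[OF W Y] by (rule MP_mono[OF l'(1) one_plus_cong[OF YW]])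
    qed
    then have M1: "M * (?b * ?a - 1\<^sub>m n) \<in> MP 1 n" by (rule MP_mult[OF m(1)])
    have "M * (?b * ?a - 1\<^sub>m n) = 1\<^sub>m n - M"
      using mult_minus_distrib_mat[OF c(4,3) one_carrier_mat] m(3) c(4) by simp
    then have "?D * (1\<^sub>m n - M) \<in> MP 1 n" using MP_mult[OF D M1] by simp
    moreover have "?D * (1\<^sub>m n - M) = ?D - ?D * M"
      using mult_minus_distrib_mat[OF c(5) one_carrier_mat c(4)] right_mult_one_mat[OF c(5)] by simp
    ultimately have "tb ?D - tb (?D * M) \<in> \<P> (0 + 1)" using tb_P[of "?D - ?D * M" 1] tb_diff[OF D DM] by simp
    then have "(tb ?D - tb (?D * M)) / \<omega> ^ 1 \<in> \<P> 0" by (simp only: P_divide_iff)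
    then have "\<tau> (tb ?D / \<omega>) = \<tau> (tb (?D * M) / \<omega>)" by (intro tau_congr) (simp add: diff_divide_distrib)
    moreover have "tb T / \<omega> ^ l' = tb (?D * M) / \<omega>"
      unfolding T_def tb_smult[OF DM] using l'(1) by (cases l') auto
    ultimately show ?thesis unfolding psi_eq[OF T] tb_def[symmetric] using tb_diff Y W by simp
  qed
  ultimately show ?thesis by blast
qed

text \<open>The two factors of S = A H act for different reasons. For \<open>H\<close> the
  commutator with z lies in \<open>N\<close> and has \<psi>-value 1, since z is in the radical of
  the pairing. For \<open>A\<close> the conjugating matrix commutes with \<beta>, so the traces do
  not change, and Y is congruent to an element of the commutative ring O[\<beta>], so neither does
  its class modulo the maximal ideal.\<close>

lemma conj_Z:
  assumes s: "s \<in> S" and z: "z \<in> Zg"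
  shows "s \<otimes>\<^bsub>G\<^esub> z \<otimes>\<^bsub>G\<^esub> inv\<^bsub>G\<^esub> s \<in> Zg" "\<rho> \<in> Rc \<Longrightarrow> \<chi> \<rho> (s \<otimes>\<^bsub>G\<^esub> z \<otimes>\<^bsub>G\<^esub> inv\<^bsub>G\<^esub> s) = \<chi> \<rho> z"
proof -
  have Hc: "h \<otimes>\<^bsub>G\<^esub> z \<otimes>\<^bsub>G\<^esub> inv\<^bsub>G\<^esub> h \<in> Zg \<and> (\<forall>\<rho>\<in>Rc. \<chi> \<rho> (h \<otimes>\<^bsub>G\<^esub> z \<otimes>\<^bsub>G\<^esub> inv\<^bsub>G\<^esub> h) = \<chi> \<rho> z)" if h: "h \<in> H" for h
  proof -
    obtain W where W: "W \<in> MP 0 n" "h = el W" using h unfolding H_eq by blast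
    obtain Y where Y: "Y \<in> cent" "z = el Y" using Zg_E[OF z] by blast
    obtain k where k: "k \<in> N" "h \<otimes>\<^bsub>G\<^esub> z = k \<otimes>\<^bsub>G\<^esub> (z \<otimes>\<^bsub>G\<^esub> h)" "\<psi> k = \<tau> ((tb (W * Y) - tb (Y * W)) / \<omega>)"
      using commutator[OF W(1) cent_MP[OF Y(1)]] Y(2) W(2) by blast
    have "tb (W * Y) - tb (Y * W) \<in> \<P> (0 + 1)" using tb_comm_cent[OF W(1) Y(1)] by simp
    then have "(tb (W * Y) - tb (Y * W)) / \<omega> ^ 1 \<in> \<P> 0" by (simp only: P_divide_iff)
    then have k1: "\<psi> k = 1" using k(3) tau_P0 by simp
    have kZ: "k \<in> Zg" using k(1) N_Zg by blast
    note car = subgroup.mem_carrier[OF Zg_subgroup kZ] subgroup.mem_carrier[OF Zg_subgroup z] subgroup.mem_carrier[OF H_subgroup h]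
    have "h \<otimes>\<^bsub>G\<^esub> z \<otimes>\<^bsub>G\<^esub> inv\<^bsub>G\<^esub> h = k \<otimes>\<^bsub>G\<^esub> z" unfolding k(2) using car by (simp add: G.m_assoc)
    then show ?thesis using Zg_mult[OF kZ z] chi_mult[OF _ kZ z] chi_N[OF _ k(1)] k1 by simp
  qed
  have Ac: "a \<otimes>\<^bsub>G\<^esub> y \<otimes>\<^bsub>G\<^esub> inv\<^bsub>G\<^esub> a \<in> Zg \<and> (\<forall>\<rho>\<in>Rc. \<chi> \<rho> (a \<otimes>\<^bsub>G\<^esub> y \<otimes>\<^bsub>G\<^esub> inv\<^bsub>G\<^esub> a) = \<chi> \<rho> y)"
    if a: "a \<in> A" and y: "y \<in> Zg" for a y
  proof -
    obtain x where x: "x \<in> Ob" "x \<in> GLO n" "a = rd x" using a unfolding A_eq by blast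
    obtain Y where Y: "Y \<in> cent" "y = el Y" using Zg_E[OF y] by blast
    obtain u where u: "u \<in> Ob" "Y - u \<in> MP 1 n" using Y(1) unfolding cent_iff by blast
    note Ym = cent_MP[OF Y(1)] and m = minv[OF x(2)]
    note c = Ob_carrier[OF x(1)] MP_carrier[OF Ym] MP_carrier[OF m(1)] beta_carrier Ob_carrier[OF u(1)]
    let ?W = "x * Y * minv n x"
    have W: "?W \<in> MP 0 n" using Ym m(1) Ob_MP[OF x(1)] by simp
    have mb: "minv n x * \<beta> = \<beta> * minv n x" by (rule Kc_closed(6)[OF Ob_Kc[OF minv_Ob[OF x(1,2)]] Kc_beta])
    have tr: "tb (x * V * minv n x) = tb V" if V: "V \<in> carrier_mat n n" for V
    proof -
      have "x * V * minv n x * \<beta> = x * (V * \<beta> * minv n x)"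
        using c V mb by (simp add: assoc_mult_mat[of _ n n _ n _ n] mult_carrier_mat[of _ n n _ n])
      then have "tb (x * V * minv n x) = mtrace (V * \<beta> * minv n x * x)"
        unfolding tb_def using mtrace_mult_comm[OF c(1) mult_carrier_mat[OF mult_carrier_mat[OF V c(4)] c(3)]] by simp
      also have "V * \<beta> * minv n x * x = V * \<beta>"
        using assoc_mult_mat[OF mult_carrier_mat[OF V c(4)] c(3,1)] m(3) right_mult_one_mat[OF mult_carrier_mat[OF V c(4)]] by simp
      finally show ?thesis by (simp add: tb_def)
    qed
    have WW: "?W * ?W = x * (Y * Y) * minv n x"
    proof -
      have "?W * ?W = x * Y * (minv n x * x) * (Y * minv n x)"
        using c by (simp add: assoc_mult_mat[of _ n n _ n _ n] mult_carrier_mat[of _ n n _ n])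
      also have "\<dots> = x * (Y * Y) * minv n x"
        unfolding m(3) using c by (simp add: assoc_mult_mat[of _ n n _ n _ n] mult_carrier_mat[of _ n n _ n])
      finally show ?thesis .
    qed
    have ex: "ex ?W = ex Y" unfolding ex_def WW tr[OF c(2)] tr[OF mult_carrier_mat[OF c(2,2)]] ..
    have cu: "x * u * minv n x = u"
    proof -
      have "x * u * minv n x = u * x * minv n x" using Kc_closed(6)[OF Ob_Kc[OF x(1)] Ob_Kc[OF u(1)]] by simp
      also have "\<dots> = u" using assoc_mult_mat[OF c(5,1,3)] m(2) c(5) by simp
      finally show ?thesis .
    qed
    have "x * (Y - u) * minv n x = ?W - u"
    proof -
      have "x * (Y - u) = x * Y - x * u" by (rule mult_minus_distrib_mat[OF c(1,2,5)])
      then show ?thesis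
        using minus_mult_distrib_mat[OF mult_carrier_mat[OF c(1,2)] mult_carrier_mat[OF c(1,5)] c(3)] cu by simp
    qed
    moreover have "x * (Y - u) * minv n x \<in> MP 1 n" by (rule MP_mult'[OF MP_mult[OF Ob_MP[OF x(1)] u(2)] m(1)])
    ultimately have Wu: "?W - u \<in> MP 1 n" by simp
    have "?W - Y = (?W - u) - (Y - u)" using c(2,5) carrier_matD[OF MP_carrier[OF W]] by (intro eq_matI) auto
    then have d: "?W - Y \<in> MP 1 n" using MP_diff[OF Wu u(2)] by simp
    have Wc: "?W \<in> cent" by (rule cent_congr[OF Y(1) W d])
    have "rd1 ?W = rd1 Y" using rd1_eq_iff[OF W Ym] d by simp
    moreover have "a \<otimes>\<^bsub>G\<^esub> y \<otimes>\<^bsub>G\<^esub> inv\<^bsub>G\<^esub> a = el ?W"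
      unfolding x(3) Y(2) rd_conj[OF x(2) one_plus_MP[OF l'(1) Ym]] conj_one_plus[OF x(2) Ym] ..
    ultimately show ?thesis using Zg_el[OF Wc] psi_rho_eq[OF Wc] psi_rho_eq[OF Y(1)] ex Y(2) by simp
  qed
  obtain a h where ah: "a \<in> A" "h \<in> H" "s = a \<otimes>\<^bsub>G\<^esub> h" using s unfolding S_AH by blast
  note car = subgroup.mem_carrier[OF A_subgroup ah(1)] subgroup.mem_carrier[OF H_subgroup ah(2)] subgroup.mem_carrier[OF Zg_subgroup z]
  have e: "s \<otimes>\<^bsub>G\<^esub> z \<otimes>\<^bsub>G\<^esub> inv\<^bsub>G\<^esub> s = a \<otimes>\<^bsub>G\<^esub> (h \<otimes>\<^bsub>G\<^esub> z \<otimes>\<^bsub>G\<^esub> inv\<^bsub>G\<^esub> h) \<otimes>\<^bsub>G\<^esub> inv\<^bsub>G\<^esub> a"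
    unfolding ah(3) using car by (simp add: G.inv_mult_group G.m_assoc)
  show "s \<otimes>\<^bsub>G\<^esub> z \<otimes>\<^bsub>G\<^esub> inv\<^bsub>G\<^esub> s \<in> Zg" "\<rho> \<in> Rc \<Longrightarrow> \<chi> \<rho> (s \<otimes>\<^bsub>G\<^esub> z \<otimes>\<^bsub>G\<^esub> inv\<^bsub>G\<^esub> s) = \<chi> \<rho> z"
    unfolding e using Hc[OF ah(2)] Ac[OF ah(1)] by auto
qed

text \<open>\<open>commutator\<close> leaves its element of \<open>N\<close> on the left.
  Conjugating it by z y moves it to the right, and the value of \<psi> survives because z y
  stabilizes \<psi>.\<close>

lemma Zg_commute:
  assumes y: "y \<in> Zg" and z: "z \<in> Zg"
  shows "\<exists>h\<in>N. y \<otimes>\<^bsub>G\<^esub> z = z \<otimes>\<^bsub>G\<^esub> y \<otimes>\<^bsub>G\<^esub> h \<and> \<psi> h = 1"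
proof -
  obtain Y W where Y: "Y \<in> cent" "y = el Y" and W: "W \<in> cent" "z = el W" using Zg_E y z by blast
  obtain k where k: "k \<in> N" "y \<otimes>\<^bsub>G\<^esub> z = k \<otimes>\<^bsub>G\<^esub> (z \<otimes>\<^bsub>G\<^esub> y)" "\<psi> k = \<tau> ((tb (Y * W) - tb (W * Y)) / \<omega>)"
    using commutator[OF cent_MP[OF Y(1)] cent_MP[OF W(1)]] Y(2) W(2) by blast
  have "tb (Y * W) - tb (W * Y) \<in> \<P> (0 + 1)" using tb_comm_cent[OF cent_MP[OF Y(1)] W(1)] by simp
  then have "(tb (Y * W) - tb (W * Y)) / \<omega> ^ 1 \<in> \<P> 0" by (simp only: P_divide_iff)
  then have k1: "\<psi> k = 1" using k(3) tau_P0 by simp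
  let ?s = "z \<otimes>\<^bsub>G\<^esub> y"
  have HS: "H \<subseteq> S"
  proof
    fix h assume "h \<in> H"
    then have "h = \<one>\<^bsub>G\<^esub> \<otimes>\<^bsub>G\<^esub> h" using subgroup.mem_carrier[OF H_subgroup] by simp
    then show "h \<in> S" unfolding S_AH using \<open>h \<in> H\<close> subgroup.one_closed[OF A_subgroup] by blast
  qed
  have "?s \<in> S" using Zg_mult[OF z y] Zg_H HS by blast
  then have sS: "inv\<^bsub>G\<^esub> ?s \<in> S" by (rule subgroup.m_inv_closed[OF CS.S_subgroup])
  note car = subgroup.mem_carrier[OF Zg_subgroup Zg_mult[OF z y]] CS.N_carrier[OF k(1)]
  have "inv\<^bsub>G\<^esub> ?s \<otimes>\<^bsub>G\<^esub> k \<otimes>\<^bsub>G\<^esub> inv\<^bsub>G\<^esub> (inv\<^bsub>G\<^esub> ?s) \<in> N" by (rule CS.N_normal[OF G.inv_closed[OF car(1)] k(1)])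
  moreover have "\<psi> (inv\<^bsub>G\<^esub> ?s \<otimes>\<^bsub>G\<^esub> k \<otimes>\<^bsub>G\<^esub> inv\<^bsub>G\<^esub> (inv\<^bsub>G\<^esub> ?s)) = \<psi> k"
    using sS k(1) unfolding CS.S_eq by blast
  moreover have "y \<otimes>\<^bsub>G\<^esub> z = ?s \<otimes>\<^bsub>G\<^esub> (inv\<^bsub>G\<^esub> ?s \<otimes>\<^bsub>G\<^esub> k \<otimes>\<^bsub>G\<^esub> inv\<^bsub>G\<^esub> (inv\<^bsub>G\<^esub> ?s))"
    unfolding k(2) G.inv_inv[OF car(1)] using G.m_assoc[of ?s "inv\<^bsub>G\<^esub> ?s \<otimes>\<^bsub>G\<^esub> k" ?s] G.m_assoc[of ?s "inv\<^bsub>G\<^esub> ?s" k] car by simp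
  ultimately show ?thesis using k1 by metis
qed

text \<open>If Y does not commute with \<beta> modulo the maximal ideal, \<open>tau_trace\<close>
  provides a W on which the pairing with Y, written by \<open>tb_comm\<close> as a trace against
  Y\<beta> - \<beta>Y, is nontrivial.\<close>

lemma nondegenerate:
  assumes h: "h \<in> H" and nz: "h \<notin> Zg"
  shows "\<exists>y\<in>H. \<exists>k\<in>N. y \<otimes>\<^bsub>G\<^esub> h \<otimes>\<^bsub>G\<^esub> inv\<^bsub>G\<^esub> y = k \<otimes>\<^bsub>G\<^esub> h \<and> \<psi> k \<noteq> 1"
proof -
  obtain Y where Y: "Y \<in> MP 0 n" "h = el Y" using h unfolding H_eq by blast
  have "Y \<notin> cent" using nz Zg_el Y(2) by blast
  then have "Y * \<beta> - \<beta> * Y \<notin> MP 1 n" using Y(1) by (simp add: cent_def)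
  moreover have "Y * \<beta> - \<beta> * Y \<in> MP 0 n" using Y(1) beta by simp
  ultimately obtain W where W: "W \<in> MP 0 n" "\<tau> (mtrace (W * (Y * \<beta> - \<beta> * Y)) / \<omega> ^ 1) \<noteq> 1"
    using tau_trace[of "Y * \<beta> - \<beta> * Y" 1] by blast
  obtain k where k: "k \<in> N" "el W \<otimes>\<^bsub>G\<^esub> h = k \<otimes>\<^bsub>G\<^esub> (h \<otimes>\<^bsub>G\<^esub> el W)" "\<psi> k = \<tau> ((tb (W * Y) - tb (Y * W)) / \<omega>)"
    using commutator[OF W(1) Y(1)] Y(2) by blast
  have wH: "el W \<in> H" unfolding H_eq using W(1) by blast
  note car = subgroup.mem_carrier[OF H_subgroup h] subgroup.mem_carrier[OF H_subgroup wH] CS.N_carrier[OF k(1)]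
  have "el W \<otimes>\<^bsub>G\<^esub> h \<otimes>\<^bsub>G\<^esub> inv\<^bsub>G\<^esub> (el W) = k \<otimes>\<^bsub>G\<^esub> h" unfolding k(2) using car by (simp add: G.m_assoc)
  moreover have "\<psi> k \<noteq> 1" using W(2) tb_comm[OF W(1) Y(1)] k(3) by simp
  ultimately show ?thesis using wH k(1) by blast
qed

end

section \<open>The bijection\<close>

lemma one_dim_irreducible:
  assumes K: "group K" and mult: "\<And>h k. h \<in> carrier K \<Longrightarrow> k \<in> carrier K \<Longrightarrow> c (h \<otimes>\<^bsub>K\<^esub> k) = c h * c k"
    and one: "c \<one>\<^bsub>K\<^esub> = 1"
  shows "irreducible_rep K (1, \<lambda>h. c h \<cdot>\<^sub>m 1\<^sub>m 1)"
proof -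
  have "is_rep K (1, \<lambda>h. c h \<cdot>\<^sub>m 1\<^sub>m 1)"
  proof (rule is_repI[OF K])
    fix g h assume "g \<in> carrier K" "h \<in> carrier K"
    then show "snd (1, \<lambda>h. c h \<cdot>\<^sub>m 1\<^sub>m 1) (g \<otimes>\<^bsub>K\<^esub> h) = snd (1, \<lambda>h. c h \<cdot>\<^sub>m 1\<^sub>m 1) g * snd (1, \<lambda>h. c h \<cdot>\<^sub>m 1\<^sub>m 1) h"
      using mult by (intro eq_matI) (auto simp: scalar_prod_def)
  qed (use one in \<open>auto simp: smult_one_mat\<close>)
  moreover have "W = {0\<^sub>v 1} \<or> W = carrier_vec 1"
    if W: "W \<subseteq> carrier_vec 1" "0\<^sub>v 1 \<in> W" "\<And>a w. w \<in> W \<Longrightarrow> a \<cdot>\<^sub>v w \<in> W" for W :: "complex vec set"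
  proof (rule disjCI)
    assume "W \<noteq> carrier_vec 1"
    then obtain u where u: "u \<in> carrier_vec 1" "u \<notin> W" using W(1) by blast
    have "w = 0\<^sub>v 1" if w: "w \<in> W" for w
    proof (rule ccontr)
      have wc: "dim_vec w = 1" using w W(1) carrier_vecD by blast
      assume "w \<noteq> 0\<^sub>v 1"
      then have "w $ 0 \<noteq> 0" using wc by (auto simp: vec_eq_iff)
      then have "(u $ 0 / w $ 0) \<cdot>\<^sub>v w = u" using wc carrier_vecD[OF u(1)] by (intro eq_vecI) auto
      then show False using W(3)[OF w] u(2) by metis
    qed
    then show "W = {0\<^sub>v 1}" using W(2) by blast
  qed
  ultimately show ?thesis unfolding irreducible_rep_def subspace_module_vec_iff by simp
qed

section \<open>Even level\<close>

locale even_setting = character_setting v \<omega> n p \<beta> \<tau> l l'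
  for v :: "'f::field \<Rightarrow> int" and \<omega> :: 'f and n :: nat and p :: "'f poly" and \<beta> :: "'f mat"
    and \<tau> :: "'f \<Rightarrow> complex" and l l' :: nat +
  assumes l_eq: "l' = l"
begin

lemma H_N: "H = N"
  by (simp only: l_eq)

text \<open>\<psi> is multiplicative with values in a commutative group, so it is 1 on commutators
  of \<open>N\<close>.\<close>

lemma N_commute:
  assumes y: "y \<in> N" and z: "z \<in> N"
  shows "\<exists>k\<in>N. y \<otimes>\<^bsub>G\<^esub> z = z \<otimes>\<^bsub>G\<^esub> y \<otimes>\<^bsub>G\<^esub> k \<and> \<psi> k = 1"
proof -
  note N = CS.N
  let ?k = "inv\<^bsub>G\<^esub> (z \<otimes>\<^bsub>G\<^esub> y) \<otimes>\<^bsub>G\<^esub> (y \<otimes>\<^bsub>G\<^esub> z)"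
  have zy: "z \<otimes>\<^bsub>G\<^esub> y \<in> N" "y \<otimes>\<^bsub>G\<^esub> z \<in> N" using subgroup.m_closed[OF N] y z by auto
  have k: "?k \<in> N" by (rule subgroup.m_closed[OF N subgroup.m_inv_closed[OF N zy(1)] zy(2)])
  have e: "y \<otimes>\<^bsub>G\<^esub> z = z \<otimes>\<^bsub>G\<^esub> y \<otimes>\<^bsub>G\<^esub> ?k"
    using CS.N_carrier[OF zy(1)] CS.N_carrier[OF zy(2)] G.m_assoc[of "z \<otimes>\<^bsub>G\<^esub> y" "inv\<^bsub>G\<^esub> (z \<otimes>\<^bsub>G\<^esub> y)" "y \<otimes>\<^bsub>G\<^esub> z"] by simp
  have "\<psi> (z \<otimes>\<^bsub>G\<^esub> y) * \<psi> ?k = \<psi> (y \<otimes>\<^bsub>G\<^esub> z)" using psi_mult[OF zy(1) k] e by simp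
  also have "\<dots> = \<psi> (z \<otimes>\<^bsub>G\<^esub> y)" using psi_mult[OF y z] psi_mult[OF z y] by simp
  finally have "\<psi> ?k = 1" using CS.\<psi>_nz[OF zy(1)] by simp
  then show ?thesis using e k by blast
qed

lemma A_le_S: "a \<in> A \<Longrightarrow> a \<in> S"
proof -
  assume a: "a \<in> A"
  then have "a = a \<otimes>\<^bsub>G\<^esub> \<one>\<^bsub>G\<^esub>" using subgroup.mem_carrier[OF A_subgroup] by simp
  then show "a \<in> S" unfolding S_AH using a subgroup.one_closed[OF H_subgroup] by blast
qed

abbreviation \<pi>\<^sub>0 :: "unit \<Rightarrow> 'f set mat matrix_rep" where "\<pi>\<^sub>0 \<equiv> \<lambda>_. (1, \<lambda>h. \<psi> h \<cdot>\<^sub>m 1\<^sub>m 1)"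

sublocale HE: heisenberg_extension G N \<psi> S N N A "{()}" "\<lambda>_. \<psi>" \<pi>\<^sub>0 "\<lambda>_ _. 1\<^sub>m 1"
proof (intro heisenberg_extension.intro heisenberg_extension_axioms.intro CS.character_stabilizer_axioms
    CS.N A_subgroup A_commute S_AH[unfolded H_N] N_commute)
  fix a h assume a: "a \<in> A" and h: "h \<in> N"
  have aG: "a \<in> carrier G" by (rule subgroup.mem_carrier[OF A_subgroup a])
  show "inv\<^bsub>G\<^esub> a \<otimes>\<^bsub>G\<^esub> h \<otimes>\<^bsub>G\<^esub> a \<in> N"
    using CS.N_normal[OF G.inv_closed[OF aG] h] aG by simp
  have "inv\<^bsub>G\<^esub> a \<in> S" by (rule subgroup.m_inv_closed[OF CS.S_subgroup A_le_S[OF a]])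
  \<comment> \<open>With trivial U and the scalar representation given by \<psi>, the twisting
    relation is just the invariance of \<psi> under conjugation by \<open>A\<close>.\<close>
  then have "\<psi> (inv\<^bsub>G\<^esub> a \<otimes>\<^bsub>G\<^esub> h \<otimes>\<^bsub>G\<^esub> inv\<^bsub>G\<^esub> (inv\<^bsub>G\<^esub> a)) = \<psi> h" using h unfolding CS.S_eq by blast
  then have "\<psi> (inv\<^bsub>G\<^esub> a \<otimes>\<^bsub>G\<^esub> h \<otimes>\<^bsub>G\<^esub> a) = \<psi> h" using aG by simp
  moreover have "inv\<^bsub>GLC 1\<^esub> (1\<^sub>m 1) = 1\<^sub>m 1"
    using monoid.inv_one[OF group.is_monoid[OF GLC_group[of 1]]] by (simp add: GLC_simps)
  ultimately show "snd (\<pi>\<^sub>0 i) (inv\<^bsub>G\<^esub> a \<otimes>\<^bsub>G\<^esub> h \<otimes>\<^bsub>G\<^esub> a) =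
      inv\<^bsub>GLC (fst (\<pi>\<^sub>0 i))\<^esub> (1\<^sub>m 1) \<otimes>\<^bsub>GLC (fst (\<pi>\<^sub>0 i))\<^esub> snd (\<pi>\<^sub>0 i) h \<otimes>\<^bsub>GLC (fst (\<pi>\<^sub>0 i))\<^esub> 1\<^sub>m 1" for i
    by (simp add: GLC_simps(2) del: One_nat_def)
next
  show "A \<inter> N \<subseteq> N" by blast
  show "\<exists>a\<in>A \<inter> N. \<exists>k\<in>N. z = a \<otimes>\<^bsub>G\<^esub> k" if "z \<in> N" for z
    using that CS.N_one subgroup.one_closed[OF A_subgroup] CS.N_carrier[OF that]
    by (intro bexI[of _ "\<one>\<^bsub>G\<^esub>"] bexI[of _ z]) auto
  show "\<psi> (y \<otimes>\<^bsub>G\<^esub> z) = \<psi> y * \<psi> z" if "y \<in> N" "z \<in> N" for y z by (rule psi_mult[OF that])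
  show "\<exists>i\<in>{()}. \<forall>z\<in>N. \<phi> z = \<psi> z" if "\<And>k. k \<in> N \<Longrightarrow> \<phi> k = \<psi> k" for \<phi> using that by blast
  show "s \<otimes>\<^bsub>G\<^esub> z \<otimes>\<^bsub>G\<^esub> inv\<^bsub>G\<^esub> s \<in> N" if "s \<in> S" "z \<in> N" for s z
    by (rule CS.N_normal[OF CS.S_carrier[OF that(1)] that(2)])
  show "\<psi> (s \<otimes>\<^bsub>G\<^esub> z \<otimes>\<^bsub>G\<^esub> inv\<^bsub>G\<^esub> s) = \<psi> z" if "s \<in> S" "z \<in> N" for s z
    using that unfolding CS.S_eq by blast
  show "irreducible_rep (G\<lparr>carrier := N\<rparr>) (\<pi>\<^sub>0 i)" for i
  proof (rule one_dim_irreducible)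
    show "group (G\<lparr>carrier := N\<rparr>)" by (rule subgroup.subgroup_is_group[OF CS.N G.is_group])
  qed (simp_all add: psi_mult CS.\<psi>_one)
  show "contains_char N \<psi> (\<pi>\<^sub>0 i)" for i
  proof -
    have "\<psi> h \<cdot>\<^sub>m 1\<^sub>m 1 *\<^sub>v unit_vec 1 0 = \<psi> h \<cdot>\<^sub>v unit_vec 1 0" for h
      by (intro eq_vecI) (auto simp: scalar_prod_def)
    moreover have "unit_vec 1 0 \<noteq> (0\<^sub>v 1 :: complex vec)"
      using index_unit_vec(1)[of 0 1 0, where 'a = complex] by (metis index_zero_vec(1) less_one zero_neq_one)
    ultimately show ?thesis unfolding contains_char_def by (intro bexI[of _ "unit_vec 1 0"]) auto
  qed
  show "(\<lambda>_. 1\<^sub>m 1) \<in> hom (G\<lparr>carrier := A\<rparr>) (GLC (fst (\<pi>\<^sub>0 i)))" for i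
    by (auto simp: hom_def GLC_simps intro!: bexI[of _ "1\<^sub>m 1"])
qed auto

text \<open>Both definite descriptions range over g in \<open>A\<close>, where
  \<open>to_A \<theta>\<close> and \<open>theta_G\<close> agree, so they describe the same
  predicate; existence and uniqueness of the described value play no part at this point.\<close>

lemma sigma_eq: "sigma v \<omega> \<tau> n l l' \<beta> P U \<theta> = HE.extension (to_A \<theta>)"
proof -
  have "(THE M. \<exists>g\<in>A. \<exists>h\<in>N. x = g \<otimes>\<^bsub>G\<^esub> h \<and> M = (theta_G v n r \<beta> \<theta> g * \<psi> h) \<cdot>\<^sub>m 1\<^sub>m 1) =
      (THE M. \<exists>g\<in>A. \<exists>h\<in>N. x = g \<otimes>\<^bsub>G\<^esub> h \<and> M = to_A \<theta> g \<cdot>\<^sub>m (1\<^sub>m 1 * (\<psi> h \<cdot>\<^sub>m 1\<^sub>m 1)))" for x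
  proof (intro arg_cong[of _ _ The] ext bex_cong refl)
    fix M g h assume "g \<in> A"
    moreover have "1\<^sub>m 1 * (\<psi> h \<cdot>\<^sub>m 1\<^sub>m 1) = \<psi> h \<cdot>\<^sub>m (1\<^sub>m 1 :: complex mat)"
      by (rule left_mult_one_mat[of _ 1 1]) simp
    ultimately show "(x = g \<otimes>\<^bsub>G\<^esub> h \<and> M = (theta_G v n r \<beta> \<theta> g * \<psi> h) \<cdot>\<^sub>m 1\<^sub>m 1) =
        (x = g \<otimes>\<^bsub>G\<^esub> h \<and> M = to_A \<theta> g \<cdot>\<^sub>m (1\<^sub>m 1 * (\<psi> h \<cdot>\<^sub>m 1\<^sub>m 1)))"
      by (simp add: to_A_def smult_smult_mat)
  qed
  then show ?thesis unfolding sigma_def if_P[OF l_eq] HE.extension_def fst_conv snd_conv by (simp only:)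
qed

theorem Ind_sigma_bij:
  "bij_betw (\<lambda>\<theta>. Ind_class G S (sigma v \<omega> \<tau> n l l' \<beta> P U \<theta>)) \<Theta> (Irr_over G N \<psi>)"
proof -
  have "A_chars = HE.A_chars" unfolding A_chars_def HE.A_chars_def by (rule refl)
  then have "bij_betw ((\<lambda>\<phi>. Ind_class G S (HE.extension \<phi>)) \<circ> to_A) \<Theta> (Irr_over G N \<psi>)"
    using bij_betw_trans[OF theta_set_bij, of "\<lambda>\<phi>. Ind_class G S (HE.extension \<phi>)"] HE.Ind_extension_bij by simp
  then show ?thesis unfolding sigma_eq comp_def .
qed

end

section \<open>Odd level with the chosen families of representations and operators\<close>

locale odd_data = odd_setting v \<omega> n p \<beta> \<tau> l l'
  for v :: "'f::field \<Rightarrow> int" and \<omega> :: 'f and n :: nat and p :: "'f poly" and \<beta> :: "'f mat"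
    and \<tau> :: "'f \<Rightarrow> complex" and l l' :: nat +
  fixes P :: "('f set mat \<Rightarrow> complex) \<Rightarrow> 'f set mat matrix_rep"
    and U :: "('f set mat \<Rightarrow> complex) \<Rightarrow> 'f set mat \<Rightarrow> complex mat"
  assumes P: "\<And>\<rho>. \<rho> \<in> g_cent_chars v n \<beta> \<Longrightarrow> is_pi_rho v \<omega> \<tau> n l l' \<beta> \<rho> (P \<rho>)"
    and U: "\<And>\<rho>. \<rho> \<in> g_cent_chars v n \<beta> \<Longrightarrow> is_U_rho v n l l' \<beta> (P \<rho>) (U \<rho>)"
begin

lemma l_pred: "l - 1 = l'"
  using l_eq by simp

sublocale HE: heisenberg_extension G N \<psi> S Zg H A Rc \<chi> P U
proof (intro heisenberg_extension.intro heisenberg_extension_axioms.intro CS.character_stabilizer_axioms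
    Zg_subgroup H_subgroup A_subgroup N_Zg Zg_H A_commute S_AH AH_Zg Zg_AN chi_mult chi_N chi_inj chi_surj
    Zg_commute conj_Z nondegenerate)
  fix \<rho> assume \<rho>: "\<rho> \<in> Rc"
  show "irreducible_rep (G\<lparr>carrier := H\<rparr>) (P \<rho>)" "contains_char Zg (\<chi> \<rho>) (P \<rho>)"
    using P[OF \<rho>] unfolding is_pi_rho_def l_pred by auto
  show "U \<rho> \<in> hom (G\<lparr>carrier := A\<rparr>) (GLC (fst (P \<rho>)))"
    using U[OF \<rho>] unfolding is_U_rho_def by blast
  show "snd (P \<rho>) (inv\<^bsub>G\<^esub> a \<otimes>\<^bsub>G\<^esub> h \<otimes>\<^bsub>G\<^esub> a) =
      inv\<^bsub>GLC (fst (P \<rho>))\<^esub> (U \<rho> a) \<otimes>\<^bsub>GLC (fst (P \<rho>))\<^esub> snd (P \<rho>) h \<otimes>\<^bsub>GLC (fst (P \<rho>))\<^esub> U \<rho> a"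
    if "a \<in> A" "h \<in> H" for a h
    using U[OF \<rho>] that unfolding is_U_rho_def l_pred by blast
  show "U \<rho> a = 1\<^sub>m (fst (P \<rho>))" if "a \<in> A" "a \<in> H" for a
    using U[OF \<rho>] that unfolding is_U_rho_def l_pred by blast
next
  fix a h assume "a \<in> A" "h \<in> H"
  then show "inv\<^bsub>G\<^esub> a \<otimes>\<^bsub>G\<^esub> h \<otimes>\<^bsub>G\<^esub> a \<in> H" using H_conj subgroup.mem_carrier[OF A_subgroup] by blast
qed assumption+

text \<open>The two conditions on \<rho> coincide as predicates, since \<theta> is only evaluated on
  elements of \<open>A\<close>.\<close>

lemma rho_of_eq: "rho_of v \<omega> \<tau> n l l' \<beta> \<theta> = HE.char_index (to_A \<theta>)"
  unfolding rho_of_def HE.char_index_def l_pred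
  by (intro arg_cong[of _ _ The] ext) (simp add: to_A_def)

lemma sigma_eq: "sigma v \<omega> \<tau> n l l' \<beta> P U \<theta> = HE.extension (to_A \<theta>)"
proof -
  have ne: "l' \<noteq> l" using l_eq by simp
  let ?i = "HE.char_index (to_A \<theta>)"
  have "(THE M. \<exists>g\<in>A. \<exists>h\<in>H. x = g \<otimes>\<^bsub>G\<^esub> h \<and> M = theta_G v n r \<beta> \<theta> g \<cdot>\<^sub>m (U ?i g * snd (P ?i) h)) =
      (THE M. \<exists>g\<in>A. \<exists>h\<in>H. x = g \<otimes>\<^bsub>G\<^esub> h \<and> M = to_A \<theta> g \<cdot>\<^sub>m (U ?i g * snd (P ?i) h))" for x
    by (intro arg_cong[of _ _ The] ext bex_cong refl) (simp add: to_A_def)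
  then show ?thesis unfolding sigma_def if_not_P[OF ne] Let_def rho_of_eq l_pred HE.extension_def by simp
qed

theorem Ind_sigma_bij:
  "bij_betw (\<lambda>\<theta>. Ind_class G S (sigma v \<omega> \<tau> n l l' \<beta> P U \<theta>)) \<Theta> (Irr_over G N \<psi>)"
proof -
  have "A_chars = HE.A_chars" unfolding A_chars_def HE.A_chars_def by (rule refl)
  then have "bij_betw ((\<lambda>\<phi>. Ind_class G S (HE.extension \<phi>)) \<circ> to_A) \<Theta> (Irr_over G N \<psi>)"
    using bij_betw_trans[OF theta_set_bij, of "\<lambda>\<phi>. Ind_class G S (HE.extension \<phi>)"] HE.Ind_extension_bij by simp
  then show ?thesis unfolding sigma_eq comp_def .
qed

end

theorem proposition5p1p4:
  fixes v :: "'f::field \<Rightarrow> int"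
    and \<omega> :: 'f
    and \<tau> :: "'f \<Rightarrow> complex"
    and n r l l' :: nat
    and p :: "'f poly"
    and \<beta> :: "'f mat"
    and P :: "('f set mat \<Rightarrow> complex) \<Rightarrow> 'f set mat matrix_rep"
    and U :: "('f set mat \<Rightarrow> complex) \<Rightarrow> 'f set mat \<Rightarrow> complex mat"
  assumes local_field: "nonarch_local_field v"
    and odd_residue_char: "odd (residue_char v)"
    and prime_element: "\<omega> \<noteq> 0" "v \<omega> = 1"
    and tau_char: "unitary_additive_char v \<tau>"
    and tau_conductor: "{x. \<forall>a\<in>carrier (int_ring v). \<tau> (x * a) = 1} = carrier (int_ring v)"
    and n: "2 \<le> n"
    and r: "2 \<le> r" "r = l + l'" "(r = 2 * l \<and> l' = l) \<or> (r = 2 * l - 1 \<and> l' = l - 1)"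
    and p: "int_poly v p" "Polynomial.coeff p (Polynomial.degree p) = 1" "Polynomial.degree p = n"
    and p_irred: "pirreducible\<^bsub>res_ring v 1\<^esub> (carrier (res_ring v 1)) (red_poly v p)"
    and beta: "\<beta> \<in> int_mats v n"
    and char_beta: "\<And>i. Polynomial.coeff (char_poly \<beta>) i - Polynomial.coeff p i \<in> pow_ideal v 1"
    and P: "\<And>\<rho>. r = 2 * l - 1 \<Longrightarrow> \<rho> \<in> g_cent_chars v n \<beta> \<Longrightarrow>
              is_pi_rho v \<omega> \<tau> n l l' \<beta> \<rho> (P \<rho>)"
    and U: "\<And>\<rho>. r = 2 * l - 1 \<Longrightarrow> \<rho> \<in> g_cent_chars v n \<beta> \<Longrightarrow>
              is_U_rho v n l l' \<beta> (P \<rho>) (U \<rho>)"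
  shows "Ring.field (Kalg n \<beta>) \<and>
         vectorspace.fin_dim class_ring (Kalg n \<beta>) \<and> vectorspace.dim class_ring (Kalg n \<beta>) = n \<and>
         carrier (OK v n \<beta>) = {poly_mat n q \<beta> | q. int_poly v q} \<and>
         {M. maximalideal M (OK v n \<beta>)} = {pK_pow v \<omega> n \<beta> 1} \<and>
         bij_betw
           (\<lambda>\<theta>. Ind_class (GL_res v n r) (stab v n l l' \<beta>) (sigma v \<omega> \<tau> n l l' \<beta> P U \<theta>))
           (theta_set v \<omega> \<tau> n l l' \<beta>)
           (Irr_over (GL_res v n r) (cong_subgroup v n r l) (psi v \<omega> \<tau> n l l' \<beta>))"
proof -
  have PE: "prime_element v \<omega>"
    by (intro prime_element.intro prime_element_axioms.intro local_field prime_element)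
  interpret PE: prime_element v \<omega> by (rule PE)
  \<comment> \<open>In the odd case r is at least 3, so l is at least 2 and l' = l - 1 is
    positive.\<close>
  have ll: "1 \<le> l'" "l' \<le> l" using r by auto
  have "PE.polP 1 (char_poly \<beta> - p)" using char_beta by (simp add: PE.polP_def del: One_nat_def)
  then have "unramified v \<omega> n p \<beta>"
    using n p p_irred beta
    by (intro unramified.intro unramified_axioms.intro PE) (simp_all add: PE.int_poly_iff del: One_nat_def)
  moreover have "\<tau> x \<noteq> 0" for x using tau_char by (auto simp: unitary_additive_char_def dest: spec[of _ x])
  moreover have "(\<forall>a\<in>pow_ideal v 0. \<tau> (x * a) = 1) \<longleftrightarrow> x \<in> pow_ideal v 0" for x
    using tau_conductor by (simp add: set_eq_iff)
  ultimately have CS: "character_setting v \<omega> n p \<beta> \<tau> l l'"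
    using tau_char ll
    by (intro character_setting.intro character_setting_axioms.intro) (simp_all add: unitary_additive_char_def)
  interpret CS: character_setting v \<omega> n p \<beta> \<tau> l l' by (rule CS)
  have "bij_betw (\<lambda>\<theta>. Ind_class CS.G CS.S (sigma v \<omega> \<tau> n l l' \<beta> P U \<theta>)) CS.\<Theta> (Irr_over CS.G CS.N CS.\<psi>)"
  proof (cases "l' = l")
    case True
    interpret even_setting v \<omega> n p \<beta> \<tau> l l' by (intro even_setting.intro even_setting_axioms.intro CS True)
    show ?thesis by (rule Ind_sigma_bij)
  next
    case False
    \<comment> \<open>The two cases for r are told apart by l' = l alone: l is at least 1, so l' = l
      - 1 differs from l.\<close>
    then have l: "l = Suc l'" and r1: "r = 2 * l - 1" using r ll by auto
    interpret odd_data v \<omega> n p \<beta> \<tau> l l' P U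
      by (intro odd_data.intro odd_setting.intro odd_setting_axioms.intro odd_data_axioms.intro CS l
          odd_residue_char P[OF r1] U[OF r1])
    show ?thesis by (rule Ind_sigma_bij)
  qed
  moreover have "CS.Ob = {poly_mat n q \<beta> | q. int_poly v q}" by (simp add: CS.Ob_def PE.int_poly_iff)
  ultimately show ?thesis
    unfolding r(2) using CS.Kalg_field CS.Kalg_dim CS.OK_carrier CS.maximal_ideals_OK by simp
qed

end
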